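(* Let $k$ be an algebraically closed field of characteristic zero and let $\mathcal{C}$ be a braided fusion category over $k$, with representatives $X_1=I,X_2,\dots,X_n$ of the isomorphism classes of simple objects. Then the Witt group $W(\mathcal{C})$ is a vector space over $\mathbb{Z}_2=\mathbb{Z}/2\mathbb{Z}$ with a basis given by the classes of the $X_i$ (each endowed with its non-singular symmetric bilinear form, which is unique up to isometry), where $i$ runs over all indices such that $i=i^*$ and $d_i=1$.
   Context: A braided fusion category over $k$ is a $k$-linear semisimple rigid braided monoidal category with finitely many isomorphism classes of simple objects, finite-dimensional Hom spaces and simple unit object $I$. For each $i$, $i^*$ is the unique index with $(X_i)^*\cong X_{i^*}$. Choose $X_{i^*}$ as dual of $X_i$, with evaluation $\mathrm{ev}_i:X_{i^*}\otimes X_i\to I$; it spans the one-dimensional space $\mathrm{Hom}(X_{i^*}\otimes X_i,I)$. The nonzero scalar $d_i\in k$ is defined by $\mathrm{ev}_i\circ c_{X_i,X_{i^*}}=d_i\,\mathrm{ev}_{i^*}$, where $c$ is the braiding. Witt group. Let $\mathcal{C}$ be a $k$-linear rigid braided monoidal category with finite direct sums, with braiding $c$ and unit $I$, and $\frac12\in k$. For each object $M$ fix a dual $M^*$ with $\mathrm{ev}_M:M^*\otimes M\to I$ and $\mathrm{coev}_M:I\to M\otimes M^*$ satisfying the duality (triangle) identities. A bilinear form $b:M\otimes M\to I$ is symmetric if $b\circ c_{M,M}=b$, and non-singular if $h_M(b):=(b\otimes 1_{M^*})\circ(1_M\otimes \mathrm{coev}_M):M\to M^*$ is an isomorphism. A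 non-singular quadratic object is a pair $(M,b)$ with $b$ symmetric and non-singular; an isometry $(M,b)\to(M',b')$ is an isomorphism $f:M\to M'$ with $b'\circ(f\otimes f)=b$. The orthogonal sum is $(M,b)\perp(M',b')=(M\oplus M',b\oplus b')$ (zero on the cross terms). $\mathcal{Q}$ is the category of non-singular quadratic objects with isometries as morphisms. An object $M$ is weakly symmetric if $\mathrm{ev}_M=\mathrm{ev}_M\circ c_{M,M^*}\circ c_{M^*,M}$; $\mathcal{D}$ is the category of weakly symmetric objects with isomorphisms as morphisms. For $M\in\mathcal{D}$ the hyperbolic object is $\mathcal{H}(M)=(M\oplus M^*,b_M)$, where $b_M$ vanishes on $M\otimes M$ and on $M^*\otimes M^*$, equals $\mathrm{ev}_M$ on $M^*\otimes M$, and equals $\mathrm{ev}_M\circ c_{M,M^*}$ on $M\otimes M^*$. The Witt group is $W(\mathcal{C})=K_0(\mathcal{Q})/\mathrm{Im}(K_0(\mathcal{H}):K_0(\mathcal{D})\to K_0(\mathcal{Q}))$, where $K_0$ denotes the Grothendieck group of the commutative monoid of isomorphism classes under $\perp$ (resp. $\oplus$). *)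

theory Defs
  imports
    "Jordan_Normal_Form.VS_Connect"
    "HOL-Number_Theory.Residues"
    "HOL-Algebra.Coset"
begin

section \<open>Categories, linear categories, abelian categories\<close>

text \<open>
  Composition and the tensor product of morphisms are total operations on the type of morphisms,
  constrained only on composable arguments taken from the sets \<open>Hom A B\<close>. The sets
  \<open>Hom A B\<close> are not required to be disjoint: every notion below carries the source and target of
  the morphisms it speaks about.
\<close>

record ('o, 'm) category_data =
  Ob :: "'o set"
  Hom :: "'o \<Rightarrow> 'o \<Rightarrow> 'm set"
  Ident :: "'o \<Rightarrow> 'm"
  Comp :: "'m \<Rightarrow> 'm \<Rightarrow> 'm"  (infixl "\<cdot>\<index>" 60)

record ('o, 'm, 'k) linear_category_data = "('o, 'm) category_data" +
  ZeroM :: "'o \<Rightarrow> 'o \<Rightarrow> 'm"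
  AddM :: "'m \<Rightarrow> 'm \<Rightarrow> 'm"  (infixl "\<uplus>\<index>" 55)
  ScaleM :: "'k \<Rightarrow> 'm \<Rightarrow> 'm"

locale category =
  fixes C :: "('o, 'm, 'x) category_data_scheme" (structure)
  assumes Ident_Hom: "A \<in> Ob C \<Longrightarrow> Ident C A \<in> Hom C A A"
    and Comp_Hom: "\<lbrakk>A \<in> Ob C; B \<in> Ob C; D \<in> Ob C; f \<in> Hom C A B; g \<in> Hom C B D\<rbrakk>
      \<Longrightarrow> g \<cdot> f \<in> Hom C A D"
    and Comp_Ident: "\<lbrakk>A \<in> Ob C; B \<in> Ob C; f \<in> Hom C A B\<rbrakk> \<Longrightarrow> f \<cdot> Ident C A = f"
    and Ident_Comp: "\<lbrakk>A \<in> Ob C; B \<in> Ob C; f \<in> Hom C A B\<rbrakk> \<Longrightarrow> Ident C B \<cdot> f = f"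
    and Comp_assoc: "\<lbrakk>A \<in> Ob C; B \<in> Ob C; D \<in> Ob C; E \<in> Ob C;
        f \<in> Hom C A B; g \<in> Hom C B D; h \<in> Hom C D E\<rbrakk> \<Longrightarrow> h \<cdot> (g \<cdot> f) = (h \<cdot> g) \<cdot> f"

context
  fixes C :: "('o, 'm, 'x) category_data_scheme" (structure)
begin

definition inverse_arrows :: "'o \<Rightarrow> 'o \<Rightarrow> 'm \<Rightarrow> 'm \<Rightarrow> bool" where
  "inverse_arrows A B f g \<longleftrightarrow>
     f \<in> Hom C A B \<and> g \<in> Hom C B A \<and> g \<cdot> f = Ident C A \<and> f \<cdot> g = Ident C B"

definition iso_arrow :: "'o \<Rightarrow> 'o \<Rightarrow> 'm \<Rightarrow> bool" where
  "iso_arrow A B f \<longleftrightarrow> (\<exists>g. inverse_arrows A B f g)"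

definition inv_arrow :: "'o \<Rightarrow> 'o \<Rightarrow> 'm \<Rightarrow> 'm" where
  "inv_arrow A B f = (THE g. inverse_arrows A B f g)"

definition isomorphic :: "'o \<Rightarrow> 'o \<Rightarrow> bool" where
  "isomorphic A B \<longleftrightarrow> A \<in> Ob C \<and> B \<in> Ob C \<and> (\<exists>f. iso_arrow A B f)"

definition mono_arrow :: "'o \<Rightarrow> 'o \<Rightarrow> 'm \<Rightarrow> bool" where
  "mono_arrow A B f \<longleftrightarrow> f \<in> Hom C A B \<and>
     (\<forall>T\<in>Ob C. \<forall>g\<in>Hom C T A. \<forall>h\<in>Hom C T A. f \<cdot> g = f \<cdot> h \<longrightarrow> g = h)"

definition epi_arrow :: "'o \<Rightarrow> 'o \<Rightarrow> 'm \<Rightarrow> bool" where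
  "epi_arrow A B f \<longleftrightarrow> f \<in> Hom C A B \<and>
     (\<forall>T\<in>Ob C. \<forall>g\<in>Hom C B T. \<forall>h\<in>Hom C B T. g \<cdot> f = h \<cdot> f \<longrightarrow> g = h)"

definition zero_object :: "'o \<Rightarrow> bool" where
  "zero_object Z \<longleftrightarrow> Z \<in> Ob C \<and>
     (\<forall>A\<in>Ob C. (\<exists>!f. f \<in> Hom C Z A) \<and> (\<exists>!f. f \<in> Hom C A Z))"

definition simple_object :: "'o \<Rightarrow> bool" where
  "simple_object X \<longleftrightarrow> X \<in> Ob C \<and> \<not> zero_object X \<and>
     (\<forall>Y\<in>Ob C. \<forall>f. mono_arrow Y X f \<longrightarrow> zero_object Y \<or> iso_arrow Y X f)"

end

definition hom_space ::
  "('o, 'm, 'k, 'x) linear_category_data_scheme \<Rightarrow> 'o \<Rightarrow> 'o \<Rightarrow> ('k, 'm) module" where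
  "hom_space C A B = \<lparr>carrier = Hom C A B, monoid.mult = undefined, one = undefined,
     zero = ZeroM C A B, add = AddM C, smult = ScaleM C\<rparr>"

locale linear_category = category C
  for C :: "('o, 'm, 'k::field, 'x) linear_category_data_scheme" (structure) +
  assumes Hom_vectorspace:
      "\<lbrakk>A \<in> Ob C; B \<in> Ob C\<rbrakk> \<Longrightarrow> vectorspace (class_ring :: 'k ring) (hom_space C A B)"
    and Comp_Add_right: "\<lbrakk>A \<in> Ob C; B \<in> Ob C; D \<in> Ob C;
        f \<in> Hom C A B; f' \<in> Hom C A B; g \<in> Hom C B D\<rbrakk> \<Longrightarrow> g \<cdot> (f \<uplus> f') = g \<cdot> f \<uplus> g \<cdot> f'"
    and Comp_Add_left: "\<lbrakk>A \<in> Ob C; B \<in> Ob C; D \<in> Ob C;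
        f \<in> Hom C A B; g \<in> Hom C B D; g' \<in> Hom C B D\<rbrakk> \<Longrightarrow> (g \<uplus> g') \<cdot> f = g \<cdot> f \<uplus> g' \<cdot> f"
    and Comp_Scale_right: "\<lbrakk>A \<in> Ob C; B \<in> Ob C; D \<in> Ob C; f \<in> Hom C A B; g \<in> Hom C B D\<rbrakk>
        \<Longrightarrow> g \<cdot> ScaleM C r f = ScaleM C r (g \<cdot> f)"
    and Comp_Scale_left: "\<lbrakk>A \<in> Ob C; B \<in> Ob C; D \<in> Ob C; f \<in> Hom C A B; g \<in> Hom C B D\<rbrakk>
        \<Longrightarrow> ScaleM C r g \<cdot> f = ScaleM C r (g \<cdot> f)"

context
  fixes C :: "('o, 'm, 'k, 'x) linear_category_data_scheme" (structure)
begin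

text \<open>\<open>biproduct M N S i\<^sub>1 i\<^sub>2 p\<^sub>1 p\<^sub>2\<close>: \<open>S = M \<oplus> N\<close> with the given injections and projections.\<close>

definition biproduct :: "'o \<Rightarrow> 'o \<Rightarrow> 'o \<Rightarrow> 'm \<Rightarrow> 'm \<Rightarrow> 'm \<Rightarrow> 'm \<Rightarrow> bool" where
  "biproduct M N S i\<^sub>1 i\<^sub>2 p\<^sub>1 p\<^sub>2 \<longleftrightarrow> M \<in> Ob C \<and> N \<in> Ob C \<and> S \<in> Ob C \<and>
     i\<^sub>1 \<in> Hom C M S \<and> i\<^sub>2 \<in> Hom C N S \<and> p\<^sub>1 \<in> Hom C S M \<and> p\<^sub>2 \<in> Hom C S N \<and>
     p\<^sub>1 \<cdot> i\<^sub>1 = Ident C M \<and> p\<^sub>2 \<cdot> i\<^sub>2 = Ident C N \<and>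
     p\<^sub>1 \<cdot> i\<^sub>2 = ZeroM C N M \<and> p\<^sub>2 \<cdot> i\<^sub>1 = ZeroM C M N \<and>
     i\<^sub>1 \<cdot> p\<^sub>1 \<uplus> i\<^sub>2 \<cdot> p\<^sub>2 = Ident C S"

definition is_kernel :: "'o \<Rightarrow> 'o \<Rightarrow> 'm \<Rightarrow> 'o \<Rightarrow> 'm \<Rightarrow> bool" where
  "is_kernel A B f K \<kappa> \<longleftrightarrow> f \<in> Hom C A B \<and> K \<in> Ob C \<and> \<kappa> \<in> Hom C K A \<and> f \<cdot> \<kappa> = ZeroM C K B \<and>
     (\<forall>T\<in>Ob C. \<forall>g\<in>Hom C T A. f \<cdot> g = ZeroM C T B \<longrightarrow> (\<exists>!h. h \<in> Hom C T K \<and> \<kappa> \<cdot> h = g))"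

definition is_cokernel :: "'o \<Rightarrow> 'o \<Rightarrow> 'm \<Rightarrow> 'o \<Rightarrow> 'm \<Rightarrow> bool" where
  "is_cokernel A B f K \<kappa> \<longleftrightarrow> f \<in> Hom C A B \<and> K \<in> Ob C \<and> \<kappa> \<in> Hom C B K \<and> \<kappa> \<cdot> f = ZeroM C A K \<and>
     (\<forall>T\<in>Ob C. \<forall>g\<in>Hom C B T. g \<cdot> f = ZeroM C A T \<longrightarrow> (\<exists>!h. h \<in> Hom C K T \<and> h \<cdot> \<kappa> = g))"

definition semisimple_object :: "'o \<Rightarrow> bool" where
  "semisimple_object M \<longleftrightarrow> M \<in> Ob C \<and>
     (\<exists>n S \<iota> \<pi>.
        (\<forall>i<n. simple_object C (S i) \<and> \<iota> i \<in> Hom C (S i) M \<and> \<pi> i \<in> Hom C M (S i)) \<and>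
        (\<forall>i<n. \<forall>j<n. \<pi> i \<cdot> \<iota> j = (if i = j then Ident C (S i) else ZeroM C (S j) (S i))) \<and>
        finsum (hom_space C M M) (\<lambda>i. \<iota> i \<cdot> \<pi> i) {..<n::nat} = Ident C M)"

end

locale abelian_linear_category = linear_category C
  for C :: "('o, 'm, 'k::field, 'x) linear_category_data_scheme" (structure) +
  assumes zero_object_exists: "\<exists>Z. zero_object C Z"
    and biproduct_exists: "\<lbrakk>M \<in> Ob C; N \<in> Ob C\<rbrakk> \<Longrightarrow> \<exists>S i\<^sub>1 i\<^sub>2 p\<^sub>1 p\<^sub>2. biproduct C M N S i\<^sub>1 i\<^sub>2 p\<^sub>1 p\<^sub>2"
    and kernel_exists: "\<lbrakk>A \<in> Ob C; B \<in> Ob C; f \<in> Hom C A B\<rbrakk> \<Longrightarrow> \<exists>K \<kappa>. is_kernel C A B f K \<kappa>"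
    and cokernel_exists: "\<lbrakk>A \<in> Ob C; B \<in> Ob C; f \<in> Hom C A B\<rbrakk> \<Longrightarrow> \<exists>K \<kappa>. is_cokernel C A B f K \<kappa>"
    and mono_is_kernel: "\<lbrakk>A \<in> Ob C; B \<in> Ob C; mono_arrow C A B f\<rbrakk>
      \<Longrightarrow> \<exists>D\<in>Ob C. \<exists>g. is_kernel C B D g A f"
    and epi_is_cokernel: "\<lbrakk>A \<in> Ob C; B \<in> Ob C; epi_arrow C A B f\<rbrakk>
      \<Longrightarrow> \<exists>D\<in>Ob C. \<exists>g. is_cokernel C D A g B f"

section \<open>Rigid braided monoidal categories\<close>

record ('o, 'm, 'k) monoidal_category_data = "('o, 'm, 'k) linear_category_data" +
  TensorO :: "'o \<Rightarrow> 'o \<Rightarrow> 'o"  (infixl "\<diamondop>\<^sub>o\<index>" 70)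
  TensorM :: "'m \<Rightarrow> 'm \<Rightarrow> 'm"  (infixl "\<diamondop>\<index>" 70)
  Unit :: "'o"
  Assoc :: "'o \<Rightarrow> 'o \<Rightarrow> 'o \<Rightarrow> 'm"
  LUnit :: "'o \<Rightarrow> 'm"
  RUnit :: "'o \<Rightarrow> 'm"

record ('o, 'm, 'k) braided_category_data = "('o, 'm, 'k) monoidal_category_data" +
  Braid :: "'o \<Rightarrow> 'o \<Rightarrow> 'm"

text \<open>A rigid category comes with a fixed choice of dual, evaluation and coevaluation for each object.\<close>

record ('o, 'm, 'k) rigid_braided_category_data = "('o, 'm, 'k) braided_category_data" +
  Dual :: "'o \<Rightarrow> 'o"
  Ev :: "'o \<Rightarrow> 'm"
  Coev :: "'o \<Rightarrow> 'm"

definition AssocInv ::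
  "('o, 'm, 'k, 'x) monoidal_category_data_scheme \<Rightarrow> 'o \<Rightarrow> 'o \<Rightarrow> 'o \<Rightarrow> 'm" where
  "AssocInv C A B D =
     inv_arrow C ((A \<diamondop>\<^sub>o\<^bsub>C\<^esub> B) \<diamondop>\<^sub>o\<^bsub>C\<^esub> D) (A \<diamondop>\<^sub>o\<^bsub>C\<^esub> (B \<diamondop>\<^sub>o\<^bsub>C\<^esub> D)) (Assoc C A B D)"

locale monoidal_linear_category = linear_category C
  for C :: "('o, 'm, 'k::field, 'x) monoidal_category_data_scheme" (structure) +
  assumes Unit_Ob: "Unit C \<in> Ob C"
    and TensorO_Ob: "\<lbrakk>A \<in> Ob C; B \<in> Ob C\<rbrakk> \<Longrightarrow> A \<diamondop>\<^sub>o B \<in> Ob C"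
    and TensorM_Hom: "\<lbrakk>A \<in> Ob C; B \<in> Ob C; A' \<in> Ob C; B' \<in> Ob C; f \<in> Hom C A B; f' \<in> Hom C A' B'\<rbrakk>
      \<Longrightarrow> f \<diamondop> f' \<in> Hom C (A \<diamondop>\<^sub>o A') (B \<diamondop>\<^sub>o B')"
    and Tensor_Ident: "\<lbrakk>A \<in> Ob C; B \<in> Ob C\<rbrakk> \<Longrightarrow> Ident C A \<diamondop> Ident C B = Ident C (A \<diamondop>\<^sub>o B)"
    and Tensor_Comp: "\<lbrakk>A \<in> Ob C; B \<in> Ob C; D \<in> Ob C; A' \<in> Ob C; B' \<in> Ob C; D' \<in> Ob C;
        f \<in> Hom C A B; g \<in> Hom C B D; f' \<in> Hom C A' B'; g' \<in> Hom C B' D'\<rbrakk>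
      \<Longrightarrow> (g \<cdot> f) \<diamondop> (g' \<cdot> f') = (g \<diamondop> g') \<cdot> (f \<diamondop> f')"
    and Tensor_Add_left: "\<lbrakk>A \<in> Ob C; B \<in> Ob C; A' \<in> Ob C; B' \<in> Ob C;
        f \<in> Hom C A B; g \<in> Hom C A B; f' \<in> Hom C A' B'\<rbrakk> \<Longrightarrow> (f \<uplus> g) \<diamondop> f' = f \<diamondop> f' \<uplus> g \<diamondop> f'"
    and Tensor_Add_right: "\<lbrakk>A \<in> Ob C; B \<in> Ob C; A' \<in> Ob C; B' \<in> Ob C;
        f \<in> Hom C A B; f' \<in> Hom C A' B'; g' \<in> Hom C A' B'\<rbrakk> \<Longrightarrow> f \<diamondop> (f' \<uplus> g') = f \<diamondop> f' \<uplus> f \<diamondop> g'"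
    and Tensor_Scale_left: "\<lbrakk>A \<in> Ob C; B \<in> Ob C; A' \<in> Ob C; B' \<in> Ob C;
        f \<in> Hom C A B; f' \<in> Hom C A' B'\<rbrakk> \<Longrightarrow> ScaleM C r f \<diamondop> f' = ScaleM C r (f \<diamondop> f')"
    and Tensor_Scale_right: "\<lbrakk>A \<in> Ob C; B \<in> Ob C; A' \<in> Ob C; B' \<in> Ob C;
        f \<in> Hom C A B; f' \<in> Hom C A' B'\<rbrakk> \<Longrightarrow> f \<diamondop> ScaleM C r f' = ScaleM C r (f \<diamondop> f')"
    and Assoc_iso: "\<lbrakk>A \<in> Ob C; B \<in> Ob C; D \<in> Ob C\<rbrakk>
      \<Longrightarrow> iso_arrow C ((A \<diamondop>\<^sub>o B) \<diamondop>\<^sub>o D) (A \<diamondop>\<^sub>o (B \<diamondop>\<^sub>o D)) (Assoc C A B D)"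
    and Assoc_natural: "\<lbrakk>A \<in> Ob C; B \<in> Ob C; D \<in> Ob C; A' \<in> Ob C; B' \<in> Ob C; D' \<in> Ob C;
        f \<in> Hom C A A'; g \<in> Hom C B B'; h \<in> Hom C D D'\<rbrakk>
      \<Longrightarrow> Assoc C A' B' D' \<cdot> ((f \<diamondop> g) \<diamondop> h) = (f \<diamondop> (g \<diamondop> h)) \<cdot> Assoc C A B D"
    and LUnit_iso: "A \<in> Ob C \<Longrightarrow> iso_arrow C (Unit C \<diamondop>\<^sub>o A) A (LUnit C A)"
    and LUnit_natural: "\<lbrakk>A \<in> Ob C; B \<in> Ob C; f \<in> Hom C A B\<rbrakk>
      \<Longrightarrow> LUnit C B \<cdot> (Ident C (Unit C) \<diamondop> f) = f \<cdot> LUnit C A"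
    and RUnit_iso: "A \<in> Ob C \<Longrightarrow> iso_arrow C (A \<diamondop>\<^sub>o Unit C) A (RUnit C A)"
    and RUnit_natural: "\<lbrakk>A \<in> Ob C; B \<in> Ob C; f \<in> Hom C A B\<rbrakk>
      \<Longrightarrow> RUnit C B \<cdot> (f \<diamondop> Ident C (Unit C)) = f \<cdot> RUnit C A"
    and triangle: "\<lbrakk>A \<in> Ob C; B \<in> Ob C\<rbrakk>
      \<Longrightarrow> (Ident C A \<diamondop> LUnit C B) \<cdot> Assoc C A (Unit C) B = RUnit C A \<diamondop> Ident C B"
    and pentagon: "\<lbrakk>A \<in> Ob C; B \<in> Ob C; D \<in> Ob C; E \<in> Ob C\<rbrakk>
      \<Longrightarrow> Assoc C A B (D \<diamondop>\<^sub>o E) \<cdot> Assoc C (A \<diamondop>\<^sub>o B) D E =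
          (Ident C A \<diamondop> Assoc C B D E) \<cdot> Assoc C A (B \<diamondop>\<^sub>o D) E \<cdot> (Assoc C A B D \<diamondop> Ident C E)"

locale braided_linear_category = monoidal_linear_category C
  for C :: "('o, 'm, 'k::field, 'x) braided_category_data_scheme" (structure) +
  assumes Braid_iso: "\<lbrakk>A \<in> Ob C; B \<in> Ob C\<rbrakk> \<Longrightarrow> iso_arrow C (A \<diamondop>\<^sub>o B) (B \<diamondop>\<^sub>o A) (Braid C A B)"
    and Braid_natural: "\<lbrakk>A \<in> Ob C; B \<in> Ob C; A' \<in> Ob C; B' \<in> Ob C; f \<in> Hom C A A'; g \<in> Hom C B B'\<rbrakk>
      \<Longrightarrow> Braid C A' B' \<cdot> (f \<diamondop> g) = (g \<diamondop> f) \<cdot> Braid C A B"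
    and hexagon1: "\<lbrakk>A \<in> Ob C; B \<in> Ob C; D \<in> Ob C\<rbrakk>
      \<Longrightarrow> Assoc C B D A \<cdot> Braid C A (B \<diamondop>\<^sub>o D) \<cdot> Assoc C A B D =
          (Ident C B \<diamondop> Braid C A D) \<cdot> Assoc C B A D \<cdot> (Braid C A B \<diamondop> Ident C D)"
    and hexagon2: "\<lbrakk>A \<in> Ob C; B \<in> Ob C; D \<in> Ob C\<rbrakk>
      \<Longrightarrow> AssocInv C D A B \<cdot> Braid C (A \<diamondop>\<^sub>o B) D \<cdot> AssocInv C A B D =
          (Braid C A D \<diamondop> Ident C B) \<cdot> AssocInv C A D B \<cdot> (Ident C A \<diamondop> Braid C B D)"

text \<open>
  \<open>duality M N e c\<close>: \<open>N\<close> is a dual of \<open>M\<close> with evaluation \<open>e : N \<otimes> M \<rightarrow> I\<close> and coevaluation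
  \<open>c : I \<rightarrow> M \<otimes> N\<close>. In the two triangle identities the unit constraints are moved to the right-hand
  sides.
\<close>

definition duality ::
  "('o, 'm, 'k, 'x) monoidal_category_data_scheme \<Rightarrow> 'o \<Rightarrow> 'o \<Rightarrow> 'm \<Rightarrow> 'm \<Rightarrow> bool" where
  "duality C M N e c \<longleftrightarrow> M \<in> Ob C \<and> N \<in> Ob C \<and>
     e \<in> Hom C (N \<diamondop>\<^sub>o\<^bsub>C\<^esub> M) (Unit C) \<and> c \<in> Hom C (Unit C) (M \<diamondop>\<^sub>o\<^bsub>C\<^esub> N) \<and>
     RUnit C M \<cdot>\<^bsub>C\<^esub> (Ident C M \<diamondop>\<^bsub>C\<^esub> e) \<cdot>\<^bsub>C\<^esub> Assoc C M N M \<cdot>\<^bsub>C\<^esub> (c \<diamondop>\<^bsub>C\<^esub> Ident C M) = LUnit C M \<and>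
     LUnit C N \<cdot>\<^bsub>C\<^esub> (e \<diamondop>\<^bsub>C\<^esub> Ident C N) \<cdot>\<^bsub>C\<^esub> AssocInv C N M N \<cdot>\<^bsub>C\<^esub> (Ident C N \<diamondop>\<^bsub>C\<^esub> c) = RUnit C N"

locale rigid_braided_linear_category = braided_linear_category C
  for C :: "('o, 'm, 'k::field, 'x) rigid_braided_category_data_scheme" (structure) +
  assumes Dual: "M \<in> Ob C \<Longrightarrow> duality C M (Dual C M) (Ev C M) (Coev C M)"

locale braided_fusion_category =
  rigid_braided_linear_category C + abelian_linear_category C
  for C :: "('o, 'm, 'k::field, 'x) rigid_braided_category_data_scheme" (structure) +
  assumes semisimple: "M \<in> Ob C \<Longrightarrow> semisimple_object C M"
    and finitely_many_simples:
      "\<exists>S. finite S \<and> (\<forall>Y. simple_object C Y \<longrightarrow> (\<exists>Y'\<in>S. isomorphic C Y Y'))"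
    and Hom_fin_dim: "\<lbrakk>A \<in> Ob C; B \<in> Ob C\<rbrakk>
      \<Longrightarrow> vectorspace.fin_dim (class_ring :: 'k ring) (hom_space C A B)"
    and Unit_simple: "simple_object C (Unit C)"

section \<open>Representatives of the simple objects\<close>

definition simple_representatives ::
  "('o, 'm, 'k, 'x) monoidal_category_data_scheme \<Rightarrow> nat \<Rightarrow> (nat \<Rightarrow> 'o) \<Rightarrow> bool" where
  "simple_representatives C n X \<longleftrightarrow> 1 \<le> n \<and> X 1 = Unit C \<and>
     (\<forall>i\<in>{1..n}. simple_object C (X i)) \<and>
     (\<forall>i\<in>{1..n}. \<forall>j\<in>{1..n}. isomorphic C (X i) (X j) \<longrightarrow> i = j) \<and>
     (\<forall>Y. simple_object C Y \<longrightarrow> (\<exists>i\<in>{1..n}. isomorphic C Y (X i)))"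

definition dual_index ::
  "('o, 'm, 'k, 'x) rigid_braided_category_data_scheme \<Rightarrow> nat \<Rightarrow> (nat \<Rightarrow> 'o) \<Rightarrow> nat \<Rightarrow> nat" where
  "dual_index C n X i = (THE j. j \<in> {1..n} \<and> isomorphic C (Dual C (X i)) (X j))"

text \<open>
  Evaluations \<open>e i\<close> exhibiting \<open>X (dual_index i)\<close> itself (rather than the object \<open>Dual (X i)\<close>, which
  is merely isomorphic to it) as a dual of \<open>X i\<close>.
\<close>

definition simple_evaluations :: "('o, 'm, 'k, 'x) rigid_braided_category_data_scheme
    \<Rightarrow> nat \<Rightarrow> (nat \<Rightarrow> 'o) \<Rightarrow> (nat \<Rightarrow> 'm) \<Rightarrow> bool" where
  "simple_evaluations C n X e \<longleftrightarrow>
     (\<forall>i\<in>{1..n}. \<exists>c. duality C (X i) (X (dual_index C n X i)) (e i) c)"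

definition braid_scalar :: "('o, 'm, 'k, 'x) rigid_braided_category_data_scheme
    \<Rightarrow> nat \<Rightarrow> (nat \<Rightarrow> 'o) \<Rightarrow> (nat \<Rightarrow> 'm) \<Rightarrow> nat \<Rightarrow> 'k" where
  "braid_scalar C n X e i =
     (THE r. e i \<cdot>\<^bsub>C\<^esub> Braid C (X i) (X (dual_index C n X i)) = ScaleM C r (e (dual_index C n X i)))"

section \<open>Quadratic objects and the Witt group\<close>

context
  fixes C :: "('o, 'm, 'k, 'x) rigid_braided_category_data_scheme" (structure)
begin

text \<open>The adjoint \<open>h\<^sub>M(b) : M \<rightarrow> M\<^sup>*\<close>, with the associativity and unit constraints inserted.\<close>

definition adjoint_map :: "'o \<Rightarrow> 'm \<Rightarrow> 'm" where
  "adjoint_map M b =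
     LUnit C (Dual C M) \<cdot> (b \<diamondop> Ident C (Dual C M)) \<cdot> AssocInv C M M (Dual C M) \<cdot>
     (Ident C M \<diamondop> Coev C M) \<cdot> inv_arrow C (M \<diamondop>\<^sub>o Unit C) M (RUnit C M)"

definition symmetric_form :: "'o \<Rightarrow> 'm \<Rightarrow> bool" where
  "symmetric_form M b \<longleftrightarrow> b \<in> Hom C (M \<diamondop>\<^sub>o M) (Unit C) \<and> b \<cdot> Braid C M M = b"

definition nonsingular_form :: "'o \<Rightarrow> 'm \<Rightarrow> bool" where
  "nonsingular_form M b \<longleftrightarrow>
     b \<in> Hom C (M \<diamondop>\<^sub>o M) (Unit C) \<and> iso_arrow C M (Dual C M) (adjoint_map M b)"

definition quadratic_objects :: "('o \<times> 'm) set" where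
  "quadratic_objects = {(M, b). M \<in> Ob C \<and> symmetric_form M b \<and> nonsingular_form M b}"

definition isometric :: "'o \<times> 'm \<Rightarrow> 'o \<times> 'm \<Rightarrow> bool" where
  "isometric = (\<lambda>(M, b) (M', b'). \<exists>f. iso_arrow C M M' f \<and> b' \<cdot> (f \<diamondop> f) = b)"

definition orthogonal_sum :: "'o \<times> 'm \<Rightarrow> 'o \<times> 'm \<Rightarrow> 'o \<times> 'm \<Rightarrow> bool" where
  "orthogonal_sum = (\<lambda>(M, b) (M', b') (S, s). \<exists>i\<^sub>1 i\<^sub>2 p\<^sub>1 p\<^sub>2.
     biproduct C M M' S i\<^sub>1 i\<^sub>2 p\<^sub>1 p\<^sub>2 \<and> s = b \<cdot> (p\<^sub>1 \<diamondop> p\<^sub>1) \<uplus> b' \<cdot> (p\<^sub>2 \<diamondop> p\<^sub>2))"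

definition weakly_symmetric :: "'o \<Rightarrow> bool" where
  "weakly_symmetric M \<longleftrightarrow> M \<in> Ob C \<and>
     Ev C M = Ev C M \<cdot> Braid C M (Dual C M) \<cdot> Braid C (Dual C M) M"

text \<open>\<open>(S, s)\<close> is a hyperbolic object of \<open>M\<close>: the first projection goes to \<open>M\<close>, the second to \<open>M\<^sup>*\<close>.\<close>

definition hyperbolic_object :: "'o \<Rightarrow> 'o \<times> 'm \<Rightarrow> bool" where
  "hyperbolic_object M = (\<lambda>(S, s). \<exists>i\<^sub>1 i\<^sub>2 p\<^sub>1 p\<^sub>2. biproduct C M (Dual C M) S i\<^sub>1 i\<^sub>2 p\<^sub>1 p\<^sub>2 \<and>
     s = Ev C M \<cdot> (p\<^sub>2 \<diamondop> p\<^sub>1) \<uplus> Ev C M \<cdot> Braid C M (Dual C M) \<cdot> (p\<^sub>1 \<diamondop> p\<^sub>2))"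

definition isometry_class :: "'o \<times> 'm \<Rightarrow> ('o \<times> 'm) set" where
  "isometry_class q = {q' \<in> quadratic_objects. isometric q q'}"

definition weakly_symmetric_class :: "'o \<Rightarrow> 'o set" where
  "weakly_symmetric_class M = {M'. weakly_symmetric M' \<and> isomorphic C M M'}"

text \<open>
  Direct sums are determined only up to isomorphism, so the sum of two classes is the set of all
  direct sums of their members; this set is a single class.
\<close>

definition quadratic_monoid :: "('o \<times> 'm) set monoid" where
  "quadratic_monoid =
     \<lparr>carrier = isometry_class ` quadratic_objects,
      monoid.mult = (\<lambda>U V. {q \<in> quadratic_objects. \<exists>u\<in>U. \<exists>v\<in>V. orthogonal_sum u v q}),
      one = {(Z, z) \<in> quadratic_objects. zero_object C Z}\<rparr>"

definition weakly_symmetric_monoid :: "'o set monoid" where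
  "weakly_symmetric_monoid =
     \<lparr>carrier = weakly_symmetric_class ` {M. weakly_symmetric M},
      monoid.mult = (\<lambda>U V. {S. weakly_symmetric S \<and>
        (\<exists>M\<in>U. \<exists>N\<in>V. \<exists>i\<^sub>1 i\<^sub>2 p\<^sub>1 p\<^sub>2. biproduct C M N S i\<^sub>1 i\<^sub>2 p\<^sub>1 p\<^sub>2)}),
      one = {Z. weakly_symmetric Z \<and> zero_object C Z}\<rparr>"

definition hyperbolic_class :: "'o set \<Rightarrow> ('o \<times> 'm) set" where
  "hyperbolic_class U = {q \<in> quadratic_objects. \<exists>M\<in>U. hyperbolic_object M q}"

end

text \<open>The Grothendieck group of a commutative monoid, written multiplicatively;
  the class of \<open>(a, b)\<close> is the formal quotient of \<open>a\<close> by \<open>b\<close>.\<close>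

definition grothendieck_rel :: "('a, 'x) monoid_scheme \<Rightarrow> (('a \<times> 'a) \<times> ('a \<times> 'a)) set" where
  "grothendieck_rel G = {((a, b), (a', b')). {a, b, a', b'} \<subseteq> carrier G \<and>
     (\<exists>t\<in>carrier G. a \<otimes>\<^bsub>G\<^esub> b' \<otimes>\<^bsub>G\<^esub> t = a' \<otimes>\<^bsub>G\<^esub> b \<otimes>\<^bsub>G\<^esub> t)}"

definition grothendieck_class :: "('a, 'x) monoid_scheme \<Rightarrow> 'a \<Rightarrow> 'a \<Rightarrow> ('a \<times> 'a) set" where
  "grothendieck_class G a b = grothendieck_rel G `` {(a, b)}"

definition grothendieck_group :: "('a, 'x) monoid_scheme \<Rightarrow> ('a \<times> 'a) set monoid" where
  "grothendieck_group G =
     \<lparr>carrier = (carrier G \<times> carrier G) // grothendieck_rel G,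
      monoid.mult = (\<lambda>U V. \<Union>(a, b)\<in>U. \<Union>(a', b')\<in>V.
        grothendieck_class G (a \<otimes>\<^bsub>G\<^esub> a') (b \<otimes>\<^bsub>G\<^esub> b')),
      one = grothendieck_class G \<one>\<^bsub>G\<^esub> \<one>\<^bsub>G\<^esub>\<rparr>"

definition grothendieck_map :: "('b, 'y) monoid_scheme \<Rightarrow> ('a \<Rightarrow> 'b)
    \<Rightarrow> ('a \<times> 'a) set \<Rightarrow> ('b \<times> 'b) set" where
  "grothendieck_map H f U = (\<Union>(a, b)\<in>U. grothendieck_class H (f a) (f b))"

context
  fixes C :: "('o, 'm, 'k, 'x) rigid_braided_category_data_scheme"
begin

definition K0_quadratic :: "(('o \<times> 'm) set \<times> ('o \<times> 'm) set) set monoid" where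
  "K0_quadratic = grothendieck_group (quadratic_monoid C)"

definition hyperbolic_subgroup :: "(('o \<times> 'm) set \<times> ('o \<times> 'm) set) set set" where
  "hyperbolic_subgroup =
     grothendieck_map (quadratic_monoid C) (hyperbolic_class C) `
       carrier (grothendieck_group (weakly_symmetric_monoid C))"

definition witt_group :: "(('o \<times> 'm) set \<times> ('o \<times> 'm) set) set set monoid" where
  "witt_group = K0_quadratic Mod hyperbolic_subgroup"

definition witt_class :: "'o \<times> 'm \<Rightarrow> (('o \<times> 'm) set \<times> ('o \<times> 'm) set) set set" where
  "witt_class q = hyperbolic_subgroup #>\<^bsub>K0_quadratic\<^esub>
     grothendieck_class (quadratic_monoid C) (isometry_class C q) \<one>\<^bsub>quadratic_monoid C\<^esub>"

text \<open>The Witt group written additively, with the residue class of \<open>r\<close> acting as the \<open>r\<close>-fold multiple;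
  this is the only candidate for a \<open>\<int>/2\<int>\<close>-vector space structure on the group.\<close>

definition witt_space :: "(int, (('o \<times> 'm) set \<times> ('o \<times> 'm) set) set set) module" where
  "witt_space = \<lparr>carrier = carrier witt_group, monoid.mult = undefined, one = undefined,
     zero = \<one>\<^bsub>witt_group\<^esub>, add = monoid.mult witt_group,
     smult = (\<lambda>r w. w [^]\<^bsub>witt_group\<^esub> r)\<rparr>"

end

end

theory Submission
  imports Defs
begin

text \<open>
  An arrow \<open>u : X\<^sub>i \<rightarrow> M\<close> with a retraction pulls a form \<open>b\<close> on \<open>M\<close> back to a form on the simple object \<open>X\<^sub>i\<close>.
  By Schur's lemma this pullback is either non-singular, so that it splits off as an orthogonal summand, or
  zero, and then \<open>u\<close> spans a hyperbolic summand since 2 is invertible. Hence every quadratic object is an orthogonal sum of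
  hyperbolic objects and of simple ones. A form on \<open>X\<^sub>i\<close> is determined up to a scalar, thus up to isometry
  because scalars are squares, and a symmetric non-singular one exists iff \<open>i = i\<^sup>*\<close> and \<open>d\<^sub>i = 1\<close>. A square root
  of \<open>-1\<close> provides a Lagrangian of \<open>b \<perp> b\<close>, so the Witt group has exponent 2. The simple classes are
  independent because the multiplicity of a self-dual \<open>X\<^sub>i\<close> in \<open>M \<oplus> M\<^sup>*\<close> is even.
\<close>

section \<open>Monoids of classes and Grothendieck groups\<close>

text \<open>Composition and tensor product are total on untyped arrows and Hom sets may overlap, so
  every equation would drag source and target conditions along. Arrows are therefore stored with
  their ends, and all operations are strict in junk. The abstract part also drops the tensor
  product: it sees only forms, their pullbacks along pairs of arrows, and the swap. Non-singularity
  becomes representability (\<open>perfect\<close>), so associators and unit constraints matter only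
  for the universal property of a dual pair.

  A braiding need not be an involution, so swapping a form twice may change it. Weak symmetry
  excludes this, and an object that carries a non-singular symmetric form satisfies it
  automatically. Comparing the dual of a direct sum with the sum of the duals is avoided: hyperbolic
  forms are recognised by a Lagrangian.

  A class vanishes in the Witt group only up to a common summand, so independence calls for an
  additive invariant. Multiplicities serve; they are well defined because the number of copies of a
  simple object is a trace in \<open>k\<close>, and characteristic zero recovers the number from its
  image in \<open>k\<close>.\<close>

locale sum_relation =
  fixes Q :: "'a set" and eq :: "'a \<Rightarrow> 'a \<Rightarrow> bool"
    and S :: "'a \<Rightarrow> 'a \<Rightarrow> 'a \<Rightarrow> bool" and E :: "'a set"
  assumes eq_refl: "u \<in> Q \<Longrightarrow> eq u u"
    and eq_sym: "\<lbrakk>u \<in> Q; v \<in> Q; eq u v\<rbrakk> \<Longrightarrow> eq v u"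
    and eq_trans: "\<lbrakk>u \<in> Q; v \<in> Q; w \<in> Q; eq u v; eq v w\<rbrakk> \<Longrightarrow> eq u w"
    and sum_exists: "\<lbrakk>u \<in> Q; v \<in> Q\<rbrakk> \<Longrightarrow> \<exists>q\<in>Q. S u v q"
    and sum_unique: "\<lbrakk>u \<in> Q; v \<in> Q; u' \<in> Q; v' \<in> Q; q \<in> Q; q' \<in> Q; S u v q; S u' v' q'; eq u u'; eq v v'\<rbrakk>
      \<Longrightarrow> eq q q'"
    and sum_transport: "\<lbrakk>u \<in> Q; v \<in> Q; q \<in> Q; q' \<in> Q; S u v q; eq q q'\<rbrakk> \<Longrightarrow> S u v q'"
    and sum_commute: "\<lbrakk>u \<in> Q; v \<in> Q; q \<in> Q; S u v q\<rbrakk> \<Longrightarrow> S v u q"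
    and sum_assoc: "\<lbrakk>u \<in> Q; v \<in> Q; w \<in> Q; p \<in> Q; q \<in> Q; r \<in> Q; S u v p; S p w q; S v w r\<rbrakk> \<Longrightarrow> S u r q"
    and E_subset: "E \<subseteq> Q" and E_nonempty: "E \<noteq> {}"
    and E_class: "\<lbrakk>z \<in> E; z' \<in> Q\<rbrakk> \<Longrightarrow> eq z z' \<longleftrightarrow> z' \<in> E"
    and E_sum: "\<lbrakk>z \<in> E; u \<in> Q\<rbrakk> \<Longrightarrow> S z u u"
begin

definition cls :: "'a \<Rightarrow> 'a set" where "cls u = {q \<in> Q. eq u q}"

text \<open>Sums are a ternary relation because direct sums exist only up to isomorphism. The
  product has the shape used in \<open>quadratic_monoid\<close> and
  \<open>weakly_symmetric_monoid\<close>, both of which become instances.\<close>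

definition class_monoid :: "'a set monoid" where
  "class_monoid = \<lparr>carrier = cls ` Q,
     monoid.mult = (\<lambda>U V. {q \<in> Q. \<exists>u\<in>U. \<exists>v\<in>V. S u v q}), one = E\<rparr>"

lemma cls_self: "u \<in> Q \<Longrightarrow> u \<in> cls u"
  by (simp add: cls_def eq_refl)

lemma cls_eq_iff: "\<lbrakk>u \<in> Q; v \<in> Q\<rbrakk> \<Longrightarrow> cls u = cls v \<longleftrightarrow> eq u v"
  unfolding cls_def by (auto intro: eq_refl eq_sym eq_trans)

lemma cls_E: "z \<in> E \<Longrightarrow> cls z = E"
  using E_subset E_class by (auto simp: cls_def)

text \<open>\<open>sum_unique\<close> keeps all sums of members inside one class, and
  \<open>sum_transport\<close> shows that the whole class is reached. This replaces the set of sums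
  by a single representative, after which the monoid laws can be checked on objects.\<close>

lemma cls_mult:
  assumes "u \<in> Q" "v \<in> Q" "q \<in> Q" "S u v q"
  shows "cls u \<otimes>\<^bsub>class_monoid\<^esub> cls v = cls q"
proof -
  have "q' \<in> cls q" if "q' \<in> Q" "u' \<in> cls u" "v' \<in> cls v" "S u' v' q'" for q' u' v'
    using sum_unique[of u v u' v' q q'] that assms by (auto simp: cls_def)
  moreover have "S u v q'" if "q' \<in> cls q" for q'
    using that assms sum_transport[of u v q q'] by (auto simp: cls_def)
  moreover have "cls q \<subseteq> Q" by (auto simp: cls_def)
  ultimately show ?thesis
    using cls_self[OF assms(1)] cls_self[OF assms(2)]
    by (fastforce simp: class_monoid_def)
qed

lemma comm_monoid_class_monoid: "comm_monoid class_monoid"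
proof (rule comm_monoidI)
  fix x y z
  assume "x \<in> carrier class_monoid" "y \<in> carrier class_monoid" "z \<in> carrier class_monoid"
  then obtain u v w where u: "u \<in> Q" "x = cls u" and v: "v \<in> Q" "y = cls v" and w: "w \<in> Q" "z = cls w"
    by (auto simp: class_monoid_def)
  obtain p where p: "p \<in> Q" "S u v p" using sum_exists u v by blast
  obtain q where q: "q \<in> Q" "S p w q" using sum_exists p w by blast
  obtain r where r: "r \<in> Q" "S v w r" using sum_exists v w by blast
  have "S u r q" using sum_assoc u v w p q r by blast
  then show "x \<otimes>\<^bsub>class_monoid\<^esub> y \<otimes>\<^bsub>class_monoid\<^esub> z = x \<otimes>\<^bsub>class_monoid\<^esub> (y \<otimes>\<^bsub>class_monoid\<^esub> z)"
    using u v w p q r by (simp add: cls_mult)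
next
  fix x y
  assume "x \<in> carrier class_monoid" "y \<in> carrier class_monoid"
  then obtain u v where u: "u \<in> Q" "x = cls u" and v: "v \<in> Q" "y = cls v"
    by (auto simp: class_monoid_def)
  obtain p where p: "p \<in> Q" "S u v p" using sum_exists u v by blast
  have "S v u p" using sum_commute u v p by blast
  then show "x \<otimes>\<^bsub>class_monoid\<^esub> y = y \<otimes>\<^bsub>class_monoid\<^esub> x"
    using u v p by (simp add: cls_mult)
  show "x \<otimes>\<^bsub>class_monoid\<^esub> y \<in> carrier class_monoid"
    using u v p by (simp add: cls_mult) (simp add: class_monoid_def)
next
  obtain z where z: "z \<in> E" using E_nonempty by blast
  then have zQ: "z \<in> Q" using E_subset by blast
  show "\<one>\<^bsub>class_monoid\<^esub> \<in> carrier class_monoid"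
    using cls_E[OF z] zQ by (auto simp: class_monoid_def)
  fix x assume "x \<in> carrier class_monoid"
  then obtain u where u: "u \<in> Q" "x = cls u" by (auto simp: class_monoid_def)
  have "cls z \<otimes>\<^bsub>class_monoid\<^esub> cls u = cls u"
    using cls_mult[OF zQ u(1) u(1)] E_sum[OF z u(1)] .
  then show "\<one>\<^bsub>class_monoid\<^esub> \<otimes>\<^bsub>class_monoid\<^esub> x = x"
    using cls_E[OF z] u by (simp add: class_monoid_def)
qed

end

section \<open>The Grothendieck group of a commutative monoid\<close>

lemma (in comm_monoid) grothendieck_equiv:
  "equiv (carrier G \<times> carrier G) (grothendieck_rel G)"
proof (rule equivI)
  show "grothendieck_rel G \<subseteq> (carrier G \<times> carrier G) \<times> (carrier G \<times> carrier G)"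
    by (auto simp: grothendieck_rel_def)
  show "refl_on (carrier G \<times> carrier G) (grothendieck_rel G)"
    unfolding refl_on_def by (auto simp: grothendieck_rel_def intro!: bexI[of _ \<one>])
  show "sym (grothendieck_rel G)"
  proof (rule symI)
    fix x y assume "(x, y) \<in> grothendieck_rel G"
    then obtain a b a' b' t where "x = (a, b)" "y = (a', b')" "{a, b, a', b'} \<subseteq> carrier G"
      "t \<in> carrier G" and t: "a \<otimes> b' \<otimes> t = a' \<otimes> b \<otimes> t"
      by (auto simp: grothendieck_rel_def)
    then show "(y, x) \<in> grothendieck_rel G"
      using t[symmetric] unfolding grothendieck_rel_def by blast
  qed
  show "trans (grothendieck_rel G)"
  proof (rule transI)
    fix x y z assume "(x, y) \<in> grothendieck_rel G" "(y, z) \<in> grothendieck_rel G"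
    then obtain a b a' b' a'' b'' s t where eqs: "x = (a, b)" "y = (a', b')" "z = (a'', b'')"
      and c: "a \<in> carrier G" "b \<in> carrier G" "a' \<in> carrier G" "b' \<in> carrier G"
        "a'' \<in> carrier G" "b'' \<in> carrier G" "s \<in> carrier G" "t \<in> carrier G"
      and s: "a \<otimes> b' \<otimes> s = a' \<otimes> b \<otimes> s" and t: "a' \<otimes> b'' \<otimes> t = a'' \<otimes> b' \<otimes> t"
      by (auto simp: grothendieck_rel_def)
    \<comment> \<open>The middle denominator \<open>b'\<close> cannot be cancelled in a monoid; it
      is absorbed into the stabilising factor together with \<open>s\<close> and
      \<open>t\<close>.\<close>
    have "a \<otimes> b'' \<otimes> (b' \<otimes> s \<otimes> t) = (a \<otimes> b' \<otimes> s) \<otimes> (b'' \<otimes> t)"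
      using c by (simp add: m_ac)
    also have "\<dots> = (a' \<otimes> b'' \<otimes> t) \<otimes> (b \<otimes> s)"
      using c by (simp add: s m_ac)
    also have "\<dots> = a'' \<otimes> b \<otimes> (b' \<otimes> s \<otimes> t)"
      using c by (simp add: t m_ac)
    finally show "(x, z) \<in> grothendieck_rel G"
      using c eqs by (auto simp: grothendieck_rel_def)
  qed
qed

lemma (in comm_monoid) grothendieck_class_eq_iff:
  assumes "a \<in> carrier G" "b \<in> carrier G" "a' \<in> carrier G" "b' \<in> carrier G"
  shows "grothendieck_class G a b = grothendieck_class G a' b' \<longleftrightarrow>
    (\<exists>t\<in>carrier G. a \<otimes> b' \<otimes> t = a' \<otimes> b \<otimes> t)"
  using eq_equiv_class_iff[OF grothendieck_equiv, of "(a, b)" "(a', b')"] assms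
  by (simp add: grothendieck_class_def) (auto simp: grothendieck_rel_def)

lemma (in comm_monoid) grothendieck_carrier:
  "carrier (grothendieck_group G) = {grothendieck_class G a b |a b. a \<in> carrier G \<and> b \<in> carrier G}"
  by (auto simp: grothendieck_group_def quotient_def grothendieck_class_def)

lemma (in comm_monoid) grothendieck_class_members:
  assumes "(x, y) \<in> grothendieck_class G a b"
  shows "x \<in> carrier G" "y \<in> carrier G" "\<exists>t\<in>carrier G. a \<otimes> y \<otimes> t = x \<otimes> b \<otimes> t"
  using assms by (auto simp: grothendieck_class_def grothendieck_rel_def)

lemma (in comm_monoid) grothendieck_class_self:
  "\<lbrakk>a \<in> carrier G; b \<in> carrier G\<rbrakk> \<Longrightarrow> (a, b) \<in> grothendieck_class G a b"
  by (auto simp: grothendieck_class_def grothendieck_rel_def intro!: bexI[of _ \<one>])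

text \<open>The group operation is a union over all pairs of representatives. The class under the
  union does not depend on them, since stabilising factors multiply, so the union collapses to its
  value at one pair.\<close>

lemma (in comm_monoid) grothendieck_mult:
  assumes c: "a \<in> carrier G" "b \<in> carrier G" "a' \<in> carrier G" "b' \<in> carrier G"
  shows "grothendieck_class G a b \<otimes>\<^bsub>grothendieck_group G\<^esub> grothendieck_class G a' b' =
    grothendieck_class G (a \<otimes> a') (b \<otimes> b')"
proof -
  have "grothendieck_class G (x \<otimes> x') (y \<otimes> y') = grothendieck_class G (a \<otimes> a') (b \<otimes> b')"
    if xy: "(x, y) \<in> grothendieck_class G a b" and xy': "(x', y') \<in> grothendieck_class G a' b'" for x y x' y'
  proof -
    note m = grothendieck_class_members[OF xy] grothendieck_class_members[OF xy']
    obtain t t' where t: "t \<in> carrier G" "a \<otimes> y \<otimes> t = x \<otimes> b \<otimes> t"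
      and t': "t' \<in> carrier G" "a' \<otimes> y' \<otimes> t' = x' \<otimes> b' \<otimes> t'"
      using m by blast
    have "a \<otimes> a' \<otimes> (y \<otimes> y') \<otimes> (t \<otimes> t') = (a \<otimes> y \<otimes> t) \<otimes> (a' \<otimes> y' \<otimes> t')"
      using c m t(1) t'(1) by (simp add: m_ac)
    also have "\<dots> = x \<otimes> x' \<otimes> (b \<otimes> b') \<otimes> (t \<otimes> t')"
      using c m t(1) t'(1) by (simp add: t(2) t'(2) m_ac)
    finally show ?thesis
      using c m t(1) t'(1) by (subst grothendieck_class_eq_iff) (auto intro!: bexI[of _ "t \<otimes> t'"])
  qed
  then have "(\<Union>(x', y')\<in>grothendieck_class G a' b'. grothendieck_class G (x \<otimes> x') (y \<otimes> y')) =
      grothendieck_class G (a \<otimes> a') (b \<otimes> b')" if "(x, y) \<in> grothendieck_class G a b" for x y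
    using that by (intro UN_constant_eq[OF grothendieck_class_self[OF c(3,4)]]) auto
  then show ?thesis
    unfolding grothendieck_group_def monoid.simps
    by (intro UN_constant_eq[OF grothendieck_class_self[OF c(1,2)]] ballI) clarsimp
qed

lemma (in comm_monoid) grothendieck_comm_group: "comm_group (grothendieck_group G)"
proof (rule comm_groupI)
  fix x y z
  assume "x \<in> carrier (grothendieck_group G)" "y \<in> carrier (grothendieck_group G)"
    "z \<in> carrier (grothendieck_group G)"
  then show "x \<otimes>\<^bsub>grothendieck_group G\<^esub> y \<otimes>\<^bsub>grothendieck_group G\<^esub> z =
    x \<otimes>\<^bsub>grothendieck_group G\<^esub> (y \<otimes>\<^bsub>grothendieck_group G\<^esub> z)"
    by (auto simp: grothendieck_carrier grothendieck_mult m_assoc)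
next
  fix x y
  assume "x \<in> carrier (grothendieck_group G)" "y \<in> carrier (grothendieck_group G)"
  then obtain a b a' b' where ab: "a \<in> carrier G" "b \<in> carrier G" "a' \<in> carrier G" "b' \<in> carrier G"
    and x: "x = grothendieck_class G a b" and y: "y = grothendieck_class G a' b'"
    unfolding grothendieck_carrier by blast
  show "x \<otimes>\<^bsub>grothendieck_group G\<^esub> y = y \<otimes>\<^bsub>grothendieck_group G\<^esub> x"
    using ab by (simp add: x y grothendieck_mult m_comm)
  show "x \<otimes>\<^bsub>grothendieck_group G\<^esub> y \<in> carrier (grothendieck_group G)"
    unfolding x y grothendieck_mult[OF ab] grothendieck_carrier using ab by blast
next
  have one: "\<one>\<^bsub>grothendieck_group G\<^esub> = grothendieck_class G \<one> \<one>"
    by (simp add: grothendieck_group_def)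
  show "\<one>\<^bsub>grothendieck_group G\<^esub> \<in> carrier (grothendieck_group G)"
    by (auto simp: one grothendieck_carrier)
  fix x assume "x \<in> carrier (grothendieck_group G)"
  then obtain a b where ab: "a \<in> carrier G" "b \<in> carrier G" "x = grothendieck_class G a b"
    by (auto simp: grothendieck_carrier)
  show "\<one>\<^bsub>grothendieck_group G\<^esub> \<otimes>\<^bsub>grothendieck_group G\<^esub> x = x"
    using ab by (simp add: one grothendieck_mult)
  \<comment> \<open>The inverse of a formal quotient exchanges numerator and denominator.\<close>
  have "b \<otimes> a \<otimes> \<one> \<otimes> \<one> = \<one> \<otimes> (a \<otimes> b) \<otimes> \<one>" using ab by (simp add: m_comm)
  then have "grothendieck_class G (b \<otimes> a) (a \<otimes> b) = grothendieck_class G \<one> \<one>"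
    using ab by (subst grothendieck_class_eq_iff) (auto simp del: r_one)
  then show "\<exists>y\<in>carrier (grothendieck_group G). y \<otimes>\<^bsub>grothendieck_group G\<^esub> x = \<one>\<^bsub>grothendieck_group G\<^esub>"
    using ab grothendieck_mult[of b a a b] unfolding one grothendieck_carrier by blast
qed

section \<open>The quotient of a Grothendieck group by the image of a monoid homomorphism\<close>

locale comm_monoid_hom = G: comm_monoid G + H: comm_monoid H
  for G :: "('b, 'y) monoid_scheme" and H :: "('a, 'x) monoid_scheme" +
  fixes f :: "'b \<Rightarrow> 'a"
  assumes f_closed: "c \<in> carrier G \<Longrightarrow> f c \<in> carrier H"
    and f_mult: "\<lbrakk>c \<in> carrier G; d \<in> carrier G\<rbrakk> \<Longrightarrow> f (c \<otimes>\<^bsub>G\<^esub> d) = f c \<otimes>\<^bsub>H\<^esub> f d"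
    and f_one: "f \<one>\<^bsub>G\<^esub> = \<one>\<^bsub>H\<^esub>"
begin

text \<open>Applying \<open>f\<close> to an equation stabilised by \<open>t\<close> gives one
  stabilised by \<open>f t\<close>, so the union in \<open>grothendieck_map\<close> runs over equal
  classes.\<close>

lemma grothendieck_map_class:
  assumes c: "a \<in> carrier G" "b \<in> carrier G"
  shows "grothendieck_map H f (grothendieck_class G a b) = grothendieck_class H (f a) (f b)"
proof -
  have "grothendieck_class H (f x) (f y) = grothendieck_class H (f a) (f b)"
    if xy: "(x, y) \<in> grothendieck_class G a b" for x y
  proof -
    note m = G.grothendieck_class_members[OF xy]
    obtain t where t: "t \<in> carrier G" "a \<otimes>\<^bsub>G\<^esub> y \<otimes>\<^bsub>G\<^esub> t = x \<otimes>\<^bsub>G\<^esub> b \<otimes>\<^bsub>G\<^esub> t"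
      using m(3) by blast
    have "f (a \<otimes>\<^bsub>G\<^esub> y \<otimes>\<^bsub>G\<^esub> t) = f (x \<otimes>\<^bsub>G\<^esub> b \<otimes>\<^bsub>G\<^esub> t)" using t by simp
    then show ?thesis
      using c m(1,2) t(1)
      by (subst H.grothendieck_class_eq_iff) (auto simp: f_closed f_mult intro!: bexI[of _ "f t"])
  qed
  then show ?thesis
    unfolding grothendieck_map_def
    by (intro UN_constant_eq[OF G.grothendieck_class_self[OF c]] ballI) clarsimp
qed

abbreviation K where "K \<equiv> grothendieck_group H"

definition image_subgroup where
  "image_subgroup = grothendieck_map H f ` carrier (grothendieck_group G)"

lemma image_subgroup_eq:
  "image_subgroup = {grothendieck_class H (f a) (f b) |a b. a \<in> carrier G \<and> b \<in> carrier G}"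
  by (force simp: image_subgroup_def G.grothendieck_carrier grothendieck_map_class)

sublocale K: comm_group K by (rule H.grothendieck_comm_group)

lemma K_one: "\<one>\<^bsub>K\<^esub> = grothendieck_class H \<one>\<^bsub>H\<^esub> \<one>\<^bsub>H\<^esub>"
  by (simp add: grothendieck_group_def)

lemma K_inv:
  assumes "a \<in> carrier H" "b \<in> carrier H"
  shows "inv\<^bsub>K\<^esub> (grothendieck_class H a b) = grothendieck_class H b a"
proof (rule K.inv_equality)
  show "grothendieck_class H b a \<otimes>\<^bsub>K\<^esub> grothendieck_class H a b = \<one>\<^bsub>K\<^esub>"
    using assms by (simp add: K_one H.grothendieck_mult H.grothendieck_class_eq_iff) (auto simp: H.m_comm)
qed (use assms in \<open>auto simp: H.grothendieck_carrier\<close>)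

lemma image_subgroup_normal: "normal image_subgroup K"
proof -
  have "subgroup image_subgroup K"
  proof (rule K.subgroupI)
    show "image_subgroup \<subseteq> carrier K"
      by (auto simp: image_subgroup_eq H.grothendieck_carrier intro: f_closed)
    show "image_subgroup \<noteq> {}" unfolding image_subgroup_eq by blast
  next
    fix a assume "a \<in> image_subgroup"
    then show "inv\<^bsub>K\<^esub> a \<in> image_subgroup"
      by (auto simp: image_subgroup_eq K_inv f_closed) blast
  next
    fix a b assume "a \<in> image_subgroup" "b \<in> image_subgroup"
    then show "a \<otimes>\<^bsub>K\<^esub> b \<in> image_subgroup"
      by (auto simp: image_subgroup_eq H.grothendieck_mult f_closed f_mult[symmetric]) blast
  qed
  then show ?thesis by (rule K.subgroup_imp_normal)
qed

sublocale N: normal image_subgroup K by (rule image_subgroup_normal)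

abbreviation W where "W \<equiv> K Mod image_subgroup"

text \<open>For the quadratic monoid and the hyperbolic map this is the Witt class of an isometry
  class.\<close>

definition coset_class where
  "coset_class a = image_subgroup #>\<^bsub>K\<^esub> grothendieck_class H a \<one>\<^bsub>H\<^esub>"

lemma W_comm_group: "comm_group W"
  using K.abelian_FactGroup N.is_subgroup by blast

sublocale W: comm_group W by (rule W_comm_group)

lemma class_in_K: "a \<in> carrier H \<Longrightarrow> grothendieck_class H a \<one>\<^bsub>H\<^esub> \<in> carrier K"
  by (auto simp: H.grothendieck_carrier)

lemma coset_class_closed: "a \<in> carrier H \<Longrightarrow> coset_class a \<in> carrier W"
  by (auto simp: coset_class_def FactGroup_def RCOSETS_def class_in_K)

lemma coset_class_mult:
  assumes "a \<in> carrier H" "b \<in> carrier H"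
  shows "coset_class (a \<otimes>\<^bsub>H\<^esub> b) = coset_class a \<otimes>\<^bsub>W\<^esub> coset_class b"
proof -
  have "coset_class a \<otimes>\<^bsub>W\<^esub> coset_class b = image_subgroup #>\<^bsub>K\<^esub>
      (grothendieck_class H a \<one>\<^bsub>H\<^esub> \<otimes>\<^bsub>K\<^esub> grothendieck_class H b \<one>\<^bsub>H\<^esub>)"
    using assms by (simp add: coset_class_def N.rcos_sum class_in_K)
  then show ?thesis
    using assms by (simp add: coset_class_def H.grothendieck_mult)
qed

text \<open>Brings the vanishing of a class down to an equation inside the monoid, where an additive
  invariant can be evaluated. The independence of the simple classes is tested in this form.\<close>

lemma coset_class_eq_one_iff:
  assumes "a \<in> carrier H"
  shows "coset_class a = \<one>\<^bsub>W\<^esub> \<longleftrightarrow>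
    (\<exists>c\<in>carrier G. \<exists>d\<in>carrier G. \<exists>t\<in>carrier H. a \<otimes>\<^bsub>H\<^esub> f d \<otimes>\<^bsub>H\<^esub> t = f c \<otimes>\<^bsub>H\<^esub> t)"
proof -
  have "coset_class a = \<one>\<^bsub>W\<^esub> \<longleftrightarrow> grothendieck_class H a \<one>\<^bsub>H\<^esub> \<in> image_subgroup"
  proof -
    have "\<one>\<^bsub>W\<^esub> = image_subgroup" by (simp add: FactGroup_def)
    then show ?thesis
      unfolding coset_class_def
      using K.coset_join1[OF _ class_in_K[OF assms] N.is_subgroup]
        K.coset_join2[OF class_in_K[OF assms] N.is_subgroup] by metis
  qed
  also have "\<dots> \<longleftrightarrow> (\<exists>c\<in>carrier G. \<exists>d\<in>carrier G. grothendieck_class H a \<one>\<^bsub>H\<^esub> = grothendieck_class H (f c) (f d))"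
    by (auto simp: image_subgroup_eq)
  finally show ?thesis
    using assms by (simp add: H.grothendieck_class_eq_iff f_closed)
qed

lemma coset_class_f:
  assumes "c \<in> carrier G"
  shows "coset_class (f c) = \<one>\<^bsub>W\<^esub>"
proof -
  have "f c \<otimes>\<^bsub>H\<^esub> f \<one>\<^bsub>G\<^esub> \<otimes>\<^bsub>H\<^esub> \<one>\<^bsub>H\<^esub> = f c \<otimes>\<^bsub>H\<^esub> \<one>\<^bsub>H\<^esub>"
    using assms by (simp add: f_one f_closed)
  then show ?thesis
    unfolding coset_class_eq_one_iff[OF f_closed[OF assms]]
    using assms G.one_closed H.one_closed by (intro bexI)
qed

text \<open>The formal quotient of \<open>a\<close> by \<open>b\<close>, multiplied by the class of
  \<open>b\<close>, is the class of \<open>a\<close>; hence the quotient group is generated by the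
  monoid.\<close>

lemma coset_class_surj:
  assumes "w \<in> carrier W"
  obtains a b where "a \<in> carrier H" "b \<in> carrier H" "w = coset_class a \<otimes>\<^bsub>W\<^esub> inv\<^bsub>W\<^esub> coset_class b"
proof -
  obtain x where x: "x \<in> carrier K" and "w = image_subgroup #>\<^bsub>K\<^esub> x"
    using assms unfolding FactGroup_def RCOSETS_def by auto
  then obtain a b where ab: "a \<in> carrier H" "b \<in> carrier H"
    and w: "w = image_subgroup #>\<^bsub>K\<^esub> grothendieck_class H a b"
    unfolding H.grothendieck_carrier by auto
  have K: "grothendieck_class H a b \<in> carrier K"
    using ab by (auto simp: H.grothendieck_carrier)
  have "grothendieck_class H a b \<otimes>\<^bsub>K\<^esub> grothendieck_class H b \<one>\<^bsub>H\<^esub> = grothendieck_class H a \<one>\<^bsub>H\<^esub>"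
    using ab by (simp add: H.grothendieck_mult H.grothendieck_class_eq_iff) (use H.one_closed in blast)
  then have "w \<otimes>\<^bsub>W\<^esub> coset_class b = coset_class a"
    unfolding w coset_class_def by (simp add: N.rcos_sum[OF K class_in_K[OF ab(2)]])
  then have "w = coset_class a \<otimes>\<^bsub>W\<^esub> inv\<^bsub>W\<^esub> coset_class b"
    using W.inv_solve_right[OF assms coset_class_closed[OF ab(1)] coset_class_closed[OF ab(2)]]
    by (simp only:)
  then show thesis by (rule that[OF ab])
qed

end

section \<open>Groups of exponent two as vector spaces\<close>

text \<open>The construction of \<open>witt_space\<close> for an arbitrary group, so that the linear
  algebra can be done without any category.\<close>

definition exponent_two_space :: "('a, 'b) monoid_scheme \<Rightarrow> (int, 'a) module" where
  "exponent_two_space G = \<lparr>carrier = carrier G, monoid.mult = undefined, one = undefined,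
     zero = \<one>\<^bsub>G\<^esub>, add = monoid.mult G, smult = (\<lambda>r w. w [^]\<^bsub>G\<^esub> r)\<rparr>"

locale exponent_two_group = comm_group G for G (structure) +
  assumes square_one: "x \<in> carrier G \<Longrightarrow> x \<otimes> x = \<one>"
begin

abbreviation V where "V \<equiv> exponent_two_space G"

lemma V_simps [simp]: "carrier V = carrier G" "\<zero>\<^bsub>V\<^esub> = \<one>" "x \<oplus>\<^bsub>V\<^esub> y = x \<otimes> y" "r \<odot>\<^bsub>V\<^esub> x = x [^] r"
  by (simp_all add: exponent_two_space_def)

sublocale R2: residues 2 "residue_ring 2"
  by unfold_locales simp_all

lemma carrier_R2: "carrier (residue_ring 2) = {0, 1}"
  by (auto simp: residue_ring_def)

text \<open>Residues are represented by integers, and the operations of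
  \<open>residue_ring 2\<close> reduce modulo 2. The scalar action respects this reduction exactly
  because squares are trivial.\<close>

lemma pow_mod: "x \<in> carrier G \<Longrightarrow> x [^] (r mod 2 :: int) = x [^] r"
proof -
  assume x: "x \<in> carrier G"
  have "x [^] (2 :: int) = \<one>" using x square_one[OF x] int_pow_int[of G x 2] by (simp add: numeral_2_eq_2)
  have "x [^] r = x [^] (2 * (r div 2) + r mod 2)" by simp
  also have "\<dots> = (x [^] (2 :: int)) [^] (r div 2) \<otimes> x [^] (r mod 2)"
    using x by (simp only: int_pow_mult int_pow_pow)
  also have "\<dots> = x [^] (r mod 2)" using x \<open>x [^] (2 :: int) = \<one>\<close> by (simp add: int_pow_one)
  finally show ?thesis by simp
qed

lemma vectorspace_V: "vectorspace (residue_ring 2) V"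
proof -
  have "Ring.field (residue_ring 2)"
    using residues_prime.is_field[OF residues_prime.intro[OF two_is_prime_nat]] by simp
  moreover have "abelian_group V"
    by (rule abelian_groupI) (use m_assoc m_comm in \<open>auto intro: bexI[of _ "inv x" for x]\<close>)
  moreover have "Module.module (residue_ring 2) V"
  proof (rule Module.module.intro[OF R2.is_cring \<open>abelian_group V\<close>], rule Module.module_axioms.intro)
    show "(a \<oplus>\<^bsub>residue_ring 2\<^esub> b) \<odot>\<^bsub>V\<^esub> x = a \<odot>\<^bsub>V\<^esub> x \<oplus>\<^bsub>V\<^esub> b \<odot>\<^bsub>V\<^esub> x" if "x \<in> carrier V" for a b x
      using that by (simp add: residue_ring_def pow_mod int_pow_mult)
    show "(a \<otimes>\<^bsub>residue_ring 2\<^esub> b) \<odot>\<^bsub>V\<^esub> x = a \<odot>\<^bsub>V\<^esub> (b \<odot>\<^bsub>V\<^esub> x)" if "x \<in> carrier V" for a b x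
      using that by (simp add: residue_ring_def pow_mod int_pow_pow mult.commute)
    show "a \<odot>\<^bsub>V\<^esub> (x \<oplus>\<^bsub>V\<^esub> y) = a \<odot>\<^bsub>V\<^esub> x \<oplus>\<^bsub>V\<^esub> a \<odot>\<^bsub>V\<^esub> y" if "x \<in> carrier V" "y \<in> carrier V" for a x y
      using that by (simp add: int_pow_distrib)
  qed (simp_all add: residue_ring_def)
  ultimately show ?thesis by (simp add: vectorspace_def)
qed

sublocale VS: vectorspace "residue_ring 2" V by (rule vectorspace_V)

text \<open>Over the field with two elements a coefficient only decides whether a vector occurs, so
  linear combinations are products over subsets.\<close>

lemma lincomb_eq_finprod:
  assumes "finite B" "B \<subseteq> carrier G" "a \<in> B \<rightarrow> {0, 1}"
  shows "VS.lincomb a B = finprod G (\<lambda>x. x) {x \<in> B. a x = 1}"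
  using assms
proof (induction B rule: finite_induct)
  case empty
  have "VS.lincomb a {} = \<zero>\<^bsub>V\<^esub>" unfolding VS.lincomb_def by (rule VS.finsum_empty)
  then show ?case by simp
next
  case (insert x B)
  have x: "x \<in> carrier G" and B: "B \<subseteq> carrier G" and a: "a \<in> B \<rightarrow> {0, 1}" "a x = 0 \<or> a x = 1"
    using insert.prems by auto
  have f: "(\<lambda>x. a x \<odot>\<^bsub>V\<^esub> x) \<in> B \<rightarrow> carrier V" "a x \<odot>\<^bsub>V\<^esub> x \<in> carrier V" using x B by auto
  have "VS.lincomb a (insert x B) = a x \<odot>\<^bsub>V\<^esub> x \<oplus>\<^bsub>V\<^esub> VS.lincomb a B"
    unfolding VS.lincomb_def by (rule VS.finsum_insert[OF insert(1,2) f])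
  then have 1: "VS.lincomb a (insert x B) = x [^] a x \<otimes> finprod G (\<lambda>x. x) {x \<in> B. a x = 1}"
    using insert.IH[OF B a(1)] by simp
  have cl: "(\<lambda>x. x) \<in> {x \<in> B. a x = 1} \<rightarrow> carrier G" using B by auto
  show ?case
  proof (cases "a x = 1")
    case True
    then have "{y \<in> insert x B. a y = 1} = insert x {y \<in> B. a y = 1}" by auto
    then show ?thesis
      using 1 True x finprod_insert[OF _ _ cl x] insert(1,2) by (simp add: int_pow_1)
  next
    case False
    then have "{y \<in> insert x B. a y = 1} = {y \<in> B. a y = 1}" by auto
    then show ?thesis using 1 False a(2) x finprod_closed[OF cl] by simp
  qed
qed

text \<open>Spanning and independence are phrased by subsets of the index set rather than of its
  image. Injectivity comes for free: two equal members with different indices multiply to a square,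
  a product equal to one over a nonempty set.\<close>

lemma basis_criterion:
  assumes J: "finite J" and w: "w \<in> J \<rightarrow> carrier G"
    and span: "\<And>x. x \<in> carrier G \<Longrightarrow> \<exists>A\<subseteq>J. x = finprod G w A"
    and indep: "\<And>A. \<lbrakk>A \<subseteq> J; finprod G w A = \<one>\<rbrakk> \<Longrightarrow> A = {}"
  shows "inj_on w J \<and> VS.basis (w ` J)"
proof -
  have inj: "inj_on w J"
  proof (rule inj_onI, rule ccontr)
    fix i j assume ij: "i \<in> J" "j \<in> J" "w i = w j" "i \<noteq> j"
    have wi: "w i \<in> carrier G" "w j \<in> carrier G" using ij w by auto
    have "finprod G w {i, j} = w i \<otimes> finprod G w {j}"
      by (rule finprod_insert) (use ij wi in auto)
    also have "finprod G w {j} = w j \<otimes> finprod G w {}" by (rule finprod_insert) (use wi in auto)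
    also have "w i \<otimes> (w j \<otimes> finprod G w {}) = \<one>" using ij wi square_one by simp
    finally show False using indep[of "{i, j}"] ij by blast
  qed
  have reindex: "finprod G (\<lambda>x. x) (w ` A) = finprod G w A" if "A \<subseteq> J" for A
    by (rule finprod_reindex) (use that w inj in \<open>auto intro: inj_on_subset\<close>)
  have wJ: "w ` J \<subseteq> carrier G" "finite (w ` J)" using w J by auto
  have "VS.gen_set (w ` J)"
  proof -
    have "x \<in> VS.span (w ` J)" if x: "x \<in> carrier G" for x
    proof -
      obtain A where A: "A \<subseteq> J" "x = finprod G w A" using span[OF x] by blast
      let ?a = "\<lambda>y. if y \<in> w ` A then 1 else (0 :: int)"
      have "{y \<in> w ` J. ?a y = 1} = w ` A" using A(1) by auto
      then have "VS.lincomb ?a (w ` J) = x"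
        using lincomb_eq_finprod[OF wJ(2,1), of ?a] reindex[OF A(1)] A(2) by simp
      moreover have "?a \<in> w ` J \<rightarrow> carrier (residue_ring 2)" by (auto simp: carrier_R2)
      ultimately show ?thesis unfolding VS.span_def using wJ by blast
    qed
    moreover have "VS.span (w ` J) \<subseteq> carrier V" using VS.span_is_subset2[of "w ` J"] wJ by simp
    ultimately show ?thesis by auto
  qed
  moreover have "VS.lin_indpt (w ` J)"
  proof
    assume "VS.lin_dep (w ` J)"
    then obtain B a v where B: "finite B" "B \<subseteq> w ` J" "a \<in> B \<rightarrow> carrier (residue_ring 2)"
      "VS.lincomb a B = \<zero>\<^bsub>V\<^esub>" "v \<in> B" "a v \<noteq> \<zero>\<^bsub>residue_ring 2\<^esub>" unfolding VS.lin_dep_def by blast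
    have a: "a \<in> B \<rightarrow> {0, 1}" using B(3) carrier_R2 by simp
    obtain A where A: "A \<subseteq> J" "{x \<in> B. a x = 1} = w ` A"
      using B(2) subset_image_iff[of "{x \<in> B. a x = 1}" w J] by blast
    have "finprod G w A = \<one>"
      using lincomb_eq_finprod[OF B(1) _ a] reindex[OF A(1)] B(2,4) wJ(1) A(2) by auto
    then have "{x \<in> B. a x = 1} = {}" using indep[OF A(1)] A(2) by simp
    then have "a v = 0" using B(5) a by auto
    then show False using B(6) by (simp add: residue_ring_def)
  qed
  ultimately show ?thesis using inj wJ by (simp add: VS.basis_def)
qed

end

section \<open>Additive categories with a bilinear form functor\<close>

text \<open>Used twice, for arrows and for bilinear forms. Commutativity, associativity and
  distributivity carry no typing premises; this is what the strict treatment of junk values makes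
  possible.\<close>

locale typed_space =
  fixes Ob :: "'o set" and valid :: "'a \<Rightarrow> bool" and src trg :: "'a \<Rightarrow> 'o"
    and plus :: "'a \<Rightarrow> 'a \<Rightarrow> 'a" (infixl "\<boxplus>" 65)
    and scale :: "'k::field_char_0 \<Rightarrow> 'a \<Rightarrow> 'a" (infixr "\<triangleright>" 75)
    and zero :: "'o \<Rightarrow> 'o \<Rightarrow> 'a"
  assumes src_Ob [simp]: "valid f \<Longrightarrow> src f \<in> Ob"
    and trg_Ob [simp]: "valid f \<Longrightarrow> trg f \<in> Ob"
    and valid_plus [simp]: "\<lbrakk>valid f; valid g; src f = src g; trg f = trg g\<rbrakk> \<Longrightarrow> valid (f \<boxplus> g)"
    and src_plus [simp]: "\<lbrakk>valid f; valid g; src f = src g; trg f = trg g\<rbrakk> \<Longrightarrow> src (f \<boxplus> g) = src g"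
    and trg_plus [simp]: "\<lbrakk>valid f; valid g; src f = src g; trg f = trg g\<rbrakk> \<Longrightarrow> trg (f \<boxplus> g) = trg g"
    and plus_commute: "f \<boxplus> g = g \<boxplus> f"
    and plus_assoc: "f \<boxplus> g \<boxplus> h = f \<boxplus> (g \<boxplus> h)"
    and valid_scale [simp]: "valid f \<Longrightarrow> valid (c \<triangleright> f)"
    and src_scale [simp]: "valid f \<Longrightarrow> src (c \<triangleright> f) = src f"
    and trg_scale [simp]: "valid f \<Longrightarrow> trg (c \<triangleright> f) = trg f"
    and scale_plus: "c \<triangleright> (f \<boxplus> g) = c \<triangleright> f \<boxplus> c \<triangleright> g"
    and scale_add: "(c + d) \<triangleright> f = c \<triangleright> f \<boxplus> d \<triangleright> f"
    and scale_scale [simp]: "c \<triangleright> d \<triangleright> f = (c * d) \<triangleright> f"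
    and scale_one [simp]: "valid f \<Longrightarrow> 1 \<triangleright> f = f"
    and scale_zero: "valid f \<Longrightarrow> 0 \<triangleright> f = zero (src f) (trg f)"
    and valid_zero [simp]: "\<lbrakk>A \<in> Ob; B \<in> Ob\<rbrakk> \<Longrightarrow> valid (zero A B)"
    and src_zero [simp]: "\<lbrakk>A \<in> Ob; B \<in> Ob\<rbrakk> \<Longrightarrow> src (zero A B) = A"
    and trg_zero [simp]: "\<lbrakk>A \<in> Ob; B \<in> Ob\<rbrakk> \<Longrightarrow> trg (zero A B) = B"
begin

lemma plus_left_commute: "f \<boxplus> (g \<boxplus> h) = g \<boxplus> (f \<boxplus> h)"
  by (metis plus_assoc plus_commute)

lemmas plus_ac = plus_assoc plus_commute plus_left_commute

lemma zero_plus [simp]: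
  assumes "valid f" "src f = A" "trg f = B"
  shows "zero A B \<boxplus> f = f"
  using scale_add[of 0 1 f] assms by (simp add: scale_zero)

lemma plus_zero [simp]: "\<lbrakk>valid f; src f = A; trg f = B\<rbrakk> \<Longrightarrow> f \<boxplus> zero A B = f"
  by (simp add: plus_commute[of f])

lemma scale_of_zero [simp]:
  assumes "A \<in> Ob" "B \<in> Ob"
  shows "c \<triangleright> zero A B = zero A B"
  using scale_scale[of c 0 "zero A B"] scale_zero[of "zero A B"] assms by simp

lemma plus_neg [simp]:
  assumes "valid f"
  shows "f \<boxplus> (-1) \<triangleright> f = zero (src f) (trg f)"
  using scale_add[of 1 "-1" f] assms by (simp add: scale_zero)

lemma cancel_left:
  assumes eq: "f \<boxplus> g = f \<boxplus> h" and v: "valid f" "valid g" "valid h"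
    and t: "src f = src g" "src f = src h" "trg f = trg g" "trg f = trg h"
  shows "g = h"
proof -
  have *: "(-1) \<triangleright> f \<boxplus> (f \<boxplus> x) = x" if "valid x" "src f = src x" "trg f = trg x" for x
    using that v(1) by (simp add: plus_assoc[symmetric] plus_commute[of "(-1) \<triangleright> f" f])
  have "g = (-1) \<triangleright> f \<boxplus> (f \<boxplus> g)" using * v t by simp
  also have "\<dots> = h" unfolding eq using * v t by simp
  finally show ?thesis .
qed

lemma eq_of_diff_zero:
  assumes eq: "f \<boxplus> (-1) \<triangleright> g = zero A B" and v: "valid f" "valid g"
    and t: "src f = A" "src g = A" "trg f = B" "trg g = B"
  shows "f = g"
proof -
  have "g \<boxplus> (-1) \<triangleright> g = zero A B" using v t plus_neg[OF v(2)] by simp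
  then have "(-1) \<triangleright> g \<boxplus> f = (-1) \<triangleright> g \<boxplus> g" using eq by (simp add: plus_commute)
  then show ?thesis by (rule cancel_left) (use v t in auto)
qed

text \<open>Source of the constant in the correction of an isotropic complement: the two cross terms
  contribute minus one half of the form each and cancel it together.\<close>

lemma minus_halves:
  assumes "valid f"
  shows "f \<boxplus> ((-1/2) \<triangleright> f \<boxplus> (-1/2) \<triangleright> f) = zero (src f) (trg f)"
  using scale_add[of "-1/2" "-1/2" f] plus_neg[OF assms] by simp

lemma scale_eq_zero:
  assumes "c \<triangleright> f = zero A B" "c \<noteq> 0" "valid f" "A \<in> Ob" "B \<in> Ob"
  shows "f = zero A B"
proof -
  have "(1/c) \<triangleright> c \<triangleright> f = (1/c) \<triangleright> zero A B" by (simp only: assms(1))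
  then show ?thesis using assms(2-5) by (simp del: scale_scale add: scale_scale[of "1/c" c])
qed

text \<open>The ends \<open>A\<close> and \<open>B\<close> are arguments because an empty sum must
  know which zero arrow it denotes.\<close>

definition lsum :: "'o \<Rightarrow> 'o \<Rightarrow> 'a list \<Rightarrow> 'a" where
  "lsum A B fs = foldr (\<boxplus>) fs (zero A B)"

lemma lsum_simps [simp]: "lsum A B [] = zero A B" "lsum A B (f # fs) = f \<boxplus> lsum A B fs"
  by (simp_all add: lsum_def)

lemma lsum_type [simp]:
  assumes "A \<in> Ob" "B \<in> Ob" "\<forall>f\<in>set fs. valid f \<and> src f = A \<and> trg f = B"
  shows "valid (lsum A B fs)" "src (lsum A B fs) = A" "trg (lsum A B fs) = B"
  using assms(3) by (induction fs) (use assms(1,2) in auto)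

lemma lsum_append:
  assumes "A \<in> Ob" "B \<in> Ob" "\<forall>f\<in>set (fs @ gs). valid f \<and> src f = A \<and> trg f = B"
  shows "lsum A B (fs @ gs) = lsum A B fs \<boxplus> lsum A B gs"
  using assms(3) by (induction fs) (use assms(1,2) in \<open>auto simp: plus_assoc\<close>)

end

text \<open>Forms \<open>b : A \<otimes> B \<rightarrow> I\<close> replace the tensor product: \<open>b\<langle>f, g\<rangle>\<close> stands for \<open>b \<circ> (f \<otimes> g)\<close>
  and \<open>swap b\<close> for \<open>b \<circ> c\<close>. Nothing else about the tensor product and the braiding \<open>c\<close> is needed.\<close>

locale form_category =
  A: typed_space Ob arr dm cd plus scale zero + F: typed_space Ob frm ld rd fplus fscale fzero
  for Ob :: "'o set" and arr :: "'a \<Rightarrow> bool" and dm cd :: "'a \<Rightarrow> 'o"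
    and plus :: "'a \<Rightarrow> 'a \<Rightarrow> 'a" (infixl "\<boxplus>" 65)
    and scale :: "'k::field_char_0 \<Rightarrow> 'a \<Rightarrow> 'a" (infixr "\<triangleright>" 75)
    and zero :: "'o \<Rightarrow> 'o \<Rightarrow> 'a"
    and frm :: "'f \<Rightarrow> bool" and ld rd :: "'f \<Rightarrow> 'o"
    and fplus :: "'f \<Rightarrow> 'f \<Rightarrow> 'f" (infixl "\<boxplus>\<^sub>f" 65)
    and fscale :: "'k \<Rightarrow> 'f \<Rightarrow> 'f" (infixr "\<triangleright>\<^sub>f" 75)
    and fzero :: "'o \<Rightarrow> 'o \<Rightarrow> 'f" +
  fixes I :: "'o \<Rightarrow> 'a" and comp :: "'a \<Rightarrow> 'a \<Rightarrow> 'a" (infixr "\<ast>" 70)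
    and act :: "'f \<Rightarrow> 'a \<Rightarrow> 'a \<Rightarrow> 'f" ("_\<langle>_,/ _\<rangle>" [1000, 0, 0] 1000)
    and swap :: "'f \<Rightarrow> 'f" and D :: "'o \<Rightarrow> 'o" and ev :: "'o \<Rightarrow> 'f"
  assumes I_type [simp]: "A \<in> Ob \<Longrightarrow> arr (I A)" "A \<in> Ob \<Longrightarrow> dm (I A) = A" "A \<in> Ob \<Longrightarrow> cd (I A) = A"
    and comp_type [simp]: "\<lbrakk>arr g; arr f; cd f = dm g\<rbrakk> \<Longrightarrow> arr (g \<ast> f)"
      "\<lbrakk>arr g; arr f; cd f = dm g\<rbrakk> \<Longrightarrow> dm (g \<ast> f) = dm f"
      "\<lbrakk>arr g; arr f; cd f = dm g\<rbrakk> \<Longrightarrow> cd (g \<ast> f) = cd g"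
    and comp_assoc [simp]: "(h \<ast> g) \<ast> f = h \<ast> (g \<ast> f)"
    and I_comp [simp]: "\<lbrakk>arr f; cd f = B\<rbrakk> \<Longrightarrow> I B \<ast> f = f"
    and comp_I [simp]: "\<lbrakk>arr f; dm f = B\<rbrakk> \<Longrightarrow> f \<ast> I B = f"
    and comp_plus_right: "g \<ast> (f \<boxplus> f') = g \<ast> f \<boxplus> g \<ast> f'"
    and comp_plus_left: "(g \<boxplus> g') \<ast> f = g \<ast> f \<boxplus> g' \<ast> f"
    and comp_scale_right [simp]: "g \<ast> (c \<triangleright> f) = c \<triangleright> (g \<ast> f)"
    and comp_scale_left [simp]: "(c \<triangleright> g) \<ast> f = c \<triangleright> (g \<ast> f)"
    and act_type [simp]: "\<lbrakk>frm b; arr f; arr g; cd f = ld b; cd g = rd b\<rbrakk> \<Longrightarrow> frm (b\<langle>f, g\<rangle>)"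
      "\<lbrakk>frm b; arr f; arr g; cd f = ld b; cd g = rd b\<rbrakk> \<Longrightarrow> ld (b\<langle>f, g\<rangle>) = dm f"
      "\<lbrakk>frm b; arr f; arr g; cd f = ld b; cd g = rd b\<rbrakk> \<Longrightarrow> rd (b\<langle>f, g\<rangle>) = dm g"
    and act_act [simp]: "(b\<langle>f, g\<rangle>)\<langle>f', g'\<rangle> = b\<langle>f \<ast> f', g \<ast> g'\<rangle>"
    and act_I [simp]: "\<lbrakk>frm b; ld b = A; rd b = B\<rbrakk> \<Longrightarrow> b\<langle>I A, I B\<rangle> = b"
    and act_plus_left: "b\<langle>f \<boxplus> f', g\<rangle> = b\<langle>f, g\<rangle> \<boxplus>\<^sub>f b\<langle>f', g\<rangle>"
    and act_plus_right: "b\<langle>f, g \<boxplus> g'\<rangle> = b\<langle>f, g\<rangle> \<boxplus>\<^sub>f b\<langle>f, g'\<rangle>"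
    and act_fplus: "(b \<boxplus>\<^sub>f b')\<langle>f, g\<rangle> = b\<langle>f, g\<rangle> \<boxplus>\<^sub>f b'\<langle>f, g\<rangle>"
    and act_scale_left [simp]: "b\<langle>c \<triangleright> f, g\<rangle> = c \<triangleright>\<^sub>f b\<langle>f, g\<rangle>"
    and act_scale_right [simp]: "b\<langle>f, c \<triangleright> g\<rangle> = c \<triangleright>\<^sub>f b\<langle>f, g\<rangle>"
    and act_fscale [simp]: "(c \<triangleright>\<^sub>f b)\<langle>f, g\<rangle> = c \<triangleright>\<^sub>f b\<langle>f, g\<rangle>"
    and swap_type [simp]: "frm b \<Longrightarrow> frm (swap b)" "frm b \<Longrightarrow> ld (swap b) = rd b" "frm b \<Longrightarrow> rd (swap b) = ld b"
    and swap_act [simp]: "swap (b\<langle>f, g\<rangle>) = (swap b)\<langle>g, f\<rangle>"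
    and swap_fplus: "swap (b \<boxplus>\<^sub>f b') = swap b \<boxplus>\<^sub>f swap b'"
    and swap_fscale [simp]: "swap (c \<triangleright>\<^sub>f b) = c \<triangleright>\<^sub>f swap b"
    and swap_inj: "\<lbrakk>frm b; frm b'; swap b = swap b'\<rbrakk> \<Longrightarrow> b = b'"
    and swap_surj: "frm b \<Longrightarrow> \<exists>b'. frm b' \<and> swap b' = b"
    and ev_type [simp]: "M \<in> Ob \<Longrightarrow> D M \<in> Ob" "M \<in> Ob \<Longrightarrow> frm (ev M)"
      "M \<in> Ob \<Longrightarrow> ld (ev M) = D M" "M \<in> Ob \<Longrightarrow> rd (ev M) = M"
    and ev_left: "\<lbrakk>M \<in> Ob; frm b; rd b = M\<rbrakk> \<Longrightarrow>
      \<exists>!f. arr f \<and> dm f = ld b \<and> cd f = D M \<and> (ev M)\<langle>f, I M\<rangle> = b"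
    and ev_right: "\<lbrakk>M \<in> Ob; frm b; ld b = D M\<rbrakk> \<Longrightarrow>
      \<exists>!f. arr f \<and> dm f = rd b \<and> cd f = M \<and> (ev M)\<langle>I (D M), f\<rangle> = b"
begin

definition hom :: "'o \<Rightarrow> 'o \<Rightarrow> 'a set" where
  "hom A B = {f. arr f \<and> dm f = A \<and> cd f = B}"

lemma hom_iff [simp]: "f \<in> hom A B \<longleftrightarrow> arr f \<and> dm f = A \<and> cd f = B"
  by (simp add: hom_def)

text \<open>Composites are kept nested to the right, where \<open>g \<ast> f\<close> occurs only in
  front of a tail \<open>x\<close>; an equation for it is therefore also needed in this
  shape.\<close>

lemma comp_eq_comp: "g \<ast> f = h \<Longrightarrow> g \<ast> (f \<ast> x) = h \<ast> x"
  by (simp flip: comp_assoc)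

lemma comp_zero [simp]:
  assumes "arr g" "dm g = B" "A \<in> Ob"
  shows "g \<ast> zero A B = zero A (cd g)"
  using assms comp_scale_right[of g 0 "zero A B"] A.scale_zero[of "g \<ast> zero A B"] by (auto simp del: comp_scale_right)

lemma zero_comp [simp]:
  assumes "arr f" "cd f = A" "B \<in> Ob"
  shows "zero A B \<ast> f = zero (dm f) B"
  using assms comp_scale_left[of 0 "zero A B" f] A.scale_zero[of "zero A B \<ast> f"] by (auto simp del: comp_scale_left)

lemma act_zero_left [simp]:
  assumes "frm b" "arr g" "cd g = rd b" "ld b = B" "A \<in> Ob"
  shows "b\<langle>zero A B, g\<rangle> = fzero A (dm g)"
  using assms act_scale_left[of b 0 "zero A B" g] F.scale_zero[of "b\<langle>zero A B, g\<rangle>"] by (auto simp del: act_scale_left)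

lemma act_zero_right [simp]:
  assumes "frm b" "arr f" "cd f = ld b" "rd b = B" "A \<in> Ob"
  shows "b\<langle>f, zero A B\<rangle> = fzero (dm f) A"
  using assms act_scale_right[of b f 0 "zero A B"] F.scale_zero[of "b\<langle>f, zero A B\<rangle>"] by (auto simp del: act_scale_right)

lemma act_fzero [simp]:
  assumes "arr f" "arr g" "cd f = A" "cd g = B"
  shows "(fzero A B)\<langle>f, g\<rangle> = fzero (dm f) (dm g)"
proof -
  have "A \<in> Ob" "B \<in> Ob" using assms by auto
  then show ?thesis
    using assms act_fscale[of 0 "fzero A B" f g] F.scale_zero[of "(fzero A B)\<langle>f, g\<rangle>"] by (simp del: act_fscale)
qed

lemma swap_fzero [simp]:
  assumes "A \<in> Ob" "B \<in> Ob"
  shows "swap (fzero A B) = fzero B A"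
  using assms swap_fscale[of 0 "fzero A B"] F.scale_zero[of "swap (fzero A B)"] by (simp del: swap_fscale)

lemma act_eq_comp: "b\<langle>f, g\<rangle> = c \<Longrightarrow> b\<langle>f \<ast> f', g \<ast> g'\<rangle> = c\<langle>f', g'\<rangle>"
  by (simp flip: act_act)

definition inverse_pair :: "'o \<Rightarrow> 'o \<Rightarrow> 'a \<Rightarrow> 'a \<Rightarrow> bool" where
  "inverse_pair A B f g \<longleftrightarrow> f \<in> hom A B \<and> g \<in> hom B A \<and> g \<ast> f = I A \<and> f \<ast> g = I B"

definition bip :: "'o \<Rightarrow> 'o \<Rightarrow> 'o \<Rightarrow> 'a \<Rightarrow> 'a \<Rightarrow> 'a \<Rightarrow> 'a \<Rightarrow> bool" where
  "bip M N S i j p q \<longleftrightarrow> M \<in> Ob \<and> N \<in> Ob \<and> S \<in> Ob \<and>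
     i \<in> hom M S \<and> j \<in> hom N S \<and> p \<in> hom S M \<and> q \<in> hom S N \<and>
     p \<ast> i = I M \<and> q \<ast> j = I N \<and> p \<ast> j = zero N M \<and> q \<ast> i = zero M N \<and>
     i \<ast> p \<boxplus> j \<ast> q = I S"

lemma bipD:
  assumes "bip M N S i j p q"
  shows "M \<in> Ob" "N \<in> Ob" "S \<in> Ob" "arr i" "arr j" "arr p" "arr q" "dm i = M" "cd i = S" "dm j = N"
    "cd j = S" "dm p = S" "cd p = M" "dm q = S" "cd q = N"
    "p \<ast> i = I M" "q \<ast> j = I N" "p \<ast> j = zero N M" "q \<ast> i = zero M N"
    "p \<ast> (i \<ast> x) = I M \<ast> x" "q \<ast> (j \<ast> x) = I N \<ast> x" "p \<ast> (j \<ast> x) = zero N M \<ast> x" "q \<ast> (i \<ast> x) = zero M N \<ast> x"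
  using assms by (auto simp: bip_def intro: comp_eq_comp)

lemma bip_sum: "bip M N S i j p q \<Longrightarrow> i \<ast> p \<boxplus> j \<ast> q = I S"
  by (simp add: bip_def)

lemma bip_commute: "bip M N S i j p q \<Longrightarrow> bip N M S j i q p"
  by (auto simp: bip_def A.plus_commute)

lemma bip_eq:
  assumes "bip M N S i j p q" "arr f" "cd f = S"
  shows "f = i \<ast> p \<ast> f \<boxplus> j \<ast> q \<ast> f"
proof -
  have "f = (i \<ast> p \<boxplus> j \<ast> q) \<ast> f" using assms bip_sum by simp
  then show ?thesis by (simp add: comp_plus_left)
qed

lemma bip_form_right:
  assumes "bip M N S i j p q" "frm b" "rd b = S" "arr g" "cd g = ld b"
  shows "b\<langle>g, I S\<rangle> = b\<langle>g, i \<ast> p\<rangle> \<boxplus>\<^sub>f b\<langle>g, j \<ast> q\<rangle>"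
  using bip_sum[OF assms(1)] by (simp flip: act_plus_right)

text \<open>A form on a direct sum is given by its two by two matrix. The diagonal blocks and the
  cross blocks are grouped separately because each application kills one of the groups: the diagonal
  for hyperbolic forms, the cross terms for orthogonal sums.\<close>

lemma bip_form_expand:
  assumes "bip M N S i j p q" "frm b" "ld b = S" "rd b = S"
  shows "b = (b\<langle>i, i\<rangle>)\<langle>p, p\<rangle> \<boxplus>\<^sub>f (b\<langle>j, j\<rangle>)\<langle>q, q\<rangle> \<boxplus>\<^sub>f ((b\<langle>j, i\<rangle>)\<langle>q, p\<rangle> \<boxplus>\<^sub>f (b\<langle>i, j\<rangle>)\<langle>p, q\<rangle>)"
proof -
  have "b = b\<langle>i \<ast> p \<boxplus> j \<ast> q, i \<ast> p \<boxplus> j \<ast> q\<rangle>" using assms bip_sum by simp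
  then show ?thesis by (simp add: act_plus_left act_plus_right F.plus_ac)
qed

subsection \<open>Perfect pairings\<close>

text \<open>Representability: each form with the same right leg arises from \<open>e\<close> by a
  unique arrow in the left argument. For a form on one object this is equivalent to the adjoint map
  being invertible, see \<open>nonsingular_iff\<close>, but it mentions neither duals nor
  coevaluations.\<close>

definition perfect :: "'f \<Rightarrow> bool" where
  "perfect e \<longleftrightarrow> frm e \<and>
     (\<forall>g. frm g \<longrightarrow> rd g = rd e \<longrightarrow> (\<exists>!f. f \<in> hom (ld g) (ld e) \<and> e\<langle>f, I (rd e)\<rangle> = g))"

lemma perfect_frm [simp]: "perfect e \<Longrightarrow> frm e"
  by (simp add: perfect_def)

lemma perfect_ex:
  assumes "perfect e" "frm g" "rd g = rd e"
  obtains f where "arr f" "dm f = ld g" "cd f = ld e" "e\<langle>f, I (rd e)\<rangle> = g"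
  using assms unfolding perfect_def hom_iff by metis

lemma perfect_inj:
  assumes "perfect e" "arr f" "arr f'" "dm f = dm f'" "cd f = ld e" "cd f' = ld e"
    and "e\<langle>f, I (rd e)\<rangle> = e\<langle>f', I (rd e)\<rangle>"
  shows "f = f'"
proof -
  have "\<exists>!h. h \<in> hom (dm f) (ld e) \<and> e\<langle>h, I (rd e)\<rangle> = e\<langle>f, I (rd e)\<rangle>"
    using assms unfolding perfect_def by (elim conjE allE[of _ "e\<langle>f, I (rd e)\<rangle>"]) simp
  then obtain h where h: "\<And>x. x \<in> hom (dm f) (ld e) \<and> e\<langle>x, I (rd e)\<rangle> = e\<langle>f, I (rd e)\<rangle> \<Longrightarrow> x = h"
    by (elim ex1E) blast
  have "f = h" "f' = h" by (rule h; use assms in simp)+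
  then show ?thesis by simp
qed

lemma perfectI:
  assumes "frm e" "\<And>g. \<lbrakk>frm g; rd g = rd e\<rbrakk> \<Longrightarrow> \<exists>f. arr f \<and> dm f = ld g \<and> cd f = ld e \<and> e\<langle>f, I (rd e)\<rangle> = g"
    "\<And>f f'. \<lbrakk>arr f; arr f'; dm f = dm f'; cd f = ld e; cd f' = ld e; e\<langle>f, I (rd e)\<rangle> = e\<langle>f', I (rd e)\<rangle>\<rbrakk> \<Longrightarrow> f = f'"
  shows "perfect e"
  unfolding perfect_def
proof (intro conjI allI impI)
  fix g assume g: "frm g" "rd g = rd e"
  obtain f where "f \<in> hom (ld g) (ld e)" "e\<langle>f, I (rd e)\<rangle> = g" using assms(2)[OF g] by auto
  moreover have "f' = f" if "f' \<in> hom (ld g) (ld e) \<and> e\<langle>f', I (rd e)\<rangle> = g" for f'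
    using assms(3)[of f' f] that calculation by simp
  ultimately show "\<exists>!f. f \<in> hom (ld g) (ld e) \<and> e\<langle>f, I (rd e)\<rangle> = g" by blast
qed (fact assms(1))

lemma perfect_zero:
  assumes "perfect e" "arr f" "cd f = ld e" "e\<langle>f, I (rd e)\<rangle> = fzero (dm f) (rd e)"
  shows "f = zero (dm f) (ld e)"
  by (rule perfect_inj[OF assms(1)]) (use assms in auto)

lemma perfect_ev: "M \<in> Ob \<Longrightarrow> perfect (ev M)"
  using ev_left unfolding perfect_def by simp

text \<open>Swapping is a bijection on forms that exchanges the two arguments. It carries the
  universal property of \<open>ev M\<close> in its right argument to the one of
  \<open>swap (ev M)\<close> in its left argument.\<close>

lemma perfect_swap_ev:
  assumes "M \<in> Ob"
  shows "perfect (swap (ev M))"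
proof (rule perfectI)
  fix g assume g: "frm g" "rd g = rd (swap (ev M))"
  obtain g' where g': "frm g'" "swap g' = g" using swap_surj g by blast
  then have t: "ld g' = D M" "rd g' = ld g" using g assms swap_type(2,3)[of g'] by auto
  obtain f where "arr f" "dm f = rd g'" "cd f = M" "(ev M)\<langle>I (D M), f\<rangle> = g'"
    using ev_right[OF assms g'(1) t(1)] by blast
  then show "\<exists>f. arr f \<and> dm f = ld g \<and> cd f = ld (swap (ev M)) \<and> (swap (ev M))\<langle>f, I (rd (swap (ev M)))\<rangle> = g"
    using assms t g' by (auto intro!: exI[of _ f] simp flip: swap_act)
next
  fix f f' assume f: "arr f" "arr f'" "dm f = dm f'" "cd f = ld (swap (ev M))" "cd f' = ld (swap (ev M))"
    and eq: "(swap (ev M))\<langle>f, I (rd (swap (ev M)))\<rangle> = (swap (ev M))\<langle>f', I (rd (swap (ev M)))\<rangle>"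
  then have "swap ((ev M)\<langle>I (D M), f\<rangle>) = swap ((ev M)\<langle>I (D M), f'\<rangle>)" using assms by simp
  then have "(ev M)\<langle>I (D M), f\<rangle> = (ev M)\<langle>I (D M), f'\<rangle>" by (rule swap_inj[rotated 2]) (use assms f in auto)
  then show "f = f'"
    using ev_right[OF assms, of "(ev M)\<langle>I (D M), f\<rangle>"] assms f by auto
qed (use assms in simp)

text \<open>The left and the right argument may be decomposed differently. With the same
  decomposition twice this covers orthogonal sums; with the second one commuted it covers the
  off-diagonal shape of hyperbolic forms.\<close>

lemma perfect_block:
  assumes b: "bip M N S i j p q" and b': "bip M' N' S i' j' p' q'"
    and e: "perfect e" "ld e = M'" "rd e = M" and e': "perfect e'" "ld e' = N'" "rd e' = N"
  shows "perfect (e\<langle>p', p\<rangle> \<boxplus>\<^sub>f e'\<langle>q', q\<rangle>)" (is "perfect ?s")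
proof -
  note [simp] = bipD[OF b] bipD[OF b'] e(2,3) e'(2,3) perfect_frm[OF e(1)] perfect_frm[OF e'(1)]
  have si: "?s\<langle>f, i\<rangle> = e\<langle>p' \<ast> f, I M\<rangle>" if "arr f" "cd f = S" for f
    using that by (simp add: act_fplus)
  have sj: "?s\<langle>f, j\<rangle> = e'\<langle>q' \<ast> f, I N\<rangle>" if "arr f" "cd f = S" for f
    using that by (simp add: act_fplus)
  show ?thesis
  proof (rule perfectI)
    fix g assume g [simp]: "frm g" and "rd g = rd ?s"
    then have [simp]: "rd g = S" by simp
    obtain f where f [simp]: "arr f" "dm f = ld g" "cd f = M'" and f_eq: "e\<langle>f, I M\<rangle> = g\<langle>I (ld g), i\<rangle>"
      using perfect_ex[OF e(1), of "g\<langle>I (ld g), i\<rangle>"] by auto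
    obtain f' where f' [simp]: "arr f'" "dm f' = ld g" "cd f' = N'" and f'_eq: "e'\<langle>f', I N\<rangle> = g\<langle>I (ld g), j\<rangle>"
      using perfect_ex[OF e'(1), of "g\<langle>I (ld g), j\<rangle>"] by auto
    have 1: "e\<langle>f, p\<rangle> = g\<langle>I (ld g), i \<ast> p\<rangle>" using act_eq_comp[OF f_eq, of "I (ld g)" p] by simp
    have 2: "e'\<langle>f', q\<rangle> = g\<langle>I (ld g), j \<ast> q\<rangle>" using act_eq_comp[OF f'_eq, of "I (ld g)" q] by simp
    \<comment> \<open>The representing arrow is assembled from the solutions for the restrictions of
      \<open>g\<close> to the two summands of its right leg.\<close>
    have "?s\<langle>i' \<ast> f \<boxplus> j' \<ast> f', I S\<rangle> = g\<langle>I (ld g), I S\<rangle>"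
      by (subst bip_form_right[OF b]) (simp_all add: act_fplus comp_plus_right 1 2)
    then show "\<exists>f. arr f \<and> dm f = ld g \<and> cd f = ld ?s \<and> ?s\<langle>f, I (rd ?s)\<rangle> = g"
      by (intro exI[of _ "i' \<ast> f \<boxplus> j' \<ast> f'"]) simp
  next
    fix f f' assume f [simp]: "arr f" "arr f'" "dm f = dm f'" and "cd f = ld ?s" "cd f' = ld ?s"
      and eq: "?s\<langle>f, I (rd ?s)\<rangle> = ?s\<langle>f', I (rd ?s)\<rangle>"
    then have [simp]: "cd f = S" "cd f' = S" by simp_all
    have eq': "?s\<langle>f, I S\<rangle> = ?s\<langle>f', I S\<rangle>" using eq by simp
    have "p' \<ast> f = p' \<ast> f'"
      by (rule perfect_inj[OF e(1)]) (use arg_cong[OF eq', of "\<lambda>b. b\<langle>I (dm f'), i\<rangle>"] si[of f] si[of f'] in simp_all)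
    moreover have "q' \<ast> f = q' \<ast> f'"
      by (rule perfect_inj[OF e'(1)]) (use arg_cong[OF eq', of "\<lambda>b. b\<langle>I (dm f'), j\<rangle>"] sj[of f] sj[of f'] in simp_all)
    ultimately show "f = f'"
      using bip_eq[OF b', of f] bip_eq[OF b', of f'] by simp
  qed simp
qed

end

context form_category
begin

subsection \<open>Quadratic objects\<close>

text \<open>A form remembers its legs, so a quadratic object is encoded by the form alone and
  \<open>ld b\<close> is its underlying object.\<close>

definition quad :: "'f \<Rightarrow> bool" where
  "quad b \<longleftrightarrow> rd b = ld b \<and> swap b = b \<and> perfect b"

lemma quadD [simp]: "quad b \<Longrightarrow> frm b" "quad b \<Longrightarrow> rd b = ld b" "quad b \<Longrightarrow> swap b = b" "quad b \<Longrightarrow> perfect b"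
  by (auto simp: quad_def)

lemma quadI: "\<lbrakk>rd b = ld b; swap b = b; perfect b\<rbrakk> \<Longrightarrow> quad b"
  by (simp only: quad_def)

definition isom :: "'f \<Rightarrow> 'f \<Rightarrow> bool" where
  "isom b b' \<longleftrightarrow> frm b \<and> frm b' \<and> rd b = ld b \<and> rd b' = ld b' \<and>
     (\<exists>f g. inverse_pair (ld b) (ld b') f g \<and> b'\<langle>f, f\<rangle> = b)"

definition osum :: "'f \<Rightarrow> 'f \<Rightarrow> 'f \<Rightarrow> bool" where
  "osum b b' s \<longleftrightarrow> frm s \<and> rd s = ld s \<and> frm b \<and> rd b = ld b \<and> frm b' \<and> rd b' = ld b' \<and>
     (\<exists>i j p q. bip (ld b) (ld b') (ld s) i j p q \<and> s = b\<langle>p, p\<rangle> \<boxplus>\<^sub>f b'\<langle>q, q\<rangle>)"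

definition ws :: "'o \<Rightarrow> bool" where
  "ws M \<longleftrightarrow> M \<in> Ob \<and> swap (swap (ev M)) = ev M"

definition hyp :: "'o \<Rightarrow> 'f \<Rightarrow> bool" where
  "hyp M b \<longleftrightarrow> frm b \<and> rd b = ld b \<and>
     (\<exists>i j p q. bip M (D M) (ld b) i j p q \<and> b = (ev M)\<langle>q, p\<rangle> \<boxplus>\<^sub>f (swap (ev M))\<langle>p, q\<rangle>)"

definition zob :: "'o \<Rightarrow> bool" where
  "zob Z \<longleftrightarrow> Z \<in> Ob \<and> I Z = zero Z Z"

lemma inverse_pairD:
  assumes "inverse_pair A B f g"
  shows "A \<in> Ob" "B \<in> Ob" "arr f" "dm f = A" "cd f = B" "arr g" "dm g = B" "cd g = A"
    "g \<ast> f = I A" "f \<ast> g = I B" "g \<ast> (f \<ast> x) = I A \<ast> x" "f \<ast> (g \<ast> x) = I B \<ast> x"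
  using assms by (auto simp: inverse_pair_def intro: comp_eq_comp)

lemma inverse_pair_sym: "inverse_pair A B f g \<Longrightarrow> inverse_pair B A g f"
  by (auto simp: inverse_pair_def)

lemma inverse_pair_I: "A \<in> Ob \<Longrightarrow> inverse_pair A A (I A) (I A)"
  by (simp add: inverse_pair_def)

lemma inverse_pair_comp:
  assumes "inverse_pair A B f g" "inverse_pair B E f' g'"
  shows "inverse_pair A E (f' \<ast> f) (g \<ast> g')"
  using inverse_pairD[OF assms(1)] inverse_pairD[OF assms(2)] by (simp add: inverse_pair_def)

lemma isom_refl:
  assumes "frm b" "rd b = ld b"
  shows "isom b b"
proof -
  have "ld b \<in> Ob" using assms by simp
  from inverse_pair_I[OF this] show ?thesis
    using assms act_I[of b "ld b" "ld b"] unfolding isom_def by metis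
qed

lemma isomE:
  assumes "isom b b'"
  obtains f g where "inverse_pair (ld b) (ld b') f g" "b'\<langle>f, f\<rangle> = b" "b\<langle>g, g\<rangle> = b'"
    "frm b" "rd b = ld b" "frm b'" "rd b' = ld b'"
proof -
  from assms obtain f g where fg: "inverse_pair (ld b) (ld b') f g" and f: "b'\<langle>f, f\<rangle> = b"
    and t: "frm b" "rd b = ld b" "frm b'" "rd b' = ld b'"
    unfolding isom_def by metis
  have "b\<langle>g, g\<rangle> = (b'\<langle>f, f\<rangle>)\<langle>g, g\<rangle>" by (simp only: f)
  also have "\<dots> = b'" using t(3,4) inverse_pairD[OF fg] by simp
  finally show thesis using that[OF fg f _ t] by simp
qed

lemma isom_sym:
  assumes "isom b b'"
  shows "isom b' b"
  using isomE[OF assms] inverse_pair_sym unfolding isom_def by metis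

lemma isom_trans:
  assumes "isom b b'" "isom b' b''"
  shows "isom b b''"
proof -
  obtain f g where fg: "inverse_pair (ld b) (ld b') f g" "b'\<langle>f, f\<rangle> = b"
    using isomE[OF assms(1)] by metis
  obtain f' g' where fg': "inverse_pair (ld b') (ld b'') f' g'" "b''\<langle>f', f'\<rangle> = b'"
    using isomE[OF assms(2)] by metis
  have "b''\<langle>f' \<ast> f, f' \<ast> f\<rangle> = b"
    using act_act[of b'' f' f' f f] unfolding fg'(2) fg(2) by (rule sym)
  then show ?thesis
    using assms inverse_pair_comp[OF fg(1) fg'(1)] unfolding isom_def by blast
qed

lemma osum_quad:
  assumes q: "quad b" "quad b'" and s: "osum b b' s"
  shows "quad s"
proof -
  obtain i j p q where bip: "bip (ld b) (ld b') (ld s) i j p q" and s': "s = b\<langle>p, p\<rangle> \<boxplus>\<^sub>f b'\<langle>q, q\<rangle>"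
    using s unfolding osum_def by blast
  have "swap s = s" unfolding s' using q by (simp add: swap_fplus)
  moreover have "perfect s" unfolding s' by (rule perfect_block[OF bip bip]) (use q in auto)
  ultimately show ?thesis using s unfolding osum_def by (blast intro: quadI)
qed

lemma osum_exists:
  assumes "frm b" "rd b = ld b" "frm b'" "rd b' = ld b'" "bip (ld b) (ld b') S i j p q"
  shows "osum b b' (b\<langle>p, p\<rangle> \<boxplus>\<^sub>f b'\<langle>q, q\<rangle>)"
  using assms bipD[OF assms(5)] unfolding osum_def by auto

lemma osum_commute:
  assumes "osum b b' s"
  shows "osum b' b s"
proof -
  obtain i j p q where "bip (ld b) (ld b') (ld s) i j p q" "s = b\<langle>p, p\<rangle> \<boxplus>\<^sub>f b'\<langle>q, q\<rangle>"
    using assms unfolding osum_def by blast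
  then have "bip (ld b') (ld b) (ld s) j i q p" "s = b'\<langle>q, q\<rangle> \<boxplus>\<^sub>f b\<langle>p, p\<rangle>"
    by (auto intro: bip_commute F.plus_commute)
  then show ?thesis using assms unfolding osum_def by blast
qed

lemma bip_transport:
  assumes b: "bip M N S i j p q" and f: "inverse_pair S S' f g"
  shows "bip M N S' (f \<ast> i) (f \<ast> j) (p \<ast> g) (q \<ast> g)"
proof -
  note [simp] = bipD[OF b] inverse_pairD[OF f]
  have "f \<ast> i \<ast> p \<ast> g \<boxplus> f \<ast> j \<ast> q \<ast> g = f \<ast> (i \<ast> p \<boxplus> j \<ast> q) \<ast> g"
    by (simp add: comp_plus_right comp_plus_left)
  also have "\<dots> = I S'" using bip_sum[OF b] by simp
  finally show ?thesis by (simp add: bip_def)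
qed

lemma osum_transport:
  assumes s: "osum b b' s" and iso: "isom s s'"
  shows "osum b b' s'"
proof -
  obtain i j p q where bip: "bip (ld b) (ld b') (ld s) i j p q" and s': "s = b\<langle>p, p\<rangle> \<boxplus>\<^sub>f b'\<langle>q, q\<rangle>"
    using s unfolding osum_def by blast
  obtain f g where fg: "inverse_pair (ld s) (ld s') f g" and g: "s\<langle>g, g\<rangle> = s'" and t: "frm s'" "rd s' = ld s'"
    using isomE[OF iso] by metis
  have "(b\<langle>p, p\<rangle> \<boxplus>\<^sub>f b'\<langle>q, q\<rangle>)\<langle>g, g\<rangle> = b\<langle>p \<ast> g, p \<ast> g\<rangle> \<boxplus>\<^sub>f b'\<langle>q \<ast> g, q \<ast> g\<rangle>"
    by (simp add: act_fplus)
  then have "s' = b\<langle>p \<ast> g, p \<ast> g\<rangle> \<boxplus>\<^sub>f b'\<langle>q \<ast> g, q \<ast> g\<rangle>" unfolding s'[symmetric] g .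
  then show ?thesis
    using bip_transport[OF bip fg] s t unfolding osum_def by metis
qed

lemma bip_unique:
  assumes bip: "bip M N S i j p q" and bip': "bip M' N' S' i' j' p' q'"
    and fg: "inverse_pair M M' f g" and hk: "inverse_pair N N' h k"
  shows "inverse_pair S S' (i' \<ast> f \<ast> p \<boxplus> j' \<ast> h \<ast> q) (i \<ast> g \<ast> p' \<boxplus> j \<ast> k \<ast> q')"
proof -
  note [simp] = bipD[OF bip] bipD[OF bip'] inverse_pairD[OF fg] inverse_pairD[OF hk]
  show ?thesis
    using bip_sum[OF bip] bip_sum[OF bip']
    by (simp add: inverse_pair_def comp_plus_left comp_plus_right)
qed

lemma osum_unique:
  assumes s: "osum b1 b2 s" and s': "osum b1' b2' s'" and i1: "isom b1 b1'" and i2: "isom b2 b2'"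
  shows "isom s s'"
proof -
  obtain i j p q where bip: "bip (ld b1) (ld b2) (ld s) i j p q" and s_eq: "s = b1\<langle>p, p\<rangle> \<boxplus>\<^sub>f b2\<langle>q, q\<rangle>"
    using s unfolding osum_def by blast
  obtain i' j' p' q' where bip': "bip (ld b1') (ld b2') (ld s') i' j' p' q'"
    and s'_eq: "s' = b1'\<langle>p', p'\<rangle> \<boxplus>\<^sub>f b2'\<langle>q', q'\<rangle>"
    using s' unfolding osum_def by blast
  obtain f g where fg: "inverse_pair (ld b1) (ld b1') f g" and f: "b1'\<langle>f, f\<rangle> = b1"
    using isomE[OF i1] by metis
  obtain h k where hk: "inverse_pair (ld b2) (ld b2') h k" and h: "b2'\<langle>h, h\<rangle> = b2"
    using isomE[OF i2] by metis
  note [simp] = bipD[OF bip] bipD[OF bip'] inverse_pairD[OF fg] inverse_pairD[OF hk]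
  have [simp]: "frm b1'" "rd b1' = ld b1'" "frm b2'" "rd b2' = ld b2'" using s' by (auto simp: osum_def)
  let ?F = "i' \<ast> f \<ast> p \<boxplus> j' \<ast> h \<ast> q"
  note bip_unique[OF bip bip' fg hk]
  moreover have "s'\<langle>?F, ?F\<rangle> = s"
    using act_eq_comp[OF f, of p p] act_eq_comp[OF h, of q q]
    unfolding s'_eq by (simp add: act_fplus comp_plus_right s_eq)
  ultimately show ?thesis using s s' unfolding isom_def osum_def by blast
qed

text \<open>The part \<open>B\<close> of \<open>R\<close> enters \<open>T\<close> through
  \<open>S\<close>, the part \<open>E\<close> directly; the projection to \<open>R\<close> retraces
  both ways.\<close>

lemma bip_assoc:
  assumes S: "bip A B S i1 i2 p1 p2" and T: "bip S E T j1 j2 r1 r2" and R: "bip B E R k1 k2 s1 s2"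
  shows "bip A R T (j1 \<ast> i1) (j1 \<ast> i2 \<ast> s1 \<boxplus> j2 \<ast> s2) (p1 \<ast> r1) (k1 \<ast> p2 \<ast> r1 \<boxplus> k2 \<ast> r2)"
proof -
  note [simp] = bipD[OF S] bipD[OF T] bipD[OF R]
  have "j1 \<ast> i1 \<ast> p1 \<ast> r1 \<boxplus> (j1 \<ast> i2 \<ast> p2 \<ast> r1 \<boxplus> j2 \<ast> r2) = j1 \<ast> (i1 \<ast> p1 \<boxplus> i2 \<ast> p2) \<ast> r1 \<boxplus> j2 \<ast> r2"
    by (simp add: comp_plus_left comp_plus_right A.plus_assoc)
  also have "\<dots> = I T" unfolding bip_sum[OF S] using bip_sum[OF T] by simp
  finally show ?thesis using bip_sum[OF R]
    by (simp add: bip_def comp_plus_left comp_plus_right)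
qed

lemma osum_assoc:
  assumes s: "osum a b s" and t: "osum s e t" and r: "osum b e r"
  shows "osum a r t"
proof -
  obtain i1 i2 p1 p2 where S: "bip (ld a) (ld b) (ld s) i1 i2 p1 p2" and s_eq: "s = a\<langle>p1, p1\<rangle> \<boxplus>\<^sub>f b\<langle>p2, p2\<rangle>"
    using s unfolding osum_def by blast
  obtain j1 j2 r1 r2 where T: "bip (ld s) (ld e) (ld t) j1 j2 r1 r2" and t_eq: "t = s\<langle>r1, r1\<rangle> \<boxplus>\<^sub>f e\<langle>r2, r2\<rangle>"
    using t unfolding osum_def by blast
  obtain k1 k2 s1 s2 where R: "bip (ld b) (ld e) (ld r) k1 k2 s1 s2" and r_eq: "r = b\<langle>s1, s1\<rangle> \<boxplus>\<^sub>f e\<langle>s2, s2\<rangle>"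
    using r unfolding osum_def by blast
  note [simp] = bipD[OF S] bipD[OF T] bipD[OF R]
  have "t = a\<langle>p1 \<ast> r1, p1 \<ast> r1\<rangle> \<boxplus>\<^sub>f r\<langle>k1 \<ast> p2 \<ast> r1 \<boxplus> k2 \<ast> r2, k1 \<ast> p2 \<ast> r1 \<boxplus> k2 \<ast> r2\<rangle>"
    unfolding t_eq s_eq r_eq by (simp add: act_fplus comp_plus_right F.plus_assoc)
  then show ?thesis
    using bip_assoc[OF S T R] s t r unfolding osum_def by blast
qed

lemma zob_arr:
  assumes "zob Z"
  shows "\<lbrakk>arr f; cd f = Z\<rbrakk> \<Longrightarrow> f = zero (dm f) Z" "\<lbrakk>arr f; dm f = Z\<rbrakk> \<Longrightarrow> f = zero Z (cd f)"
  using assms I_comp[of f Z] comp_I[of f Z] zero_comp[of f Z Z] comp_zero[of f Z Z]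
  by (auto simp: zob_def simp del: I_comp comp_I)

lemma zob_form:
  assumes "zob Z"
  shows "\<lbrakk>frm b; ld b = Z\<rbrakk> \<Longrightarrow> b = fzero Z (rd b)" "\<lbrakk>frm b; rd b = Z\<rbrakk> \<Longrightarrow> b = fzero (ld b) Z"
  using assms act_I[of b Z "rd b"] act_I[of b "ld b" Z] by (auto simp: zob_def simp del: act_I)

lemma zob_quad:
  assumes "zob Z"
  shows "quad (fzero Z Z)"
proof -
  have [simp]: "Z \<in> Ob" using assms by (simp add: zob_def)
  have "perfect (fzero Z Z)"
  proof (rule perfectI)
    fix g assume "frm g" "rd g = rd (fzero Z Z)"
    then show "\<exists>f. arr f \<and> dm f = ld g \<and> cd f = ld (fzero Z Z) \<and> (fzero Z Z)\<langle>f, I (rd (fzero Z Z))\<rangle> = g"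
      using zob_form(2)[OF assms, of g] by (intro exI[of _ "zero (ld g) Z"]) simp
  next
    fix f f' assume "arr f" "arr f'" "dm f = dm f'" "cd f = ld (fzero Z Z)" "cd f' = ld (fzero Z Z)"
    then show "f = f'" using zob_arr(1)[OF assms, of f] zob_arr(1)[OF assms, of f'] by simp
  qed simp
  then show ?thesis by (intro quadI) simp_all
qed

lemma zob_inverse_pair:
  assumes "zob Z" "zob Z'"
  shows "inverse_pair Z Z' (zero Z Z') (zero Z' Z)"
  using assms by (simp add: inverse_pair_def zob_def)

lemma zob_iso: "\<lbrakk>zob Z; inverse_pair Z Z' f g\<rbrakk> \<Longrightarrow> zob Z'"
  using zob_arr[of Z f] inverse_pairD[of Z Z' f g] zero_comp[of g Z Z'] unfolding zob_def by metis

lemma zob_isom: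
  assumes "quad b" "quad b'" "zob (ld b)"
  shows "isom b b' \<longleftrightarrow> zob (ld b')"
proof
  assume "isom b b'"
  then show "zob (ld b')" using zob_iso[OF assms(3)] by (auto simp: isom_def)
next
  assume z: "zob (ld b')"
  have [simp]: "ld b \<in> Ob" "ld b' \<in> Ob" using z assms(3) by (auto simp: zob_def)
  have "b'\<langle>zero (ld b) (ld b'), zero (ld b) (ld b')\<rangle> = b"
    using assms zob_form(1)[OF assms(3), of b] by simp
  then show "isom b b'"
    using zob_inverse_pair[OF assms(3) z] assms unfolding isom_def by auto
qed

lemma bip_zob:
  assumes "zob Z" "M \<in> Ob"
  shows "bip Z M M (zero Z M) (I M) (zero M Z) (I M)"
  using assms by (auto simp: bip_def zob_def)

lemma zob_osum:
  assumes "quad z" "quad b" "zob (ld z)"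
  shows "osum z b b"
proof -
  have [simp]: "ld z \<in> Ob" "ld b \<in> Ob" using assms by (auto simp: zob_def)
  have "b = z\<langle>zero (ld b) (ld z), zero (ld b) (ld z)\<rangle> \<boxplus>\<^sub>f b\<langle>I (ld b), I (ld b)\<rangle>"
    using assms by simp
  then show ?thesis using bip_zob[OF assms(3), of "ld b"] assms unfolding osum_def by fastforce
qed

subsection \<open>Weakly symmetric and hyperbolic objects\<close>

text \<open>Every form with right leg \<open>M\<close> is a pullback of \<open>ev M\<close> along an
  arrow in the left argument, and a double swap commutes with pullbacks. Weak symmetry thus becomes
  a statement about all forms, which passes easily to retracts and sums.\<close>

lemma ws_form:
  assumes "ws M" "frm g" "rd g = M"
  shows "swap (swap g) = g"
proof -
  have M [simp]: "M \<in> Ob" "swap (swap (ev M)) = ev M" using assms by (auto simp: ws_def)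
  obtain f where "arr f" "dm f = ld g" "cd f = D M" "(ev M)\<langle>f, I M\<rangle> = g"
    using perfect_ex[OF perfect_ev, of M g] assms by auto
  then show ?thesis using M by (metis swap_act)
qed

lemma wsI: "\<lbrakk>M \<in> Ob; \<And>g. \<lbrakk>frm g; rd g = M\<rbrakk> \<Longrightarrow> swap (swap g) = g\<rbrakk> \<Longrightarrow> ws M"
  by (simp add: ws_def)

text \<open>Every form with right leg \<open>ld b\<close> is a pullback of \<open>b\<close>, which
  is fixed by the swap. So the hyperbolic construction is available for each object that carries a
  quadratic form, as the proof of exponent two requires.\<close>

lemma quad_ws:
  assumes "quad b"
  shows "ws (ld b)"
proof (rule wsI)
  fix g assume "frm g" "rd g = ld b"
  then obtain f where "b\<langle>f, I (ld b)\<rangle> = g"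
    using perfect_ex[of b g] assms by auto
  then show "swap (swap g) = g" using assms by auto
qed (use assms in auto)

text \<open>A form on the retract is extended along \<open>r\<close>, swapped twice there, and
  restricted back along \<open>u\<close>.\<close>

lemma ws_retract:
  assumes "ws M" and u: "arr u" "dm u = K" "cd u = M" "arr r" "dm r = M" "cd r = K" "r \<ast> u = I K"
  shows "ws K"
proof (rule wsI)
  show K: "K \<in> Ob" using u by auto
  fix g assume g: "frm g" "rd g = K"
  have "swap (swap (g\<langle>I (ld g), r\<rangle>)) = g\<langle>I (ld g), r\<rangle>"
    by (rule ws_form[OF assms(1)]) (use g u in auto)
  then have "swap (swap ((g\<langle>I (ld g), r\<rangle>)\<langle>I (ld g), u\<rangle>)) = (g\<langle>I (ld g), r\<rangle>)\<langle>I (ld g), u\<rangle>"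
    by (metis swap_act)
  then show "swap (swap g) = g" using g u K by simp
qed

lemma ws_bip:
  assumes b: "bip M N S i j p q" and "ws M" "ws N"
  shows "ws S"
proof (rule wsI)
  note [simp] = bipD[OF b]
  fix g assume g [simp]: "frm g" "rd g = S"
  have "swap (swap (g\<langle>I (ld g), i\<rangle>)) = g\<langle>I (ld g), i\<rangle>" by (rule ws_form[OF assms(2)]) simp_all
  then have "swap (swap ((g\<langle>I (ld g), i\<rangle>)\<langle>I (ld g), p\<rangle>)) = (g\<langle>I (ld g), i\<rangle>)\<langle>I (ld g), p\<rangle>"
    by (metis swap_act)
  then have 1: "swap (swap (g\<langle>I (ld g), i \<ast> p\<rangle>)) = g\<langle>I (ld g), i \<ast> p\<rangle>" by simp
  have "swap (swap (g\<langle>I (ld g), j\<rangle>)) = g\<langle>I (ld g), j\<rangle>" by (rule ws_form[OF assms(3)]) simp_all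
  then have "swap (swap ((g\<langle>I (ld g), j\<rangle>)\<langle>I (ld g), q\<rangle>)) = (g\<langle>I (ld g), j\<rangle>)\<langle>I (ld g), q\<rangle>"
    by (metis swap_act)
  then have 2: "swap (swap (g\<langle>I (ld g), j \<ast> q\<rangle>)) = g\<langle>I (ld g), j \<ast> q\<rangle>" by simp
  have "g = g\<langle>I (ld g), i \<ast> p\<rangle> \<boxplus>\<^sub>f g\<langle>I (ld g), j \<ast> q\<rangle>"
    using bip_form_right[OF b, of g "I (ld g)"] by simp
  then show "swap (swap g) = g" using 1 2 by (metis swap_fplus)
qed (use bipD[OF b] in simp)

lemma ws_zob: "zob Z \<Longrightarrow> ws Z"
  using quad_ws[OF zob_quad, of Z] by (simp add: zob_def)

text \<open>The swap sends the cross term with \<open>ev M\<close> to the other one by definition;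
  weak symmetry is what brings the other one back.\<close>

lemma hyp_quad:
  assumes "hyp M b" "ws M"
  shows "quad b"
proof -
  obtain i j p q where bip: "bip M (D M) (ld b) i j p q"
    and b_eq: "b = (ev M)\<langle>q, p\<rangle> \<boxplus>\<^sub>f (swap (ev M))\<langle>p, q\<rangle>" and t: "frm b" "rd b = ld b"
    using assms unfolding hyp_def by blast
  have M [simp]: "M \<in> Ob" "swap (swap (ev M)) = ev M" using assms by (auto simp: ws_def)
  have "swap b = b" unfolding b_eq by (simp add: swap_fplus F.plus_commute)
  moreover have "perfect b"
    unfolding b_eq by (rule perfect_block[OF bip bip_commute[OF bip]]) (auto intro: perfect_ev perfect_swap_ev)
  ultimately show ?thesis using t by (intro quadI)
qed

lemma hyp_exists:
  assumes "bip M (D M) S i j p q"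
  shows "hyp M ((ev M)\<langle>q, p\<rangle> \<boxplus>\<^sub>f (swap (ev M))\<langle>p, q\<rangle>)"
  using assms bipD[OF assms] unfolding hyp_def by auto

lemma hyp_unique:
  assumes "hyp M b" "hyp M b'"
  shows "isom b b'"
proof -
  obtain i j p q where bip: "bip M (D M) (ld b) i j p q"
    and b_eq: "b = (ev M)\<langle>q, p\<rangle> \<boxplus>\<^sub>f (swap (ev M))\<langle>p, q\<rangle>"
    using assms unfolding hyp_def by blast
  obtain i' j' p' q' where bip': "bip M (D M) (ld b') i' j' p' q'"
    and b'_eq: "b' = (ev M)\<langle>q', p'\<rangle> \<boxplus>\<^sub>f (swap (ev M))\<langle>p', q'\<rangle>"
    using assms unfolding hyp_def by blast
  note [simp] = bipD[OF bip] bipD[OF bip']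
  let ?F = "i' \<ast> p \<boxplus> j' \<ast> q" and ?G = "i \<ast> p' \<boxplus> j \<ast> q'"
  have "inverse_pair (ld b) (ld b') ?F ?G"
    using bip_sum[OF bip] bip_sum[OF bip'] by (simp add: inverse_pair_def comp_plus_left comp_plus_right)
  moreover have "((ev M)\<langle>q', p'\<rangle> \<boxplus>\<^sub>f (swap (ev M))\<langle>p', q'\<rangle>)\<langle>?F, ?F\<rangle> =
      (ev M)\<langle>q, p\<rangle> \<boxplus>\<^sub>f (swap (ev M))\<langle>p, q\<rangle>"
    by (simp add: act_fplus comp_plus_right)
  then have "b'\<langle>?F, ?F\<rangle> = b" unfolding b'_eq[symmetric] b_eq[symmetric] .
  ultimately show ?thesis using assms unfolding isom_def hyp_def by blast
qed

lemma hyp_transport: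
  assumes "hyp M b" "isom b b'"
  shows "hyp M b'"
proof -
  obtain i j p q where bip: "bip M (D M) (ld b) i j p q"
    and b_eq: "b = (ev M)\<langle>q, p\<rangle> \<boxplus>\<^sub>f (swap (ev M))\<langle>p, q\<rangle>"
    using assms unfolding hyp_def by blast
  obtain f g where fg: "inverse_pair (ld b) (ld b') f g" and g: "b\<langle>g, g\<rangle> = b'" and t: "frm b'" "rd b' = ld b'"
    using isomE[OF assms(2)] by metis
  have "((ev M)\<langle>q, p\<rangle> \<boxplus>\<^sub>f (swap (ev M))\<langle>p, q\<rangle>)\<langle>g, g\<rangle> =
      (ev M)\<langle>q \<ast> g, p \<ast> g\<rangle> \<boxplus>\<^sub>f (swap (ev M))\<langle>p \<ast> g, q \<ast> g\<rangle>"
    by (simp add: act_fplus)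
  then have "b' = (ev M)\<langle>q \<ast> g, p \<ast> g\<rangle> \<boxplus>\<^sub>f (swap (ev M))\<langle>p \<ast> g, q \<ast> g\<rangle>" unfolding b_eq[symmetric] g .
  then show ?thesis
    using bip_transport[OF bip fg] t unfolding hyp_def by metis
qed

text \<open>A complement of the Lagrangian \<open>u\<close> is provided by the transpose \<open>s\<close> of a retraction of \<open>u\<close>;
  subtracting \<open>u q s / 2\<close> makes it isotropic.\<close>

lemma isotropic_complement:
  assumes b: "quad b" and u: "arr u" "dm u = M" "cd u = ld b" and q: "arr q" "dm q = ld b" "cd q = M"
    and qu: "q \<ast> u = I M" and iso: "b\<langle>u, u\<rangle> = fzero M M"
  obtains s where "arr s" "dm s = D M" "cd s = ld b" "b\<langle>s, u\<rangle> = ev M" "b\<langle>s, s\<rangle> = fzero (D M) (D M)"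
proof -
  have M [simp]: "M \<in> Ob" using u by auto
  note [simp] = u q quadD[OF b]
  have [simp]: "q \<ast> u \<ast> x = I M \<ast> x" for x by (rule comp_eq_comp[OF qu])
  have iso' [simp]: "b\<langle>u \<ast> x, u \<ast> y\<rangle> = (fzero M M)\<langle>x, y\<rangle>" for x y by (rule act_eq_comp[OF iso])
  obtain s where s [simp]: "arr s" "dm s = D M" "cd s = ld b" and "b\<langle>s, I (rd b)\<rangle> = (ev M)\<langle>I (D M), q\<rangle>"
    using perfect_ex[of b "(ev M)\<langle>I (D M), q\<rangle>"] by auto
  then have bs: "b\<langle>s, I (ld b)\<rangle> = (ev M)\<langle>I (D M), q\<rangle>" by simp
  have bsx: "b\<langle>s, x\<rangle> = (ev M)\<langle>I (D M), q \<ast> x\<rangle>" if "arr x" "cd x = ld b" for x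
    using act_eq_comp[OF bs, of "I (D M)" x] that by simp
  have sbx: "b\<langle>u \<ast> x, s\<rangle> = swap (b\<langle>s, u \<ast> x\<rangle>)" for x by simp
  define \<gamma> where "\<gamma> = b\<langle>s, s\<rangle>"
  have \<gamma> [simp]: "frm \<gamma>" "ld \<gamma> = D M" "rd \<gamma> = D M" "swap \<gamma> = \<gamma>" by (simp_all add: \<gamma>_def)
  have g1: "b\<langle>s, u \<ast> q \<ast> s\<rangle> = \<gamma>" by (simp add: \<gamma>_def bsx)
  have g2: "b\<langle>u \<ast> q \<ast> s, s\<rangle> = \<gamma>" unfolding sbx g1 by simp
  define s' where "s' = s \<boxplus> (-1/2) \<triangleright> (u \<ast> q \<ast> s)"
  have "b\<langle>s', s'\<rangle> = \<gamma> \<boxplus>\<^sub>f ((-1/2) \<triangleright>\<^sub>f \<gamma> \<boxplus>\<^sub>f (-1/2) \<triangleright>\<^sub>f \<gamma>)"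
    by (simp add: s'_def act_plus_left act_plus_right g1 g2 F.plus_assoc flip: \<gamma>_def)
  also have "\<dots> = fzero (D M) (D M)" using F.minus_halves[of \<gamma>] by simp
  finally have "b\<langle>s', s'\<rangle> = fzero (D M) (D M)" .
  moreover have "b\<langle>s', u\<rangle> = ev M"
    using iso'[of "q \<ast> s" "I M"] by (simp add: s'_def act_plus_left bsx qu)
  moreover have "arr s'" "dm s' = D M" "cd s' = ld b" by (simp_all add: s'_def)
  ultimately show thesis using that by blast
qed

text \<open>The last premise says that the orthogonal complement of \<open>u\<close> is contained in
  the image of \<open>u\<close>. An isotropic complement \<open>s\<close> of shape
  \<open>D M\<close> then pairs with \<open>u\<close> by evaluation, and it remains to see that
  \<open>u\<close> and \<open>s\<close> fill the whole object.\<close>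

lemma lagrangian_hyp:
  assumes b: "quad b" and u: "arr u" "dm u = M" "cd u = ld b" and q: "arr q" "dm q = ld b" "cd q = M"
    and qu: "q \<ast> u = I M" and iso: "b\<langle>u, u\<rangle> = fzero M M"
    and max: "\<And>f. \<lbrakk>arr f; cd f = ld b; b\<langle>f, u\<rangle> = fzero (dm f) M\<rbrakk> \<Longrightarrow> f = u \<ast> q \<ast> f"
  shows "hyp M b"
proof -
  have M [simp]: "M \<in> Ob" using u by auto
  note [simp] = u q quadD[OF b]
  have [simp]: "q \<ast> u \<ast> x = I M \<ast> x" for x by (rule comp_eq_comp[OF qu])
  obtain s where s [simp]: "arr s" "dm s = D M" "cd s = ld b" and su: "b\<langle>s, u\<rangle> = ev M"
    and ss: "b\<langle>s, s\<rangle> = fzero (D M) (D M)"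
    using isotropic_complement[OF b u q qu iso] by blast
  \<comment> \<open>The coordinate along \<open>s\<close>: pairing with \<open>u\<close>, read as an
    arrow into the dual.\<close>
  obtain p2 where p2 [simp]: "arr p2" "dm p2 = ld b" "cd p2 = D M" and ev_p2: "(ev M)\<langle>p2, I M\<rangle> = b\<langle>I (ld b), u\<rangle>"
    using perfect_ex[OF perfect_ev[OF M], of "b\<langle>I (ld b), u\<rangle>"] by auto
  have p2u: "p2 \<ast> u = zero M (D M)"
    using perfect_zero[OF perfect_ev[OF M], of "p2 \<ast> u"] act_eq_comp[OF ev_p2, of u "I M"] iso by simp
  have p2s: "p2 \<ast> s = I (D M)"
    by (rule perfect_inj[OF perfect_ev[OF M]]) (use act_eq_comp[OF ev_p2, of s "I M"] su in simp_all)
  have [simp]: "p2 \<ast> u \<ast> x = zero M (D M) \<ast> x" "p2 \<ast> s \<ast> x = I (D M) \<ast> x" for x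
    using comp_eq_comp[OF p2u] comp_eq_comp[OF p2s] by auto
  \<comment> \<open>Removing the component along \<open>s\<close> leaves something orthogonal to
    \<open>u\<close>, which by maximality factors through \<open>u\<close>. This yields the missing
    coordinate \<open>p1\<close>.\<close>
  define f where "f = I (ld b) \<boxplus> (-1) \<triangleright> (s \<ast> p2)"
  have f [simp]: "arr f" "dm f = ld b" "cd f = ld b" by (simp_all add: f_def)
  have "b\<langle>f, u\<rangle> = b\<langle>I (ld b), u\<rangle> \<boxplus>\<^sub>f (-1) \<triangleright>\<^sub>f b\<langle>I (ld b), u\<rangle>"
    using act_eq_comp[OF su, of p2 "I M"] ev_p2 by (simp add: f_def act_plus_left)
  also have "\<dots> = fzero (ld b) M" using F.plus_neg[of "b\<langle>I (ld b), u\<rangle>"] by simp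
  finally have f_eq: "f = u \<ast> q \<ast> f" by (intro max) simp_all
  define p1 where "p1 = q \<ast> f"
  have [simp]: "arr p1" "dm p1 = ld b" "cd p1 = M" by (simp_all add: p1_def)
  have "u \<ast> p1 \<boxplus> s \<ast> p2 = f \<boxplus> s \<ast> p2" using f_eq by (simp add: p1_def)
  also have "\<dots> = I (ld b) \<boxplus> (s \<ast> p2 \<boxplus> (-1) \<triangleright> (s \<ast> p2))"
    by (simp add: f_def A.plus_ac)
  also have "\<dots> = I (ld b)" using A.plus_neg[of "s \<ast> p2"] by simp
  finally have sum: "u \<ast> p1 \<boxplus> s \<ast> p2 = I (ld b)" .
  have p1u: "p1 \<ast> u = I M" by (simp add: p1_def f_def comp_plus_left comp_plus_right p2u qu)
  have p1s: "p1 \<ast> s = zero (D M) M"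
    using A.plus_neg[of "q \<ast> s"] by (simp add: p1_def f_def comp_plus_left comp_plus_right p2s)
  have bip: "bip M (D M) (ld b) u s p1 p2"
    using sum p1u p1s p2u p2s by (simp add: bip_def)
  have us: "b\<langle>u, s\<rangle> = swap (ev M)" unfolding su[symmetric] by simp
  have "b = (ev M)\<langle>p2, p1\<rangle> \<boxplus>\<^sub>f (swap (ev M))\<langle>p1, p2\<rangle>"
    using bip_form_expand[OF bip, of b] unfolding iso ss su us by simp
  then show ?thesis using bip quadD[OF b] unfolding hyp_def by blast
qed

text \<open>The converse of \<open>lagrangian_hyp\<close>. Pairing with \<open>M\<close> reads off
  the coordinate in \<open>D M\<close>, so an arrow orthogonal to \<open>M\<close> has no such
  coordinate and lies in \<open>M\<close>.\<close>

lemma hyp_lagrangian: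
  assumes bip: "bip M (D M) (ld b) i j p q" and b_eq: "b = (ev M)\<langle>q, p\<rangle> \<boxplus>\<^sub>f (swap (ev M))\<langle>p, q\<rangle>"
  shows "\<lbrakk>arr f; cd f = ld b\<rbrakk> \<Longrightarrow> b\<langle>f, i\<rangle> = (ev M)\<langle>q \<ast> f, I M\<rangle>"
    and "\<lbrakk>arr f; cd f = ld b; b\<langle>f, i\<rangle> = fzero (dm f) M\<rbrakk> \<Longrightarrow> f = i \<ast> p \<ast> f"
proof -
  note [simp] = bipD[OF bip]
  have *: "b\<langle>f, i\<rangle> = (ev M)\<langle>q \<ast> f, I M\<rangle>" if "arr f" "cd f = ld b" for f
    using that by (subst b_eq) (simp add: act_fplus)
  then show "\<lbrakk>arr f; cd f = ld b\<rbrakk> \<Longrightarrow> b\<langle>f, i\<rangle> = (ev M)\<langle>q \<ast> f, I M\<rangle>" .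
  assume f: "arr f" "cd f = ld b" "b\<langle>f, i\<rangle> = fzero (dm f) M"
  have "q \<ast> f = zero (dm f) (D M)"
    using perfect_zero[OF perfect_ev[of M], of "q \<ast> f"] *[of f] f by simp
  then show "f = i \<ast> p \<ast> f" using bip_eq[OF bip f(1,2)] f by simp
qed

text \<open>The chosen duals of \<open>M\<close> and \<open>M'\<close> are never compared. The
  Lagrangian \<open>M\<close> is reparametrised along the isomorphism, and
  \<open>lagrangian_hyp\<close> rebuilds the dual half from \<open>D M'\<close>.\<close>

lemma hyp_iso_object:
  assumes "hyp M b" "ws M" and fg: "inverse_pair M M' f g"
  shows "hyp M' b"
proof -
  obtain i j p q where bip: "bip M (D M) (ld b) i j p q"
    and b_eq: "b = (ev M)\<langle>q, p\<rangle> \<boxplus>\<^sub>f (swap (ev M))\<langle>p, q\<rangle>"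
    using assms unfolding hyp_def by blast
  have b: "quad b" using hyp_quad assms by blast
  note [simp] = bipD[OF bip] inverse_pairD[OF fg] quadD[OF b]
  note hl = hyp_lagrangian[OF bip b_eq]
  have ii: "b\<langle>i, i\<rangle> = fzero M M" using hl(1)[of i] by simp
  show ?thesis
  proof (rule lagrangian_hyp[OF b, of "i \<ast> g" _ "f \<ast> p"])
    show "b\<langle>i \<ast> g, i \<ast> g\<rangle> = fzero M' M'" using act_eq_comp[OF ii, of g g] by simp
    fix h assume h: "arr h" "cd h = ld b" "b\<langle>h, i \<ast> g\<rangle> = fzero (dm h) M'"
    have "b\<langle>h, i\<rangle> = fzero (dm h) M"
      using act_eq_comp[OF h(3), of "I (dm h)" f] h(1,2) by simp
    from hl(2)[OF h(1,2) this] show "h = (i \<ast> g) \<ast> (f \<ast> p) \<ast> h" using h(1,2) by simp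
  qed simp_all
qed

text \<open>The sum of the two Lagrangians is a Lagrangian of the orthogonal sum. In this way no
  isomorphism between \<open>D S\<close> and the sum of \<open>D M\<close> and \<open>D N\<close>
  has to be constructed.\<close>

lemma hyp_osum:
  assumes h: "hyp M b" "ws M" and h': "hyp N b'" "ws N" and t: "osum b b' t" and S: "bip M N S k1 k2 s1 s2"
  shows "hyp S t"
proof -
  obtain i j p q where bip: "bip M (D M) (ld b) i j p q"
    and b_eq: "b = (ev M)\<langle>q, p\<rangle> \<boxplus>\<^sub>f (swap (ev M))\<langle>p, q\<rangle>"
    using h unfolding hyp_def by blast
  obtain i' j' p' q' where bip': "bip N (D N) (ld b') i' j' p' q'"
    and b'_eq: "b' = (ev N)\<langle>q', p'\<rangle> \<boxplus>\<^sub>f (swap (ev N))\<langle>p', q'\<rangle>"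
    using h' unfolding hyp_def by blast
  obtain j1 j2 r1 r2 where T: "bip (ld b) (ld b') (ld t) j1 j2 r1 r2" and t_eq: "t = b\<langle>r1, r1\<rangle> \<boxplus>\<^sub>f b'\<langle>r2, r2\<rangle>"
    using t unfolding osum_def by blast
  have b: "quad b" and b': "quad b'" using hyp_quad h h' by blast+
  have qt: "quad t" using osum_quad[OF b b' t] .
  note [simp] = bipD[OF bip] bipD[OF bip'] bipD[OF T] bipD[OF S] quadD[OF b] quadD[OF b'] quadD[OF qt]
  note hl = hyp_lagrangian[OF bip b_eq] hyp_lagrangian[OF bip' b'_eq]
  have ii: "b\<langle>i, i\<rangle> = fzero M M" "b'\<langle>i', i'\<rangle> = fzero N N" using hl(1)[of i] hl(3)[of i'] by simp_all
  define u where "u = j1 \<ast> i \<ast> s1 \<boxplus> j2 \<ast> i' \<ast> s2"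
  have u [simp]: "arr u" "dm u = S" "cd u = ld t" by (simp_all add: u_def)
  have tu: "t\<langle>f, u\<rangle> = b\<langle>r1 \<ast> f, i \<ast> s1\<rangle> \<boxplus>\<^sub>f b'\<langle>r2 \<ast> f, i' \<ast> s2\<rangle>" if "arr f" "cd f = ld t" for f
    using that by (subst t_eq) (simp add: act_fplus u_def comp_plus_right)
  show ?thesis
  proof (rule lagrangian_hyp[OF qt, of u _ "k1 \<ast> p \<ast> r1 \<boxplus> k2 \<ast> p' \<ast> r2"])
    show "(k1 \<ast> p \<ast> r1 \<boxplus> k2 \<ast> p' \<ast> r2) \<ast> u = I S"
      using bip_sum[OF S] by (simp add: u_def comp_plus_left comp_plus_right)
    show "t\<langle>u, u\<rangle> = fzero S S"
      using act_eq_comp[OF ii(1), of s1 s1] act_eq_comp[OF ii(2), of s2 s2]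
      by (simp add: tu) (simp add: u_def comp_plus_right)
    fix f assume f: "arr f" "cd f = ld t" and z: "t\<langle>f, u\<rangle> = fzero (dm f) S"
    \<comment> \<open>Restricting the right argument along the injection of \<open>M\<close> into
      \<open>S\<close> isolates the pairing with the first Lagrangian.\<close>
    have "b\<langle>r1 \<ast> f, i\<rangle> = fzero (dm f) M"
      using arg_cong[OF z, of "\<lambda>x. x\<langle>I (dm f), k1\<rangle>"] f by (simp only: tu) (simp add: act_fplus)
    then have 1: "r1 \<ast> f = i \<ast> p \<ast> r1 \<ast> f" using hl(2)[of "r1 \<ast> f"] f by simp
    have "b'\<langle>r2 \<ast> f, i'\<rangle> = fzero (dm f) N"
      using arg_cong[OF z, of "\<lambda>x. x\<langle>I (dm f), k2\<rangle>"] f by (simp only: tu) (simp add: act_fplus)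
    then have 2: "r2 \<ast> f = i' \<ast> p' \<ast> r2 \<ast> f" using hl(4)[of "r2 \<ast> f"] f by simp
    have "f = j1 \<ast> r1 \<ast> f \<boxplus> j2 \<ast> r2 \<ast> f" by (rule bip_eq[OF T f])
    also have "\<dots> = j1 \<ast> i \<ast> p \<ast> r1 \<ast> f \<boxplus> j2 \<ast> i' \<ast> p' \<ast> r2 \<ast> f" using 1 2 by (simp only:)
    also have "\<dots> = u \<ast> (k1 \<ast> p \<ast> r1 \<boxplus> k2 \<ast> p' \<ast> r2) \<ast> f"
      using f by (simp add: u_def comp_plus_left comp_plus_right)
    finally show "f = u \<ast> (k1 \<ast> p \<ast> r1 \<boxplus> k2 \<ast> p' \<ast> r2) \<ast> f" .
  qed simp_all
qed

lemma hyp_zob: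
  assumes "quad b" "zob (ld b)"
  shows "hyp (ld b) b"
proof (rule lagrangian_hyp[OF assms(1)])
  have [simp]: "ld b \<in> Ob" using assms by (simp add: zob_def)
  show "b\<langle>I (ld b), I (ld b)\<rangle> = fzero (ld b) (ld b)"
    using zob_form[OF assms(2), of b] assms by simp
  show "arr (I (ld b))" "dm (I (ld b)) = ld b" "cd (I (ld b)) = ld b" "I (ld b) \<ast> I (ld b) = I (ld b)" by simp_all
  fix f assume "arr f" "cd f = ld b"
  then show "f = I (ld b) \<ast> I (ld b) \<ast> f" by simp
qed (use assms in \<open>auto simp: zob_def\<close>)

text \<open>The diagonal embedding twisted by a square root of \<open>-1\<close> is a Lagrangian.\<close>

lemma osum_double_hyp:
  assumes b: "quad b" and t: "osum b b t" and z: "z * z = (-1 :: 'k)"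
  shows "hyp (ld b) t"
proof -
  obtain i j p q where bip: "bip (ld b) (ld b) (ld t) i j p q" and t_eq: "t = b\<langle>p, p\<rangle> \<boxplus>\<^sub>f b\<langle>q, q\<rangle>"
    using t unfolding osum_def by blast
  have qt: "quad t" using osum_quad[OF b b t] .
  note [simp] = bipD[OF bip] quadD[OF b] quadD[OF qt]
  define u where "u = i \<boxplus> z \<triangleright> j"
  have u [simp]: "arr u" "dm u = ld b" "cd u = ld t" by (simp_all add: u_def)
  have tu: "t\<langle>f, u\<rangle> = b\<langle>p \<ast> f \<boxplus> z \<triangleright> (q \<ast> f), I (ld b)\<rangle>" if "arr f" "cd f = ld t" for f
    using that by (subst t_eq) (simp add: act_fplus u_def comp_plus_right act_plus_left)
  show ?thesis
  proof (rule lagrangian_hyp[OF qt, of u _ p])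
    show "p \<ast> u = I (ld b)" by (simp add: u_def comp_plus_right)
    \<comment> \<open>The pairing of \<open>u\<close> with itself carries the scalar
      \<open>1 + z * z\<close>, which vanishes.\<close>
    have "p \<ast> u \<boxplus> z \<triangleright> (q \<ast> u) = I (ld b) \<boxplus> (-1) \<triangleright> I (ld b)"
      by (simp add: u_def comp_plus_right z)
    also have "\<dots> = zero (ld b) (ld b)" using A.plus_neg[of "I (ld b)"] by simp
    finally show "t\<langle>u, u\<rangle> = fzero (ld b) (ld b)" by (simp only: tu u) simp
    fix f assume f: "arr f" "cd f = ld t" and z0: "t\<langle>f, u\<rangle> = fzero (dm f) (ld b)"
    have "p \<ast> f \<boxplus> z \<triangleright> (q \<ast> f) = zero (dm f) (ld b)"
      using perfect_zero[of b "p \<ast> f \<boxplus> z \<triangleright> (q \<ast> f)"] tu[OF f] z0 f by simp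
    \<comment> \<open>Multiplying by \<open>z\<close> turns the coefficient \<open>z * z\<close> of
      the second coordinate into minus one, so the orthogonality relation says that the second
      coordinate of \<open>f\<close> is \<open>z\<close> times the first. That is membership in the
      twisted diagonal \<open>u\<close>.\<close>
    then have "z \<triangleright> (p \<ast> f \<boxplus> z \<triangleright> (q \<ast> f)) = z \<triangleright> zero (dm f) (ld b)" by (simp only:)
    then have "z \<triangleright> (p \<ast> f) \<boxplus> (-1) \<triangleright> (q \<ast> f) = zero (dm f) (ld b)"
      using f by (simp add: A.scale_plus z)
    then have "z \<triangleright> (p \<ast> f) = q \<ast> f"
      by (rule A.eq_of_diff_zero) (use f in auto)
    then have "u \<ast> p \<ast> f = i \<ast> p \<ast> f \<boxplus> j \<ast> q \<ast> f"
      by (simp add: u_def comp_plus_left flip: comp_scale_right)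
    then show "f = u \<ast> p \<ast> f" using bip_eq[OF bip f] by simp
  qed simp_all
qed

end

subsection \<open>Orthogonal complements\<close>

context form_category
begin

lemma perfect_scale:
  assumes "perfect e" "c \<noteq> 0"
  shows "perfect (c \<triangleright>\<^sub>f e)"
proof (rule perfectI)
  note [simp] = perfect_frm[OF assms(1)]
  show "frm (c \<triangleright>\<^sub>f e)" by simp
  fix g assume g: "frm g" "rd g = rd (c \<triangleright>\<^sub>f e)"
  then obtain f where "arr f" "dm f = ld g" "cd f = ld e" "e\<langle>f, I (rd e)\<rangle> = g"
    using perfect_ex[OF assms(1), of g] by auto
  then show "\<exists>f. arr f \<and> dm f = ld g \<and> cd f = ld (c \<triangleright>\<^sub>f e) \<and> (c \<triangleright>\<^sub>f e)\<langle>f, I (rd (c \<triangleright>\<^sub>f e))\<rangle> = g"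
    using assms(2) g(1) by (intro exI[of _ "(1/c) \<triangleright> f"]) simp
next
  note [simp] = perfect_frm[OF assms(1)]
  fix f f' assume f: "arr f" "arr f'" "dm f = dm f'" "cd f = ld (c \<triangleright>\<^sub>f e)" "cd f' = ld (c \<triangleright>\<^sub>f e)"
    "(c \<triangleright>\<^sub>f e)\<langle>f, I (rd (c \<triangleright>\<^sub>f e))\<rangle> = (c \<triangleright>\<^sub>f e)\<langle>f', I (rd (c \<triangleright>\<^sub>f e))\<rangle>"
  then have "(1/c) \<triangleright>\<^sub>f c \<triangleright>\<^sub>f e\<langle>f, I (rd e)\<rangle> = (1/c) \<triangleright>\<^sub>f c \<triangleright>\<^sub>f e\<langle>f', I (rd e)\<rangle>"
    by (simp del: F.scale_scale)
  then show "f = f'" by (intro perfect_inj[OF assms(1)]) (use f assms(2) in simp_all)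
qed

lemma perfect_iso:
  assumes e: "perfect e" and fg: "inverse_pair A (ld e) f g"
  shows "perfect (e\<langle>f, I (rd e)\<rangle>)"
proof (rule perfectI)
  note [simp] = perfect_frm[OF e] inverse_pairD[OF fg]
  show "frm (e\<langle>f, I (rd e)\<rangle>)" by simp
  fix b assume b: "frm b" "rd b = rd (e\<langle>f, I (rd e)\<rangle>)"
  then obtain h where "arr h" "dm h = ld b" "cd h = ld e" "e\<langle>h, I (rd e)\<rangle> = b"
    using perfect_ex[OF e, of b] by auto
  then show "\<exists>h. arr h \<and> dm h = ld b \<and> cd h = ld (e\<langle>f, I (rd e)\<rangle>) \<and>
      (e\<langle>f, I (rd e)\<rangle>)\<langle>h, I (rd (e\<langle>f, I (rd e)\<rangle>))\<rangle> = b"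
    by (intro exI[of _ "g \<ast> h"]) simp
next
  note [simp] = perfect_frm[OF e] inverse_pairD[OF fg]
  fix h h' assume h: "arr h" "arr h'" "dm h = dm h'" "cd h = ld (e\<langle>f, I (rd e)\<rangle>)" "cd h' = ld (e\<langle>f, I (rd e)\<rangle>)"
    "(e\<langle>f, I (rd e)\<rangle>)\<langle>h, I (rd (e\<langle>f, I (rd e)\<rangle>))\<rangle> = (e\<langle>f, I (rd e)\<rangle>)\<langle>h', I (rd (e\<langle>f, I (rd e)\<rangle>))\<rangle>"
  then have "f \<ast> h = f \<ast> h'" using perfect_inj[OF e, of "f \<ast> h" "f \<ast> h'"] by simp
  then have "g \<ast> f \<ast> h = g \<ast> f \<ast> h'" by (simp only:)
  then show "h = h'" using h by simp
qed

text \<open>Representing \<open>e\<close> by its own pullback along \<open>f\<close> gives a right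
  inverse of \<open>f\<close>, by uniqueness for \<open>e\<close>; uniqueness for the pullback makes
  it a left inverse. Together with \<open>perfect_iso\<close>, invertibility of \<open>f\<close> is
  equivalent to perfectness of the pullback.\<close>

lemma perfect_iso_arrow:
  assumes e: "perfect e" and f: "arr f" "cd f = ld e" and e': "perfect (e\<langle>f, I (rd e)\<rangle>)"
  shows "\<exists>g. inverse_pair (dm f) (ld e) f g"
proof -
  note [simp] = perfect_frm[OF e] f
  obtain g where g [simp]: "arr g" "dm g = ld e" "cd g = dm f" and eq: "e\<langle>f \<ast> g, I (rd e)\<rangle> = e"
    using perfect_ex[OF e', of e] by auto
  have fg: "f \<ast> g = I (ld e)" by (rule perfect_inj[OF e]) (simp_all add: eq)
  have "e\<langle>f \<ast> (g \<ast> f), I (rd e)\<rangle> = e\<langle>f, I (rd e)\<rangle>" using comp_eq_comp[OF fg, of f] by simp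
  then have "g \<ast> f = I (dm f)" by (intro perfect_inj[OF e']) simp_all
  then show ?thesis using fg by (intro exI[of _ g]) (simp add: inverse_pair_def)
qed

text \<open>Pairing with \<open>u\<close> is a form with right leg \<open>K\<close>, hence
  represented through the perfect restriction of \<open>b\<close>. The representing arrow
  \<open>r\<close> is the orthogonal projection onto \<open>u\<close>, and it is a retraction
  without \<open>u\<close> being assumed to be a monomorphism.\<close>

lemma quad_retraction:
  assumes b: "quad b" and u: "arr u" "dm u = K" "cd u = ld b" and \<beta>: "quad (b\<langle>u, u\<rangle>)"
  obtains r where "arr r" "dm r = ld b" "cd r = K" "r \<ast> u = I K"
    "\<And>f. \<lbrakk>arr f; cd f = ld b\<rbrakk> \<Longrightarrow> b\<langle>f, u\<rangle> = (b\<langle>u, u\<rangle>)\<langle>r \<ast> f, I K\<rangle>"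
proof -
  note [simp] = u quadD[OF b]
  have K [simp]: "K \<in> Ob" using u(1,2) A.src_Ob by blast
  define \<beta> where "\<beta> = b\<langle>u, u\<rangle>"
  have [simp]: "frm \<beta>" "ld \<beta> = K" "rd \<beta> = K" by (simp_all add: \<beta>_def)
  have pb: "perfect \<beta>" using assms(5) by (simp add: \<beta>_def)
  obtain r where r [simp]: "arr r" "dm r = ld b" "cd r = K" and req: "\<beta>\<langle>r, I K\<rangle> = b\<langle>I (ld b), u\<rangle>"
    using perfect_ex[OF pb, of "b\<langle>I (ld b), u\<rangle>"] by auto
  have bf: "b\<langle>f, u\<rangle> = \<beta>\<langle>r \<ast> f, I K\<rangle>" if "arr f" "cd f = ld b" for f
    using act_eq_comp[OF req, of f "I K"] that by simp
  have "r \<ast> u = I K"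
    by (rule perfect_inj[OF pb]) (use bf[of u] in \<open>simp_all flip: \<beta>_def\<close>)
  then show thesis using that r bf unfolding \<beta>_def by blast
qed

text \<open>The hypothesis on \<open>r\<close> makes its kernel part \<open>v\<close> orthogonal to
  \<open>u\<close>, first on one side and then by symmetry on the other. The matrix of
  \<open>b\<close> is thus block diagonal, and perfectness descends to the complementary
  block.\<close>

lemma quad_complement:
  assumes b: "quad b" and bip: "bip K N (ld b) u v r r'" and \<beta>: "quad (b\<langle>u, u\<rangle>)"
    and bf: "\<And>f. \<lbrakk>arr f; cd f = ld b\<rbrakk> \<Longrightarrow> b\<langle>f, u\<rangle> = (b\<langle>u, u\<rangle>)\<langle>r \<ast> f, I K\<rangle>"
  shows "quad (b\<langle>v, v\<rangle>)" "osum (b\<langle>u, u\<rangle>) (b\<langle>v, v\<rangle>) b"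
proof -
  note [simp] = quadD[OF b] bipD[OF bip]
  have vu: "b\<langle>v, u\<rangle> = fzero N K" using bf[of v] by simp
  have "b\<langle>u, v\<rangle> = swap (b\<langle>v, u\<rangle>)" by simp
  then have uv: "b\<langle>u, v\<rangle> = fzero K N" unfolding vu by simp
  have b_eq: "b = (b\<langle>u, u\<rangle>)\<langle>r, r\<rangle> \<boxplus>\<^sub>f (b\<langle>v, v\<rangle>)\<langle>r', r'\<rangle>"
    using bip_form_expand[OF bip, of b] unfolding uv vu by simp
  show "osum (b\<langle>u, u\<rangle>) (b\<langle>v, v\<rangle>) b"
    using b_eq bip unfolding osum_def by (auto intro!: exI)
  have bv: "b\<langle>v \<ast> f, u\<rangle> = fzero (dm f) K" if "arr f" "cd f = N" for f
    using act_eq_comp[OF vu, of f "I K"] that by simp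
  have "perfect (b\<langle>v, v\<rangle>)"
  proof (rule perfectI)
    fix g assume g [simp]: "frm g" and "rd g = rd (b\<langle>v, v\<rangle>)"
    then have [simp]: "rd g = N" by simp
    obtain f where f [simp]: "arr f" "dm f = ld g" "cd f = ld b" and feq: "b\<langle>f, I (ld b)\<rangle> = g\<langle>I (ld g), r'\<rangle>"
      using perfect_ex[of b "g\<langle>I (ld g), r'\<rangle>"] by auto
    \<comment> \<open>The problem is solved on all of \<open>ld b\<close> for the extension of
      \<open>g\<close> by zero. The solution is orthogonal to \<open>u\<close>, so it already lives
      in the complement.\<close>
    have "b\<langle>f, u\<rangle> = fzero (ld g) K" using act_eq_comp[OF feq, of "I (ld g)" u] by simp
    then have "r \<ast> f = zero (ld g) K"
      using perfect_zero[of "b\<langle>u, u\<rangle>" "r \<ast> f"] bf[of f] \<beta> by simp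
    then have fv: "f = v \<ast> r' \<ast> f" using bip_eq[OF bip, of f] by simp
    have "b\<langle>f, v\<rangle> = g" using act_eq_comp[OF feq, of "I (ld g)" v] by simp
    then have "b\<langle>v \<ast> r' \<ast> f, v\<rangle> = g" by (simp only: fv[symmetric])
    then show "\<exists>f. arr f \<and> dm f = ld g \<and> cd f = ld (b\<langle>v, v\<rangle>) \<and> (b\<langle>v, v\<rangle>)\<langle>f, I (rd (b\<langle>v, v\<rangle>))\<rangle> = g"
      by (intro exI[of _ "r' \<ast> f"]) simp
  next
    fix f f' assume f [simp]: "arr f" "arr f'" "dm f = dm f'" and "cd f = ld (b\<langle>v, v\<rangle>)" "cd f' = ld (b\<langle>v, v\<rangle>)"
      and eq: "(b\<langle>v, v\<rangle>)\<langle>f, I (rd (b\<langle>v, v\<rangle>))\<rangle> = (b\<langle>v, v\<rangle>)\<langle>f', I (rd (b\<langle>v, v\<rangle>))\<rangle>"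
    then have [simp]: "cd f = N" "cd f' = N" by simp_all
    have eqv: "b\<langle>v \<ast> f, v\<rangle> = b\<langle>v \<ast> f', v\<rangle>" using eq by simp
    have expand: "b\<langle>v \<ast> h, I (ld b)\<rangle> = (b\<langle>v \<ast> h, u\<rangle>)\<langle>I (dm h), r\<rangle> \<boxplus>\<^sub>f (b\<langle>v \<ast> h, v\<rangle>)\<langle>I (dm h), r'\<rangle>"
      if "arr h" "cd h = N" for h
      using bip_form_right[OF bip, of b "v \<ast> h"] that by simp
    \<comment> \<open>Pairings with \<open>u\<close> vanish for both arrows, so agreement on
      \<open>v\<close> is agreement on the whole object, where \<open>b\<close> is perfect.\<close>
    have "b\<langle>v \<ast> f, I (ld b)\<rangle> = b\<langle>v \<ast> f', I (ld b)\<rangle>"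
      unfolding expand[OF f(1) \<open>cd f = N\<close>] expand[OF f(2) \<open>cd f' = N\<close>] eqv by (simp add: bv)
    then have "v \<ast> f = v \<ast> f'" using perfect_inj[of b "v \<ast> f" "v \<ast> f'"] by simp
    then have "r' \<ast> v \<ast> f = r' \<ast> v \<ast> f'" by (simp only:)
    then show "f = f'" by simp
  qed simp
  then show "quad (b\<langle>v, v\<rangle>)" by (intro quadI) simp_all
qed

end

section \<open>Semisimple categories with forms\<close>

text \<open>The \<open>X i\<close> are the representatives of the simple objects.
  \<open>X_end\<close> and \<open>X_hom\<close> are Schur's lemma over an algebraically closed
  field, \<open>sqrt_ex\<close> is the other consequence of that field, and \<open>split_ex\<close>
  provides complements of retracts.\<close>

locale semisimple_forms =
  form_category Ob arr dm cd plus scale zero frm ld rd fplus fscale fzero I comp act swap D ev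
  for Ob :: "'o set" and arr :: "'a \<Rightarrow> bool" and dm cd :: "'a \<Rightarrow> 'o"
    and plus :: "'a \<Rightarrow> 'a \<Rightarrow> 'a" (infixl "\<boxplus>" 65)
    and scale :: "'k::field_char_0 \<Rightarrow> 'a \<Rightarrow> 'a" (infixr "\<triangleright>" 75)
    and zero :: "'o \<Rightarrow> 'o \<Rightarrow> 'a"
    and frm :: "'f \<Rightarrow> bool" and ld rd :: "'f \<Rightarrow> 'o"
    and fplus :: "'f \<Rightarrow> 'f \<Rightarrow> 'f" (infixl "\<boxplus>\<^sub>f" 65)
    and fscale :: "'k \<Rightarrow> 'f \<Rightarrow> 'f" (infixr "\<triangleright>\<^sub>f" 75)
    and fzero :: "'o \<Rightarrow> 'o \<Rightarrow> 'f"
    and I :: "'o \<Rightarrow> 'a" and comp :: "'a \<Rightarrow> 'a \<Rightarrow> 'a" (infixr "\<ast>" 70)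
    and act :: "'f \<Rightarrow> 'a \<Rightarrow> 'a \<Rightarrow> 'f" ("_\<langle>_,/ _\<rangle>" [1000, 0, 0] 1000)
    and swap :: "'f \<Rightarrow> 'f" and D :: "'o \<Rightarrow> 'o" and ev :: "'o \<Rightarrow> 'f" +
  fixes Idx :: "'i set" and X :: "'i \<Rightarrow> 'o"
  assumes zob_ex: "\<exists>Z. zob Z"
    and bip_ex: "\<lbrakk>M \<in> Ob; N \<in> Ob\<rbrakk> \<Longrightarrow> \<exists>S i j p q. bip M N S i j p q"
    and split_ex: "\<lbrakk>arr u; arr r; dm u = K; cd u = M; dm r = M; cd r = K; r \<ast> u = I K\<rbrakk>
      \<Longrightarrow> \<exists>N v r'. bip K N M u v r r'"
    and sqrt_ex: "\<exists>z. z * z = (c :: 'k)"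
    and finite_Idx: "finite Idx"
    and X_Ob [simp]: "i \<in> Idx \<Longrightarrow> X i \<in> Ob"
    and X_nonzero: "i \<in> Idx \<Longrightarrow> I (X i) \<noteq> zero (X i) (X i)"
    and X_end: "\<lbrakk>i \<in> Idx; arr f; dm f = X i; cd f = X i\<rbrakk> \<Longrightarrow> \<exists>c. f = c \<triangleright> I (X i)"
    and X_hom: "\<lbrakk>i \<in> Idx; j \<in> Idx; i \<noteq> j; arr f; dm f = X i; cd f = X j\<rbrakk> \<Longrightarrow> f = zero (X i) (X j)"
    and decomp: "M \<in> Ob \<Longrightarrow> \<exists>bs. (\<forall>(i, \<iota>, \<pi>)\<in>set bs. i \<in> Idx \<and> \<iota> \<in> hom (X i) M \<and> \<pi> \<in> hom M (X i) \<and>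
      \<pi> \<ast> \<iota> = I (X i)) \<and> A.lsum M M (map (\<lambda>(i, \<iota>, \<pi>). \<iota> \<ast> \<pi>) bs) = I M"
begin

lemma scal_inj:
  assumes "i \<in> Idx" "c \<triangleright> I (X i) = d \<triangleright> I (X i)"
  shows "c = d"
proof (rule ccontr)
  assume "c \<noteq> d"
  have "(c + - d) \<triangleright> I (X i) = c \<triangleright> I (X i) \<boxplus> (- d) \<triangleright> I (X i)" by (rule A.scale_add)
  also have "\<dots> = (d + - d) \<triangleright> I (X i)" unfolding assms(2) by (rule A.scale_add[symmetric])
  also have "\<dots> = zero (X i) (X i)" using assms(1) by (simp add: A.scale_zero)
  finally have "I (X i) = zero (X i) (X i)"
    by (rule A.scale_eq_zero) (use assms(1) \<open>c \<noteq> d\<close> in auto)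
  then show False using X_nonzero assms(1) by blast
qed

lemma nonzero_summand:
  assumes "M \<in> Ob" "\<not> zob M"
  obtains i u q where "i \<in> Idx" "arr u" "dm u = X i" "cd u = M" "arr q" "dm q = M" "cd q = X i" "q \<ast> u = I (X i)"
proof -
  obtain bs where bs: "\<forall>(i, \<iota>, \<pi>)\<in>set bs. i \<in> Idx \<and> \<iota> \<in> hom (X i) M \<and> \<pi> \<in> hom M (X i) \<and> \<pi> \<ast> \<iota> = I (X i)"
    and sum: "A.lsum M M (map (\<lambda>(i, \<iota>, \<pi>). \<iota> \<ast> \<pi>) bs) = I M"
    using decomp[OF assms(1)] by blast
  have "bs \<noteq> []" using sum assms by (auto simp: zob_def)
  then obtain i \<iota> \<pi> where "(i, \<iota>, \<pi>) \<in> set bs" by (metis list.set_sel(1) prod_cases3)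
  then show thesis using bs that[of i \<iota> \<pi>] by fastforce
qed

text \<open>An endomorphism of the dual on the left of the evaluation can be moved to an
  endomorphism of \<open>X i\<close> on the right, which is a scalar.\<close>

lemma End_dual:
  assumes i: "i \<in> Idx" and f: "arr f" "dm f = D (X i)" "cd f = D (X i)"
  shows "\<exists>c. f = c \<triangleright> I (D (X i))"
proof -
  obtain g where g: "arr g" "dm g = X i" "cd g = X i"
    and eq: "(ev (X i))\<langle>I (D (X i)), g\<rangle> = (ev (X i))\<langle>f, I (X i)\<rangle>"
    using ev_right[of "X i" "(ev (X i))\<langle>f, I (X i)\<rangle>"] i f by auto
  obtain c where "g = c \<triangleright> I (X i)" using X_end[OF i g] by blast
  then have "f = c \<triangleright> I (D (X i))"
    using perfect_inj[OF perfect_ev[of "X i"], of f "c \<triangleright> I (D (X i))"] eq i f by simp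
  then show ?thesis ..
qed

text \<open>The dual is not zero, as otherwise the evaluation would vanish and could not distinguish
  the identity of \<open>X i\<close> from zero. So it has a simple retract, and the resulting
  idempotent is a scalar that the retraction identity forces to be one.\<close>

lemma dual_simple:
  assumes i: "i \<in> Idx"
  shows "\<exists>j\<in>Idx. \<exists>f g. inverse_pair (X j) (D (X i)) f g"
proof -
  have "\<not> zob (D (X i))"
  proof
    assume z: "zob (D (X i))"
    have "ev (X i) = fzero (D (X i)) (X i)" using zob_form(1)[OF z, of "ev (X i)"] i by simp
    then have "(ev (X i))\<langle>I (D (X i)), I (X i)\<rangle> = (ev (X i))\<langle>I (D (X i)), zero (X i) (X i)\<rangle>"
      using i by simp
    then show False
      using ev_right[of "X i" "(ev (X i))\<langle>I (D (X i)), I (X i)\<rangle>"] i X_nonzero[OF i] by auto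
  qed
  then obtain j u q where j: "j \<in> Idx" and u: "arr u" "dm u = X j" "cd u = D (X i)"
    and q: "arr q" "dm q = D (X i)" "cd q = X j" "q \<ast> u = I (X j)"
    using nonzero_summand[of "D (X i)"] i by auto
  obtain c where c: "u \<ast> q = c \<triangleright> I (D (X i))" using End_dual[OF i, of "u \<ast> q"] u q by auto
  have "q \<ast> (u \<ast> q) \<ast> u = I (X j)" using u q comp_eq_comp[OF q(4)] j by simp
  then have "c \<triangleright> I (X j) = 1 \<triangleright> I (X j)" unfolding c using u q i j by simp
  then have "c = 1" by (rule scal_inj[OF j])
  then have "inverse_pair (X j) (D (X i)) u q" using c u q i by (simp add: inverse_pair_def)
  then show ?thesis using j by blast
qed

subsection \<open>Multiplicities\<close>

definition sc :: "'i \<Rightarrow> 'a \<Rightarrow> 'k" where "sc i f = (THE c. f = c \<triangleright> I (X i))"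

lemma sc_scale [simp]: "i \<in> Idx \<Longrightarrow> sc i (c \<triangleright> I (X i)) = c"
  unfolding sc_def by (rule the_equality) (auto dest: scal_inj)

lemma sc_I [simp]: "i \<in> Idx \<Longrightarrow> sc i (I (X i)) = 1"
  using sc_scale[of i 1] by simp

lemma sc_eq: "\<lbrakk>i \<in> Idx; arr f; dm f = X i; cd f = X i\<rbrakk> \<Longrightarrow> f = sc i f \<triangleright> I (X i)"
  using X_end[of i f] sc_scale[of i] by metis

lemma sc_zero [simp]: "i \<in> Idx \<Longrightarrow> sc i (zero (X i) (X i)) = 0"
  using sc_scale[of i 0] by (simp add: A.scale_zero)

lemma sc_plus:
  assumes "i \<in> Idx" "arr f" "dm f = X i" "cd f = X i" "arr g" "dm g = X i" "cd g = X i"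
  shows "sc i (f \<boxplus> g) = sc i f + sc i g"
proof -
  have "f \<boxplus> g = (sc i f + sc i g) \<triangleright> I (X i)"
    using sc_eq[of i f] sc_eq[of i g] assms by (simp add: A.scale_add)
  then show ?thesis using assms by simp
qed

lemma sc_comp:
  assumes "i \<in> Idx" "arr f" "dm f = X i" "cd f = X i" "arr g" "dm g = X i" "cd g = X i"
  shows "sc i (f \<ast> g) = sc i f * sc i g"
proof -
  have "f \<ast> g = (sc i f \<triangleright> I (X i)) \<ast> (sc i g \<triangleright> I (X i))"
    using sc_eq[of i f] sc_eq[of i g] assms by simp
  also have "\<dots> = (sc i g * sc i f) \<triangleright> I (X i)" using assms by simp
  finally show ?thesis using assms by (simp add: mult.commute)
qed

definition fsum :: "'o \<Rightarrow> ('a \<times> 'a) list \<Rightarrow> 'a" where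
  "fsum M bs = A.lsum M M (map (\<lambda>(\<iota>, \<pi>). \<iota> \<ast> \<pi>) bs)"

definition frame_arrows :: "'i \<Rightarrow> 'o \<Rightarrow> ('a \<times> 'a) list \<Rightarrow> bool" where
  "frame_arrows i M bs \<longleftrightarrow> (\<forall>(\<iota>, \<pi>)\<in>set bs. arr \<iota> \<and> dm \<iota> = X i \<and> cd \<iota> = M \<and> arr \<pi> \<and> dm \<pi> = M \<and> cd \<pi> = X i \<and>
     \<pi> \<ast> \<iota> = I (X i))"

text \<open>Coordinates on the part of \<open>M\<close> isotypic for \<open>X i\<close>: the sum of
  the \<open>\<iota> \<ast> \<pi>\<close> acts as the identity on all arrows from and to
  \<open>X i\<close>. Only the diagonal relations are recorded, which is enough for the trace
  computation of the length.\<close>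

definition frame :: "'i \<Rightarrow> 'o \<Rightarrow> ('a \<times> 'a) list \<Rightarrow> bool" where
  "frame i M bs \<longleftrightarrow> frame_arrows i M bs \<and>
     (\<forall>f. arr f \<longrightarrow> dm f = X i \<longrightarrow> cd f = M \<longrightarrow> fsum M bs \<ast> f = f) \<and>
     (\<forall>g. arr g \<longrightarrow> dm g = M \<longrightarrow> cd g = X i \<longrightarrow> g \<ast> fsum M bs = g)"

lemma fsum_simps [simp]: "fsum M [] = zero M M" "fsum M ((\<iota>, \<pi>) # bs) = \<iota> \<ast> \<pi> \<boxplus> fsum M bs"
  by (simp_all add: fsum_def)

lemma frame_arrows_simps [simp]: "frame_arrows i M []"
  "frame_arrows i M ((\<iota>, \<pi>) # bs) \<longleftrightarrow> (arr \<iota> \<and> dm \<iota> = X i \<and> cd \<iota> = M \<and> arr \<pi> \<and> dm \<pi> = M \<and> cd \<pi> = X i \<and>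
     \<pi> \<ast> \<iota> = I (X i)) \<and> frame_arrows i M bs"
  by (auto simp: frame_arrows_def)

lemma fsum_type [simp]:
  assumes "M \<in> Ob" "frame_arrows i M bs"
  shows "arr (fsum M bs)" "dm (fsum M bs) = M" "cd (fsum M bs) = M"
  using assms(2) by (induction bs) (use assms(1) in auto)

lemma fsum_append:
  "\<lbrakk>M \<in> Ob; frame_arrows i M bs; frame_arrows i M cs\<rbrakk> \<Longrightarrow> fsum M (bs @ cs) = fsum M bs \<boxplus> fsum M cs"
  by (induction bs) (auto simp: A.plus_assoc)

lemma frame_arrows_append:
  "frame_arrows i M (bs @ cs) \<longleftrightarrow> frame_arrows i M bs \<and> frame_arrows i M cs"
  by (auto simp: frame_arrows_def)

lemma frameD:
  assumes "frame i M bs"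
  shows "frame_arrows i M bs" "\<lbrakk>arr f; dm f = X i; cd f = M\<rbrakk> \<Longrightarrow> fsum M bs \<ast> f = f"
    "\<lbrakk>arr g; dm g = M; cd g = X i\<rbrakk> \<Longrightarrow> g \<ast> fsum M bs = g"
  using assms by (auto simp: frame_def)

lemma sc_fsum:
  assumes i: "i \<in> Idx" and M: "M \<in> Ob" and bs: "frame_arrows i M bs"
    and a: "arr \<iota>" "dm \<iota> = X i" "cd \<iota> = M" and p: "arr \<pi>" "dm \<pi> = M" "cd \<pi> = X i"
  shows "sc i (\<pi> \<ast> fsum M bs \<ast> \<iota>) = (\<Sum>(\<iota>', \<pi>')\<leftarrow>bs. sc i (\<pi> \<ast> \<iota>') * sc i (\<pi>' \<ast> \<iota>))"
  using bs
proof (induction bs)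
  case Nil
  then show ?case using assms by simp
next
  case (Cons x bs)
  obtain \<iota>' \<pi>' where x: "x = (\<iota>', \<pi>')" by fastforce
  have t: "arr \<iota>'" "dm \<iota>' = X i" "cd \<iota>' = M" "arr \<pi>'" "dm \<pi>' = M" "cd \<pi>' = X i" "frame_arrows i M bs"
    using Cons.prems x by auto
  have "\<pi> \<ast> fsum M (x # bs) \<ast> \<iota> = (\<pi> \<ast> \<iota>') \<ast> (\<pi>' \<ast> \<iota>) \<boxplus> \<pi> \<ast> fsum M bs \<ast> \<iota>"
    by (simp add: x comp_plus_left comp_plus_right)
  also have "sc i \<dots> = sc i ((\<pi> \<ast> \<iota>') \<ast> (\<pi>' \<ast> \<iota>)) + sc i (\<pi> \<ast> fsum M bs \<ast> \<iota>)"
    by (rule sc_plus[OF i]) (use t a p M in \<open>simp_all add: fsum_type[OF M t(7)]\<close>)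
  also have "sc i ((\<pi> \<ast> \<iota>') \<ast> (\<pi>' \<ast> \<iota>)) = sc i (\<pi> \<ast> \<iota>') * sc i (\<pi>' \<ast> \<iota>)"
    by (rule sc_comp[OF i]) (use t a p in simp_all)
  finally show ?case using Cons.IH[OF t(7)] by (simp add: x)
qed

lemma sum_list_swap:
  fixes h :: "'x \<Rightarrow> 'y \<Rightarrow> 'z::comm_monoid_add"
  shows "(\<Sum>x\<leftarrow>xs. \<Sum>y\<leftarrow>ys. h x y) = (\<Sum>y\<leftarrow>ys. \<Sum>x\<leftarrow>xs. h x y)"
  by (induction xs) (simp_all add: sum_list_addf)

text \<open>Each member contributes the scalar of \<open>\<pi> \<ast> \<iota>\<close>, which is one.
  Inserting the other frame between the two arrows expands it into a sum of products of matrix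
  entries.\<close>

lemma of_nat_length_frame:
  assumes i: "i \<in> Idx" and M: "M \<in> Ob" and bs: "frame_arrows i M bs" and cs: "frame i M cs"
  shows "of_nat (length bs) = (\<Sum>(\<iota>, \<pi>)\<leftarrow>bs. \<Sum>(\<iota>', \<pi>')\<leftarrow>cs. sc i (\<pi> \<ast> \<iota>') * sc i (\<pi>' \<ast> \<iota>))"
  using bs
proof (induction bs)
  case (Cons x bs)
  obtain \<iota> \<pi> where x: "x = (\<iota>, \<pi>)" by fastforce
  have t: "arr \<iota>" "dm \<iota> = X i" "cd \<iota> = M" "arr \<pi>" "dm \<pi> = M" "cd \<pi> = X i" "\<pi> \<ast> \<iota> = I (X i)" "frame_arrows i M bs"
    using Cons.prems x by auto
  have "sc i (\<pi> \<ast> fsum M cs \<ast> \<iota>) = 1" using frameD(2)[OF cs t(1-3)] t(7) i by simp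
  then show ?case
    using Cons.IH[OF t(8)] sc_fsum[OF i M frameD(1)[OF cs] t(1-6)] by (simp add: x)
qed simp

text \<open>Both lengths are the trace of the product of the two change-of-frame matrices.\<close>

lemma frame_length_unique:
  assumes "i \<in> Idx" "M \<in> Ob" "frame i M bs" "frame i M cs"
  shows "length bs = length cs"
proof -
  have "(of_nat (length bs) :: 'k) = of_nat (length cs)"
    unfolding of_nat_length_frame[OF assms(1,2) frameD(1)[OF assms(3)] assms(4)]
      of_nat_length_frame[OF assms(1,2) frameD(1)[OF assms(4)] assms(3)]
    unfolding case_prod_beta by (subst sum_list_swap) (simp only: mult.commute)
  \<comment> \<open>Here characteristic zero enters: the two lengths are known to agree only as
    elements of the field.\<close>
  then show ?thesis by simp
qed

text \<open>The members of index \<open>i\<close> in a decomposition of the identity suffice,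
  because the remaining ones compose to zero with any arrow from or to \<open>X i\<close> by
  \<open>X_hom\<close>.\<close>

lemma frame_exists:
  assumes i: "i \<in> Idx" and M [simp]: "M \<in> Ob"
  shows "\<exists>bs. frame i M bs"
proof -
  let ?S = "\<lambda>bs. A.lsum M M (map (\<lambda>(i, \<iota>, \<pi>). \<iota> \<ast> \<pi>) bs)"
  let ?P = "\<lambda>bs. \<forall>(i, \<iota>, \<pi>)\<in>set bs. i \<in> Idx \<and> \<iota> \<in> hom (X i) M \<and> \<pi> \<in> hom M (X i) \<and> \<pi> \<ast> \<iota> = I (X i)"
  let ?F = "\<lambda>bs. map snd (filter (\<lambda>(j, _). j = i) bs)"
  obtain bs where bs: "?P bs" and sum: "?S bs = I M"
    using decomp[OF M] by blast
  have arrows: "frame_arrows i M (?F bs)" if "?P bs" for bs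
    using that by (induction bs) auto
  have S: "arr (?S bs)" "dm (?S bs) = M" "cd (?S bs) = M" if "?P bs" for bs
    using that by (induction bs) auto
  have 1: "fsum M (?F bs) \<ast> f = ?S bs \<ast> f" if "?P bs" "arr f" "dm f = X i" "cd f = M" for f bs
    using that(1)
  proof (induction bs)
    case (Cons x bs)
    obtain j \<iota> \<pi> where x: "x = (j, \<iota>, \<pi>)" by (cases x) auto
    have t: "j \<in> Idx" "arr \<iota>" "dm \<iota> = X j" "cd \<iota> = M" "arr \<pi>" "dm \<pi> = M" "cd \<pi> = X j" "?P bs"
      using Cons.prems x by auto
    note S = S[OF t(8)]
    show ?case
    proof (cases "j = i")
      case True
      then show ?thesis using Cons.IH[OF t(8)] by (simp add: x comp_plus_left)
    next
      case False
      have "\<pi> \<ast> f = zero (X i) (X j)" by (rule X_hom[OF i t(1)]) (use False t that in auto)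
      then show ?thesis using Cons.IH[OF t(8)] False t that S i by (simp add: x comp_plus_left)
    qed
  qed (use that in simp)
  have 2: "f \<ast> fsum M (?F bs) = f \<ast> ?S bs" if "?P bs" "arr f" "dm f = M" "cd f = X i" for f bs
    using that(1)
  proof (induction bs)
    case (Cons x bs)
    obtain j \<iota> \<pi> where x: "x = (j, \<iota>, \<pi>)" by (cases x) auto
    have t: "j \<in> Idx" "arr \<iota>" "dm \<iota> = X j" "cd \<iota> = M" "arr \<pi>" "dm \<pi> = M" "cd \<pi> = X j" "?P bs"
      using Cons.prems x by auto
    note S = S[OF t(8)]
    show ?case
    proof (cases "j = i")
      case True
      then show ?thesis using Cons.IH[OF t(8)] by (simp add: x comp_plus_right)
    next
      case False
      have "f \<ast> \<iota> = zero (X j) (X i)" by (rule X_hom[OF t(1) i]) (use False t that in auto)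
      then have "f \<ast> \<iota> \<ast> \<pi> = zero M (X i)" using comp_eq_comp[of f \<iota>] t i by simp
      then show ?thesis using Cons.IH[OF t(8)] False t that S i by (simp add: x comp_plus_right)
    qed
  qed (use that in simp)
  have "frame i M (?F bs)"
    unfolding frame_def using arrows[OF bs] 1[OF bs] 2[OF bs] sum by simp
  then show ?thesis ..
qed

definition mult :: "'i \<Rightarrow> 'o \<Rightarrow> nat" where "mult i M = length (SOME bs. frame i M bs)"

lemma mult_eq: "\<lbrakk>i \<in> Idx; M \<in> Ob; frame i M bs\<rbrakk> \<Longrightarrow> mult i M = length bs"
  unfolding mult_def by (meson frame_length_unique someI)

lemma fsum_conj:
  assumes M: "M \<in> Ob" and S: "S \<in> Ob" and bs: "frame_arrows i M bs"
    and a: "arr a" "dm a = M" "cd a = S" and p: "arr p" "dm p = S" "cd p = M"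
  shows "fsum S (map (\<lambda>(\<iota>, \<pi>). (a \<ast> \<iota>, \<pi> \<ast> p)) bs) = a \<ast> fsum M bs \<ast> p"
  using bs
proof (induction bs)
  case (Cons x bs)
  then show ?case by (cases x) (simp add: comp_plus_left comp_plus_right)
qed (use assms in simp)

lemma frame_arrows_conj:
  assumes bs: "frame_arrows i M bs" and "i \<in> Idx"
    and a: "arr a" "dm a = M" "cd a = S" and p: "arr p" "dm p = S" "cd p = M" and pa: "p \<ast> a = I M"
  shows "frame_arrows i S (map (\<lambda>(\<iota>, \<pi>). (a \<ast> \<iota>, \<pi> \<ast> p)) bs)"
  using bs comp_eq_comp[OF pa] a p by (induction bs) auto

lemma mult_bip:
  assumes i: "i \<in> Idx" and b: "bip M N S a a' p p'"
  shows "mult i S = mult i M + mult i N"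
proof -
  note [simp] = bipD[OF b]
  obtain bs where bs: "frame i M bs" using frame_exists[OF i, of M] by auto
  obtain cs where cs: "frame i N cs" using frame_exists[OF i, of N] by auto
  let ?bs = "map (\<lambda>(\<iota>, \<pi>). (a \<ast> \<iota>, \<pi> \<ast> p)) bs" and ?cs = "map (\<lambda>(\<iota>, \<pi>). (a' \<ast> \<iota>, \<pi> \<ast> p')) cs"
  have arrows: "frame_arrows i S ?bs" "frame_arrows i S ?cs"
    using frame_arrows_conj[OF frameD(1)[OF bs] i] frame_arrows_conj[OF frameD(1)[OF cs] i] by simp_all
  have sum: "fsum S (?bs @ ?cs) = a \<ast> fsum M bs \<ast> p \<boxplus> a' \<ast> fsum N cs \<ast> p'"
    using fsum_append[OF _ arrows] fsum_conj[OF _ _ frameD(1)[OF bs]] fsum_conj[OF _ _ frameD(1)[OF cs]] by simp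
  have "frame i S (?bs @ ?cs)"
    unfolding frame_def
  proof (intro conjI allI impI)
    show "frame_arrows i S (?bs @ ?cs)" using arrows by (simp add: frame_arrows_append)
    fix f assume f: "arr f" "dm f = X i" "cd f = S"
    show "fsum S (?bs @ ?cs) \<ast> f = f"
      unfolding sum using f frameD(2)[OF bs, of "p \<ast> f"] frameD(2)[OF cs, of "p' \<ast> f"] bip_eq[OF b, of f]
      by (simp add: comp_plus_left)
  next
    fix g assume g: "arr g" "dm g = S" "cd g = X i"
    have "g \<ast> fsum S (?bs @ ?cs) = (g \<ast> a) \<ast> fsum M bs \<ast> p \<boxplus> (g \<ast> a') \<ast> fsum N cs \<ast> p'"
      unfolding sum by (simp add: comp_plus_right)
    also have "\<dots> = ((g \<ast> a) \<ast> fsum M bs) \<ast> p \<boxplus> ((g \<ast> a') \<ast> fsum N cs) \<ast> p'" by simp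
    also have "\<dots> = g \<ast> a \<ast> p \<boxplus> g \<ast> a' \<ast> p'"
      using frameD(3)[OF bs, of "g \<ast> a"] frameD(3)[OF cs, of "g \<ast> a'"] g by (simp del: comp_assoc) simp
    also have "\<dots> = g" using bip_sum[OF b] g by (simp flip: comp_plus_right)
    finally show "g \<ast> fsum S (?bs @ ?cs) = g" .
  qed
  from mult_eq[OF i _ this] show ?thesis
    using mult_eq[OF i _ bs] mult_eq[OF i _ cs] by simp
qed

lemma mult_iso:
  assumes i: "i \<in> Idx" and fg: "inverse_pair M M' f g"
  shows "mult i M' = mult i M"
proof -
  note [simp] = inverse_pairD[OF fg]
  obtain bs where bs: "frame i M bs" using frame_exists[OF i, of M] by auto
  let ?bs = "map (\<lambda>(\<iota>, \<pi>). (f \<ast> \<iota>, \<pi> \<ast> g)) bs"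
  have arrows: "frame_arrows i M' ?bs" using frame_arrows_conj[OF frameD(1)[OF bs] i] by simp
  have sum: "fsum M' ?bs = f \<ast> fsum M bs \<ast> g" using fsum_conj[OF _ _ frameD(1)[OF bs]] by simp
  have "frame i M' ?bs"
    unfolding frame_def
  proof (intro conjI allI impI arrows)
    fix h assume h: "arr h" "dm h = X i" "cd h = M'"
    show "fsum M' ?bs \<ast> h = h" unfolding sum using h frameD(2)[OF bs, of "g \<ast> h"] by simp
  next
    fix h assume h: "arr h" "dm h = M'" "cd h = X i"
    have "h \<ast> fsum M' ?bs = ((h \<ast> f) \<ast> fsum M bs) \<ast> g" unfolding sum by simp
    also have "\<dots> = h" using frameD(3)[OF bs, of "h \<ast> f"] h by (simp del: comp_assoc) simp
    finally show "h \<ast> fsum M' ?bs = h" .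
  qed
  from mult_eq[OF i _ this] show ?thesis using mult_eq[OF i _ bs] by simp
qed

lemma mult_self:
  assumes "i \<in> Idx"
  shows "mult i (X i) = 1"
proof -
  have "frame i (X i) [(I (X i), I (X i))]" using assms by (simp add: frame_def)
  from mult_eq[OF assms _ this] show ?thesis using assms by simp
qed

lemma mult_other:
  assumes "i \<in> Idx" "j \<in> Idx" "i \<noteq> j"
  shows "mult i (X j) = 0"
proof -
  have "frame i (X j) []" using assms X_hom[of i j] X_hom[of j i] by (auto simp: frame_def)
  from mult_eq[OF assms(1) _ this] show ?thesis using assms by simp
qed

text \<open>The form \<open>e\<close> identifies \<open>X i\<close> with its own dual. Transposing a
  frame of \<open>M\<close> exchanges injections and projections and produces a frame of
  \<open>D M\<close> of the same length: \<open>F\<close> transposes projections, \<open>G\<close>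
  transposes injections.\<close>

lemma mult_dual:
  assumes i: "i \<in> Idx" and M [simp]: "M \<in> Ob" and e: "perfect e" and [simp]: "ld e = X i" "rd e = X i"
  shows "mult i (D M) = mult i M"
proof -
  note [simp] = i perfect_frm[OF e]
  define F where "F \<pi> = (SOME f. arr f \<and> dm f = X i \<and> cd f = D M \<and> (ev M)\<langle>f, I M\<rangle> = e\<langle>I (X i), \<pi>\<rangle>)" for \<pi>
  have F: "arr (F \<pi>)" "dm (F \<pi>) = X i" "cd (F \<pi>) = D M" "(ev M)\<langle>F \<pi>, I M\<rangle> = e\<langle>I (X i), \<pi>\<rangle>"
    if \<pi>: "arr \<pi>" "dm \<pi> = M" "cd \<pi> = X i" for \<pi>
  proof -
    obtain f where "arr f" "dm f = X i" "cd f = D M" "(ev M)\<langle>f, I M\<rangle> = e\<langle>I (X i), \<pi>\<rangle>"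
      using perfect_ex[OF perfect_ev[OF M], of "e\<langle>I (X i), \<pi>\<rangle>"] \<pi> by auto
    then have "\<exists>f. arr f \<and> dm f = X i \<and> cd f = D M \<and> (ev M)\<langle>f, I M\<rangle> = e\<langle>I (X i), \<pi>\<rangle>" by blast
    from someI_ex[OF this] show "arr (F \<pi>)" "dm (F \<pi>) = X i" "cd (F \<pi>) = D M"
      "(ev M)\<langle>F \<pi>, I M\<rangle> = e\<langle>I (X i), \<pi>\<rangle>" unfolding F_def by blast+
  qed
  define G where "G \<iota> = (SOME g. arr g \<and> dm g = D M \<and> cd g = X i \<and> e\<langle>g, I (X i)\<rangle> = (ev M)\<langle>I (D M), \<iota>\<rangle>)" for \<iota>
  have G: "arr (G \<iota>)" "dm (G \<iota>) = D M" "cd (G \<iota>) = X i" "e\<langle>G \<iota>, I (X i)\<rangle> = (ev M)\<langle>I (D M), \<iota>\<rangle>"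
    if \<iota>: "arr \<iota>" "dm \<iota> = X i" "cd \<iota> = M" for \<iota>
  proof -
    obtain g where "arr g" "dm g = D M" "cd g = X i" "e\<langle>g, I (X i)\<rangle> = (ev M)\<langle>I (D M), \<iota>\<rangle>"
      using perfect_ex[OF e, of "(ev M)\<langle>I (D M), \<iota>\<rangle>"] \<iota> by auto
    then have "\<exists>g. arr g \<and> dm g = D M \<and> cd g = X i \<and> e\<langle>g, I (X i)\<rangle> = (ev M)\<langle>I (D M), \<iota>\<rangle>" by blast
    from someI_ex[OF this] show "arr (G \<iota>)" "dm (G \<iota>) = D M" "cd (G \<iota>) = X i"
      "e\<langle>G \<iota>, I (X i)\<rangle> = (ev M)\<langle>I (D M), \<iota>\<rangle>" unfolding G_def by blast+
  qed
  obtain bs where bs: "frame i M bs" using frame_exists[OF i, of M] by auto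
  let ?T = "\<lambda>bs. map (\<lambda>(\<iota>, \<pi>). (F \<pi>, G \<iota>)) bs"
  have arrows: "frame_arrows i (D M) (?T bs)" if "frame_arrows i M bs" for bs
    using that
  proof (induction bs)
    case (Cons x bs)
    obtain \<iota> \<pi> where x: "x = (\<iota>, \<pi>)" by fastforce
    have t: "arr \<iota>" "dm \<iota> = X i" "cd \<iota> = M" "arr \<pi>" "dm \<pi> = M" "cd \<pi> = X i" "\<pi> \<ast> \<iota> = I (X i)"
      using Cons.prems x by auto
    note [simp] = F[OF t(4-6)] G[OF t(1-3)]
    have "e\<langle>G \<iota> \<ast> F \<pi>, I (X i)\<rangle> = e\<langle>I (X i), I (X i)\<rangle>"
      using act_eq_comp[OF G(4)[OF t(1-3)], of "F \<pi>" "I (X i)"] act_eq_comp[OF F(4)[OF t(4-6)], of "I (X i)" \<iota>] t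
      by simp
    then have "G \<iota> \<ast> F \<pi> = I (X i)"
      using perfect_inj[OF e, of "G \<iota> \<ast> F \<pi>" "I (X i)"] by simp
    then show ?case using Cons x by simp
  qed simp
  \<comment> \<open>The transposed frame sums to the transpose of the original sum, so its defining
    property can be moved across the evaluation.\<close>
  have adj: "(ev M)\<langle>fsum (D M) (?T bs), I M\<rangle> = (ev M)\<langle>I (D M), fsum M bs\<rangle>" if "frame_arrows i M bs" for bs
    using that
  proof (induction bs)
    case (Cons x bs)
    obtain \<iota> \<pi> where x: "x = (\<iota>, \<pi>)" by fastforce
    have t: "arr \<iota>" "dm \<iota> = X i" "cd \<iota> = M" "arr \<pi>" "dm \<pi> = M" "cd \<pi> = X i" "\<pi> \<ast> \<iota> = I (X i)"
      using Cons.prems x by auto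
    note [simp] = F[OF t(4-6)] G[OF t(1-3)]
    have "(ev M)\<langle>F \<pi> \<ast> G \<iota>, I M\<rangle> = (ev M)\<langle>I (D M), \<iota> \<ast> \<pi>\<rangle>"
      using act_eq_comp[OF F(4)[OF t(4-6)], of "G \<iota>" "I M"] act_eq_comp[OF G(4)[OF t(1-3)], of "I (D M)" \<pi>] t
      by simp
    then show ?case using Cons x by (simp add: act_plus_left act_plus_right)
  qed simp
  note bsa = frameD(1)[OF bs]
  note [simp] = fsum_type[OF M bsa] fsum_type[OF _ arrows[OF bsa]]
  have "frame i (D M) (?T bs)"
    unfolding frame_def
  proof (intro conjI allI impI arrows bsa)
    fix f assume f [simp]: "arr f" "dm f = X i" "cd f = D M"
    \<comment> \<open>An arrow from \<open>X i\<close> to \<open>D M\<close> amounts to a form with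
      left leg \<open>X i\<close> and right leg \<open>M\<close>. After a swap, \<open>e\<close>
      represents it by an arrow from \<open>M\<close> to \<open>X i\<close>, to which the frame of
      \<open>M\<close> applies.\<close>
    obtain g where g [simp]: "arr g" "dm g = M" "cd g = X i" and geq: "e\<langle>g, I (X i)\<rangle> = swap ((ev M)\<langle>f, I M\<rangle>)"
      using perfect_ex[OF e, of "swap ((ev M)\<langle>f, I M\<rangle>)"] by auto
    have "e\<langle>g \<ast> fsum M bs, I (X i)\<rangle> = swap ((ev M)\<langle>f, fsum M bs\<rangle>)"
      using act_eq_comp[OF geq, of "fsum M bs" "I (X i)"] by simp
    then have "swap ((ev M)\<langle>f, fsum M bs\<rangle>) = swap ((ev M)\<langle>f, I M\<rangle>)"
      unfolding frameD(3)[OF bs g] geq by (rule sym)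
    then have "(ev M)\<langle>f, fsum M bs\<rangle> = (ev M)\<langle>f, I M\<rangle>"
      by (rule swap_inj[rotated 2]) simp_all
    then have "(ev M)\<langle>fsum (D M) (?T bs) \<ast> f, I M\<rangle> = (ev M)\<langle>f, I M\<rangle>"
      using act_eq_comp[OF adj[OF bsa], of f "I M"] by simp
    then show "fsum (D M) (?T bs) \<ast> f = f"
      by (intro perfect_inj[OF perfect_ev[OF M]]) simp_all
  next
    fix g assume g [simp]: "arr g" "dm g = D M" "cd g = X i"
    obtain k where k [simp]: "arr k" "dm k = X i" "cd k = M" and keq: "(ev M)\<langle>I (D M), k\<rangle> = e\<langle>g, I (X i)\<rangle>"
      using ev_right[OF M, of "e\<langle>g, I (X i)\<rangle>"] by auto
    have "e\<langle>g \<ast> fsum (D M) (?T bs), I (X i)\<rangle> = (ev M)\<langle>fsum (D M) (?T bs), k\<rangle>"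
      using act_eq_comp[OF keq, of "fsum (D M) (?T bs)" "I (X i)"] by simp
    also have "\<dots> = (ev M)\<langle>I (D M), fsum M bs \<ast> k\<rangle>"
      using act_eq_comp[OF adj[OF bsa], of "I (D M)" k] by simp
    also have "\<dots> = e\<langle>g, I (X i)\<rangle>" using frameD(2)[OF bs k] keq by simp
    finally show "g \<ast> fsum (D M) (?T bs) = g"
      by (intro perfect_inj[OF e]) simp_all
  qed
  from mult_eq[OF i _ this] show ?thesis using mult_eq[OF i _ bs] by simp
qed

lemma mult_hyp_even:
  assumes "i \<in> Idx" "hyp M b" "perfect e" "ld e = X i" "rd e = X i"
  shows "even (mult i (ld b))"
proof -
  obtain a a' p p' where bip: "bip M (D M) (ld b) a a' p p'" using assms(2) unfolding hyp_def by blast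
  show ?thesis
    using mult_bip[OF assms(1) bip] mult_dual[OF assms(1) bipD(1)[OF bip] assms(3-5)] by simp
qed

lemma mult_osum: "\<lbrakk>i \<in> Idx; osum b b' s\<rbrakk> \<Longrightarrow> mult i (ld s) = mult i (ld b) + mult i (ld b')"
  unfolding osum_def using mult_bip by blast

lemma mult_isom: "\<lbrakk>i \<in> Idx; isom b b'\<rbrakk> \<Longrightarrow> mult i (ld b') = mult i (ld b)"
  using isomE mult_iso by metis

subsection \<open>Classification up to hyperbolic objects\<close>

text \<open>The form corresponds to a nonzero arrow from \<open>X i\<close> to its dual. The dual is
  isomorphic to some \<open>X j\<close>; Schur's lemma forces \<open>j = i\<close> and makes the
  arrow a nonzero multiple of an isomorphism, so the form is a rescaled pullback of the
  evaluation.\<close>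

lemma simple_form_perfect:
  assumes i: "i \<in> Idx" and b: "frm b" "ld b = X i" "rd b = X i" "b \<noteq> fzero (X i) (X i)"
  shows "perfect b"
proof -
  note [simp] = i b(1-3)
  obtain h where h [simp]: "arr h" "dm h = X i" "cd h = D (X i)" and heq: "(ev (X i))\<langle>h, I (X i)\<rangle> = b"
    using perfect_ex[OF perfect_ev[of "X i"], of b] by auto
  obtain j f g where j [simp]: "j \<in> Idx" and fg: "inverse_pair (X j) (D (X i)) f g" using dual_simple[OF i] by blast
  note [simp] = inverse_pairD[OF fg]
  have hf: "h = f \<ast> g \<ast> h" by simp
  have gh: "g \<ast> h \<noteq> zero (X i) (X j)"
  proof
    assume z: "g \<ast> h = zero (X i) (X j)"
    have "h = f \<ast> zero (X i) (X j)" using hf unfolding z .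
    then have "h = zero (X i) (D (X i))" by simp
    then show False using heq b(4) by simp
  qed
  then have ji: "j = i" using X_hom[OF i j, of "g \<ast> h"] by auto
  obtain c where c: "g \<ast> h = c \<triangleright> I (X i)" using X_end[OF i, of "g \<ast> h"] ji by auto
  have c0: "c \<noteq> 0" using gh c ji by (auto simp: A.scale_zero)
  have hc: "h = c \<triangleright> f" using hf unfolding c using ji by simp
  have "b = c \<triangleright>\<^sub>f (ev (X i))\<langle>f, I (X i)\<rangle>" using heq unfolding hc by simp
  moreover have "perfect ((ev (X i))\<langle>f, I (X i)\<rangle>)"
    using perfect_iso[OF perfect_ev[of "X i"], of _ f g] fg by simp
  ultimately show ?thesis using perfect_scale c0 by simp
qed

lemma simple_form_unique:
  assumes i: "i \<in> Idx" and e: "perfect e" "ld e = X i" "rd e = X i" and b: "frm b" "ld b = X i" "rd b = X i"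
  obtains c where "b = c \<triangleright>\<^sub>f e"
proof -
  note [simp] = i b e(2,3) perfect_frm[OF e(1)]
  obtain h where h: "arr h" "dm h = X i" "cd h = X i" and heq: "e\<langle>h, I (X i)\<rangle> = b"
    using perfect_ex[OF e(1), of b] by auto
  obtain c where "h = c \<triangleright> I (X i)" using X_end[OF i h] by blast
  then have "b = c \<triangleright>\<^sub>f e" using heq by simp
  then show thesis by (rule that)
qed

lemma simple_quad_nonzero:
  assumes i: "i \<in> Idx" and b: "perfect b" "ld b = X i" "rd b = X i"
  shows "b \<noteq> fzero (X i) (X i)"
proof
  assume z: "b = fzero (X i) (X i)"
  have "I (X i) = zero (X i) (X i)"
    by (rule perfect_inj[OF b(1)]) (use i b z in simp_all)
  then show False using X_nonzero[OF i] by blast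
qed

lemma simple_quad_unique:
  assumes i: "i \<in> Idx" and e: "quad e" "ld e = X i" and b: "quad b" "ld b = X i"
  shows "isom b e"
proof -
  note [simp] = i e(2) b(2) quadD[OF e(1)] quadD[OF b(1)]
  obtain c where c: "b = c \<triangleright>\<^sub>f e" using simple_form_unique[OF i, of e b] by auto
  obtain z where z: "z * z = c" using sqrt_ex by blast
  have "c \<noteq> 0"
  proof
    assume "c = 0"
    then have "b = fzero (X i) (X i)" unfolding c using F.scale_zero[of e] by simp
    then show False
      using simple_quad_nonzero[OF i quadD(4)[OF b(1)] b(2)] quadD(2)[OF b(1)] b(2) by metis
  qed
  then have "z \<noteq> 0" using z by auto
  then have "inverse_pair (X i) (X i) (z \<triangleright> I (X i)) ((1/z) \<triangleright> I (X i))"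
    by (simp add: inverse_pair_def)
  moreover have "e\<langle>z \<triangleright> I (X i), z \<triangleright> I (X i)\<rangle> = b" using z c by simp
  ultimately show ?thesis unfolding isom_def by auto
qed

text \<open>Without maximality an isotropic \<open>u\<close> still has an isotropic partner
  \<open>s\<close> of shape \<open>D M\<close>. The arrow \<open>v\<close> combining both pulls
  \<open>b\<close> back to the hyperbolic form, and since that form is perfect it splits off
  orthogonally.\<close>

lemma hyperbolic_summand:
  assumes b: "quad b" and u: "arr u" "dm u = M" "cd u = ld b" and q: "arr q" "dm q = ld b" "cd q = M"
    and qu: "q \<ast> u = I M" and iso: "b\<langle>u, u\<rangle> = fzero M M"
  obtains h b' where "ws M" "hyp M h" "quad h" "quad b'" "osum h b' b"
proof -
  have M [simp]: "M \<in> Ob" using u(1,2) A.src_Ob by blast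
  note [simp] = u q quadD[OF b]
  obtain s where s [simp]: "arr s" "dm s = D M" "cd s = ld b" and su: "b\<langle>s, u\<rangle> = ev M"
    and ss: "b\<langle>s, s\<rangle> = fzero (D M) (D M)"
    using isotropic_complement[OF b u q qu iso] by blast
  have wsM: "ws M" by (rule ws_retract[OF quad_ws[OF b] u q qu])
  obtain K k1 k2 r1 r2 where K: "bip M (D M) K k1 k2 r1 r2" using bip_ex[of M "D M"] by auto
  note [simp] = bipD[OF K]
  define v where "v = u \<ast> r1 \<boxplus> s \<ast> r2"
  have v [simp]: "arr v" "dm v = K" "cd v = ld b" by (simp_all add: v_def)
  have us: "b\<langle>u, s\<rangle> = swap (ev M)" unfolding su[symmetric] by simp
  have "b\<langle>v, v\<rangle> = (b\<langle>u, u\<rangle>)\<langle>r1, r1\<rangle> \<boxplus>\<^sub>f (b\<langle>s, u\<rangle>)\<langle>r2, r1\<rangle> \<boxplus>\<^sub>f ((b\<langle>u, s\<rangle>)\<langle>r1, r2\<rangle> \<boxplus>\<^sub>f (b\<langle>s, s\<rangle>)\<langle>r2, r2\<rangle>)"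
    by (simp add: v_def act_plus_left act_plus_right F.plus_ac)
  also have "\<dots> = (ev M)\<langle>r2, r1\<rangle> \<boxplus>\<^sub>f (swap (ev M))\<langle>r1, r2\<rangle>" unfolding iso su us ss by simp
  finally have hyp_v: "hyp M (b\<langle>v, v\<rangle>)" using hyp_exists[OF K] by simp
  have q': "quad (b\<langle>v, v\<rangle>)" by (rule hyp_quad[OF hyp_v wsM])
  \<comment> \<open>That \<open>v\<close> is a split monomorphism is a consequence of the
    perfectness of the pulled back form.\<close>
  obtain r where r: "arr r" "dm r = ld b" "cd r = K" "r \<ast> v = I K"
    and bf: "\<And>f. \<lbrakk>arr f; cd f = ld b\<rbrakk> \<Longrightarrow> b\<langle>f, v\<rangle> = (b\<langle>v, v\<rangle>)\<langle>r \<ast> f, I K\<rangle>"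
    using quad_retraction[OF b v q'] by blast
  obtain N w r' where w: "bip K N (ld b) v w r r'"
    using split_ex[OF v(1) r(1) v(2,3) r(2,3,4)] by blast
  have "quad (b\<langle>w, w\<rangle>)" "osum (b\<langle>v, v\<rangle>) (b\<langle>w, w\<rangle>) b"
    by (rule quad_complement[OF b w q'], erule (1) bf)+
  with q' wsM hyp_v show thesis using that by blast
qed

text \<open>The index set of the basis, described by the existence of a form;
  \<open>symmetric_simples_eq\<close> identifies it with the self-dual indices of braid scalar
  one.\<close>

definition symmetric_simples :: "'i set" where
  "symmetric_simples = {i \<in> Idx. \<exists>b. quad b \<and> ld b = X i}"

lemma quad_summand:
  assumes b: "quad b" and nz: "\<not> zob (ld b)"
  obtains (simple) i \<beta> b' where "i \<in> symmetric_simples" "quad \<beta>" "ld \<beta> = X i" "quad b'" "osum \<beta> b' b"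
  | (hyperbolic) i h b' where "i \<in> Idx" "ws (X i)" "hyp (X i) h" "quad h" "quad b'" "osum h b' b"
proof -
  note [simp] = quadD[OF b]
  obtain i u q where i: "i \<in> Idx" and u: "arr u" "dm u = X i" "cd u = ld b"
    and q: "arr q" "dm q = ld b" "cd q = X i" "q \<ast> u = I (X i)"
    using nonzero_summand[of "ld b"] nz by auto
  show thesis
  proof (cases "b\<langle>u, u\<rangle> = fzero (X i) (X i)")
    case True
    from hyperbolic_summand[OF b u q True] show ?thesis using hyperbolic i by blast
  next
    case False
    have "perfect (b\<langle>u, u\<rangle>)" using simple_form_perfect[OF i _ _ _ False] u by simp
    then have q': "quad (b\<langle>u, u\<rangle>)" using u by (intro quadI) simp_all
    obtain r where r: "arr r" "dm r = ld b" "cd r = X i" "r \<ast> u = I (X i)"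
      and bf: "\<And>f. \<lbrakk>arr f; cd f = ld b\<rbrakk> \<Longrightarrow> b\<langle>f, u\<rangle> = (b\<langle>u, u\<rangle>)\<langle>r \<ast> f, I (X i)\<rangle>"
      using quad_retraction[OF b u q'] by blast
    obtain N w r' where w: "bip (X i) N (ld b) u w r r'"
      using split_ex[OF u(1) r(1) u(2,3) r(2,3,4)] by blast
    have "quad (b\<langle>w, w\<rangle>)" "osum (b\<langle>u, u\<rangle>) (b\<langle>w, w\<rangle>) b"
      by (rule quad_complement[OF b w q'], erule (1) bf)+
    moreover have "ld (b\<langle>u, u\<rangle>) = X i" using u by simp
    moreover from this have "i \<in> symmetric_simples" using q' i unfolding symmetric_simples_def by blast
    ultimately show ?thesis using simple q' by blast
  qed
qed

text \<open>Induction on the total number of simple summands: by \<open>quad_summand\<close> a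
  nonzero quadratic object splits off a simple or a hyperbolic piece, and either piece contains a
  copy of some \<open>X i\<close>.\<close>

lemma quad_induct [consumes 1, case_names zero simple hyperbolic]:
  assumes "quad b"
    and zero: "\<And>b. \<lbrakk>quad b; zob (ld b)\<rbrakk> \<Longrightarrow> P b"
    and simple: "\<And>i \<beta> b' b. \<lbrakk>i \<in> symmetric_simples; quad \<beta>; ld \<beta> = X i; quad b'; quad b; osum \<beta> b' b; P b'\<rbrakk> \<Longrightarrow> P b"
    and hyperbolic: "\<And>M h b' b. \<lbrakk>ws M; hyp M h; quad h; quad b'; quad b; osum h b' b; P b'\<rbrakk> \<Longrightarrow> P b"
  shows "P b"
  using assms(1)
proof (induction "\<Sum>i\<in>Idx. mult i (ld b)" arbitrary: b rule: less_induct)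
  case less
  \<comment> \<open>Multiplicities are additive, so the complement of a piece containing
    \<open>X i\<close> has a strictly smaller total.\<close>
  have smaller: "(\<Sum>i\<in>Idx. mult i (ld b')) < (\<Sum>i\<in>Idx. mult i (ld b))"
    if "osum \<beta> b' b" "i \<in> Idx" "mult i (ld \<beta>) > 0" for \<beta> b' i
  proof (rule sum_strict_mono_ex1[OF finite_Idx])
    show "\<forall>j\<in>Idx. mult j (ld b') \<le> mult j (ld b)" using mult_osum[OF _ that(1)] by simp
    show "\<exists>j\<in>Idx. mult j (ld b') < mult j (ld b)" using mult_osum[OF that(2,1)] that by force
  qed
  show ?case
  proof (cases "zob (ld b)")
    case True
    then show ?thesis using zero less.prems by blast
  next
    case False
    from less.prems False show ?thesis
    proof (cases rule: quad_summand)
      case (simple i \<beta> b')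
      then have i: "i \<in> Idx" by (simp add: symmetric_simples_def)
      have "P b'" by (rule less.hyps[OF smaller[OF simple(5) i] simple(4)]) (use simple mult_self[OF i] in simp)
      then show ?thesis using assms(3) simple less.prems by blast
    next
      case (hyperbolic i h b')
      obtain a a' p p' where "bip (X i) (D (X i)) (ld h) a a' p p'" using hyperbolic(3) unfolding hyp_def by blast
      from mult_bip[OF hyperbolic(1) this] have "mult i (ld h) > 0" using mult_self[OF hyperbolic(1)] by simp
      then have "P b'" by (intro less.hyps[OF smaller[OF hyperbolic(6,1)] hyperbolic(5)])
      then show ?thesis using assms(4) hyperbolic less.prems by blast
    qed
  qed
qed

end

section \<open>Adjunction of a dual pair\<close>

text \<open>The inverses of the constraints are parameters on an equal footing with the constraints
  themselves. This makes the axioms stable under reversing the tensor product, which halves the work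
  on dual pairs.\<close>

locale monoidal_arrows =
  fixes Ob :: "'o set" and arr :: "'a \<Rightarrow> bool" and dm cd :: "'a \<Rightarrow> 'o"
    and I :: "'o \<Rightarrow> 'a" and comp :: "'a \<Rightarrow> 'a \<Rightarrow> 'a" (infixr "\<ast>" 70)
    and ten :: "'a \<Rightarrow> 'a \<Rightarrow> 'a" (infixr "\<boxtimes>" 75) and tob :: "'o \<Rightarrow> 'o \<Rightarrow> 'o" (infixr "\<boxtimes>\<^sub>o" 75)
    and U :: "'o" and as as' :: "'o \<Rightarrow> 'o \<Rightarrow> 'o \<Rightarrow> 'a" and lu lu' ru ru' :: "'o \<Rightarrow> 'a"
  assumes dm_Ob [simp]: "arr f \<Longrightarrow> dm f \<in> Ob" and cd_Ob [simp]: "arr f \<Longrightarrow> cd f \<in> Ob"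
    and I_type [simp]: "A \<in> Ob \<Longrightarrow> arr (I A)" "A \<in> Ob \<Longrightarrow> dm (I A) = A" "A \<in> Ob \<Longrightarrow> cd (I A) = A"
    and comp_type [simp]: "\<lbrakk>arr g; arr f; cd f = dm g\<rbrakk> \<Longrightarrow> arr (g \<ast> f)"
      "\<lbrakk>arr g; arr f; cd f = dm g\<rbrakk> \<Longrightarrow> dm (g \<ast> f) = dm f"
      "\<lbrakk>arr g; arr f; cd f = dm g\<rbrakk> \<Longrightarrow> cd (g \<ast> f) = cd g"
    and comp_assoc [simp]: "(h \<ast> g) \<ast> f = h \<ast> (g \<ast> f)"
    and I_comp [simp]: "\<lbrakk>arr f; cd f = B\<rbrakk> \<Longrightarrow> I B \<ast> f = f"
    and comp_I [simp]: "\<lbrakk>arr f; dm f = B\<rbrakk> \<Longrightarrow> f \<ast> I B = f"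
    and U_Ob [simp]: "U \<in> Ob" and tob_Ob [simp]: "\<lbrakk>A \<in> Ob; B \<in> Ob\<rbrakk> \<Longrightarrow> A \<boxtimes>\<^sub>o B \<in> Ob"
    and ten_type [simp]: "\<lbrakk>arr f; arr g\<rbrakk> \<Longrightarrow> arr (f \<boxtimes> g)" "\<lbrakk>arr f; arr g\<rbrakk> \<Longrightarrow> dm (f \<boxtimes> g) = dm f \<boxtimes>\<^sub>o dm g"
      "\<lbrakk>arr f; arr g\<rbrakk> \<Longrightarrow> cd (f \<boxtimes> g) = cd f \<boxtimes>\<^sub>o cd g"
    and ten_I [simp]: "\<lbrakk>A \<in> Ob; B \<in> Ob\<rbrakk> \<Longrightarrow> I A \<boxtimes> I B = I (A \<boxtimes>\<^sub>o B)"
    and ten_comp: "\<lbrakk>arr g; arr f; cd f = dm g; arr g'; arr f'; cd f' = dm g'\<rbrakk>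
      \<Longrightarrow> (g \<ast> f) \<boxtimes> (g' \<ast> f') = (g \<boxtimes> g') \<ast> (f \<boxtimes> f')"
    and as_type [simp]: "\<lbrakk>A \<in> Ob; B \<in> Ob; E \<in> Ob\<rbrakk> \<Longrightarrow> arr (as A B E)"
      "\<lbrakk>A \<in> Ob; B \<in> Ob; E \<in> Ob\<rbrakk> \<Longrightarrow> dm (as A B E) = (A \<boxtimes>\<^sub>o B) \<boxtimes>\<^sub>o E"
      "\<lbrakk>A \<in> Ob; B \<in> Ob; E \<in> Ob\<rbrakk> \<Longrightarrow> cd (as A B E) = A \<boxtimes>\<^sub>o (B \<boxtimes>\<^sub>o E)"
    and as'_type [simp]: "\<lbrakk>A \<in> Ob; B \<in> Ob; E \<in> Ob\<rbrakk> \<Longrightarrow> arr (as' A B E)"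
      "\<lbrakk>A \<in> Ob; B \<in> Ob; E \<in> Ob\<rbrakk> \<Longrightarrow> cd (as' A B E) = (A \<boxtimes>\<^sub>o B) \<boxtimes>\<^sub>o E"
      "\<lbrakk>A \<in> Ob; B \<in> Ob; E \<in> Ob\<rbrakk> \<Longrightarrow> dm (as' A B E) = A \<boxtimes>\<^sub>o (B \<boxtimes>\<^sub>o E)"
    and as_as' [simp]: "\<lbrakk>A \<in> Ob; B \<in> Ob; E \<in> Ob\<rbrakk> \<Longrightarrow> as A B E \<ast> as' A B E = I (A \<boxtimes>\<^sub>o (B \<boxtimes>\<^sub>o E))"
    and as'_as [simp]: "\<lbrakk>A \<in> Ob; B \<in> Ob; E \<in> Ob\<rbrakk> \<Longrightarrow> as' A B E \<ast> as A B E = I ((A \<boxtimes>\<^sub>o B) \<boxtimes>\<^sub>o E)"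
    and as_nat: "\<lbrakk>arr f; arr g; arr h\<rbrakk> \<Longrightarrow>
      as (cd f) (cd g) (cd h) \<ast> ((f \<boxtimes> g) \<boxtimes> h) = (f \<boxtimes> (g \<boxtimes> h)) \<ast> as (dm f) (dm g) (dm h)"
    and lu_type [simp]: "A \<in> Ob \<Longrightarrow> arr (lu A)" "A \<in> Ob \<Longrightarrow> dm (lu A) = U \<boxtimes>\<^sub>o A" "A \<in> Ob \<Longrightarrow> cd (lu A) = A"
      "A \<in> Ob \<Longrightarrow> arr (lu' A)" "A \<in> Ob \<Longrightarrow> cd (lu' A) = U \<boxtimes>\<^sub>o A" "A \<in> Ob \<Longrightarrow> dm (lu' A) = A"
      "A \<in> Ob \<Longrightarrow> lu A \<ast> lu' A = I A" "A \<in> Ob \<Longrightarrow> lu' A \<ast> lu A = I (U \<boxtimes>\<^sub>o A)"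
    and lu_nat: "arr f \<Longrightarrow> lu (cd f) \<ast> (I U \<boxtimes> f) = f \<ast> lu (dm f)"
    and ru_type [simp]: "A \<in> Ob \<Longrightarrow> arr (ru A)" "A \<in> Ob \<Longrightarrow> dm (ru A) = A \<boxtimes>\<^sub>o U" "A \<in> Ob \<Longrightarrow> cd (ru A) = A"
      "A \<in> Ob \<Longrightarrow> arr (ru' A)" "A \<in> Ob \<Longrightarrow> cd (ru' A) = A \<boxtimes>\<^sub>o U" "A \<in> Ob \<Longrightarrow> dm (ru' A) = A"
      "A \<in> Ob \<Longrightarrow> ru A \<ast> ru' A = I A" "A \<in> Ob \<Longrightarrow> ru' A \<ast> ru A = I (A \<boxtimes>\<^sub>o U)"
    and ru_nat: "arr f \<Longrightarrow> ru (cd f) \<ast> (f \<boxtimes> I U) = f \<ast> ru (dm f)"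
    and triangle: "\<lbrakk>A \<in> Ob; B \<in> Ob\<rbrakk> \<Longrightarrow> (I A \<boxtimes> lu B) \<ast> as A U B = ru A \<boxtimes> I B"
    and pentagon: "\<lbrakk>A \<in> Ob; B \<in> Ob; E \<in> Ob; G \<in> Ob\<rbrakk> \<Longrightarrow>
      as A B (E \<boxtimes>\<^sub>o G) \<ast> as (A \<boxtimes>\<^sub>o B) E G = (I A \<boxtimes> as B E G) \<ast> as A (B \<boxtimes>\<^sub>o E) G \<ast> (as A B E \<boxtimes> I G)"
begin

lemma comp_eq: "g \<ast> f = h \<Longrightarrow> g \<ast> (f \<ast> x) = h \<ast> x"
  by (simp flip: comp_assoc)

lemma as_cancel [simp]:
  "\<lbrakk>A \<in> Ob; B \<in> Ob; E \<in> Ob; arr x; cd x = A \<boxtimes>\<^sub>o (B \<boxtimes>\<^sub>o E)\<rbrakk> \<Longrightarrow> as A B E \<ast> as' A B E \<ast> x = x"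
  "\<lbrakk>A \<in> Ob; B \<in> Ob; E \<in> Ob; arr x; cd x = (A \<boxtimes>\<^sub>o B) \<boxtimes>\<^sub>o E\<rbrakk> \<Longrightarrow> as' A B E \<ast> as A B E \<ast> x = x"
  using comp_eq[OF as_as'[of A B E], of x] comp_eq[OF as'_as[of A B E], of x] by simp_all

lemma unit_cancel [simp]:
  "\<lbrakk>A \<in> Ob; arr x; cd x = A\<rbrakk> \<Longrightarrow> lu A \<ast> lu' A \<ast> x = x"
  "\<lbrakk>A \<in> Ob; arr x; cd x = U \<boxtimes>\<^sub>o A\<rbrakk> \<Longrightarrow> lu' A \<ast> lu A \<ast> x = x"
  "\<lbrakk>A \<in> Ob; arr x; cd x = A\<rbrakk> \<Longrightarrow> ru A \<ast> ru' A \<ast> x = x"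
  "\<lbrakk>A \<in> Ob; arr x; cd x = A \<boxtimes>\<^sub>o U\<rbrakk> \<Longrightarrow> ru' A \<ast> ru A \<ast> x = x"
  using comp_eq[OF lu_type(7)[of A], of x] comp_eq[OF lu_type(8)[of A], of x]
    comp_eq[OF ru_type(7)[of A], of x] comp_eq[OF ru_type(8)[of A], of x] by simp_all

lemma ten_split_left: "\<lbrakk>arr g; arr f; cd f = dm g; A \<in> Ob\<rbrakk> \<Longrightarrow> (g \<ast> f) \<boxtimes> I A = (g \<boxtimes> I A) \<ast> (f \<boxtimes> I A)"
  using ten_comp[of g f "I A" "I A"] by simp

lemma ten_split_right: "\<lbrakk>arr g; arr f; cd f = dm g; A \<in> Ob\<rbrakk> \<Longrightarrow> I A \<boxtimes> (g \<ast> f) = (I A \<boxtimes> g) \<ast> (I A \<boxtimes> f)"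
  using ten_comp[of "I A" "I A" g f] by simp

lemma interchange:
  assumes "arr f" "arr g"
  shows "(I (cd f) \<boxtimes> g) \<ast> (f \<boxtimes> I (dm g)) = (f \<boxtimes> I (cd g)) \<ast> (I (dm f) \<boxtimes> g)"
  using ten_comp[of "I (cd f)" f g "I (dm g)"] ten_comp[of f "I (dm f)" "I (cd g)" g] assms by simp

lemma as'_nat:
  assumes "arr f" "arr g" "arr h"
  shows "as' (cd f) (cd g) (cd h) \<ast> (f \<boxtimes> (g \<boxtimes> h)) = ((f \<boxtimes> g) \<boxtimes> h) \<ast> as' (dm f) (dm g) (dm h)"
proof -
  have "as' (cd f) (cd g) (cd h) \<ast> (f \<boxtimes> (g \<boxtimes> h)) =
      as' (cd f) (cd g) (cd h) \<ast> ((f \<boxtimes> (g \<boxtimes> h)) \<ast> as (dm f) (dm g) (dm h)) \<ast> as' (dm f) (dm g) (dm h)"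
    using assms by simp
  also have "\<dots> = ((f \<boxtimes> g) \<boxtimes> h) \<ast> as' (dm f) (dm g) (dm h)"
    unfolding as_nat[OF assms, symmetric] using assms by simp
  finally show ?thesis .
qed

lemma ru'_nat:
  assumes "arr f"
  shows "(f \<boxtimes> I U) \<ast> ru' (dm f) = ru' (cd f) \<ast> f"
proof -
  have "(f \<boxtimes> I U) \<ast> ru' (dm f) = ru' (cd f) \<ast> (ru (cd f) \<ast> (f \<boxtimes> I U)) \<ast> ru' (dm f)"
    using assms by simp
  also have "\<dots> = ru' (cd f) \<ast> f" unfolding ru_nat[OF assms] using assms by simp
  finally show ?thesis .
qed

section \<open>Coherence of the unit constraints\<close>

lemma U_ten_inj:
  assumes "I U \<boxtimes> f = I U \<boxtimes> g" "arr f" "arr g" "dm f = dm g" "cd f = cd g"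
  shows "f = g"
proof -
  have "f \<ast> lu (dm f) = g \<ast> lu (dm g)"
    using lu_nat[OF assms(2)] lu_nat[OF assms(3)] assms by simp
  then have "(f \<ast> lu (dm f)) \<ast> lu' (dm f) = (g \<ast> lu (dm g)) \<ast> lu' (dm f)" by (simp only:)
  then show ?thesis using assms by simp
qed

lemma iso_cancel:
  assumes "x \<ast> k = y \<ast> k" "k \<ast> k' = I B" "arr x" "arr y" "dm x = B" "dm y = B"
  shows "x = y"
proof -
  have "(x \<ast> k) \<ast> k' = (y \<ast> k) \<ast> k'" by (simp only: assms(1))
  then have "x \<ast> I B = y \<ast> I B" by (simp only: comp_assoc assms(2))
  then show ?thesis using assms(3-6) by simp
qed

text \<open>One of Kelly's consequences of triangle and pentagon. Tensoring with the unit object is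
  faithful, so it suffices to compare both sides under \<open>I U\<close>, and there after composing
  with an invertible arrow that makes the pentagon applicable.\<close>

lemma lu_ten:
  assumes [simp]: "N \<in> Ob" "M \<in> Ob"
  shows "lu (N \<boxtimes>\<^sub>o M) \<ast> as U N M = lu N \<boxtimes> I M"
proof (rule U_ten_inj)
  \<comment> \<open>These are the remaining two edges of the pentagon for \<open>U\<close>,
    \<open>U\<close>, \<open>N\<close>, \<open>M\<close>.\<close>
  let ?k = "as U (U \<boxtimes>\<^sub>o N) M \<ast> (as U U N \<boxtimes> I M)"
  have "(I U \<boxtimes> (lu (N \<boxtimes>\<^sub>o M) \<ast> as U N M)) \<ast> ?k =
      (I U \<boxtimes> lu (N \<boxtimes>\<^sub>o M)) \<ast> (I U \<boxtimes> as U N M) \<ast> as U (U \<boxtimes>\<^sub>o N) M \<ast> (as U U N \<boxtimes> I M)"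
    by (simp add: ten_split_right)
  also have "\<dots> = (I U \<boxtimes> lu (N \<boxtimes>\<^sub>o M)) \<ast> as U U (N \<boxtimes>\<^sub>o M) \<ast> as (U \<boxtimes>\<^sub>o U) N M"
    by (simp add: pentagon)
  also have "\<dots> = (ru U \<boxtimes> (I N \<boxtimes> I M)) \<ast> as (U \<boxtimes>\<^sub>o U) N M"
    using comp_eq[OF triangle[of U "N \<boxtimes>\<^sub>o M"]] by simp
  also have "\<dots> = as U N M \<ast> ((ru U \<boxtimes> I N) \<boxtimes> I M)"
    using as_nat[of "ru U" "I N" "I M"] by simp
  also have "\<dots> = as U N M \<ast> (((I U \<boxtimes> lu N) \<boxtimes> I M) \<ast> (as U U N \<boxtimes> I M))"
    by (simp add: triangle[symmetric] ten_split_left)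
  also have "\<dots> = (I U \<boxtimes> (lu N \<boxtimes> I M)) \<ast> ?k"
    using comp_eq[OF as_nat[of "I U" "lu N" "I M"]] by simp
  finally have "(I U \<boxtimes> (lu (N \<boxtimes>\<^sub>o M) \<ast> as U N M)) \<ast> ?k = (I U \<boxtimes> (lu N \<boxtimes> I M)) \<ast> ?k" .
  then show "I U \<boxtimes> (lu (N \<boxtimes>\<^sub>o M) \<ast> as U N M) = I U \<boxtimes> (lu N \<boxtimes> I M)"
  proof (rule iso_cancel)
    have "(as U U N \<boxtimes> I M) \<ast> (as' U U N \<boxtimes> I M) = I ((U \<boxtimes>\<^sub>o (U \<boxtimes>\<^sub>o N)) \<boxtimes>\<^sub>o M)"
      by (simp flip: ten_split_left)
    from comp_eq[OF this]
    show "?k \<ast> (as' U U N \<boxtimes> I M) \<ast> as' U (U \<boxtimes>\<^sub>o N) M = I (U \<boxtimes>\<^sub>o ((U \<boxtimes>\<^sub>o N) \<boxtimes>\<^sub>o M))" by simp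
  qed simp_all
qed simp_all

text \<open>Reversing the tensor product exchanges the two sides of all constraints.\<close>

lemma reversed:
  "monoidal_arrows Ob arr dm cd I comp (\<lambda>f g. g \<boxtimes> f) (\<lambda>A B. B \<boxtimes>\<^sub>o A) U
     (\<lambda>A B E. as' E B A) (\<lambda>A B E. as E B A) ru ru' lu lu'"
proof
  fix A B assume A [simp]: "A \<in> Ob" "B \<in> Ob"
  have "(ru B \<boxtimes> I A) \<ast> as' B U A = ((I B \<boxtimes> lu A) \<ast> as B U A) \<ast> as' B U A"
    by (simp only: triangle[OF A(2,1)])
  then show "(ru B \<boxtimes> I A) \<ast> as' B U A = I B \<boxtimes> lu A" by simp
next
  fix A B E G assume [simp]: "A \<in> Ob" "B \<in> Ob" "E \<in> Ob" "G \<in> Ob"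
  have 1: "(as G E B \<boxtimes> I A) \<ast> (as' G E B \<boxtimes> I A) \<ast> x = x" if "arr x" "cd x = (G \<boxtimes>\<^sub>o (E \<boxtimes>\<^sub>o B)) \<boxtimes>\<^sub>o A" for x
    using that by (subst comp_eq[OF ten_split_left[symmetric]]) simp_all
  have 2: "(I G \<boxtimes> as E B A) \<ast> (I G \<boxtimes> as' E B A) = I (G \<boxtimes>\<^sub>o (E \<boxtimes>\<^sub>o (B \<boxtimes>\<^sub>o A)))"
    by (subst ten_split_right[symmetric]) simp_all
  let ?l = "as' (G \<boxtimes>\<^sub>o E) B A \<ast> as' G E (B \<boxtimes>\<^sub>o A)"
  let ?r = "(as' G E B \<boxtimes> I A) \<ast> as' G (E \<boxtimes>\<^sub>o B) A \<ast> (I G \<boxtimes> as' E B A)"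
  \<comment> \<open>The candidate \<open>?r\<close> is a right inverse of the pentagon composite;
    multiplying by the inverse \<open>?l\<close> of that composite identifies the two.\<close>
  have "(as G E (B \<boxtimes>\<^sub>o A) \<ast> as (G \<boxtimes>\<^sub>o E) B A) \<ast> ?r = I (G \<boxtimes>\<^sub>o (E \<boxtimes>\<^sub>o (B \<boxtimes>\<^sub>o A)))"
    unfolding pentagon[of G E B A, simplified] by (simp add: 1 2)
  then have "?l \<ast> ((as G E (B \<boxtimes>\<^sub>o A) \<ast> as (G \<boxtimes>\<^sub>o E) B A) \<ast> ?r) = ?l" by simp
  then show "?l = ?r" by simp
next
  fix f g h assume "arr f" "arr g" "arr h"
  then show "as' (cd h) (cd g) (cd f) \<ast> (h \<boxtimes> g \<boxtimes> f) = ((h \<boxtimes> g) \<boxtimes> f) \<ast> as' (dm h) (dm g) (dm f)"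
    using as'_nat[of h g f] by simp
qed (simp_all add: lu_nat ru_nat ten_comp)

lemma ru_ten:
  assumes "A \<in> Ob" "M \<in> Ob"
  shows "ru (A \<boxtimes>\<^sub>o M) \<ast> as' A M U = I A \<boxtimes> ru M"
  using monoidal_arrows.lu_ten[OF reversed, of M A] assms by simp

text \<open>Naturality of \<open>lu\<close> at itself, with \<open>lu U\<close> cancelled, gives
  \<open>lu (U \<boxtimes>\<^sub>o U) = I U \<boxtimes> lu U\<close>. Then \<open>lu_ten\<close> and
  the triangle compute the same arrow in two ways, and naturality of \<open>ru\<close> removes the
  extra unit factor.\<close>

lemma lu_U_eq_ru_U: "lu U = ru U"
proof -
  have "lu (U \<boxtimes>\<^sub>o U) = (lu' U \<ast> lu U) \<ast> lu (U \<boxtimes>\<^sub>o U)" by simp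
  also have "\<dots> = lu' U \<ast> lu U \<ast> (I U \<boxtimes> lu U)" using lu_nat[of "lu U"] by simp
  also have "\<dots> = I U \<boxtimes> lu U" by simp
  finally have "lu U \<boxtimes> I U = ru U \<boxtimes> I U"
    using lu_ten[of U U] triangle[of U U] by simp
  then have "ru U \<ast> (lu U \<boxtimes> I U) = ru U \<ast> (ru U \<boxtimes> I U)" by simp
  then have "lu U \<ast> ru (U \<boxtimes>\<^sub>o U) = ru U \<ast> ru (U \<boxtimes>\<^sub>o U)"
    using ru_nat[of "lu U"] ru_nat[of "ru U"] by simp
  then show ?thesis by (rule iso_cancel[where k' = "ru' (U \<boxtimes>\<^sub>o U)"]) simp_all
qed

section \<open>Transposition along a dual pair\<close>

definition dual_pair :: "'o \<Rightarrow> 'o \<Rightarrow> 'a \<Rightarrow> 'a \<Rightarrow> bool" where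
  "dual_pair M N e c \<longleftrightarrow> M \<in> Ob \<and> N \<in> Ob \<and> arr e \<and> dm e = N \<boxtimes>\<^sub>o M \<and> cd e = U \<and> arr c \<and> dm c = U \<and> cd c = M \<boxtimes>\<^sub>o N \<and>
     ru M \<ast> (I M \<boxtimes> e) \<ast> as M N M \<ast> (c \<boxtimes> I M) = lu M \<and>
     lu N \<ast> (e \<boxtimes> I N) \<ast> as' N M N \<ast> (I N \<boxtimes> c) = ru N"

text \<open>The adjoint map of a form whose left leg \<open>A\<close> may differ from
  \<open>M\<close>; for \<open>A = M\<close> and the chosen dual it is
  \<open>adjoint_map\<close>.\<close>

definition transpose :: "'o \<Rightarrow> 'o \<Rightarrow> 'a \<Rightarrow> 'o \<Rightarrow> 'a \<Rightarrow> 'a" where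
  "transpose M N c A b = lu N \<ast> (b \<boxtimes> I N) \<ast> as' A M N \<ast> (I A \<boxtimes> c) \<ast> ru' A"

context
  fixes M N e c
  assumes dual: "dual_pair M N e c"
begin

lemma dual_pair_simps [simp]: "M \<in> Ob" "N \<in> Ob" "arr e" "dm e = N \<boxtimes>\<^sub>o M" "cd e = U" "arr c" "dm c = U"
  "cd c = M \<boxtimes>\<^sub>o N"
  using dual by (auto simp: dual_pair_def)

lemma transpose_type [simp]:
  assumes "A \<in> Ob" "arr b" "dm b = A \<boxtimes>\<^sub>o M" "cd b = U"
  shows "arr (transpose M N c A b)" "dm (transpose M N c A b) = A" "cd (transpose M N c A b) = N"
  using assms by (simp_all add: transpose_def)

text \<open>The evaluation is pulled past \<open>b\<close> by the interchange law. Then evaluation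
  and coevaluation stand next to each other, tensored with \<open>A\<close>, and cancel by the
  triangle identity for \<open>M\<close>; the rest of the calculation moves associators and unit
  constraints out of the way.\<close>

lemma ev_transpose:
  assumes [simp]: "A \<in> Ob" "arr b" "dm b = A \<boxtimes>\<^sub>o M" "cd b = U"
  shows "e \<ast> (transpose M N c A b \<boxtimes> I M) = b"
proof -
  have zigzag: "(I M \<boxtimes> e) \<ast> as M N M \<ast> (c \<boxtimes> I M) = ru' M \<ast> lu M"
  proof -
    have "ru' M \<ast> ru M \<ast> (I M \<boxtimes> e) \<ast> as M N M \<ast> (c \<boxtimes> I M) = ru' M \<ast> lu M"
      using dual unfolding dual_pair_def by (simp only:)
    then show ?thesis by simp
  qed
  have ev_lu: "e \<ast> (lu N \<boxtimes> I M) = lu U \<ast> (I U \<boxtimes> e) \<ast> as U N M"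
    using comp_eq[OF lu_nat[of e], of "as U N M"] by (simp add: lu_ten)
  let ?X = "(as' A M N \<boxtimes> I M) \<ast> ((I A \<boxtimes> c) \<boxtimes> I M) \<ast> (ru' A \<boxtimes> I M)"
  have "e \<ast> (transpose M N c A b \<boxtimes> I M) = e \<ast> (lu N \<boxtimes> I M) \<ast> ((b \<boxtimes> I N) \<boxtimes> I M) \<ast> ?X"
    by (simp add: transpose_def ten_split_left)
  also have "\<dots> = lu U \<ast> (I U \<boxtimes> e) \<ast> as U N M \<ast> ((b \<boxtimes> I N) \<boxtimes> I M) \<ast> ?X"
    using comp_eq[OF ev_lu] by simp
  also have "\<dots> = lu U \<ast> (I U \<boxtimes> e) \<ast> (b \<boxtimes> I (N \<boxtimes>\<^sub>o M)) \<ast> as (A \<boxtimes>\<^sub>o M) N M \<ast> ?X"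
    using comp_eq[OF as_nat[of b "I N" "I M"]] by simp
  also have "\<dots> = lu U \<ast> (b \<boxtimes> I U) \<ast> (I (A \<boxtimes>\<^sub>o M) \<boxtimes> e) \<ast> as (A \<boxtimes>\<^sub>o M) N M \<ast> ?X"
    using comp_eq[OF interchange[of b e]] by simp
  also have "as (A \<boxtimes>\<^sub>o M) N M \<ast> ?X =
      as' A M (N \<boxtimes>\<^sub>o M) \<ast> (I A \<boxtimes> as M N M) \<ast> as A (M \<boxtimes>\<^sub>o N) M \<ast> ((I A \<boxtimes> c) \<boxtimes> I M) \<ast> (ru' A \<boxtimes> I M)"
  proof -
    have *: "(as A M N \<boxtimes> I M) \<ast> (as' A M N \<boxtimes> I M) \<ast> x = x" if "arr x" "cd x = (A \<boxtimes>\<^sub>o (M \<boxtimes>\<^sub>o N)) \<boxtimes>\<^sub>o M" for x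
      using that by (subst comp_eq[OF ten_split_left[symmetric]]) simp_all
    \<comment> \<open>A cancelling pair of associators is inserted so that one side of the pentagon
      for \<open>A\<close>, \<open>M\<close>, \<open>N\<close>, \<open>M\<close> appears.\<close>
    have "as (A \<boxtimes>\<^sub>o M) N M \<ast> ?X = as' A M (N \<boxtimes>\<^sub>o M) \<ast> (as A M (N \<boxtimes>\<^sub>o M) \<ast> as (A \<boxtimes>\<^sub>o M) N M) \<ast> ?X"
      by simp
    also have "\<dots> = as' A M (N \<boxtimes>\<^sub>o M) \<ast> (I A \<boxtimes> as M N M) \<ast> as A (M \<boxtimes>\<^sub>o N) M \<ast> ((I A \<boxtimes> c) \<boxtimes> I M) \<ast> (ru' A \<boxtimes> I M)"
      unfolding pentagon[OF assms(1) dual_pair_simps(1,2,1)] by (simp add: *)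
    finally show ?thesis .
  qed
  also have "as A (M \<boxtimes>\<^sub>o N) M \<ast> ((I A \<boxtimes> c) \<boxtimes> I M) \<ast> (ru' A \<boxtimes> I M) =
      (I A \<boxtimes> (c \<boxtimes> I M)) \<ast> as A U M \<ast> (ru' A \<boxtimes> I M)"
    using comp_eq[OF as_nat[of "I A" c "I M"]] by simp
  also have "(I (A \<boxtimes>\<^sub>o M) \<boxtimes> e) \<ast> as' A M (N \<boxtimes>\<^sub>o M) \<ast> (I A \<boxtimes> as M N M) \<ast> (I A \<boxtimes> (c \<boxtimes> I M)) \<ast> as A U M \<ast> (ru' A \<boxtimes> I M) =
      as' A M U \<ast> (I A \<boxtimes> (I M \<boxtimes> e)) \<ast> (I A \<boxtimes> as M N M) \<ast> (I A \<boxtimes> (c \<boxtimes> I M)) \<ast> as A U M \<ast> (ru' A \<boxtimes> I M)"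
    using comp_eq[OF as'_nat[of "I A" "I M" e, symmetric]] by simp
  also have "(I A \<boxtimes> (I M \<boxtimes> e)) \<ast> (I A \<boxtimes> as M N M) \<ast> (I A \<boxtimes> (c \<boxtimes> I M)) \<ast> as A U M \<ast> (ru' A \<boxtimes> I M) =
      (I A \<boxtimes> ((I M \<boxtimes> e) \<ast> as M N M \<ast> (c \<boxtimes> I M))) \<ast> as A U M \<ast> (ru' A \<boxtimes> I M)"
    by (simp add: ten_split_right)
  also have "\<dots> = (I A \<boxtimes> ru' M) \<ast> ((I A \<boxtimes> lu M) \<ast> as A U M) \<ast> (ru' A \<boxtimes> I M)"
    unfolding zigzag by (simp add: ten_split_right)
  also have "\<dots> = I A \<boxtimes> ru' M"
    unfolding triangle[OF assms(1) dual_pair_simps(1)] by (simp flip: ten_split_left)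
  \<comment> \<open>What is left of the constraints is the inverse right unit of the tensor product,
    by coherence.\<close>
  also have "as' A M U \<ast> (I A \<boxtimes> ru' M) = ru' (A \<boxtimes>\<^sub>o M)"
  proof -
    have "as' A M U \<ast> (I A \<boxtimes> ru' M) = ru' (A \<boxtimes>\<^sub>o M) \<ast> (ru (A \<boxtimes>\<^sub>o M) \<ast> as' A M U) \<ast> (I A \<boxtimes> ru' M)" by simp
    also have "\<dots> = ru' (A \<boxtimes>\<^sub>o M)"
      unfolding ru_ten[OF assms(1) dual_pair_simps(1)] by (simp flip: ten_split_right)
    finally show ?thesis .
  qed
  also have "lu U \<ast> (b \<boxtimes> I U) \<ast> ru' (A \<boxtimes>\<^sub>o M) = b"
    using ru'_nat[of b] by (simp add: lu_U_eq_ru_U)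
  finally show ?thesis .
qed

text \<open>Here \<open>f\<close> is pulled past the coevaluation, and the other triangle identity,
  the one for \<open>N\<close>, applies.\<close>

lemma transpose_ev:
  assumes [simp]: "arr f" "cd f = N"
  shows "transpose M N c (dm f) (e \<ast> (f \<boxtimes> I M)) = f"
proof -
  have "transpose M N c (dm f) (e \<ast> (f \<boxtimes> I M)) =
      lu N \<ast> (e \<boxtimes> I N) \<ast> ((f \<boxtimes> I M) \<boxtimes> I N) \<ast> as' (dm f) M N \<ast> (I (dm f) \<boxtimes> c) \<ast> ru' (dm f)"
    by (simp add: transpose_def ten_split_left)
  also have "\<dots> = lu N \<ast> (e \<boxtimes> I N) \<ast> as' N M N \<ast> (f \<boxtimes> I (M \<boxtimes>\<^sub>o N)) \<ast> (I (dm f) \<boxtimes> c) \<ast> ru' (dm f)"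
    using comp_eq[OF as'_nat[of f "I M" "I N", symmetric]] by simp
  also have "\<dots> = lu N \<ast> (e \<boxtimes> I N) \<ast> as' N M N \<ast> (I N \<boxtimes> c) \<ast> (f \<boxtimes> I U) \<ast> ru' (dm f)"
    using comp_eq[OF interchange[of f c, symmetric]] by simp
  also have "\<dots> = (lu N \<ast> (e \<boxtimes> I N) \<ast> as' N M N \<ast> (I N \<boxtimes> c)) \<ast> (f \<boxtimes> I U) \<ast> ru' (dm f)" by simp
  also have "\<dots> = ru N \<ast> (f \<boxtimes> I U) \<ast> ru' (dm f)" using dual unfolding dual_pair_def by (simp only:)
  also have "\<dots> = f" using comp_eq[OF ru_nat[of f]] by simp
  finally show ?thesis .
qed

lemma dual_pair_left:
  assumes "A \<in> Ob" "arr b" "dm b = A \<boxtimes>\<^sub>o M" "cd b = U"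
  shows "\<exists>!f. arr f \<and> dm f = A \<and> cd f = N \<and> e \<ast> (f \<boxtimes> I M) = b"
proof (rule ex1I[of _ "transpose M N c A b"])
  show "arr (transpose M N c A b) \<and> dm (transpose M N c A b) = A \<and> cd (transpose M N c A b) = N \<and>
      e \<ast> (transpose M N c A b \<boxtimes> I M) = b"
    using assms ev_transpose by simp
  show "f = transpose M N c A b" if "arr f \<and> dm f = A \<and> cd f = N \<and> e \<ast> (f \<boxtimes> I M) = b" for f
    using transpose_ev[of f] that by auto
qed

end

text \<open>Under the reversed tensor product \<open>M\<close> and \<open>N\<close> exchange their
  roles with the same evaluation and coevaluation, so this is \<open>dual_pair_left\<close>
  there.\<close>

lemma dual_pair_right:
  assumes d: "dual_pair M N e c" and b: "A \<in> Ob" "arr b" "dm b = N \<boxtimes>\<^sub>o A" "cd b = U"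
  shows "\<exists>!f. arr f \<and> dm f = A \<and> cd f = M \<and> e \<ast> (I N \<boxtimes> f) = b"
proof -
  interpret rev: monoidal_arrows Ob arr dm cd I comp "\<lambda>f g. g \<boxtimes> f" "\<lambda>A B. B \<boxtimes>\<^sub>o A" U
    "\<lambda>A B E. as' E B A" "\<lambda>A B E. as E B A" ru ru' lu lu' by (rule reversed)
  have "rev.dual_pair N M e c" using d unfolding rev.dual_pair_def dual_pair_def by simp
  from rev.dual_pair_left[OF this, of A b] b show ?thesis by simp
qed

end

section \<open>Typed arrows of a linear category\<close>

text \<open>An arrow is stored with its source and target; every other value, in particular \<open>None\<close>,
  is junk. All operations are strict in junk, so that associativity and bilinearity hold
  without side conditions.\<close>

definition tsrc :: "('o \<times> 'o \<times> 'm) option \<Rightarrow> 'o" where "tsrc x = fst (the x)"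
definition ttrg :: "('o \<times> 'o \<times> 'm) option \<Rightarrow> 'o" where "ttrg x = fst (snd (the x))"
definition tval :: "('o \<times> 'o \<times> 'm) option \<Rightarrow> 'm" where "tval x = snd (snd (the x))"

lemma typed_simps [simp]:
  "tsrc (Some (A, B, f)) = A" "ttrg (Some (A, B, f)) = B" "tval (Some (A, B, f)) = f"
  by (simp_all add: tsrc_def ttrg_def tval_def)

text \<open>Covers both the Hom spaces and the spaces of forms. Addition and scaling are fixed
  operations on raw arrows, as in the category record, whereas carrier and zero vary with the
  ends.\<close>

locale hom_family =
  fixes Ob :: "'o set" and V :: "'o \<Rightarrow> 'o \<Rightarrow> ('k::field_char_0, 'm) module"
    and add0 :: "'m \<Rightarrow> 'm \<Rightarrow> 'm" and smult0 :: "'k \<Rightarrow> 'm \<Rightarrow> 'm"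
  assumes vs: "\<lbrakk>A \<in> Ob; B \<in> Ob\<rbrakk> \<Longrightarrow> vectorspace (class_ring :: 'k ring) (V A B)"
    and add_V: "add (V A B) = add0" and smult_V: "smult (V A B) = smult0"
begin

lemma raw:
  assumes "A \<in> Ob" "B \<in> Ob" "f \<in> carrier (V A B)"
  shows "smult0 c f \<in> carrier (V A B)"
    "smult0 (c + d) f = add0 (smult0 c f) (smult0 d f)" "smult0 c (smult0 d f) = smult0 (c * d) f"
    "smult0 1 f = f" "smult0 0 f = zero (V A B)"
proof -
  interpret V: vectorspace "class_ring :: 'k ring" "V A B" by (rule vs[OF assms(1,2)])
  show "smult0 c f \<in> carrier (V A B)"
    "smult0 (c + d) f = add0 (smult0 c f) (smult0 d f)" "smult0 c (smult0 d f) = smult0 (c * d) f"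
    "smult0 1 f = f" "smult0 0 f = zero (V A B)"
    using assms V.smult_closed[of c f] V.smult_l_distr[of c d f] V.smult_assoc1[of c d f] V.smult_one[of f]
      V.smult_l_null[of f] by (simp_all add: add_V smult_V)
qed

lemma raw_add:
  assumes "A \<in> Ob" "B \<in> Ob" "f \<in> carrier (V A B)" "g \<in> carrier (V A B)"
  shows "add0 f g \<in> carrier (V A B)" "add0 f g = add0 g f"
    "smult0 c (add0 f g) = add0 (smult0 c f) (smult0 c g)"
proof -
  interpret V: vectorspace "class_ring :: 'k ring" "V A B" by (rule vs[OF assms(1,2)])
  show "add0 f g \<in> carrier (V A B)" "add0 f g = add0 g f"
    "smult0 c (add0 f g) = add0 (smult0 c f) (smult0 c g)"
    using assms V.a_closed[of f g] V.a_comm[of f g] V.smult_r_distr[of c f g] by (simp_all add: add_V smult_V)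
qed

lemma raw_zero: "\<lbrakk>A \<in> Ob; B \<in> Ob\<rbrakk> \<Longrightarrow> zero (V A B) \<in> carrier (V A B)"
proof -
  assume "A \<in> Ob" "B \<in> Ob"
  then interpret V: vectorspace "class_ring :: 'k ring" "V A B" by (rule vs)
  show ?thesis by simp
qed

lemma raw_assoc:
  assumes "A \<in> Ob" "B \<in> Ob" "f \<in> carrier (V A B)" "g \<in> carrier (V A B)" "h \<in> carrier (V A B)"
  shows "add0 (add0 f g) h = add0 f (add0 g h)"
proof -
  interpret V: vectorspace "class_ring :: 'k ring" "V A B" by (rule vs[OF assms(1,2)])
  show ?thesis using assms V.a_assoc[of f g h] by (simp add: add_V)
qed

definition tvalid :: "('o \<times> 'o \<times> 'm) option \<Rightarrow> bool" where
  "tvalid x = (case x of None \<Rightarrow> False | Some (A, B, f) \<Rightarrow> A \<in> Ob \<and> B \<in> Ob \<and> f \<in> carrier (V A B))"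

definition tplus :: "('o \<times> 'o \<times> 'm) option \<Rightarrow> ('o \<times> 'o \<times> 'm) option \<Rightarrow> ('o \<times> 'o \<times> 'm) option" where
  "tplus x y = (if tvalid x \<and> tvalid y \<and> tsrc x = tsrc y \<and> ttrg x = ttrg y
     then Some (tsrc x, ttrg x, add0 (tval x) (tval y)) else None)"

definition tscale :: "'k \<Rightarrow> ('o \<times> 'o \<times> 'm) option \<Rightarrow> ('o \<times> 'o \<times> 'm) option" where
  "tscale c x = (if tvalid x then Some (tsrc x, ttrg x, smult0 c (tval x)) else None)"

definition tzero :: "'o \<Rightarrow> 'o \<Rightarrow> ('o \<times> 'o \<times> 'm) option" where
  "tzero A B = Some (A, B, zero (V A B))"

lemma tvalid_simps [simp]: "\<not> tvalid None" "tvalid (Some (A, B, f)) \<longleftrightarrow> A \<in> Ob \<and> B \<in> Ob \<and> f \<in> carrier (V A B)"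
  by (simp_all add: tvalid_def)

lemma tvalidE:
  assumes "tvalid x"
  obtains A B f where "x = Some (A, B, f)" "A \<in> Ob" "B \<in> Ob" "f \<in> carrier (V A B)"
  using assms by (auto simp: tvalid_def split: option.splits)

lemma tzero_simps [simp]: "tsrc (tzero A B) = A" "ttrg (tzero A B) = B" "tval (tzero A B) = zero (V A B)"
  "\<lbrakk>A \<in> Ob; B \<in> Ob\<rbrakk> \<Longrightarrow> tvalid (tzero A B)"
  by (simp_all add: tzero_def raw_zero)

lemma tplus_simps [simp]:
  "\<lbrakk>A \<in> Ob; B \<in> Ob; f \<in> carrier (V A B); g \<in> carrier (V A B)\<rbrakk> \<Longrightarrow>
    tplus (Some (A, B, f)) (Some (A, B, g)) = Some (A, B, add0 f g)"
  by (simp add: tplus_def)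

lemma tplus_junk [simp]: "\<not> tvalid x \<Longrightarrow> tplus x y = None" "\<not> tvalid y \<Longrightarrow> tplus x y = None"
  "tsrc x \<noteq> tsrc y \<Longrightarrow> tplus x y = None" "ttrg x \<noteq> ttrg y \<Longrightarrow> tplus x y = None"
  by (auto simp: tplus_def)

lemma tscale_simps [simp]:
  "\<lbrakk>A \<in> Ob; B \<in> Ob; f \<in> carrier (V A B)\<rbrakk> \<Longrightarrow> tscale c (Some (A, B, f)) = Some (A, B, smult0 c f)"
  "\<not> tvalid x \<Longrightarrow> tscale c x = None"
  by (auto simp: tscale_def)

lemma tplus_cases:
  obtains (junk) "tplus x y = None" "\<not> (tvalid x \<and> tvalid y \<and> tsrc x = tsrc y \<and> ttrg x = ttrg y)"
  | (valid) A B f g where "x = Some (A, B, f)" "y = Some (A, B, g)" "A \<in> Ob" "B \<in> Ob"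
    "f \<in> carrier (V A B)" "g \<in> carrier (V A B)"
proof (cases "tvalid x \<and> tvalid y \<and> tsrc x = tsrc y \<and> ttrg x = ttrg y")
  case True
  then show ?thesis using valid by (auto elim!: tvalidE)
next
  case False
  then show ?thesis using junk by (simp add: tplus_def)
qed

sublocale typed_space Ob tvalid tsrc ttrg tplus tscale tzero
proof
  fix f g h :: "('o \<times> 'o \<times> 'm) option" and c d :: 'k and A B
  show "tsrc f \<in> Ob" "ttrg f \<in> Ob" if "tvalid f" using that by (auto elim: tvalidE)
  show "tvalid (tplus f g)" "tsrc (tplus f g) = tsrc g" "ttrg (tplus f g) = ttrg g"
    if "tvalid f" "tvalid g" "tsrc f = tsrc g" "ttrg f = ttrg g"
    using that by (auto elim!: tvalidE simp: raw_add(1))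
  show "tplus f g = tplus g f"
    by (cases f g rule: tplus_cases) (auto simp: tplus_def raw_add(2))
  show "tplus (tplus f g) h = tplus f (tplus g h)"
  proof (cases "tvalid f \<and> tvalid g \<and> tvalid h \<and> tsrc f = tsrc g \<and> ttrg f = ttrg g \<and> tsrc g = tsrc h \<and> ttrg g = ttrg h")
    case True
    then obtain A B f' where f: "f = Some (A, B, f')" "A \<in> Ob" "B \<in> Ob" "f' \<in> carrier (V A B)"
      by (auto elim: tvalidE)
    obtain g' where g: "g = Some (A, B, g')" "g' \<in> carrier (V A B)"
      using True f(1) by (auto elim!: tvalidE)
    obtain h' where "h = Some (A, B, h')" "h' \<in> carrier (V A B)"
      using True f(1) g(1) by (auto elim!: tvalidE)
    with f g show ?thesis by (simp add: raw_add(1) raw_assoc)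
  next
    case False
    have "tplus (tplus f g) h = None"
      using False by (cases f g rule: tplus_cases) (auto simp: raw_add(1))
    moreover have "tplus f (tplus g h) = None"
      using False by (cases g h rule: tplus_cases) (auto simp: raw_add(1))
    ultimately show ?thesis by simp
  qed
  show "tvalid (tscale c f)" "tsrc (tscale c f) = tsrc f" "ttrg (tscale c f) = ttrg f" if "tvalid f"
    using that by (auto elim!: tvalidE simp: raw(1))
  show "tscale c (tplus f g) = tplus (tscale c f) (tscale c g)"
  proof (cases f g rule: tplus_cases)
    case junk
    then have "tplus (tscale c f) (tscale c g) = None"
      by (cases "tvalid f"; cases "tvalid g") (auto simp: raw(1) elim!: tvalidE)
    with junk show ?thesis by simp
  next
    case (valid A B f' g')
    then show ?thesis by (simp add: raw(1) raw_add(1) raw_add(3)[OF valid(3-6)])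
  qed
  show "tscale (c + d) f = tplus (tscale c f) (tscale d f)" "tscale c (tscale d f) = tscale (c * d) f"
    by (cases "tvalid f", auto elim!: tvalidE simp: raw(1) intro: raw(2,3))+
  show "tscale 1 f = f" if "tvalid f" using that by (auto elim!: tvalidE intro: raw(4))
  show "tscale 0 f = tzero (tsrc f) (ttrg f)" if "tvalid f"
    using that by (auto elim!: tvalidE simp: tzero_def intro: raw(5))
  show "tvalid (tzero A B)" "tsrc (tzero A B) = A" "ttrg (tzero A B) = B" if "A \<in> Ob" "B \<in> Ob"
    using that by simp_all
qed

text \<open>Validity of a compound expression is equivalent to typing conditions on its parts. This
  is how unconditional laws are proved: where these conditions fail, both sides are
  \<open>None\<close>.\<close>

lemma tvalid_tplus_iff: "tvalid (tplus f g) \<longleftrightarrow> tvalid f \<and> tvalid g \<and> tsrc f = tsrc g \<and> ttrg f = ttrg g"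
  by (cases "tvalid f \<and> tvalid g \<and> tsrc f = tsrc g \<and> ttrg f = ttrg g") (simp, auto simp: tplus_def)

lemma tvalid_tscale_iff: "tvalid (tscale c f) \<longleftrightarrow> tvalid f"
  by (cases "tvalid f") simp_all

lemma tplus_None: "\<not> tvalid (tplus f g) \<Longrightarrow> tplus f g = None"
  unfolding tvalid_tplus_iff by (auto simp: tplus_def)

end

section \<open>Typed arrows of a braided fusion category\<close>

context category
begin

lemma inverse_arrows_unique:
  assumes "A \<in> Ob C" "B \<in> Ob C" "inverse_arrows C A B f g" "inverse_arrows C A B f g'"
  shows "g' = g"
proof -
  have "g = g \<cdot> (f \<cdot> g')" using assms by (simp add: inverse_arrows_def Comp_Ident[of B A])
  also have "\<dots> = (g \<cdot> f) \<cdot> g'"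
    by (rule Comp_assoc[of B A B A]) (use assms in \<open>auto simp: inverse_arrows_def\<close>)
  also have "\<dots> = g'" using assms by (simp add: inverse_arrows_def Ident_Comp[of B A])
  finally show ?thesis by simp
qed

lemma inv_arrow:
  assumes "A \<in> Ob C" "B \<in> Ob C" "iso_arrow C A B f"
  shows "inverse_arrows C A B f (inv_arrow C A B f)"
proof -
  obtain g where g: "inverse_arrows C A B f g" using assms(3) by (auto simp: iso_arrow_def)
  show ?thesis unfolding inv_arrow_def
    by (rule theI[of _ g]) (use g inverse_arrows_unique[OF assms(1,2) g] in blast)+
qed

end

locale fusion = braided_fusion_category C
  for C :: "('o, 'm, 'k::{alg_closed_field, field_char_0}, 'x) rigid_braided_category_data_scheme" (structure)
begin

lemma carrier_hom_space [simp]: "carrier (hom_space C A B) = Hom C A B" "zero (hom_space C A B) = ZeroM C A B"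
  "add (hom_space C A B) = AddM C" "smult (hom_space C A B) = ScaleM C"
  by (simp_all add: hom_space_def)

sublocale A: hom_family "Ob C" "hom_space C" "AddM C" "ScaleM C"
  by (rule hom_family.intro) (simp_all add: Hom_vectorspace)

text \<open>Forms are indexed by their two legs and not by the tensor product, from which the legs
  could not be recovered.\<close>

sublocale F: hom_family "Ob C" "\<lambda>A B. hom_space C (A \<diamondop>\<^sub>o B) (Unit C)" "AddM C" "ScaleM C"
  by (rule hom_family.intro) (simp_all add: Hom_vectorspace TensorO_Ob Unit_Ob)

lemmas raw_Hom = A.raw(1)[simplified] A.raw_add(1)[simplified]

lemma Zero_Hom [simp]: "\<lbrakk>A \<in> Ob C; B \<in> Ob C\<rbrakk> \<Longrightarrow> ZeroM C A B \<in> Hom C A B"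
  using A.tzero_simps(4)[of A B] by (simp add: A.tzero_def)

definition tI :: "'o \<Rightarrow> ('o \<times> 'o \<times> 'm) option" where "tI A = Some (A, A, Ident C A)"

definition tcomp :: "('o \<times> 'o \<times> 'm) option \<Rightarrow> ('o \<times> 'o \<times> 'm) option \<Rightarrow> ('o \<times> 'o \<times> 'm) option"
  (infixr "\<ast>" 70) where
  "g \<ast> f = (if A.tvalid g \<and> A.tvalid f \<and> ttrg f = tsrc g then Some (tsrc f, ttrg g, tval g \<cdot> tval f) else None)"

definition tten :: "('o \<times> 'o \<times> 'm) option \<Rightarrow> ('o \<times> 'o \<times> 'm) option \<Rightarrow> ('o \<times> 'o \<times> 'm) option" where
  "tten f g = (if A.tvalid f \<and> A.tvalid g
     then Some (tsrc f \<diamondop>\<^sub>o tsrc g, ttrg f \<diamondop>\<^sub>o ttrg g, tval f \<diamondop> tval g) else None)"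

definition tact :: "('o \<times> 'o \<times> 'm) option \<Rightarrow> ('o \<times> 'o \<times> 'm) option \<Rightarrow> ('o \<times> 'o \<times> 'm) option
    \<Rightarrow> ('o \<times> 'o \<times> 'm) option" where
  "tact b f g = (if F.tvalid b \<and> A.tvalid f \<and> A.tvalid g \<and> ttrg f = tsrc b \<and> ttrg g = ttrg b
     then Some (tsrc f, tsrc g, tval b \<cdot> (tval f \<diamondop> tval g)) else None)"

definition tswap :: "('o \<times> 'o \<times> 'm) option \<Rightarrow> ('o \<times> 'o \<times> 'm) option" where
  "tswap b = (if F.tvalid b then Some (ttrg b, tsrc b, tval b \<cdot> Braid C (ttrg b) (tsrc b)) else None)"

definition tev :: "'o \<Rightarrow> ('o \<times> 'o \<times> 'm) option" where "tev M = Some (Dual C M, M, Ev C M)"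

lemma tI_simps [simp]: "tsrc (tI A) = A" "ttrg (tI A) = A" "tval (tI A) = Ident C A"
  "A \<in> Ob C \<Longrightarrow> A.tvalid (tI A)"
  by (simp_all add: tI_def Ident_Hom)

lemma tcomp_Some [simp]:
  "\<lbrakk>A \<in> Ob C; B \<in> Ob C; D \<in> Ob C; f \<in> Hom C A B; g \<in> Hom C B D\<rbrakk> \<Longrightarrow>
    Some (B, D, g) \<ast> Some (A, B, f) = Some (A, D, g \<cdot> f)"
  by (simp add: tcomp_def)

lemma tcomp_junk: "\<not> (A.tvalid g \<and> A.tvalid f \<and> ttrg f = tsrc g) \<Longrightarrow> g \<ast> f = None"
  by (auto simp: tcomp_def)

lemma tcomp_type:
  assumes "A.tvalid g" "A.tvalid f" "ttrg f = tsrc g"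
  shows "A.tvalid (g \<ast> f)" "tsrc (g \<ast> f) = tsrc f" "ttrg (g \<ast> f) = ttrg g"
  using assms by (auto elim!: A.tvalidE intro: Comp_Hom)

lemma tvalid_tcomp_iff: "A.tvalid (g \<ast> f) \<longleftrightarrow> A.tvalid g \<and> A.tvalid f \<and> ttrg f = tsrc g"
  using tcomp_type(1) tcomp_junk[of g f] by fastforce

lemma tcomp_None: "\<not> A.tvalid (g \<ast> f) \<Longrightarrow> g \<ast> f = None"
  unfolding tvalid_tcomp_iff by (rule tcomp_junk)

lemmas valid_iffs = tvalid_tcomp_iff A.tvalid_tplus_iff A.tvalid_tscale_iff F.tvalid_tplus_iff F.tvalid_tscale_iff

lemma tcompE:
  assumes "A.tvalid g" "A.tvalid f" "ttrg f = tsrc g"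
  obtains A B D f' g' where "f = Some (A, B, f')" "g = Some (B, D, g')" "A \<in> Ob C" "B \<in> Ob C" "D \<in> Ob C"
    "f' \<in> Hom C A B" "g' \<in> Hom C B D"
  by (rule A.tvalidE[OF assms(1)], rule A.tvalidE[OF assms(2)]) (use assms(3) that in auto)

text \<open>Both sides are valid under the same typing conditions. If these hold, the axiom of the
  category applies; otherwise both sides are \<open>None\<close>. The laws below follow the same
  pattern.\<close>

lemma tcomp_assoc: "(h \<ast> g) \<ast> f = h \<ast> (g \<ast> f)"
proof (cases "A.tvalid h \<and> A.tvalid g \<and> A.tvalid f \<and> ttrg f = tsrc g \<and> ttrg g = tsrc h")
  case True
  then obtain A B D E f' g' h' where "f = Some (A, B, f')" "g = Some (B, D, g')" "h = Some (D, E, h')"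
    "A \<in> Ob C" "B \<in> Ob C" "D \<in> Ob C" "E \<in> Ob C" "f' \<in> Hom C A B" "g' \<in> Hom C B D" "h' \<in> Hom C D E"
    by (auto elim!: A.tvalidE)
  then show ?thesis by (simp add: Comp_Hom[of A B D] Comp_Hom[of B D E] Comp_assoc[of A B D E])
next
  case False
  then have n: "\<not> A.tvalid ((h \<ast> g) \<ast> f)" "\<not> A.tvalid (h \<ast> (g \<ast> f))"
    by (auto simp: valid_iffs tcomp_type)
  show ?thesis using tcomp_None[OF n(1)] tcomp_None[OF n(2)] by simp
qed

lemma tcomp_plus_right: "g \<ast> A.tplus f f' = A.tplus (g \<ast> f) (g \<ast> f')"
proof (cases "A.tvalid g \<and> A.tvalid f \<and> A.tvalid f' \<and> ttrg f = tsrc g \<and> tsrc f = tsrc f' \<and> ttrg f = ttrg f'")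
  case True
  then obtain A B D f0 g0 where f: "f = Some (A, B, f0)" "g = Some (B, D, g0)"
    "A \<in> Ob C" "B \<in> Ob C" "D \<in> Ob C" "f0 \<in> Hom C A B" "g0 \<in> Hom C B D"
    by (elim conjE) (rule tcompE)
  obtain f1 where "f' = Some (A, B, f1)" "f1 \<in> Hom C A B"
    using True f(1) by (auto elim!: A.tvalidE)
  with f show ?thesis by (simp add: raw_Hom Comp_Hom[of A B D] Comp_Add_right[of A B D])
next
  case False
  then have n: "\<not> A.tvalid (g \<ast> A.tplus f f')" "\<not> A.tvalid (A.tplus (g \<ast> f) (g \<ast> f'))"
    by (auto simp: valid_iffs tcomp_type)
  show ?thesis using tcomp_None[OF n(1)] A.tplus_None[OF n(2)] by simp
qed

lemma tcomp_plus_left: "A.tplus g g' \<ast> f = A.tplus (g \<ast> f) (g' \<ast> f)"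
proof (cases "A.tvalid g \<and> A.tvalid g' \<and> A.tvalid f \<and> ttrg f = tsrc g \<and> tsrc g = tsrc g' \<and> ttrg g = ttrg g'")
  case True
  then obtain A B D f0 g0 where f: "f = Some (A, B, f0)" "g = Some (B, D, g0)"
    "A \<in> Ob C" "B \<in> Ob C" "D \<in> Ob C" "f0 \<in> Hom C A B" "g0 \<in> Hom C B D"
    by (elim conjE) (rule tcompE)
  obtain g1 where "g' = Some (B, D, g1)" "g1 \<in> Hom C B D"
    using True f(2) by (auto elim!: A.tvalidE)
  with f show ?thesis by (simp add: raw_Hom Comp_Hom[of A B D] Comp_Add_left[of A B D])
next
  case False
  then have n: "\<not> A.tvalid (A.tplus g g' \<ast> f)" "\<not> A.tvalid (A.tplus (g \<ast> f) (g' \<ast> f))"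
    by (auto simp: valid_iffs tcomp_type)
  show ?thesis using tcomp_None[OF n(1)] A.tplus_None[OF n(2)] by simp
qed

lemma tcomp_scale:
  "g \<ast> A.tscale c f = A.tscale c (g \<ast> f)" "A.tscale c g \<ast> f = A.tscale c (g \<ast> f)"
proof (atomize(full), cases "A.tvalid g \<and> A.tvalid f \<and> ttrg f = tsrc g")
  case True
  then obtain A B D f' g' where "f = Some (A, B, f')" "g = Some (B, D, g')" "A \<in> Ob C" "B \<in> Ob C" "D \<in> Ob C"
    "f' \<in> Hom C A B" "g' \<in> Hom C B D"
    by (elim conjE) (rule tcompE)
  then show "g \<ast> A.tscale c f = A.tscale c (g \<ast> f) \<and> A.tscale c g \<ast> f = A.tscale c (g \<ast> f)"
    by (simp add: raw_Hom Comp_Hom[of A B D] Comp_Scale_right[of A B D] Comp_Scale_left[of A B D])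
next
  case False
  then have n: "\<not> A.tvalid (g \<ast> A.tscale c f)" "\<not> A.tvalid (A.tscale c g \<ast> f)" "\<not> A.tvalid (g \<ast> f)"
    by (auto simp: valid_iffs)
  show "g \<ast> A.tscale c f = A.tscale c (g \<ast> f) \<and> A.tscale c g \<ast> f = A.tscale c (g \<ast> f)"
    using tcomp_None[OF n(1)] tcomp_None[OF n(2)] tcomp_None[OF n(3)] by simp
qed

lemma tcomp_tI: "\<lbrakk>A.tvalid f; ttrg f = B\<rbrakk> \<Longrightarrow> tI B \<ast> f = f" "\<lbrakk>A.tvalid f; tsrc f = B\<rbrakk> \<Longrightarrow> f \<ast> tI B = f"
  by (auto elim!: A.tvalidE simp: tI_def Ident_Hom Ident_Comp Comp_Ident)

lemma iso_inverse_Some: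
  assumes "A \<in> Ob C" "B \<in> Ob C" "iso_arrow C A B f"
  shows "f \<in> Hom C A B" "inv_arrow C A B f \<in> Hom C B A"
    "Some (B, A, inv_arrow C A B f) \<ast> Some (A, B, f) = tI A" "Some (A, B, f) \<ast> Some (B, A, inv_arrow C A B f) = tI B"
  using inv_arrow[OF assms] assms(1,2) by (auto simp: inverse_arrows_def tI_def)

sublocale M: monoidal_arrows "Ob C" A.tvalid tsrc ttrg tI tcomp tten "TensorO C" "Unit C"
  "\<lambda>A B E. Some ((A \<diamondop>\<^sub>o B) \<diamondop>\<^sub>o E, A \<diamondop>\<^sub>o (B \<diamondop>\<^sub>o E), Assoc C A B E)"
  "\<lambda>A B E. Some (A \<diamondop>\<^sub>o (B \<diamondop>\<^sub>o E), (A \<diamondop>\<^sub>o B) \<diamondop>\<^sub>o E, AssocInv C A B E)"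
  "\<lambda>A. Some (Unit C \<diamondop>\<^sub>o A, A, LUnit C A)" "\<lambda>A. Some (A, Unit C \<diamondop>\<^sub>o A, inv_arrow C (Unit C \<diamondop>\<^sub>o A) A (LUnit C A))"
  "\<lambda>A. Some (A \<diamondop>\<^sub>o Unit C, A, RUnit C A)" "\<lambda>A. Some (A, A \<diamondop>\<^sub>o Unit C, inv_arrow C (A \<diamondop>\<^sub>o Unit C) A (RUnit C A))"
proof
  note [simp] = Unit_Ob TensorO_Ob
  fix f g h f' g' :: "('o \<times> 'o \<times> 'm) option" and A B E G B'
  show "tsrc f \<in> Ob C" "ttrg f \<in> Ob C" if "A.tvalid f" using that by simp_all
  show "A.tvalid (tI A)" "tsrc (tI A) = A" "ttrg (tI A) = A" if "A \<in> Ob C" using that by simp_all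
  show "A.tvalid (g \<ast> f)" "tsrc (g \<ast> f) = tsrc f" "ttrg (g \<ast> f) = ttrg g"
    if "A.tvalid g" "A.tvalid f" "ttrg f = tsrc g" using tcomp_type that by simp_all
  show "(h \<ast> g) \<ast> f = h \<ast> (g \<ast> f)" by (rule tcomp_assoc)
  show "tI B' \<ast> f = f" if "A.tvalid f" "ttrg f = B'" using tcomp_tI that by simp
  show "f \<ast> tI B' = f" if "A.tvalid f" "tsrc f = B'" using tcomp_tI that by simp
  show "Unit C \<in> Ob C" by simp
  show "A \<diamondop>\<^sub>o B \<in> Ob C" if "A \<in> Ob C" "B \<in> Ob C" using that by simp_all
  show "A.tvalid (tten f g)" "tsrc (tten f g) = tsrc f \<diamondop>\<^sub>o tsrc g" "ttrg (tten f g) = ttrg f \<diamondop>\<^sub>o ttrg g"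
    if "A.tvalid f" "A.tvalid g"
    using that by (auto elim!: A.tvalidE simp: tten_def intro: TensorM_Hom)
  show "tten (tI A) (tI B) = tI (A \<diamondop>\<^sub>o B)" if "A \<in> Ob C" "B \<in> Ob C"
    using that by (simp add: tten_def) (simp add: tI_def Tensor_Ident)
  show "tten (g \<ast> f) (g' \<ast> f') = tten g g' \<ast> tten f f'"
    if h: "A.tvalid g" "A.tvalid f" "ttrg f = tsrc g" "A.tvalid g'" "A.tvalid f'" "ttrg f' = tsrc g'"
  proof -
    obtain A B D f0 g0 where 1: "f = Some (A, B, f0)" "g = Some (B, D, g0)"
      "A \<in> Ob C" "B \<in> Ob C" "D \<in> Ob C" "f0 \<in> Hom C A B" "g0 \<in> Hom C B D"
      by (rule tcompE[OF h(1-3)])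
    obtain A' B' D' f1 g1 where 2: "f' = Some (A', B', f1)" "g' = Some (B', D', g1)"
      "A' \<in> Ob C" "B' \<in> Ob C" "D' \<in> Ob C" "f1 \<in> Hom C A' B'" "g1 \<in> Hom C B' D'"
      by (rule tcompE[OF h(4-6)])
    show ?thesis
      using 1 2 by (simp add: tten_def Comp_Hom[of A B D] Comp_Hom[of A' B' D'] TensorM_Hom[of A B A' B']
        TensorM_Hom[of B D B' D'] Tensor_Comp[of A B D A' B' D'])
  qed
  show "A.tvalid (Some ((A \<diamondop>\<^sub>o B) \<diamondop>\<^sub>o E, A \<diamondop>\<^sub>o (B \<diamondop>\<^sub>o E), Assoc C A B E))"
    "tsrc (Some ((A \<diamondop>\<^sub>o B) \<diamondop>\<^sub>o E, A \<diamondop>\<^sub>o (B \<diamondop>\<^sub>o E), Assoc C A B E)) = (A \<diamondop>\<^sub>o B) \<diamondop>\<^sub>o E"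
    "ttrg (Some ((A \<diamondop>\<^sub>o B) \<diamondop>\<^sub>o E, A \<diamondop>\<^sub>o (B \<diamondop>\<^sub>o E), Assoc C A B E)) = A \<diamondop>\<^sub>o (B \<diamondop>\<^sub>o E)"
    "A.tvalid (Some (A \<diamondop>\<^sub>o (B \<diamondop>\<^sub>o E), (A \<diamondop>\<^sub>o B) \<diamondop>\<^sub>o E, AssocInv C A B E))"
    "ttrg (Some (A \<diamondop>\<^sub>o (B \<diamondop>\<^sub>o E), (A \<diamondop>\<^sub>o B) \<diamondop>\<^sub>o E, AssocInv C A B E)) = (A \<diamondop>\<^sub>o B) \<diamondop>\<^sub>o E"
    "tsrc (Some (A \<diamondop>\<^sub>o (B \<diamondop>\<^sub>o E), (A \<diamondop>\<^sub>o B) \<diamondop>\<^sub>o E, AssocInv C A B E)) = A \<diamondop>\<^sub>o (B \<diamondop>\<^sub>o E)"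
    "Some ((A \<diamondop>\<^sub>o B) \<diamondop>\<^sub>o E, A \<diamondop>\<^sub>o (B \<diamondop>\<^sub>o E), Assoc C A B E) \<ast>
       Some (A \<diamondop>\<^sub>o (B \<diamondop>\<^sub>o E), (A \<diamondop>\<^sub>o B) \<diamondop>\<^sub>o E, AssocInv C A B E) = tI (A \<diamondop>\<^sub>o (B \<diamondop>\<^sub>o E))"
    "Some (A \<diamondop>\<^sub>o (B \<diamondop>\<^sub>o E), (A \<diamondop>\<^sub>o B) \<diamondop>\<^sub>o E, AssocInv C A B E) \<ast>
       Some ((A \<diamondop>\<^sub>o B) \<diamondop>\<^sub>o E, A \<diamondop>\<^sub>o (B \<diamondop>\<^sub>o E), Assoc C A B E) = tI ((A \<diamondop>\<^sub>o B) \<diamondop>\<^sub>o E)"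
    if "A \<in> Ob C" "B \<in> Ob C" "E \<in> Ob C"
    using iso_inverse_Some[OF _ _ Assoc_iso[OF that]] that by (simp_all add: AssocInv_def)
  show "Some ((ttrg f \<diamondop>\<^sub>o ttrg g) \<diamondop>\<^sub>o ttrg h, ttrg f \<diamondop>\<^sub>o (ttrg g \<diamondop>\<^sub>o ttrg h), Assoc C (ttrg f) (ttrg g) (ttrg h)) \<ast>
      tten (tten f g) h = tten f (tten g h) \<ast>
      Some ((tsrc f \<diamondop>\<^sub>o tsrc g) \<diamondop>\<^sub>o tsrc h, tsrc f \<diamondop>\<^sub>o (tsrc g \<diamondop>\<^sub>o tsrc h), Assoc C (tsrc f) (tsrc g) (tsrc h))"
    if h: "A.tvalid f" "A.tvalid g" "A.tvalid h"
  proof -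
    obtain A A' f0 where 1: "f = Some (A, A', f0)" "A \<in> Ob C" "A' \<in> Ob C" "f0 \<in> Hom C A A'"
      using h(1) by (auto elim!: A.tvalidE)
    obtain B B' g0 where 2: "g = Some (B, B', g0)" "B \<in> Ob C" "B' \<in> Ob C" "g0 \<in> Hom C B B'"
      using h(2) by (auto elim!: A.tvalidE)
    obtain D D' h0 where 3: "h = Some (D, D', h0)" "D \<in> Ob C" "D' \<in> Ob C" "h0 \<in> Hom C D D'"
      using h(3) by (auto elim!: A.tvalidE)
    have H: "f0 \<diamondop> g0 \<in> Hom C (A \<diamondop>\<^sub>o B) (A' \<diamondop>\<^sub>o B')" "g0 \<diamondop> h0 \<in> Hom C (B \<diamondop>\<^sub>o D) (B' \<diamondop>\<^sub>o D')"
      using 1 2 3 by (auto intro: TensorM_Hom)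
    have H': "(f0 \<diamondop> g0) \<diamondop> h0 \<in> Hom C ((A \<diamondop>\<^sub>o B) \<diamondop>\<^sub>o D) ((A' \<diamondop>\<^sub>o B') \<diamondop>\<^sub>o D')"
      "f0 \<diamondop> (g0 \<diamondop> h0) \<in> Hom C (A \<diamondop>\<^sub>o (B \<diamondop>\<^sub>o D)) (A' \<diamondop>\<^sub>o (B' \<diamondop>\<^sub>o D'))"
      using 1 2 3 H by (auto intro: TensorM_Hom)
    have as: "Assoc C A B D \<in> Hom C ((A \<diamondop>\<^sub>o B) \<diamondop>\<^sub>o D) (A \<diamondop>\<^sub>o (B \<diamondop>\<^sub>o D))"
      "Assoc C A' B' D' \<in> Hom C ((A' \<diamondop>\<^sub>o B') \<diamondop>\<^sub>o D') (A' \<diamondop>\<^sub>o (B' \<diamondop>\<^sub>o D'))"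
      using iso_inverse_Some(1)[OF _ _ Assoc_iso] 1 2 3 by simp_all
    show ?thesis using 1 2 3 H H' as Assoc_natural[of A B D A' B' D' f0 g0 h0] by (simp add: tten_def)
  qed
  show "A.tvalid (Some (Unit C \<diamondop>\<^sub>o A, A, LUnit C A))" "tsrc (Some (Unit C \<diamondop>\<^sub>o A, A, LUnit C A)) = Unit C \<diamondop>\<^sub>o A"
    "ttrg (Some (Unit C \<diamondop>\<^sub>o A, A, LUnit C A)) = A"
    "A.tvalid (Some (A, Unit C \<diamondop>\<^sub>o A, inv_arrow C (Unit C \<diamondop>\<^sub>o A) A (LUnit C A)))"
    "ttrg (Some (A, Unit C \<diamondop>\<^sub>o A, inv_arrow C (Unit C \<diamondop>\<^sub>o A) A (LUnit C A))) = Unit C \<diamondop>\<^sub>o A"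
    "tsrc (Some (A, Unit C \<diamondop>\<^sub>o A, inv_arrow C (Unit C \<diamondop>\<^sub>o A) A (LUnit C A))) = A"
    "Some (Unit C \<diamondop>\<^sub>o A, A, LUnit C A) \<ast> Some (A, Unit C \<diamondop>\<^sub>o A, inv_arrow C (Unit C \<diamondop>\<^sub>o A) A (LUnit C A)) = tI A"
    "Some (A, Unit C \<diamondop>\<^sub>o A, inv_arrow C (Unit C \<diamondop>\<^sub>o A) A (LUnit C A)) \<ast> Some (Unit C \<diamondop>\<^sub>o A, A, LUnit C A) = tI (Unit C \<diamondop>\<^sub>o A)"
    if "A \<in> Ob C"
    using iso_inverse_Some[OF _ _ LUnit_iso[OF that]] that by simp_all
  show "A.tvalid (Some (A \<diamondop>\<^sub>o Unit C, A, RUnit C A))" "tsrc (Some (A \<diamondop>\<^sub>o Unit C, A, RUnit C A)) = A \<diamondop>\<^sub>o Unit C"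
    "ttrg (Some (A \<diamondop>\<^sub>o Unit C, A, RUnit C A)) = A"
    "A.tvalid (Some (A, A \<diamondop>\<^sub>o Unit C, inv_arrow C (A \<diamondop>\<^sub>o Unit C) A (RUnit C A)))"
    "ttrg (Some (A, A \<diamondop>\<^sub>o Unit C, inv_arrow C (A \<diamondop>\<^sub>o Unit C) A (RUnit C A))) = A \<diamondop>\<^sub>o Unit C"
    "tsrc (Some (A, A \<diamondop>\<^sub>o Unit C, inv_arrow C (A \<diamondop>\<^sub>o Unit C) A (RUnit C A))) = A"
    "Some (A \<diamondop>\<^sub>o Unit C, A, RUnit C A) \<ast> Some (A, A \<diamondop>\<^sub>o Unit C, inv_arrow C (A \<diamondop>\<^sub>o Unit C) A (RUnit C A)) = tI A"
    "Some (A, A \<diamondop>\<^sub>o Unit C, inv_arrow C (A \<diamondop>\<^sub>o Unit C) A (RUnit C A)) \<ast> Some (A \<diamondop>\<^sub>o Unit C, A, RUnit C A) = tI (A \<diamondop>\<^sub>o Unit C)"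
    if "A \<in> Ob C"
    using iso_inverse_Some[OF _ _ RUnit_iso[OF that]] that by simp_all
  show "Some (Unit C \<diamondop>\<^sub>o ttrg f, ttrg f, LUnit C (ttrg f)) \<ast> tten (tI (Unit C)) f =
      f \<ast> Some (Unit C \<diamondop>\<^sub>o tsrc f, tsrc f, LUnit C (tsrc f))" if h: "A.tvalid f"
  proof -
    obtain A A' f0 where 1: "f = Some (A, A', f0)" "A \<in> Ob C" "A' \<in> Ob C" "f0 \<in> Hom C A A'"
      using h(1) by (auto elim!: A.tvalidE)
    then show ?thesis
      using iso_inverse_Some(1)[OF _ _ LUnit_iso] LUnit_natural[of A A' f0] TensorM_Hom[of "Unit C" "Unit C" A A' _ f0]
      by (simp add: tten_def Ident_Hom)
  qed
  show "Some (ttrg f \<diamondop>\<^sub>o Unit C, ttrg f, RUnit C (ttrg f)) \<ast> tten f (tI (Unit C)) =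
      f \<ast> Some (tsrc f \<diamondop>\<^sub>o Unit C, tsrc f, RUnit C (tsrc f))" if h: "A.tvalid f"
  proof -
    obtain A A' f0 where 1: "f = Some (A, A', f0)" "A \<in> Ob C" "A' \<in> Ob C" "f0 \<in> Hom C A A'"
      using h(1) by (auto elim!: A.tvalidE)
    then show ?thesis
      using iso_inverse_Some(1)[OF _ _ RUnit_iso] RUnit_natural[of A A' f0] TensorM_Hom[of A A' "Unit C" "Unit C" f0]
      by (simp add: tten_def Ident_Hom)
  qed
  show "tten (tI A) (Some (Unit C \<diamondop>\<^sub>o B, B, LUnit C B)) \<ast>
      Some ((A \<diamondop>\<^sub>o Unit C) \<diamondop>\<^sub>o B, A \<diamondop>\<^sub>o (Unit C \<diamondop>\<^sub>o B), Assoc C A (Unit C) B) =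
      tten (Some (A \<diamondop>\<^sub>o Unit C, A, RUnit C A)) (tI B)" if "A \<in> Ob C" "B \<in> Ob C"
    using that iso_inverse_Some(1)[OF _ _ LUnit_iso] iso_inverse_Some(1)[OF _ _ RUnit_iso]
      iso_inverse_Some(1)[OF _ _ Assoc_iso] triangle[of A B] TensorM_Hom[of A A "Unit C \<diamondop>\<^sub>o B" B]
    by (simp add: tten_def Ident_Hom)
  show "Some ((A \<diamondop>\<^sub>o B) \<diamondop>\<^sub>o (E \<diamondop>\<^sub>o G), A \<diamondop>\<^sub>o (B \<diamondop>\<^sub>o (E \<diamondop>\<^sub>o G)), Assoc C A B (E \<diamondop>\<^sub>o G)) \<ast>
      Some (((A \<diamondop>\<^sub>o B) \<diamondop>\<^sub>o E) \<diamondop>\<^sub>o G, (A \<diamondop>\<^sub>o B) \<diamondop>\<^sub>o (E \<diamondop>\<^sub>o G), Assoc C (A \<diamondop>\<^sub>o B) E G) =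
      tten (tI A) (Some ((B \<diamondop>\<^sub>o E) \<diamondop>\<^sub>o G, B \<diamondop>\<^sub>o (E \<diamondop>\<^sub>o G), Assoc C B E G)) \<ast>
      Some ((A \<diamondop>\<^sub>o (B \<diamondop>\<^sub>o E)) \<diamondop>\<^sub>o G, A \<diamondop>\<^sub>o ((B \<diamondop>\<^sub>o E) \<diamondop>\<^sub>o G), Assoc C A (B \<diamondop>\<^sub>o E) G) \<ast>
      tten (Some ((A \<diamondop>\<^sub>o B) \<diamondop>\<^sub>o E, A \<diamondop>\<^sub>o (B \<diamondop>\<^sub>o E), Assoc C A B E)) (tI G)"
    if "A \<in> Ob C" "B \<in> Ob C" "E \<in> Ob C" "G \<in> Ob C"
  proof -
    note a = iso_inverse_Some(1)[OF _ _ Assoc_iso]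
    have 1: "Ident C A \<diamondop> Assoc C B E G \<in> Hom C (A \<diamondop>\<^sub>o ((B \<diamondop>\<^sub>o E) \<diamondop>\<^sub>o G)) (A \<diamondop>\<^sub>o (B \<diamondop>\<^sub>o (E \<diamondop>\<^sub>o G)))"
      "Assoc C A B E \<diamondop> Ident C G \<in> Hom C (((A \<diamondop>\<^sub>o B) \<diamondop>\<^sub>o E) \<diamondop>\<^sub>o G) ((A \<diamondop>\<^sub>o (B \<diamondop>\<^sub>o E)) \<diamondop>\<^sub>o G)"
      using that a by (auto intro!: TensorM_Hom Ident_Hom)
    have 2: "Some ((A \<diamondop>\<^sub>o B) \<diamondop>\<^sub>o (E \<diamondop>\<^sub>o G), A \<diamondop>\<^sub>o (B \<diamondop>\<^sub>o (E \<diamondop>\<^sub>o G)), Assoc C A B (E \<diamondop>\<^sub>o G)) \<ast>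
      Some (((A \<diamondop>\<^sub>o B) \<diamondop>\<^sub>o E) \<diamondop>\<^sub>o G, (A \<diamondop>\<^sub>o B) \<diamondop>\<^sub>o (E \<diamondop>\<^sub>o G), Assoc C (A \<diamondop>\<^sub>o B) E G) =
      (Some (A \<diamondop>\<^sub>o ((B \<diamondop>\<^sub>o E) \<diamondop>\<^sub>o G), A \<diamondop>\<^sub>o (B \<diamondop>\<^sub>o (E \<diamondop>\<^sub>o G)), Ident C A \<diamondop> Assoc C B E G) \<ast>
      Some ((A \<diamondop>\<^sub>o (B \<diamondop>\<^sub>o E)) \<diamondop>\<^sub>o G, A \<diamondop>\<^sub>o ((B \<diamondop>\<^sub>o E) \<diamondop>\<^sub>o G), Assoc C A (B \<diamondop>\<^sub>o E) G)) \<ast>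
      Some (((A \<diamondop>\<^sub>o B) \<diamondop>\<^sub>o E) \<diamondop>\<^sub>o G, (A \<diamondop>\<^sub>o (B \<diamondop>\<^sub>o E)) \<diamondop>\<^sub>o G, Assoc C A B E \<diamondop> Ident C G)"
      using that a 1 pentagon[OF that]
        Comp_Hom[OF _ _ _ a[of "A" "B \<diamondop>\<^sub>o E" G] 1(1)] by simp
    show ?thesis using 2 that a by (simp add: tten_def Ident_Hom tcomp_assoc)
  qed
qed

end

section \<open>Bilinear forms of a braided fusion category\<close>

context fusion
begin

lemma tI_in [simp]: "A \<in> Ob C \<Longrightarrow> A.tvalid (tI A)"
  by simp

lemma form_comp_closed:
  assumes "A \<in> Ob C" "B \<in> Ob C" "A' \<in> Ob C" "B' \<in> Ob C" "\<beta> \<in> Hom C (A \<diamondop>\<^sub>o B) (Unit C)" "f \<in> Hom C A' A" "g \<in> Hom C B' B"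
  shows "f \<diamondop> g \<in> Hom C (A' \<diamondop>\<^sub>o B') (A \<diamondop>\<^sub>o B)" "\<beta> \<cdot> (f \<diamondop> g) \<in> Hom C (A' \<diamondop>\<^sub>o B') (Unit C)"
proof -
  show 1: "f \<diamondop> g \<in> Hom C (A' \<diamondop>\<^sub>o B') (A \<diamondop>\<^sub>o B)" using assms by (intro TensorM_Hom)
  show "\<beta> \<cdot> (f \<diamondop> g) \<in> Hom C (A' \<diamondop>\<^sub>o B') (Unit C)"
    using assms 1 by (intro Comp_Hom[of "A' \<diamondop>\<^sub>o B'" "A \<diamondop>\<^sub>o B"]) (auto simp: TensorO_Ob Unit_Ob)
qed

lemma Ftvalid_simp [simp]: "F.tvalid (Some (A, B, f)) \<longleftrightarrow> A \<in> Ob C \<and> B \<in> Ob C \<and> f \<in> Hom C (A \<diamondop>\<^sub>o B) (Unit C)"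
  by simp

lemma tactE:
  assumes "F.tvalid b" "A.tvalid f" "A.tvalid g" "ttrg f = tsrc b" "ttrg g = ttrg b"
  obtains A B A' B' \<beta> f0 g0 where "b = Some (A, B, \<beta>)" "f = Some (A', A, f0)" "g = Some (B', B, g0)"
    "A \<in> Ob C" "B \<in> Ob C" "A' \<in> Ob C" "B' \<in> Ob C" "\<beta> \<in> Hom C (A \<diamondop>\<^sub>o B) (Unit C)"
    "f0 \<in> Hom C A' A" "g0 \<in> Hom C B' B"
  by (rule F.tvalidE[OF assms(1)], rule A.tvalidE[OF assms(2)], rule A.tvalidE[OF assms(3)])
    (use assms(4,5) that in auto)

lemma tact_Some [simp]:
  "\<lbrakk>A \<in> Ob C; B \<in> Ob C; A' \<in> Ob C; B' \<in> Ob C; \<beta> \<in> Hom C (A \<diamondop>\<^sub>o B) (Unit C); f0 \<in> Hom C A' A; g0 \<in> Hom C B' B\<rbrakk> \<Longrightarrow>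
    tact (Some (A, B, \<beta>)) (Some (A', A, f0)) (Some (B', B, g0)) = Some (A', B', \<beta> \<cdot> (f0 \<diamondop> g0))"
  by (simp add: tact_def)

lemma tact_type:
  assumes "F.tvalid b" "A.tvalid f" "A.tvalid g" "ttrg f = tsrc b" "ttrg g = ttrg b"
  shows "F.tvalid (tact b f g)" "tsrc (tact b f g) = tsrc f" "ttrg (tact b f g) = tsrc g"
  by (rule tactE[OF assms], simp add: form_comp_closed)+

lemma tact_junk:
  "\<not> (F.tvalid b \<and> A.tvalid f \<and> A.tvalid g \<and> ttrg f = tsrc b \<and> ttrg g = ttrg b) \<Longrightarrow> tact b f g = None"
  by (auto simp: tact_def)

lemma tvalid_tact_iff:
  "F.tvalid (tact b f g) \<longleftrightarrow> F.tvalid b \<and> A.tvalid f \<and> A.tvalid g \<and> ttrg f = tsrc b \<and> ttrg g = ttrg b"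
  by (metis tact_type(1) tact_junk F.tvalid_simps(1))

lemma tact_None: "\<not> F.tvalid (tact b f g) \<Longrightarrow> tact b f g = None"
  unfolding tvalid_tact_iff by (rule tact_junk)

lemmas form_iffs = valid_iffs tvalid_tact_iff

lemma tact_tact: "tact (tact b f g) f' g' = tact b (f \<ast> f') (g \<ast> g')"
proof (cases "F.tvalid b \<and> A.tvalid f \<and> A.tvalid g \<and> ttrg f = tsrc b \<and> ttrg g = ttrg b \<and>
    A.tvalid f' \<and> A.tvalid g' \<and> ttrg f' = tsrc f \<and> ttrg g' = tsrc g")
  case True
  then obtain A B A' B' \<beta> f0 g0 where b: "b = Some (A, B, \<beta>)" "f = Some (A', A, f0)" "g = Some (B', B, g0)"
    "A \<in> Ob C" "B \<in> Ob C" "A' \<in> Ob C" "B' \<in> Ob C" "\<beta> \<in> Hom C (A \<diamondop>\<^sub>o B) (Unit C)"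
    "f0 \<in> Hom C A' A" "g0 \<in> Hom C B' B"
    by (elim conjE) (rule tactE)
  obtain A'' f1 where f: "f' = Some (A'', A', f1)" "A'' \<in> Ob C" "f1 \<in> Hom C A'' A'"
    using True b by (auto elim!: A.tvalidE)
  obtain B'' g1 where g: "g' = Some (B'', B', g1)" "B'' \<in> Ob C" "g1 \<in> Hom C B'' B'"
    using True b by (auto elim!: A.tvalidE)
  note c = form_comp_closed[OF b(4-10)]
  have "f1 \<diamondop> g1 \<in> Hom C (A'' \<diamondop>\<^sub>o B'') (A' \<diamondop>\<^sub>o B')" using b f g by (intro TensorM_Hom)
  then have "\<beta> \<cdot> (f0 \<diamondop> g0) \<cdot> (f1 \<diamondop> g1) = \<beta> \<cdot> ((f0 \<cdot> f1) \<diamondop> (g0 \<cdot> g1))"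
    using b f g c Tensor_Comp[of A'' A' A B'' B' B f1 f0 g1 g0]
      Comp_assoc[of "A'' \<diamondop>\<^sub>o B''" "A' \<diamondop>\<^sub>o B'" "A \<diamondop>\<^sub>o B" "Unit C" "f1 \<diamondop> g1" "f0 \<diamondop> g0" \<beta>]
    by (simp add: TensorO_Ob Unit_Ob)
  then show ?thesis
    using b f g c Comp_Hom[of A'' A' A f1 f0] Comp_Hom[of B'' B' B g1 g0] by simp
next
  case False
  have n: "\<not> F.tvalid (tact (tact b f g) f' g')" "\<not> F.tvalid (tact b (f \<ast> f') (g \<ast> g'))"
    unfolding form_iffs by (rule notI, rule notE[OF False], elim conjE, simp add: tact_type tcomp_type)+
  show ?thesis using tact_None[OF n(1)] tact_None[OF n(2)] by simp
qed

lemma tact_I: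
  assumes "F.tvalid b" "tsrc b = A" "ttrg b = B"
  shows "tact b (tI A) (tI B) = b"
proof -
  obtain \<beta> where b: "b = Some (A, B, \<beta>)" "A \<in> Ob C" "B \<in> Ob C" "\<beta> \<in> Hom C (A \<diamondop>\<^sub>o B) (Unit C)"
    using assms by (auto elim!: F.tvalidE)
  then show ?thesis
    by (simp add: tI_def Ident_Hom Tensor_Ident Comp_Ident[of "A \<diamondop>\<^sub>o B" "Unit C"] TensorO_Ob Unit_Ob)
qed

lemma tact_plus_left: "tact b (A.tplus f f') g = F.tplus (tact b f g) (tact b f' g)"
proof (cases "F.tvalid b \<and> A.tvalid f \<and> A.tvalid g \<and> ttrg f = tsrc b \<and> ttrg g = ttrg b \<and>
    A.tvalid f' \<and> tsrc f' = tsrc f \<and> ttrg f' = tsrc b")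
  case True
  then obtain A B A' B' \<beta> f0 g0 where b: "b = Some (A, B, \<beta>)" "f = Some (A', A, f0)" "g = Some (B', B, g0)"
    "A \<in> Ob C" "B \<in> Ob C" "A' \<in> Ob C" "B' \<in> Ob C" "\<beta> \<in> Hom C (A \<diamondop>\<^sub>o B) (Unit C)"
    "f0 \<in> Hom C A' A" "g0 \<in> Hom C B' B"
    by (elim conjE) (rule tactE)
  obtain f1 where f: "f' = Some (A', A, f1)" "f1 \<in> Hom C A' A"
    using True b by (auto elim!: A.tvalidE)
  note c = form_comp_closed[OF b(4-10)] form_comp_closed[OF b(4-8) f(2) b(10)]
  have "\<beta> \<cdot> ((f0 \<uplus> f1) \<diamondop> g0) = \<beta> \<cdot> (f0 \<diamondop> g0) \<uplus> \<beta> \<cdot> (f1 \<diamondop> g0)"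
    using b f c Tensor_Add_left[of A' A B' B f0 f1 g0]
      Comp_Add_right[of "A' \<diamondop>\<^sub>o B'" "A \<diamondop>\<^sub>o B" "Unit C" "f0 \<diamondop> g0" "f1 \<diamondop> g0" \<beta>]
    by (simp add: TensorO_Ob Unit_Ob)
  then show ?thesis using b f c by (simp add: raw_Hom)
next
  case False
  have n: "\<not> F.tvalid (tact b (A.tplus f f') g)" "\<not> F.tvalid (F.tplus (tact b f g) (tact b f' g))"
    unfolding form_iffs by (rule notI, rule notE[OF False], elim conjE, simp add: tact_type tcomp_type)+
  show ?thesis using tact_None[OF n(1)] F.tplus_None[OF n(2)] by simp
qed

lemma tact_plus_right: "tact b f (A.tplus g g') = F.tplus (tact b f g) (tact b f g')"
proof (cases "F.tvalid b \<and> A.tvalid f \<and> A.tvalid g \<and> ttrg f = tsrc b \<and> ttrg g = ttrg b \<and>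
    A.tvalid g' \<and> tsrc g' = tsrc g \<and> ttrg g' = ttrg b")
  case True
  then obtain A B A' B' \<beta> f0 g0 where b: "b = Some (A, B, \<beta>)" "f = Some (A', A, f0)" "g = Some (B', B, g0)"
    "A \<in> Ob C" "B \<in> Ob C" "A' \<in> Ob C" "B' \<in> Ob C" "\<beta> \<in> Hom C (A \<diamondop>\<^sub>o B) (Unit C)"
    "f0 \<in> Hom C A' A" "g0 \<in> Hom C B' B"
    by (elim conjE) (rule tactE)
  obtain g1 where g: "g' = Some (B', B, g1)" "g1 \<in> Hom C B' B"
    using True b by (auto elim!: A.tvalidE)
  note c = form_comp_closed[OF b(4-10)] form_comp_closed[OF b(4-9) g(2)]
  have "\<beta> \<cdot> (f0 \<diamondop> (g0 \<uplus> g1)) = \<beta> \<cdot> (f0 \<diamondop> g0) \<uplus> \<beta> \<cdot> (f0 \<diamondop> g1)"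
    using b g c Tensor_Add_right[of A' A B' B f0 g0 g1]
      Comp_Add_right[of "A' \<diamondop>\<^sub>o B'" "A \<diamondop>\<^sub>o B" "Unit C" "f0 \<diamondop> g0" "f0 \<diamondop> g1" \<beta>]
    by (simp add: TensorO_Ob Unit_Ob)
  then show ?thesis using b g c by (simp add: raw_Hom)
next
  case False
  have n: "\<not> F.tvalid (tact b f (A.tplus g g'))" "\<not> F.tvalid (F.tplus (tact b f g) (tact b f g'))"
    unfolding form_iffs by (rule notI, rule notE[OF False], elim conjE, simp add: tact_type tcomp_type)+
  show ?thesis using tact_None[OF n(1)] F.tplus_None[OF n(2)] by simp
qed

lemma raw_form: "\<lbrakk>A \<in> Ob C; B \<in> Ob C; \<beta> \<in> Hom C (A \<diamondop>\<^sub>o B) (Unit C); \<beta>' \<in> Hom C (A \<diamondop>\<^sub>o B) (Unit C)\<rbrakk>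
    \<Longrightarrow> \<beta> \<uplus> \<beta>' \<in> Hom C (A \<diamondop>\<^sub>o B) (Unit C)"
  "\<lbrakk>A \<in> Ob C; B \<in> Ob C; \<beta> \<in> Hom C (A \<diamondop>\<^sub>o B) (Unit C)\<rbrakk> \<Longrightarrow> ScaleM C c \<beta> \<in> Hom C (A \<diamondop>\<^sub>o B) (Unit C)"
  using F.raw_add(1)[of A B] F.raw(1)[of A B] by simp_all

lemma tact_fplus: "tact (F.tplus b b') f g = F.tplus (tact b f g) (tact b' f g)"
proof (cases "F.tvalid b \<and> A.tvalid f \<and> A.tvalid g \<and> ttrg f = tsrc b \<and> ttrg g = ttrg b \<and>
    F.tvalid b' \<and> tsrc b' = tsrc b \<and> ttrg b' = ttrg b")
  case True
  then obtain A B A' B' \<beta> f0 g0 where b: "b = Some (A, B, \<beta>)" "f = Some (A', A, f0)" "g = Some (B', B, g0)"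
    "A \<in> Ob C" "B \<in> Ob C" "A' \<in> Ob C" "B' \<in> Ob C" "\<beta> \<in> Hom C (A \<diamondop>\<^sub>o B) (Unit C)"
    "f0 \<in> Hom C A' A" "g0 \<in> Hom C B' B"
    by (elim conjE) (rule tactE)
  obtain \<beta>' where b': "b' = Some (A, B, \<beta>')" "\<beta>' \<in> Hom C (A \<diamondop>\<^sub>o B) (Unit C)"
    using True b by (auto elim!: F.tvalidE)
  note c = form_comp_closed[OF b(4-10)] form_comp_closed[OF b(4-7) b'(2) b(9,10)]
  have "(\<beta> \<uplus> \<beta>') \<cdot> (f0 \<diamondop> g0) = \<beta> \<cdot> (f0 \<diamondop> g0) \<uplus> \<beta>' \<cdot> (f0 \<diamondop> g0)"
    using b b' c Comp_Add_left[of "A' \<diamondop>\<^sub>o B'" "A \<diamondop>\<^sub>o B" "Unit C" "f0 \<diamondop> g0" \<beta> \<beta>']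
    by (simp add: TensorO_Ob Unit_Ob)
  then show ?thesis using b b' c by (simp add: raw_form)
next
  case False
  have n: "\<not> F.tvalid (tact (F.tplus b b') f g)" "\<not> F.tvalid (F.tplus (tact b f g) (tact b' f g))"
    unfolding form_iffs by (rule notI, rule notE[OF False], elim conjE, simp add: tact_type tcomp_type)+
  show ?thesis using tact_None[OF n(1)] F.tplus_None[OF n(2)] by simp
qed

lemma tscale_None: "\<not> F.tvalid (F.tscale c b) \<Longrightarrow> F.tscale c b = None"
  unfolding F.tvalid_tscale_iff by simp

lemma tact_scale:
  "tact b (A.tscale c f) g = F.tscale c (tact b f g)" "tact b f (A.tscale c g) = F.tscale c (tact b f g)"
  "tact (F.tscale c b) f g = F.tscale c (tact b f g)"
proof (atomize(full), cases "F.tvalid b \<and> A.tvalid f \<and> A.tvalid g \<and> ttrg f = tsrc b \<and> ttrg g = ttrg b")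
  case True
  then obtain A B A' B' \<beta> f0 g0 where b: "b = Some (A, B, \<beta>)" "f = Some (A', A, f0)" "g = Some (B', B, g0)"
    "A \<in> Ob C" "B \<in> Ob C" "A' \<in> Ob C" "B' \<in> Ob C" "\<beta> \<in> Hom C (A \<diamondop>\<^sub>o B) (Unit C)"
    "f0 \<in> Hom C A' A" "g0 \<in> Hom C B' B"
    by (elim conjE) (rule tactE)
  note c = form_comp_closed[OF b(4-10)]
  have "\<beta> \<cdot> (ScaleM C c f0 \<diamondop> g0) = ScaleM C c (\<beta> \<cdot> (f0 \<diamondop> g0))"
    "\<beta> \<cdot> (f0 \<diamondop> ScaleM C c g0) = ScaleM C c (\<beta> \<cdot> (f0 \<diamondop> g0))"
    "ScaleM C c \<beta> \<cdot> (f0 \<diamondop> g0) = ScaleM C c (\<beta> \<cdot> (f0 \<diamondop> g0))"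
    using b c Comp_Scale_right[of "A' \<diamondop>\<^sub>o B'" "A \<diamondop>\<^sub>o B" "Unit C" "f0 \<diamondop> g0" \<beta>]
      Comp_Scale_left[of "A' \<diamondop>\<^sub>o B'" "A \<diamondop>\<^sub>o B" "Unit C" "f0 \<diamondop> g0" \<beta>]
      Tensor_Scale_left[of A' A B' B f0 g0] Tensor_Scale_right[of A' A B' B f0 g0]
    by (simp_all add: TensorO_Ob Unit_Ob)
  then show "tact b (A.tscale c f) g = F.tscale c (tact b f g) \<and> tact b f (A.tscale c g) = F.tscale c (tact b f g) \<and>
      tact (F.tscale c b) f g = F.tscale c (tact b f g)"
    using b c by (simp add: raw_Hom raw_form)
next
  case False
  have n: "\<not> F.tvalid (tact b (A.tscale c f) g)" "\<not> F.tvalid (tact b f (A.tscale c g))"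
    "\<not> F.tvalid (tact (F.tscale c b) f g)" "\<not> F.tvalid (F.tscale c (tact b f g))"
    unfolding form_iffs by (rule notI, rule notE[OF False], elim conjE, simp add: tact_type tcomp_type)+
  show "tact b (A.tscale c f) g = F.tscale c (tact b f g) \<and> tact b f (A.tscale c g) = F.tscale c (tact b f g) \<and>
      tact (F.tscale c b) f g = F.tscale c (tact b f g)"
    using tact_None[OF n(1)] tact_None[OF n(2)] tact_None[OF n(3)] tscale_None[OF n(4)] by simp
qed

section \<open>Swapping forms by the braiding\<close>

lemma Braid_Hom: "\<lbrakk>A \<in> Ob C; B \<in> Ob C\<rbrakk> \<Longrightarrow> Braid C A B \<in> Hom C (A \<diamondop>\<^sub>o B) (B \<diamondop>\<^sub>o A)"
  using iso_inverse_Some(1)[OF _ _ Braid_iso] TensorO_Ob by simp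

lemma swap_closed: "\<lbrakk>A \<in> Ob C; B \<in> Ob C; \<beta> \<in> Hom C (A \<diamondop>\<^sub>o B) (Unit C)\<rbrakk>
    \<Longrightarrow> \<beta> \<cdot> Braid C B A \<in> Hom C (B \<diamondop>\<^sub>o A) (Unit C)"
  by (rule Comp_Hom[of "B \<diamondop>\<^sub>o A" "A \<diamondop>\<^sub>o B"]) (simp_all add: TensorO_Ob Unit_Ob Braid_Hom)

lemma tswap_Some [simp]: "\<lbrakk>A \<in> Ob C; B \<in> Ob C; \<beta> \<in> Hom C (A \<diamondop>\<^sub>o B) (Unit C)\<rbrakk>
    \<Longrightarrow> tswap (Some (A, B, \<beta>)) = Some (B, A, \<beta> \<cdot> Braid C B A)"
  by (simp add: tswap_def)

lemma tswap_type:
  assumes "F.tvalid b"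
  shows "F.tvalid (tswap b)" "tsrc (tswap b) = ttrg b" "ttrg (tswap b) = tsrc b"
  by (rule F.tvalidE[OF assms], simp add: swap_closed)+

lemma tswap_junk: "\<not> F.tvalid b \<Longrightarrow> tswap b = None"
  by (simp add: tswap_def)

lemma tvalid_tswap_iff: "F.tvalid (tswap b) \<longleftrightarrow> F.tvalid b"
  using tswap_type(1) tswap_junk[of b] by fastforce

lemma tswap_None: "\<not> F.tvalid (tswap b) \<Longrightarrow> tswap b = None"
  unfolding tvalid_tswap_iff by (rule tswap_junk)

lemma tswap_act: "tswap (tact b f g) = tact (tswap b) g f"
proof (cases "F.tvalid b \<and> A.tvalid f \<and> A.tvalid g \<and> ttrg f = tsrc b \<and> ttrg g = ttrg b")
  case True
  then obtain A B A' B' \<beta> f0 g0 where b: "b = Some (A, B, \<beta>)" "f = Some (A', A, f0)" "g = Some (B', B, g0)"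
    "A \<in> Ob C" "B \<in> Ob C" "A' \<in> Ob C" "B' \<in> Ob C" "\<beta> \<in> Hom C (A \<diamondop>\<^sub>o B) (Unit C)"
    "f0 \<in> Hom C A' A" "g0 \<in> Hom C B' B"
    by (elim conjE) (rule tactE)
  note c = form_comp_closed[OF b(4-10)] swap_closed[OF b(4,5,8)]
  have "\<beta> \<cdot> (f0 \<diamondop> g0) \<cdot> Braid C B' A' = \<beta> \<cdot> ((f0 \<diamondop> g0) \<cdot> Braid C B' A')"
    by (rule Comp_assoc[symmetric, of "B' \<diamondop>\<^sub>o A'" "A' \<diamondop>\<^sub>o B'" "A \<diamondop>\<^sub>o B" "Unit C"])
      (use b c in \<open>simp_all add: TensorO_Ob Unit_Ob Braid_Hom\<close>)
  also have "(f0 \<diamondop> g0) \<cdot> Braid C B' A' = Braid C B A \<cdot> (g0 \<diamondop> f0)"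
    using Braid_natural[of B' A' B A g0 f0] b by simp
  also have "\<beta> \<cdot> \<dots> = \<beta> \<cdot> Braid C B A \<cdot> (g0 \<diamondop> f0)"
    by (rule Comp_assoc[of "B' \<diamondop>\<^sub>o A'" "B \<diamondop>\<^sub>o A" "A \<diamondop>\<^sub>o B" "Unit C"])
      (use b c in \<open>simp_all add: TensorO_Ob Unit_Ob Braid_Hom TensorM_Hom\<close>)
  finally show ?thesis using b c by simp
next
  case False
  have n: "\<not> F.tvalid (tswap (tact b f g))" "\<not> F.tvalid (tact (tswap b) g f)"
    unfolding form_iffs tvalid_tswap_iff by (rule notI, rule notE[OF False], elim conjE, simp add: tact_type tcomp_type tswap_type)+
  show ?thesis using tact_None[OF n(2)] tswap_None[OF n(1)] by simp
qed

lemma tswap_fplus: "tswap (F.tplus b b') = F.tplus (tswap b) (tswap b')"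
proof (cases "F.tvalid b \<and> F.tvalid b' \<and> tsrc b = tsrc b' \<and> ttrg b = ttrg b'")
  case True
  then obtain A B \<beta> where b: "b = Some (A, B, \<beta>)" "A \<in> Ob C" "B \<in> Ob C" "\<beta> \<in> Hom C (A \<diamondop>\<^sub>o B) (Unit C)"
    by (auto elim: F.tvalidE)
  obtain \<beta>' where b': "b' = Some (A, B, \<beta>')" "\<beta>' \<in> Hom C (A \<diamondop>\<^sub>o B) (Unit C)"
    using True b by (auto elim!: F.tvalidE)
  have "(\<beta> \<uplus> \<beta>') \<cdot> Braid C B A = \<beta> \<cdot> Braid C B A \<uplus> \<beta>' \<cdot> Braid C B A"
    by (rule Comp_Add_left[of "B \<diamondop>\<^sub>o A" "A \<diamondop>\<^sub>o B" "Unit C"]) (use b b' in \<open>simp_all add: TensorO_Ob Unit_Ob Braid_Hom\<close>)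
  then show ?thesis using b b' by (simp add: raw_form swap_closed)
next
  case False
  have n: "\<not> F.tvalid (tswap (F.tplus b b'))" "\<not> F.tvalid (F.tplus (tswap b) (tswap b'))"
    unfolding form_iffs tvalid_tswap_iff by (rule notI, rule notE[OF False], elim conjE, simp add: tact_type tcomp_type tswap_type)+
  show ?thesis using F.tplus_None[OF n(2)] tswap_None[OF n(1)] by simp
qed

lemma tswap_fscale: "tswap (F.tscale c b) = F.tscale c (tswap b)"
proof (cases "F.tvalid b")
  case True
  then obtain A B \<beta> where b: "b = Some (A, B, \<beta>)" "A \<in> Ob C" "B \<in> Ob C" "\<beta> \<in> Hom C (A \<diamondop>\<^sub>o B) (Unit C)"
    by (auto elim: F.tvalidE)
  have "ScaleM C c \<beta> \<cdot> Braid C B A = ScaleM C c (\<beta> \<cdot> Braid C B A)"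
    by (rule Comp_Scale_left[of "B \<diamondop>\<^sub>o A" "A \<diamondop>\<^sub>o B" "Unit C"]) (use b in \<open>simp_all add: TensorO_Ob Unit_Ob Braid_Hom\<close>)
  then show ?thesis using b by (simp add: raw_form swap_closed)
next
  case False
  then show ?thesis by (simp add: tswap_junk)
qed

lemma Braid_cancel:
  assumes [simp]: "A \<in> Ob C" "B \<in> Ob C" and b: "\<beta> \<in> Hom C (A \<diamondop>\<^sub>o B) (Unit C)"
  defines "v \<equiv> inv_arrow C (B \<diamondop>\<^sub>o A) (A \<diamondop>\<^sub>o B) (Braid C B A)"
  shows "v \<in> Hom C (A \<diamondop>\<^sub>o B) (B \<diamondop>\<^sub>o A)" "\<beta> \<cdot> Braid C B A \<cdot> v = \<beta>"
    "\<beta>' \<in> Hom C (B \<diamondop>\<^sub>o A) (Unit C) \<Longrightarrow> \<beta>' \<cdot> v \<cdot> Braid C B A = \<beta>'"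
proof -
  have o [simp]: "A \<diamondop>\<^sub>o B \<in> Ob C" "B \<diamondop>\<^sub>o A \<in> Ob C" "Unit C \<in> Ob C" by (simp_all add: TensorO_Ob Unit_Ob)
  have v: "inverse_arrows C (B \<diamondop>\<^sub>o A) (A \<diamondop>\<^sub>o B) (Braid C B A) v"
    unfolding v_def by (rule inv_arrow) (simp_all add: Braid_iso)
  then show vH: "v \<in> Hom C (A \<diamondop>\<^sub>o B) (B \<diamondop>\<^sub>o A)" by (simp add: inverse_arrows_def)
  show "\<beta> \<cdot> Braid C B A \<cdot> v = \<beta>"
    using Comp_assoc[of "A \<diamondop>\<^sub>o B" "B \<diamondop>\<^sub>o A" "A \<diamondop>\<^sub>o B" "Unit C" v "Braid C B A" \<beta>] v vH b
    by (simp add: Braid_Hom inverse_arrows_def Comp_Ident[of "A \<diamondop>\<^sub>o B" "Unit C"])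
  show "\<beta>' \<cdot> v \<cdot> Braid C B A = \<beta>'" if "\<beta>' \<in> Hom C (B \<diamondop>\<^sub>o A) (Unit C)"
    using Comp_assoc[of "B \<diamondop>\<^sub>o A" "A \<diamondop>\<^sub>o B" "B \<diamondop>\<^sub>o A" "Unit C" "Braid C B A" v \<beta>'] v vH that
    by (simp add: Braid_Hom inverse_arrows_def Comp_Ident[of "B \<diamondop>\<^sub>o A" "Unit C"])
qed

lemma tswap_inj:
  assumes "F.tvalid b" "F.tvalid b'" "tswap b = tswap b'"
  shows "b = b'"
proof -
  obtain A B \<beta> where b: "b = Some (A, B, \<beta>)" "A \<in> Ob C" "B \<in> Ob C" "\<beta> \<in> Hom C (A \<diamondop>\<^sub>o B) (Unit C)"
    using assms(1) by (auto elim: F.tvalidE)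
  obtain A' B' \<beta>' where b': "b' = Some (A', B', \<beta>')" "A' \<in> Ob C" "B' \<in> Ob C" "\<beta>' \<in> Hom C (A' \<diamondop>\<^sub>o B') (Unit C)"
    using assms(2) by (auto elim: F.tvalidE)
  have "A' = A" "B' = B" "\<beta> \<cdot> Braid C B A = \<beta>' \<cdot> Braid C B A" using assms(3) b b' by auto
  then show ?thesis using Braid_cancel(2)[OF b(2,3,4)] Braid_cancel(2)[OF b(2,3), of \<beta>'] b b' by simp
qed

lemma tswap_surj:
  assumes "F.tvalid b"
  shows "\<exists>b'. F.tvalid b' \<and> tswap b' = b"
proof -
  obtain B A \<beta> where b: "b = Some (B, A, \<beta>)" "B \<in> Ob C" "A \<in> Ob C" "\<beta> \<in> Hom C (B \<diamondop>\<^sub>o A) (Unit C)"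
    using assms(1) by (auto elim: F.tvalidE)
  let ?v = "inv_arrow C (B \<diamondop>\<^sub>o A) (A \<diamondop>\<^sub>o B) (Braid C B A)"
  \<comment> \<open>The zero form serves as a form with legs \<open>A\<close> and \<open>B\<close>
    to instantiate \<open>Braid_cancel\<close>; the arrow of interest is the inverse
    braiding.\<close>
  have z: "ZeroM C (A \<diamondop>\<^sub>o B) (Unit C) \<in> Hom C (A \<diamondop>\<^sub>o B) (Unit C)" using b by (simp add: TensorO_Ob Unit_Ob)
  have "\<beta> \<cdot> ?v \<in> Hom C (A \<diamondop>\<^sub>o B) (Unit C)"
    by (rule Comp_Hom[of "A \<diamondop>\<^sub>o B" "B \<diamondop>\<^sub>o A"]) (use b Braid_cancel(1)[OF b(3,2) z] in \<open>simp_all add: TensorO_Ob Unit_Ob\<close>)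
  then show ?thesis
    using b Braid_cancel(3)[OF b(3,2) z b(4)] by (intro exI[of _ "Some (A, B, \<beta> \<cdot> ?v)"]) simp
qed

text \<open>A form seen as an arrow out of the tensor product, where the calculus of dual pairs
  applies. The legs are forgotten, so this is injective only on forms with the same legs.\<close>

definition larr :: "('o \<times> 'o \<times> 'm) option \<Rightarrow> ('o \<times> 'o \<times> 'm) option" where
  "larr b = Some (tsrc b \<diamondop>\<^sub>o ttrg b, Unit C, tval b)"

lemma larr_type:
  assumes "F.tvalid b"
  shows "A.tvalid (larr b)" "tsrc (larr b) = tsrc b \<diamondop>\<^sub>o ttrg b" "ttrg (larr b) = Unit C"
  by (rule F.tvalidE[OF assms], simp add: larr_def TensorO_Ob Unit_Ob)+

lemma larr_act:
  assumes "F.tvalid b" "A.tvalid f" "A.tvalid g" "ttrg f = tsrc b" "ttrg g = ttrg b"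
  shows "larr (tact b f g) = larr b \<ast> tten f g"
  by (rule tactE[OF assms]) (simp add: larr_def tten_def form_comp_closed TensorO_Ob Unit_Ob)

lemma larr_inj:
  assumes "F.tvalid b" "F.tvalid b'" "tsrc b = tsrc b'" "ttrg b = ttrg b'" "larr b = larr b'"
  shows "b = b'"
  using assms by (auto elim!: F.tvalidE simp: larr_def)

text \<open>Pure bookkeeping: the triangle identities are given with composites nested to the left
  and are needed nested to the right, which requires the type of each intermediate
  composite.\<close>

lemma duality_dual_pair:
  assumes "duality C M N e c"
  shows "M.dual_pair M N (larr (Some (N, M, e))) (Some (Unit C, M \<diamondop>\<^sub>o N, c))"
proof -
  note d = assms[unfolded duality_def]
  have [simp]: "M \<in> Ob C" "N \<in> Ob C" "e \<in> Hom C (N \<diamondop>\<^sub>o M) (Unit C)" "c \<in> Hom C (Unit C) (M \<diamondop>\<^sub>o N)"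
    using d by auto
  note [simp] = TensorO_Ob Unit_Ob Ident_Hom
  have a: "Assoc C M N M \<in> Hom C ((M \<diamondop>\<^sub>o N) \<diamondop>\<^sub>o M) (M \<diamondop>\<^sub>o (N \<diamondop>\<^sub>o M))"
    "AssocInv C N M N \<in> Hom C (N \<diamondop>\<^sub>o (M \<diamondop>\<^sub>o N)) ((N \<diamondop>\<^sub>o M) \<diamondop>\<^sub>o N)"
    "LUnit C M \<in> Hom C (Unit C \<diamondop>\<^sub>o M) M" "RUnit C M \<in> Hom C (M \<diamondop>\<^sub>o Unit C) M"
    "LUnit C N \<in> Hom C (Unit C \<diamondop>\<^sub>o N) N" "RUnit C N \<in> Hom C (N \<diamondop>\<^sub>o Unit C) N"
    using iso_inverse_Some(1)[OF _ _ Assoc_iso] iso_inverse_Some(2)[OF _ _ Assoc_iso]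
      iso_inverse_Some(1)[OF _ _ LUnit_iso] iso_inverse_Some(1)[OF _ _ RUnit_iso]
    by (simp_all add: AssocInv_def)
  have t: "Ident C M \<diamondop> e \<in> Hom C (M \<diamondop>\<^sub>o (N \<diamondop>\<^sub>o M)) (M \<diamondop>\<^sub>o Unit C)"
    "c \<diamondop> Ident C M \<in> Hom C (Unit C \<diamondop>\<^sub>o M) ((M \<diamondop>\<^sub>o N) \<diamondop>\<^sub>o M)"
    "e \<diamondop> Ident C N \<in> Hom C ((N \<diamondop>\<^sub>o M) \<diamondop>\<^sub>o N) (Unit C \<diamondop>\<^sub>o N)"
    "Ident C N \<diamondop> c \<in> Hom C (N \<diamondop>\<^sub>o Unit C) (N \<diamondop>\<^sub>o (M \<diamondop>\<^sub>o N))"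
    by (auto intro!: TensorM_Hom)
  have h: "RUnit C M \<cdot> (Ident C M \<diamondop> e) \<in> Hom C (M \<diamondop>\<^sub>o (N \<diamondop>\<^sub>o M)) M"
    "LUnit C N \<cdot> (e \<diamondop> Ident C N) \<in> Hom C ((N \<diamondop>\<^sub>o M) \<diamondop>\<^sub>o N) N"
    using Comp_Hom[OF _ _ _ t(1) a(4)] Comp_Hom[OF _ _ _ t(3) a(5)] by simp_all
  have k: "Assoc C M N M \<cdot> (c \<diamondop> Ident C M) \<in> Hom C (Unit C \<diamondop>\<^sub>o M) (M \<diamondop>\<^sub>o (N \<diamondop>\<^sub>o M))"
    "AssocInv C N M N \<cdot> (Ident C N \<diamondop> c) \<in> Hom C (N \<diamondop>\<^sub>o Unit C) ((N \<diamondop>\<^sub>o M) \<diamondop>\<^sub>o N)"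
    using Comp_Hom[OF _ _ _ t(2) a(1)] Comp_Hom[OF _ _ _ t(4) a(2)] by simp_all
  have l: "(Ident C M \<diamondop> e) \<cdot> (Assoc C M N M \<cdot> (c \<diamondop> Ident C M)) \<in> Hom C (Unit C \<diamondop>\<^sub>o M) (M \<diamondop>\<^sub>o Unit C)"
    "(e \<diamondop> Ident C N) \<cdot> (AssocInv C N M N \<cdot> (Ident C N \<diamondop> c)) \<in> Hom C (N \<diamondop>\<^sub>o Unit C) (Unit C \<diamondop>\<^sub>o N)"
    using Comp_Hom[OF _ _ _ k(1) t(1)] Comp_Hom[OF _ _ _ k(2) t(3)] by simp_all
  have "RUnit C M \<cdot> ((Ident C M \<diamondop> e) \<cdot> (Assoc C M N M \<cdot> (c \<diamondop> Ident C M))) = LUnit C M"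
    "LUnit C N \<cdot> ((e \<diamondop> Ident C N) \<cdot> (AssocInv C N M N \<cdot> (Ident C N \<diamondop> c))) = RUnit C N"
    using Comp_assoc[OF _ _ _ _ t(2) a(1) h(1)] Comp_assoc[OF _ _ _ _ t(4) a(2) h(2)] d
      Comp_assoc[OF _ _ _ _ k(1) t(1) a(4)] Comp_assoc[OF _ _ _ _ k(2) t(3) a(5)] by simp_all
  then show ?thesis
    unfolding M.dual_pair_def
    using a t k l by (simp add: larr_def tten_def tI_def)
qed

text \<open>Stated for an arbitrary dual and not just the chosen one, since the evaluations of the
  simple objects exhibit \<open>X i\<close> itself as a dual.\<close>

lemma duality_left:
  assumes d: "duality C M N e c" and b: "F.tvalid b" "ttrg b = M"
  shows "\<exists>!f. A.tvalid f \<and> tsrc f = tsrc b \<and> ttrg f = N \<and> tact (Some (N, M, e)) f (tI M) = b"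
proof -
  let ?e = "Some (N, M, e)"
  have [simp]: "M \<in> Ob C" "N \<in> Ob C" and e: "F.tvalid ?e" using d by (auto simp: duality_def)
  have ex: "\<exists>!f. A.tvalid f \<and> tsrc f = tsrc b \<and> ttrg f = N \<and> larr ?e \<ast> tten f (tI M) = larr b"
    by (rule M.dual_pair_left[OF duality_dual_pair[OF d]]) (use b larr_type[OF b(1)] in simp_all)
  have iff: "larr ?e \<ast> tten f (tI M) = larr b \<longleftrightarrow> tact ?e f (tI M) = b"
    if "A.tvalid f" "tsrc f = tsrc b" "ttrg f = N" for f
    using larr_act[OF e that(1), of "tI M"] tact_type[OF e that(1), of "tI M"] that b
      larr_inj[of "tact ?e f (tI M)" b] by auto
  show ?thesis using ex iff by (metis (no_types, lifting))
qed

lemma duality_right: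
  assumes d: "duality C M N e c" and b: "F.tvalid b" "tsrc b = N"
  shows "\<exists>!f. A.tvalid f \<and> tsrc f = ttrg b \<and> ttrg f = M \<and> tact (Some (N, M, e)) (tI N) f = b"
proof -
  let ?e = "Some (N, M, e)"
  have [simp]: "M \<in> Ob C" "N \<in> Ob C" and e: "F.tvalid ?e" using d by (auto simp: duality_def)
  have ex: "\<exists>!f. A.tvalid f \<and> tsrc f = ttrg b \<and> ttrg f = M \<and> larr ?e \<ast> tten (tI N) f = larr b"
    by (rule M.dual_pair_right[OF duality_dual_pair[OF d]]) (use b larr_type[OF b(1)] in simp_all)
  have iff: "larr ?e \<ast> tten (tI N) f = larr b \<longleftrightarrow> tact ?e (tI N) f = b"
    if "A.tvalid f" "tsrc f = ttrg b" "ttrg f = M" for f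
    using larr_act[OF e _ that(1), of "tI N"] tact_type[OF e _ that(1), of "tI N"] that b
      larr_inj[of "tact ?e (tI N) f" b] by auto
  show ?thesis using ex iff by (metis (no_types, lifting))
qed

sublocale T: form_category "Ob C" A.tvalid tsrc ttrg A.tplus A.tscale A.tzero F.tvalid tsrc ttrg F.tplus F.tscale F.tzero
  tI tcomp tact tswap "Dual C" tev
proof
  fix f g h f' g' b b' :: "('o \<times> 'o \<times> 'm) option" and A B M :: 'o and c :: 'k
  show "A.tvalid (tI A)" "tsrc (tI A) = A" "ttrg (tI A) = A" if "A \<in> Ob C" using that by simp_all
  show "A.tvalid (g \<ast> f)" "tsrc (g \<ast> f) = tsrc f" "ttrg (g \<ast> f) = ttrg g"
    if "A.tvalid g" "A.tvalid f" "ttrg f = tsrc g" using tcomp_type that by simp_all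
  show "(h \<ast> g) \<ast> f = h \<ast> (g \<ast> f)" by (rule tcomp_assoc)
  show "tI B \<ast> f = f" if "A.tvalid f" "ttrg f = B" using tcomp_tI that by simp
  show "f \<ast> tI B = f" if "A.tvalid f" "tsrc f = B" using tcomp_tI that by simp
  show "g \<ast> A.tplus f f' = A.tplus (g \<ast> f) (g \<ast> f')" by (rule tcomp_plus_right)
  show "A.tplus g g' \<ast> f = A.tplus (g \<ast> f) (g' \<ast> f)" by (rule tcomp_plus_left)
  show "g \<ast> A.tscale c f = A.tscale c (g \<ast> f)" "A.tscale c g \<ast> f = A.tscale c (g \<ast> f)" by (rule tcomp_scale)+
  show "F.tvalid (tact b f g)" "tsrc (tact b f g) = tsrc f" "ttrg (tact b f g) = tsrc g"
    if "F.tvalid b" "A.tvalid f" "A.tvalid g" "ttrg f = tsrc b" "ttrg g = ttrg b" using tact_type that by simp_all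
  show "tact (tact b f g) f' g' = tact b (f \<ast> f') (g \<ast> g')" by (rule tact_tact)
  show "tact b (tI A) (tI B) = b" if "F.tvalid b" "tsrc b = A" "ttrg b = B" using tact_I that by simp
  show "tact b (A.tplus f f') g = F.tplus (tact b f g) (tact b f' g)" by (rule tact_plus_left)
  show "tact b f (A.tplus g g') = F.tplus (tact b f g) (tact b f g')" by (rule tact_plus_right)
  show "tact (F.tplus b b') f g = F.tplus (tact b f g) (tact b' f g)" by (rule tact_fplus)
  show "tact b (A.tscale c f) g = F.tscale c (tact b f g)" "tact b f (A.tscale c g) = F.tscale c (tact b f g)"
    "tact (F.tscale c b) f g = F.tscale c (tact b f g)" by (rule tact_scale)+
  show "F.tvalid (tswap b)" "tsrc (tswap b) = ttrg b" "ttrg (tswap b) = tsrc b" if "F.tvalid b"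
    using tswap_type that by simp_all
  show "tswap (tact b f g) = tact (tswap b) g f" by (rule tswap_act)
  show "tswap (F.tplus b b') = F.tplus (tswap b) (tswap b')" by (rule tswap_fplus)
  show "tswap (F.tscale c b) = F.tscale c (tswap b)" by (rule tswap_fscale)
  show "b = b'" if "F.tvalid b" "F.tvalid b'" "tswap b = tswap b'" using tswap_inj that by blast
  show "\<exists>b'. F.tvalid b' \<and> tswap b' = b" if "F.tvalid b" using tswap_surj that by blast
  show "Dual C M \<in> Ob C" "F.tvalid (tev M)" "tsrc (tev M) = Dual C M" "ttrg (tev M) = M" if "M \<in> Ob C"
    using Dual[OF that] by (auto simp: duality_def tev_def)
  show "\<exists>!f. A.tvalid f \<and> tsrc f = tsrc b \<and> ttrg f = Dual C M \<and> tact (tev M) f (tI M) = b"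
    if "M \<in> Ob C" "F.tvalid b" "ttrg b = M"
    unfolding tev_def by (rule duality_left[OF Dual[OF that(1)] that(2,3)])
  show "\<exists>!f. A.tvalid f \<and> tsrc f = ttrg b \<and> ttrg f = M \<and> tact (tev M) (tI (Dual C M)) f = b"
    if "M \<in> Ob C" "F.tvalid b" "tsrc b = Dual C M"
    unfolding tev_def by (rule duality_right[OF Dual[OF that(1)] that(2,3)])
qed

end

section \<open>Schur's lemma and the decomposition into simple objects\<close>

context fusion
begin

declare A.tplus_junk [simp del] F.tplus_junk [simp del]

lemma zob_iff: "T.zob Z \<longleftrightarrow> zero_object C Z"
proof
  assume z: "T.zob Z"
  then have Z: "Z \<in> Ob C" by (simp add: T.zob_def)
  have "\<exists>!f. f \<in> Hom C Z A" "\<exists>!f. f \<in> Hom C A Z" if A: "A \<in> Ob C" for A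
  proof -
    have "f = ZeroM C Z A" if "f \<in> Hom C Z A" for f
      using T.zob_arr(2)[OF z, of "Some (Z, A, f)"] that A Z by (simp add: A.tzero_def)
    then show "\<exists>!f. f \<in> Hom C Z A" using Zero_Hom[OF Z A] by blast
    have "f = ZeroM C A Z" if "f \<in> Hom C A Z" for f
      using T.zob_arr(1)[OF z, of "Some (A, Z, f)"] that A Z by (simp add: A.tzero_def)
    then show "\<exists>!f. f \<in> Hom C A Z" using Zero_Hom[OF A Z] by blast
  qed
  then show "zero_object C Z" using Z by (simp add: zero_object_def)
next
  assume "zero_object C Z"
  then have Z: "Z \<in> Ob C" and u: "\<exists>!f. f \<in> Hom C Z Z" by (auto simp: zero_object_def)
  then have "Ident C Z = ZeroM C Z Z" using Ident_Hom[OF Z] Zero_Hom[OF Z Z] by blast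
  then show "T.zob Z" using Z by (simp add: T.zob_def tI_def A.tzero_def)
qed

lemma bip_iff:
  "T.bip M N S (Some (M, S, i)) (Some (N, S, j)) (Some (S, M, p)) (Some (S, N, q)) \<longleftrightarrow> biproduct C M N S i j p q"
proof (cases "M \<in> Ob C \<and> N \<in> Ob C \<and> S \<in> Ob C \<and> i \<in> Hom C M S \<and> j \<in> Hom C N S \<and> p \<in> Hom C S M \<and> q \<in> Hom C S N")
  case True
  then have "i \<cdot> p \<in> Hom C S S" "j \<cdot> q \<in> Hom C S S" using Comp_Hom[of S M S] Comp_Hom[of S N S] by auto
  with True show ?thesis
    by (simp add: T.bip_def biproduct_def tI_def A.tzero_def)
next
  case False
  then show ?thesis by (auto simp: T.bip_def biproduct_def)
qed

lemma arrow_cases: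
  assumes "A.tvalid x" "tsrc x = A" "ttrg x = B"
  obtains f where "x = Some (A, B, f)" "f \<in> Hom C A B" "A \<in> Ob C" "B \<in> Ob C"
  using assms by (auto elim!: A.tvalidE)

lemma arrow_eq: "\<lbrakk>A.tvalid x; tsrc x = A; ttrg x = B\<rbrakk> \<Longrightarrow> x = Some (A, B, tval x)"
  by (rule arrow_cases[of x A B]) simp_all

lemma bip_raw:
  assumes "T.bip M N S i j p q"
  shows "biproduct C M N S (tval i) (tval j) (tval p) (tval q)"
proof -
  note d = T.bipD[OF assms]
  have "i = Some (M, S, tval i)" by (rule arrow_eq) (use d in blast)+
  moreover have "j = Some (N, S, tval j)" by (rule arrow_eq) (use d in blast)+
  moreover have "p = Some (S, M, tval p)" by (rule arrow_eq) (use d in blast)+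
  moreover have "q = Some (S, N, tval q)" by (rule arrow_eq) (use d in blast)+
  ultimately show ?thesis using assms bip_iff by metis
qed

lemma ex_bip_iff: "(\<exists>i j p q. T.bip M N S i j p q) \<longleftrightarrow> (\<exists>i j p q. biproduct C M N S i j p q)"
  using bip_raw bip_iff by blast

lemma inverse_pair_iff:
  assumes "A \<in> Ob C" "B \<in> Ob C"
  shows "T.inverse_pair A B (Some (A, B, f)) (Some (B, A, g)) \<longleftrightarrow> inverse_arrows C A B f g"
  using assms by (auto simp: T.inverse_pair_def inverse_arrows_def tI_def)

lemma inverse_pair_raw:
  assumes "T.inverse_pair A B f g"
  shows "f = Some (A, B, tval f)" "g = Some (B, A, tval g)" "inverse_arrows C A B (tval f) (tval g)"
proof -
  note d = T.inverse_pairD[OF assms]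
  show f: "f = Some (A, B, tval f)" by (rule arrow_eq) (use d in blast)+
  show g: "g = Some (B, A, tval g)" by (rule arrow_eq) (use d in blast)+
  show "inverse_arrows C A B (tval f) (tval g)"
    using assms inverse_pair_iff[OF d(1,2)] f g by metis
qed

lemma isomorphic_iff: "isomorphic C A B \<longleftrightarrow> (\<exists>f g. T.inverse_pair A B f g)"
proof
  assume "isomorphic C A B"
  then show "\<exists>f g. T.inverse_pair A B f g"
    using inverse_pair_iff unfolding isomorphic_def iso_arrow_def by blast
next
  assume "\<exists>f g. T.inverse_pair A B f g"
  then show "isomorphic C A B"
    using inverse_pair_raw(3) T.inverse_pairD(1,2) unfolding isomorphic_def iso_arrow_def by blast
qed

section \<open>Kernels, complements of retracts and Schur's lemma\<close>

lemma kernel: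
  assumes f: "A.tvalid f"
  obtains v where "A.tvalid v" "ttrg v = tsrc f" "f \<ast> v = A.tzero (tsrc v) (ttrg f)"
    "\<And>g. \<lbrakk>A.tvalid g; ttrg g = tsrc f; f \<ast> g = A.tzero (tsrc g) (ttrg f)\<rbrakk>
      \<Longrightarrow> \<exists>!h. A.tvalid h \<and> tsrc h = tsrc g \<and> ttrg h = tsrc v \<and> v \<ast> h = g"
proof -
  obtain A B f0 where F: "f = Some (A, B, f0)" "A \<in> Ob C" "B \<in> Ob C" "f0 \<in> Hom C A B"
    using f by (auto elim!: A.tvalidE)
  obtain K k where k: "is_kernel C A B f0 K k" using kernel_exists F by blast
  then have K: "K \<in> Ob C" "k \<in> Hom C K A" "f0 \<cdot> k = ZeroM C K B" by (auto simp: is_kernel_def)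
  let ?v = "Some (K, A, k)"
  have "\<exists>!h. A.tvalid h \<and> tsrc h = tsrc g \<and> ttrg h = tsrc ?v \<and> ?v \<ast> h = g"
    if h: "A.tvalid g" "ttrg g = tsrc f" "f \<ast> g = A.tzero (tsrc g) (ttrg f)" for g
  proof -
    have "ttrg g = A" using h(2) F(1) by simp
    then obtain E g0 where g: "g = Some (E, A, g0)" "E \<in> Ob C" "g0 \<in> Hom C E A"
      using arrow_cases[OF h(1) refl] by metis
    have "f0 \<cdot> g0 = ZeroM C E B" using h(3) F g by (simp add: A.tzero_def)
    then have ex: "\<exists>!h. h \<in> Hom C E K \<and> k \<cdot> h = g0" using k g by (simp add: is_kernel_def)
    then obtain h where h: "h \<in> Hom C E K" "k \<cdot> h = g0" by blast
    show ?thesis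
    proof (rule ex1I[of _ "Some (E, K, h)"])
      show "A.tvalid (Some (E, K, h)) \<and> tsrc (Some (E, K, h)) = tsrc g \<and> ttrg (Some (E, K, h)) = tsrc ?v \<and>
          ?v \<ast> Some (E, K, h) = g" using h g K F by simp
      fix h' assume h': "A.tvalid h' \<and> tsrc h' = tsrc g \<and> ttrg h' = tsrc ?v \<and> ?v \<ast> h' = g"
      then have "A.tvalid h'" "tsrc h' = E" "ttrg h' = K" using g by simp_all
      then obtain h0 where h0: "h' = Some (E, K, h0)" "h0 \<in> Hom C E K" by (rule arrow_cases)
      then have "k \<cdot> h0 = g0" using h' g K F by simp
      then show "h' = Some (E, K, h)" using ex h h0 by blast
    qed
  qed
  then show thesis using that[of ?v] F K by (auto simp: A.tzero_def)
qed

text \<open>The complement is the kernel \<open>v\<close> of the retraction. The arrow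
  \<open>1 - u r\<close> is killed by \<open>r\<close> and hence factors through \<open>v\<close>,
  which defines the second projection; the remaining identities are checked after composing with the
  monomorphism \<open>v\<close>.\<close>

lemma retraction_complement:
  assumes u: "A.tvalid u" "tsrc u = K" "ttrg u = M" and r: "A.tvalid r" "tsrc r = M" "ttrg r = K"
    and ru: "r \<ast> u = tI K"
  shows "\<exists>N v r'. T.bip K N M u v r r'"
proof -
  note [simp] = u r
  have [simp]: "K \<in> Ob C" "M \<in> Ob C" using u A.src_Ob A.trg_Ob by blast+
  have rux: "r \<ast> u \<ast> x = tI K \<ast> x" for x by (rule T.comp_eq_comp[OF ru])
  obtain v where v [simp]: "A.tvalid v" "ttrg v = M" and rv: "r \<ast> v = A.tzero (tsrc v) K"
    and uni: "\<And>g. \<lbrakk>A.tvalid g; ttrg g = M; r \<ast> g = A.tzero (tsrc g) K\<rbrakk>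
      \<Longrightarrow> \<exists>!h. A.tvalid h \<and> tsrc h = tsrc g \<and> ttrg h = tsrc v \<and> v \<ast> h = g"
    using kernel[OF r(1)] unfolding r(2,3) by blast
  define N where "N = tsrc v"
  have [simp]: "tsrc v = N" "N \<in> Ob C" using v A.src_Ob by (auto simp: N_def)
  have rv0: "r \<ast> v \<ast> x = A.tzero N K \<ast> x" for x using T.comp_eq_comp[OF rv] by simp
  have mono: "h = h'" if h: "A.tvalid h" "A.tvalid h'" "ttrg h = N" "ttrg h' = N" "tsrc h = tsrc h'" "v \<ast> h = v \<ast> h'" for h h'
  proof -
    have "\<exists>!x. A.tvalid x \<and> tsrc x = tsrc (v \<ast> h) \<and> ttrg x = tsrc v \<and> v \<ast> x = v \<ast> h"
      by (rule uni) (use h in \<open>simp_all add: rv0\<close>)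
    then show ?thesis using h by auto
  qed
  define g where "g = A.tplus (tI M) (A.tscale (-1) (u \<ast> r))"
  have [simp]: "A.tvalid g" "tsrc g = M" "ttrg g = M" by (simp_all add: g_def)
  have "r \<ast> g = A.tzero M K"
    using A.plus_neg[of r] by (simp add: g_def T.comp_plus_right rux)
  then obtain r' where r' [simp]: "A.tvalid r'" "tsrc r' = M" "ttrg r' = N" and vr': "v \<ast> r' = g"
    using uni[of g] by auto
  have "A.tplus (u \<ast> r) (v \<ast> r') = A.tplus (tI M) (A.tplus (u \<ast> r) (A.tscale (-1) (u \<ast> r)))"
    unfolding vr' g_def by (simp add: A.plus_ac)
  also have "\<dots> = tI M" using A.plus_neg[of "u \<ast> r"] by simp
  finally have sum: "A.tplus (u \<ast> r) (v \<ast> r') = tI M" .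
  have vrx: "v \<ast> r' \<ast> x = g \<ast> x" for x by (rule T.comp_eq_comp[OF vr'])
  have r'v: "r' \<ast> v = tI N"
    by (rule mono) (simp_all add: vrx, simp add: g_def T.comp_plus_left rv)
  have r'u: "r' \<ast> u = A.tzero K N"
    by (rule mono) (use A.plus_neg[of u] in \<open>simp_all add: vrx\<close>, use A.plus_neg[of u] in \<open>simp add: g_def T.comp_plus_left ru\<close>)
  have "T.bip K N M u v r r'"
    using sum r'v r'u ru rv by (simp add: T.bip_def)
  then show ?thesis by blast
qed

lemma mono_arrowI:
  assumes "A \<in> Ob C" "B \<in> Ob C" "f \<in> Hom C A B"
    and "\<And>g h. \<lbrakk>A.tvalid g; A.tvalid h; tsrc g = tsrc h; ttrg g = A; ttrg h = A; Some (A, B, f) \<ast> g = Some (A, B, f) \<ast> h\<rbrakk>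
      \<Longrightarrow> g = h"
  shows "mono_arrow C A B f"
  unfolding mono_arrow_def
proof (intro conjI ballI impI assms(3))
  fix E g h assume E: "E \<in> Ob C" "g \<in> Hom C E A" "h \<in> Hom C E A" "f \<cdot> g = f \<cdot> h"
  have "Some (E, A, g) = Some (E, A, h)" by (rule assms(4)) (use assms(1-3) E in simp_all)
  then show "g = h" by simp
qed

lemma simple_nonzero: "simple_object C X \<Longrightarrow> X \<in> Ob C" "simple_object C X \<Longrightarrow> tI X \<noteq> A.tzero X X"
  using zob_iff[of X] by (auto simp: simple_object_def T.zob_def)

text \<open>The kernel of \<open>f\<close> is a subobject of \<open>X\<close> and not all of
  \<open>X\<close>, since \<open>f\<close> is nonzero; so it vanishes and \<open>f\<close> is a
  monomorphism. Then \<open>f\<close> is a nonzero subobject of \<open>Y\<close>, hence invertible.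
  Simplicity enters once for each object.\<close>

lemma schur:
  assumes X: "simple_object C X" and Y: "simple_object C Y"
    and f: "A.tvalid f" "tsrc f = X" "ttrg f = Y" and nz: "f \<noteq> A.tzero X Y"
  obtains g where "T.inverse_pair X Y f g"
proof -
  have [simp]: "X \<in> Ob C" "Y \<in> Ob C" using simple_nonzero X Y by blast+
  note [simp] = f
  obtain v where v [simp]: "A.tvalid v" "ttrg v = X" and fv: "f \<ast> v = A.tzero (tsrc v) Y"
    and uni: "\<And>g. \<lbrakk>A.tvalid g; ttrg g = X; f \<ast> g = A.tzero (tsrc g) Y\<rbrakk>
      \<Longrightarrow> \<exists>!h. A.tvalid h \<and> tsrc h = tsrc g \<and> ttrg h = tsrc v \<and> v \<ast> h = g"
    using kernel[OF f(1)] unfolding f(2,3) by blast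
  define K where "K = tsrc v"
  have [simp]: "tsrc v = K" "K \<in> Ob C" using v A.src_Ob by (auto simp: K_def)
  have fvx: "f \<ast> v \<ast> x = A.tzero K Y \<ast> x" for x using T.comp_eq_comp[OF fv] by simp
  obtain v0 where v0: "v = Some (K, X, v0)" "v0 \<in> Hom C K X"
    by (rule arrow_cases[of v K X]) simp_all
  obtain f0 where f0: "f = Some (X, Y, f0)" "f0 \<in> Hom C X Y"
    by (rule arrow_cases[of f X Y]) simp_all
  have "mono_arrow C K X v0"
  proof (rule mono_arrowI)
    fix g h assume h: "A.tvalid g" "A.tvalid h" "tsrc g = tsrc h" "ttrg g = K" "ttrg h = K"
      "Some (K, X, v0) \<ast> g = Some (K, X, v0) \<ast> h"
    then have "\<exists>!x. A.tvalid x \<and> tsrc x = tsrc (v \<ast> h) \<and> ttrg x = tsrc v \<and> v \<ast> x = v \<ast> h"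
      by (intro uni) (simp_all add: fvx)
    then show "g = h" using h v0 by auto
  qed (use v0 in simp_all)
  moreover have "\<not> iso_arrow C K X v0"
  proof
    assume "iso_arrow C K X v0"
    then obtain w0 where "inverse_arrows C K X v0 w0" by (auto simp: iso_arrow_def)
    then have p: "T.inverse_pair K X v (Some (X, K, w0))" using inverse_pair_iff[of K X] v0 by simp
    note T.inverse_pairD[OF p]
    then have "f = (f \<ast> v) \<ast> Some (X, K, w0)" by simp
    also have "\<dots> = A.tzero X Y" unfolding fv using T.inverse_pairD[OF p] by simp
    finally show False using nz by simp
  qed
  ultimately have "T.zob K" using X zob_iff by (auto simp: simple_object_def)
  have "mono_arrow C X Y f0"
  proof (rule mono_arrowI)
    fix g h assume h: "A.tvalid g" "A.tvalid h" "tsrc g = tsrc h" "ttrg g = X" "ttrg h = X"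
      and eq: "Some (X, Y, f0) \<ast> g = Some (X, Y, f0) \<ast> h"
    have eq': "f \<ast> g = f \<ast> h" using eq f0 by simp
    define d where "d = A.tplus g (A.tscale (-1) h)"
    have d: "A.tvalid d" "tsrc d = tsrc h" "ttrg d = X" using h by (simp_all add: d_def)
    have "f \<ast> d = A.tzero (tsrc h) Y"
      using h A.plus_neg[of "f \<ast> h"] by (simp add: d_def T.comp_plus_right eq')
    then obtain k where k: "A.tvalid k" "tsrc k = tsrc h" "ttrg k = K" "v \<ast> k = d"
      using uni[of d] d by auto
    have "k = A.tzero (tsrc h) K" using T.zob_arr(1)[OF \<open>T.zob K\<close>, of k] k by simp
    then have "d = A.tzero (tsrc h) X" using k h by simp
    then show "g = h" unfolding d_def by (rule A.eq_of_diff_zero) (use h in simp_all)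
  qed (use f0 in simp_all)
  \<comment> \<open>The first alternative is excluded because \<open>X\<close>, being simple, is not
    a zero object.\<close>
  then have "zero_object C X \<or> iso_arrow C X Y f0" using Y by (simp add: simple_object_def)
  then obtain g0 where "inverse_arrows C X Y f0 g0"
    using X by (auto simp: simple_object_def iso_arrow_def)
  then show thesis using that inverse_pair_iff[of X Y f0 g0] f0 by simp
qed

section \<open>Endomorphisms of a simple object are scalars\<close>

definition peval :: "'o \<Rightarrow> ('o \<times> 'o \<times> 'm) option \<Rightarrow> 'k poly \<Rightarrow> ('o \<times> 'o \<times> 'm) option" where
  "peval X f p = foldr (\<lambda>a y. A.tplus (A.tscale a (tI X)) (f \<ast> y)) (coeffs p) (A.tzero X X)"

context
  fixes X f
  assumes X [simp]: "X \<in> Ob C" and f [simp]: "A.tvalid f" "tsrc f = X" "ttrg f = X"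
begin

lemma peval_0 [simp]: "peval X f 0 = A.tzero X X"
  by (simp add: peval_def)

lemma peval_pCons: "peval X f (pCons a p) = A.tplus (A.tscale a (tI X)) (f \<ast> peval X f p)"
proof -
  \<comment> \<open>Needed because a zero coefficient in front of the zero polynomial leaves no
    trace in the coefficient list; the right-hand side is then zero as well.\<close>
  have "A.tscale 0 (tI X) = A.tzero X X" using A.scale_zero[of "tI X"] by simp
  then show ?thesis by (simp add: peval_def cCons_def)
qed

lemma peval_type [simp]: "A.tvalid (peval X f p)" "tsrc (peval X f p) = X" "ttrg (peval X f p) = X"
  by (induction p) (simp_all add: peval_pCons)

lemma peval_add: "peval X f (p + q) = A.tplus (peval X f p) (peval X f q)"
proof (induction p q rule: poly_induct2)
  case (pCons a p b q)
  then show ?case by (simp add: peval_pCons A.scale_add T.comp_plus_right A.plus_ac)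
qed simp

lemma peval_smult: "peval X f (Polynomial.smult c p) = A.tscale c (peval X f p)"
  by (induction p) (simp_all add: peval_pCons A.scale_plus)

lemma peval_root_factor: "peval X f ([:- r, 1:] * q) = A.tplus f (A.tscale (- r) (tI X)) \<ast> peval X f q"
proof -
  have "A.tscale 0 (tI X) = A.tzero X X" using A.scale_zero[of "tI X"] by simp
  then have "peval X f (pCons 0 q) = f \<ast> peval X f q" by (simp add: peval_pCons)
  moreover have "[:- r, 1:] * q = Polynomial.smult (- r) q + pCons 0 q" by simp
  ultimately have "peval X f ([:- r, 1:] * q) = A.tplus (A.tscale (- r) (peval X f q)) (f \<ast> peval X f q)"
    by (simp only: peval_add peval_smult)
  then show ?thesis by (simp add: T.comp_plus_left A.plus_commute)
qed

text \<open>A root \<open>r\<close> of the annihilating polynomial exists. Either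
  \<open>f - r\<close> is zero and \<open>f\<close> is a scalar, or it is invertible by Schur's
  lemma and can be cancelled, which leaves an annihilator of smaller degree. A constant annihilator
  would make the identity zero.\<close>

lemma scalar_of_annihilator:
  assumes simple: "simple_object C X" and "p \<noteq> 0" "peval X f p = A.tzero X X"
  shows "\<exists>c. f = A.tscale c (tI X)"
  using assms(2,3)
proof (induction "degree p" arbitrary: p rule: less_induct)
  case less
  show ?case
  proof (cases "degree p = 0")
    case True
    then obtain a where a: "p = [:a:]" by (auto elim: degree_eq_zeroE)
    then have "A.tscale a (tI X) = A.tzero X X" using less.prems by (simp add: peval_pCons)
    then have "tI X = A.tzero X X" by (rule A.scale_eq_zero) (use a less.prems in simp_all)
    then show ?thesis using simple_nonzero(2)[OF simple] by blast
  next
    case False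
    then obtain r where "poly p r = 0" using alg_closed_imp_poly_has_root[of p] by blast
    then obtain q where q: "p = [:- r, 1:] * q" by (auto simp: poly_eq_0_iff_dvd)
    have q0: "q \<noteq> 0" "degree q < degree p"
    proof -
      show "q \<noteq> 0" using q less.prems(1) by auto
      then show "degree q < degree p" unfolding q using degree_mult_eq[of "[:- r, 1:]" q] by simp
    qed
    let ?g = "A.tplus f (A.tscale (- r) (tI X))"
    have g: "?g \<ast> peval X f q = A.tzero X X" using less.prems(2) unfolding q peval_root_factor .
    show ?thesis
    proof (cases "?g = A.tzero X X")
      case True
      have "A.tplus f (A.tscale (-1) (A.tscale r (tI X))) = A.tzero X X" using True by simp
      then have "f = A.tscale r (tI X)" by (rule A.eq_of_diff_zero) simp_all
      then show ?thesis by blast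
    next
      case False
      have "A.tvalid ?g" "tsrc ?g = X" "ttrg ?g = X" by simp_all
      then obtain h where h: "T.inverse_pair X X ?g h" using schur[OF simple simple _ _ _ False] by metis
      note T.inverse_pairD[OF h]
      then have "peval X f q = h \<ast> ?g \<ast> peval X f q" by simp
      also have "\<dots> = A.tzero X X" unfolding g using T.inverse_pairD[OF h] by simp
      finally show ?thesis using less.hyps[OF q0(2,1)] by blast
    qed
  qed
qed

definition tpow :: "nat \<Rightarrow> ('o \<times> 'o \<times> 'm) option" where "tpow m = ((\<ast>) f ^^ m) (tI X)"

lemma tpow_simps [simp]: "tpow 0 = tI X" "tpow (Suc m) = f \<ast> tpow m"
  by (simp_all add: tpow_def)

lemma tpow_type [simp]: "A.tvalid (tpow m)" "tsrc (tpow m) = X" "ttrg (tpow m) = X"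
  by (induction m) simp_all

lemma peval_monom: "peval X f (Polynomial.monom c m) = A.tscale c (tpow m)"
proof (induction m)
  case (Suc m)
  have "A.tscale 0 (tI X) = A.tzero X X" using A.scale_zero[of "tI X"] by simp
  with Suc show ?case by (simp add: monom_Suc peval_pCons)
qed (simp add: monom_0 peval_pCons)

lemma tpow_raw: "tval (tpow m) \<in> Hom C X X" "tpow m = Some (X, X, tval (tpow m))"
  by (rule arrow_cases[of "tpow m" X X]; simp)+

text \<open>The powers of \<open>f\<close> live in a finite-dimensional space, so some nontrivial
  combination of them vanishes.\<close>

lemma annihilator_exists: "\<exists>p. p \<noteq> 0 \<and> peval X f p = A.tzero X X"
proof -
  let ?V = "hom_space C X X"
  interpret V: vectorspace "class_ring :: 'k ring" ?V by (rule Hom_vectorspace) simp_all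
  let ?r = "\<lambda>m. tval (tpow m)"
  show ?thesis
  \<comment> \<open>Linear dependence concerns the set of powers, in which repetitions are
    invisible. If two powers coincide, the difference of two monomials annihilates \<open>f\<close>;
    otherwise the set of powers is infinite and therefore dependent.\<close>
  proof (cases "inj ?r")
    case False
    then obtain i j where ij: "i \<noteq> j" "?r i = ?r j" by (auto simp: inj_def)
    then have "tpow i = tpow j" using tpow_raw(2)[of i] tpow_raw(2)[of j] by metis
    then have "peval X f (Polynomial.monom 1 i + Polynomial.smult (-1) (Polynomial.monom 1 j)) = A.tzero X X"
      using A.plus_neg[of "tpow j"] by (simp only: peval_add peval_smult peval_monom) simp
    moreover have "Polynomial.coeff (Polynomial.monom 1 i + Polynomial.smult (-1) (Polynomial.monom 1 j)) i \<noteq> (0 :: 'k)" using ij by simp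
    ultimately show ?thesis by (metis coeff_0)
  next
    case True
    have sub: "range ?r \<subseteq> carrier ?V" using tpow_raw(1) by auto
    have "\<not> finite (range ?r)" using True range_inj_infinite by blast
    then have "V.lin_dep (range ?r)"
      using V.fin_dim_li_fin[OF Hom_fin_dim[OF X X] _ sub] by blast
    then obtain A a v where A: "finite A" "A \<subseteq> range ?r" "V.lincomb a A = ZeroM C X X" "v \<in> A" "a v \<noteq> 0"
      unfolding V.lin_dep_def by auto
    define S where "S = ?r -` A"
    have S: "finite S" "A = ?r ` S"
      using A True by (auto simp: S_def finite_vimageI)
    define c where "c i = a (?r i)" for i
    have "peval X f (\<Sum>i\<in>S. Polynomial.monom (c i) i) = Some (X, X, finsum ?V (\<lambda>i. c i \<odot>\<^bsub>?V\<^esub> ?r i) S)"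
      using S(1)
    proof (induction S rule: finite_induct)
      case empty
      have "finsum ?V (\<lambda>i. c i \<odot>\<^bsub>?V\<^esub> ?r i) {} = \<zero>\<^bsub>?V\<^esub>" by (rule V.finsum_empty)
      then show ?case by (simp add: A.tzero_def)
    next
      case (insert i S)
      have cl: "(\<lambda>i. c i \<odot>\<^bsub>?V\<^esub> ?r i) \<in> S \<rightarrow> carrier ?V" "c i \<odot>\<^bsub>?V\<^esub> ?r i \<in> carrier ?V"
        using tpow_raw(1) raw_Hom(1)[OF X X] by auto
      have "peval X f (\<Sum>i\<in>insert i S. Polynomial.monom (c i) i) =
          A.tplus (A.tscale (c i) (tpow i)) (Some (X, X, finsum ?V (\<lambda>i. c i \<odot>\<^bsub>?V\<^esub> ?r i) S))"
        using insert by (simp add: peval_add peval_monom)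
      also have "\<dots> = Some (X, X, c i \<odot>\<^bsub>?V\<^esub> ?r i \<oplus>\<^bsub>?V\<^esub> finsum ?V (\<lambda>i. c i \<odot>\<^bsub>?V\<^esub> ?r i) S)"
      proof -
        have w: "finsum ?V (\<lambda>i. c i \<odot>\<^bsub>?V\<^esub> ?r i) S \<in> Hom C X X" using V.finsum_closed[OF cl(1)] by simp
        have "A.tplus (A.tscale (c i) (Some (X, X, t))) (Some (X, X, w)) = Some (X, X, c i \<odot>\<^bsub>?V\<^esub> t \<oplus>\<^bsub>?V\<^esub> w)"
          if "t \<in> Hom C X X" "w \<in> Hom C X X" for t w using that by (simp add: raw_Hom)
        from this[OF tpow_raw(1)[of i] w] show ?thesis unfolding tpow_raw(2)[symmetric] .
      qed
      also have "\<dots> = Some (X, X, finsum ?V (\<lambda>i. c i \<odot>\<^bsub>?V\<^esub> ?r i) (insert i S))"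
        using V.finsum_insert[OF insert(1,2) cl] by simp
      finally show ?case .
    qed
    also have "finsum ?V (\<lambda>i. c i \<odot>\<^bsub>?V\<^esub> ?r i) S = V.lincomb a A"
    proof -
      have "finsum ?V (\<lambda>v. a v \<odot>\<^bsub>?V\<^esub> v) (?r ` S) = finsum ?V (\<lambda>i. a (?r i) \<odot>\<^bsub>?V\<^esub> ?r i) S"
        by (rule V.finsum_reindex)
          (use tpow_raw(1) raw_Hom(1)[OF X X] True in \<open>auto intro: inj_on_subset\<close>)
      then show ?thesis unfolding V.lincomb_def S(2) c_def by simp
    qed
    finally have zero: "peval X f (\<Sum>i\<in>S. Polynomial.monom (c i) i) = A.tzero X X" unfolding A(3) A.tzero_def by simp
    obtain m where m: "m \<in> S" "?r m = v" using A(4) S(2) by auto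
    moreover have "Polynomial.coeff (\<Sum>i\<in>S. Polynomial.monom (c i) i) m = c m"
      using S(1) m by (simp add: coeff_sum coeff_monom sum.delta)
    ultimately have "Polynomial.coeff (\<Sum>i\<in>S. Polynomial.monom (c i) i) m \<noteq> 0"
      using A(5) unfolding c_def by simp
    then have "(\<Sum>i\<in>S. Polynomial.monom (c i) i) \<noteq> 0" by auto
    with zero show ?thesis by blast
  qed
qed

end

lemma simple_End:
  assumes "simple_object C X" "A.tvalid f" "tsrc f = X" "ttrg f = X"
  shows "\<exists>c. f = A.tscale c (tI X)"
  using annihilator_exists[of X f] scalar_of_annihilator[of X f] assms simple_nonzero(1) by blast

lemma lsum_finsum:
  assumes M: "M \<in> Ob C" and h: "\<And>i. i < m \<Longrightarrow> h i \<in> Hom C M M"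
  shows "A.lsum M M (map (\<lambda>i. Some (M, M, h i)) [0..<m]) = Some (M, M, finsum (hom_space C M M) h {..<m})"
  using h
proof (induction m)
  interpret V: vectorspace "class_ring :: 'k ring" "hom_space C M M" by (rule Hom_vectorspace[OF M M])
  case 0
  have "finsum (hom_space C M M) h {} = \<zero>\<^bsub>hom_space C M M\<^esub>" by (rule V.finsum_empty)
  have "A.lsum M M (map (\<lambda>i. Some (M, M, h i)) [0..<0]) = A.tzero M M" by simp
  also have "\<dots> = Some (M, M, finsum (hom_space C M M) h {..<0})" by (simp add: A.tzero_def)
  finally show ?case .
next
  interpret V: vectorspace "class_ring :: 'k ring" "hom_space C M M" by (rule Hom_vectorspace[OF M M])
  case (Suc m)
  have cl: "h \<in> {..<m} \<rightarrow> carrier (hom_space C M M)" "h m \<in> carrier (hom_space C M M)" using Suc.prems by auto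
  have fin: "finsum (hom_space C M M) h {..<m} \<in> Hom C M M" using V.finsum_closed[OF cl(1)] by simp
  have "A.lsum M M (map (\<lambda>i. Some (M, M, h i)) [0..<Suc m]) =
      A.tplus (A.lsum M M (map (\<lambda>i. Some (M, M, h i)) [0..<m])) (A.lsum M M [Some (M, M, h m)])"
    unfolding upt_Suc_append[OF le0] map_append list.map
    by (rule A.lsum_append) (use M Suc.prems in auto)
  also have "\<dots> = Some (M, M, finsum (hom_space C M M) h {..<m} \<uplus> h m)"
    using Suc fin M by simp
  also have "\<dots> = Some (M, M, finsum (hom_space C M M) h {..<Suc m})"
    using V.finsum_insert[of "{..<m}" m, OF _ _ cl] fin cl(2) V.a_comm[of "h m"] by (simp add: lessThan_Suc)
  finally show ?case .
qed

end

locale fusion_simples = fusion C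
  for C :: "('o, 'm, 'k::{alg_closed_field, field_char_0}, 'x) rigid_braided_category_data_scheme" (structure) +
  fixes n :: nat and X :: "nat \<Rightarrow> 'o"
  assumes reps: "simple_representatives C n X"
begin

lemma X_simple: "i \<in> {1..n} \<Longrightarrow> simple_object C (X i)"
  using reps unfolding simple_representatives_def by blast

text \<open>Each simple summand is replaced by its representative. The isomorphism and its inverse
  meet in the middle of \<open>\<iota> \<ast> \<pi>\<close>, so the sum of these composites is
  unchanged.\<close>

lemma X_decomposition:
  assumes M: "M \<in> Ob C"
  shows "\<exists>bs. (\<forall>(i, \<iota>, \<pi>)\<in>set bs. i \<in> {1..n} \<and> \<iota> \<in> T.hom (X i) M \<and> \<pi> \<in> T.hom M (X i) \<and> \<pi> \<ast> \<iota> = tI (X i)) \<and>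
    A.lsum M M (map (\<lambda>(i, \<iota>, \<pi>). \<iota> \<ast> \<pi>) bs) = tI M"
proof -
  obtain m :: nat and S \<iota> \<pi> where S: "\<forall>i<m. simple_object C (S i) \<and> \<iota> i \<in> Hom C (S i) M \<and> \<pi> i \<in> Hom C M (S i)"
    and pi: "\<forall>i<m. \<forall>j<m. \<pi> i \<cdot> \<iota> j = (if i = j then Ident C (S i) else ZeroM C (S j) (S i))"
    and sum: "finsum (hom_space C M M) (\<lambda>i. \<iota> i \<cdot> \<pi> i) {..<m} = Ident C M"
    using semisimple[OF M] unfolding semisimple_object_def by blast
  have SO: "S i \<in> Ob C" if "i < m" for i using S that simple_nonzero(1) by blast
  have "\<exists>t g h. t \<in> {1..n} \<and> T.inverse_pair (S i) (X t) g h" if "i < m" for i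
    using reps S that unfolding simple_representatives_def isomorphic_iff by blast
  then obtain t g h where t: "\<And>i. i < m \<Longrightarrow> t i \<in> {1..n} \<and> T.inverse_pair (S i) (X (t i)) (g i) (h i)"
    by metis
  let ?\<iota> = "\<lambda>i. Some (S i, M, \<iota> i)" and ?\<pi> = "\<lambda>i. Some (M, S i, \<pi> i)"
  let ?bs = "map (\<lambda>i. (t i, ?\<iota> i \<ast> h i, g i \<ast> ?\<pi> i)) [0..<m]"
  have i: "t i \<in> {1..n} \<and> ?\<iota> i \<ast> h i \<in> T.hom (X (t i)) M \<and> g i \<ast> ?\<pi> i \<in> T.hom M (X (t i)) \<and>
      (g i \<ast> ?\<pi> i) \<ast> (?\<iota> i \<ast> h i) = tI (X (t i)) \<and> (?\<iota> i \<ast> h i) \<ast> (g i \<ast> ?\<pi> i) = Some (M, M, \<iota> i \<cdot> \<pi> i)"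
    if "i < m" for i
  proof -
    have ti: "t i \<in> {1..n}" and gh: "T.inverse_pair (S i) (X (t i)) (g i) (h i)" using t[OF that] by auto
    note [simp] = T.inverse_pairD[OF gh] SO[OF that] M
    have [simp]: "\<iota> i \<in> Hom C (S i) M" "\<pi> i \<in> Hom C M (S i)" using S that by blast+
    have "?\<pi> i \<ast> ?\<iota> i = tI (S i)" using pi that by (simp add: tI_def)
    from T.comp_eq_comp[OF this] have 1: "?\<pi> i \<ast> ?\<iota> i \<ast> x = tI (S i) \<ast> x" for x .
    show ?thesis using ti by (simp add: 1 del: tcomp_Some) simp
  qed
  have "A.lsum M M (map (\<lambda>(i, \<iota>, \<pi>). \<iota> \<ast> \<pi>) ?bs) = A.lsum M M (map (\<lambda>i. Some (M, M, \<iota> i \<cdot> \<pi> i)) [0..<m])"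
    by (rule arg_cong[where f = "A.lsum M M"]) (use i in \<open>simp add: comp_def\<close>)
  also have "\<dots> = tI M"
    using lsum_finsum[OF M, of m "\<lambda>i. \<iota> i \<cdot> \<pi> i"] Comp_Hom[OF M SO M] S sum by (simp add: tI_def)
  finally show ?thesis using i by (intro exI[of _ ?bs]) auto
qed

sublocale S: semisimple_forms "Ob C" A.tvalid tsrc ttrg A.tplus A.tscale A.tzero F.tvalid tsrc ttrg F.tplus F.tscale F.tzero
  tI tcomp tact tswap "Dual C" tev "{1..n}" X
proof
  show "\<exists>Z. T.zob Z" using zero_object_exists zob_iff by blast
  show "\<exists>S i j p q. T.bip M N S i j p q" if "M \<in> Ob C" "N \<in> Ob C" for M N
    using biproduct_exists[OF that] ex_bip_iff by blast
  show "\<exists>N v r'. T.bip K N M u v r r'"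
    if "A.tvalid u" "A.tvalid r" "tsrc u = K" "ttrg u = M" "tsrc r = M" "ttrg r = K" "r \<ast> u = tI K" for u r K M
    using retraction_complement that by blast
  show "\<exists>z. z * z = c" for c :: 'k
  proof -
    obtain z where "poly [:- c, 0, 1:] z = 0" using alg_closed_imp_poly_has_root[of "[:- c, 0, 1:]"] by auto
    then show ?thesis by (intro exI[of _ z]) simp
  qed
  show "finite {1..n}" by simp
  show "X i \<in> Ob C" "tI (X i) \<noteq> A.tzero (X i) (X i)" if "i \<in> {1..n}" for i
    using simple_nonzero X_simple[OF that] by blast+
  show "\<exists>c. f = A.tscale c (tI (X i))" if "i \<in> {1..n}" "A.tvalid f" "tsrc f = X i" "ttrg f = X i" for i f
    using simple_End X_simple that by blast
  show "f = A.tzero (X i) (X j)"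
    if h: "i \<in> {1..n}" "j \<in> {1..n}" "i \<noteq> j" "A.tvalid f" "tsrc f = X i" "ttrg f = X j" for i j f
  proof (rule ccontr)
    assume "f \<noteq> A.tzero (X i) (X j)"
    then obtain g where "T.inverse_pair (X i) (X j) f g" 
      by (rule schur[OF X_simple[OF h(1)] X_simple[OF h(2)] h(4-6)])
    then have "isomorphic C (X i) (X j)" using isomorphic_iff by blast
    then show False using reps h unfolding simple_representatives_def by blast
  qed
  show "\<exists>bs. (\<forall>(i, \<iota>, \<pi>)\<in>set bs. i \<in> {1..n} \<and> \<iota> \<in> T.hom (X i) M \<and> \<pi> \<in> T.hom M (X i) \<and> \<pi> \<ast> \<iota> = tI (X i)) \<and>
    A.lsum M M (map (\<lambda>(i, \<iota>, \<pi>). \<iota> \<ast> \<pi>) bs) = tI M" if "M \<in> Ob C" for M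
    using X_decomposition[OF that] .
qed

end

section \<open>Quadratic objects of a braided fusion category as typed forms\<close>

context fusion
begin

text \<open>The adjoint map is the transpose of \<open>b\<close> along the chosen dual, so pairing
  it with the evaluation returns \<open>b\<close>.\<close>

lemma adjoint_map_typed:
  assumes M: "M \<in> Ob C" and b: "b \<in> Hom C (M \<diamondop>\<^sub>o M) (Unit C)"
  shows "A.tvalid (Some (M, Dual C M, adjoint_map C M b))"
    "tact (tev M) (Some (M, Dual C M, adjoint_map C M b)) (tI M) = Some (M, M, b)"
proof -
  let ?N = "Dual C M" and ?b = "Some (M, M, b)"
  let ?c = "Some (Unit C, M \<diamondop>\<^sub>o ?N, Coev C M)"
  have d: "duality C M ?N (Ev C M) (Coev C M)" by (rule Dual[OF M])
  have N: "?N \<in> Ob C" and c: "Coev C M \<in> Hom C (Unit C) (M \<diamondop>\<^sub>o ?N)" using d by (auto simp: duality_def)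
  have dp: "M.dual_pair M ?N (larr (tev M)) ?c" using duality_dual_pair[OF d] by (simp add: tev_def)
  note [simp] = M N b c TensorO_Ob Unit_Ob Ident_Hom
  have a: "AssocInv C M M ?N \<in> Hom C (M \<diamondop>\<^sub>o (M \<diamondop>\<^sub>o ?N)) ((M \<diamondop>\<^sub>o M) \<diamondop>\<^sub>o ?N)"
    "LUnit C ?N \<in> Hom C (Unit C \<diamondop>\<^sub>o ?N) ?N" "inv_arrow C (M \<diamondop>\<^sub>o Unit C) M (RUnit C M) \<in> Hom C M (M \<diamondop>\<^sub>o Unit C)"
    using iso_inverse_Some(2)[OF _ _ Assoc_iso] iso_inverse_Some(1)[OF _ _ LUnit_iso] iso_inverse_Some(2)[OF _ _ RUnit_iso]
    by (simp_all add: AssocInv_def)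
  have t: "b \<diamondop> Ident C ?N \<in> Hom C ((M \<diamondop>\<^sub>o M) \<diamondop>\<^sub>o ?N) (Unit C \<diamondop>\<^sub>o ?N)"
    "Ident C M \<diamondop> Coev C M \<in> Hom C (M \<diamondop>\<^sub>o Unit C) (M \<diamondop>\<^sub>o (M \<diamondop>\<^sub>o ?N))"
    by (auto intro!: TensorM_Hom)
  have h1: "LUnit C ?N \<cdot> (b \<diamondop> Ident C ?N) \<in> Hom C ((M \<diamondop>\<^sub>o M) \<diamondop>\<^sub>o ?N) ?N"
    using Comp_Hom[OF _ _ _ t(1) a(2)] by simp
  have h2: "LUnit C ?N \<cdot> (b \<diamondop> Ident C ?N) \<cdot> AssocInv C M M ?N \<in> Hom C (M \<diamondop>\<^sub>o (M \<diamondop>\<^sub>o ?N)) ?N"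
    using Comp_Hom[OF _ _ _ a(1) h1] by simp
  have h3: "LUnit C ?N \<cdot> (b \<diamondop> Ident C ?N) \<cdot> AssocInv C M M ?N \<cdot> (Ident C M \<diamondop> Coev C M) \<in> Hom C (M \<diamondop>\<^sub>o Unit C) ?N"
    using Comp_Hom[OF _ _ _ t(2) h2] by simp
  have h4: "adjoint_map C M b \<in> Hom C M ?N"
    using Comp_Hom[OF _ _ _ a(3) h3] by (simp add: adjoint_map_def)
  then show v: "A.tvalid (Some (M, ?N, adjoint_map C M b))" by simp
  have tr: "M.transpose M ?N ?c M (larr ?b) = Some (M, ?N, adjoint_map C M b)"
    unfolding M.transpose_def tcomp_assoc[symmetric] adjoint_map_def
    using a t h1 h2 h3 by (simp add: larr_def tten_def tI_def)
  have Fb: "F.tvalid ?b" by simp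
  have "larr (tev M) \<ast> tten (M.transpose M ?N ?c M (larr ?b)) (tI M) = larr ?b"
    by (rule M.ev_transpose[OF dp]) (use larr_type[OF Fb] in simp_all)
  then have "larr (tact (tev M) (Some (M, ?N, adjoint_map C M b)) (tI M)) = larr ?b"
    unfolding tr by (subst larr_act) (use h4 d in \<open>simp_all add: tev_def duality_def\<close>)
  then show "tact (tev M) (Some (M, ?N, adjoint_map C M b)) (tI M) = ?b"
    by (rule larr_inj[rotated 4]) (use h4 T.ev_type[of M] T.act_type[of "tev M" "Some (M, ?N, adjoint_map C M b)" "tI M"] in simp_all)
qed

text \<open>By the previous lemma \<open>b\<close> is the pullback of the perfect form
  \<open>tev M\<close> along the adjoint map, and such a pullback is perfect iff the arrow is
  invertible.\<close>

lemma nonsingular_iff: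
  assumes M: "M \<in> Ob C" and b: "b \<in> Hom C (M \<diamondop>\<^sub>o M) (Unit C)"
  shows "nonsingular_form C M b \<longleftrightarrow> T.perfect (Some (M, M, b))"
proof -
  let ?h = "Some (M, Dual C M, adjoint_map C M b)"
  note h = adjoint_map_typed[OF M b]
  have N: "Dual C M \<in> Ob C" using M by simp
  have "iso_arrow C M (Dual C M) (adjoint_map C M b) \<longleftrightarrow> T.perfect (Some (M, M, b))"
  proof
    assume "iso_arrow C M (Dual C M) (adjoint_map C M b)"
    then obtain g where "T.inverse_pair M (Dual C M) ?h (Some (Dual C M, M, g))"
      using inverse_pair_iff[OF M N] by (auto simp: iso_arrow_def)
    then have "T.perfect (tact (tev M) ?h (tI M))"
      using T.perfect_iso[OF T.perfect_ev[OF M], of M ?h] M by simp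
    then show "T.perfect (Some (M, M, b))" unfolding h(2) .
  next
    assume "T.perfect (Some (M, M, b))"
    then obtain g where "T.inverse_pair M (Dual C M) ?h g"
      using T.perfect_iso_arrow[OF T.perfect_ev[OF M] h(1)] h(2) M by auto
    from inverse_pair_raw(3)[OF this] show "iso_arrow C M (Dual C M) (adjoint_map C M b)"
      by (auto simp: iso_arrow_def)
  qed
  then show ?thesis using b by (simp add: nonsingular_form_def)
qed

definition tform :: "'o \<times> 'm \<Rightarrow> ('o \<times> 'o \<times> 'm) option" where
  "tform = (\<lambda>(M, b). Some (M, M, b))"

lemma tform_simps [simp]: "tform (M, b) = Some (M, M, b)" "tsrc (tform q) = fst q" "ttrg (tform q) = fst q"
  by (cases q; simp add: tform_def)+

lemma tform_surj:
  assumes "F.tvalid b" "ttrg b = tsrc b"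
  obtains q where "tform q = b"
proof -
  obtain A B \<beta> where "b = Some (A, B, \<beta>)" using F.tvalidE[OF assms(1)] by metis
  then show thesis using that[of "(A, \<beta>)"] assms(2) by (simp add: tform_def)
qed

lemma quad_iff: "q \<in> quadratic_objects C \<longleftrightarrow> T.quad (tform q)"
proof -
  obtain M b where q: "q = (M, b)" by (metis surj_pair)
  show ?thesis
  proof (cases "M \<in> Ob C \<and> b \<in> Hom C (M \<diamondop>\<^sub>o M) (Unit C)")
    case True
    then show ?thesis
      unfolding T.quad_def quadratic_objects_def q using nonsingular_iff[of M b] by (auto simp: symmetric_form_def)
  next
    case False
    then have "\<not> T.quad (tform q)" using T.quadD(1)[of "tform q"] by (auto simp: q)
    moreover have "q \<notin> quadratic_objects C"
      using False by (auto simp: q quadratic_objects_def symmetric_form_def)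
    ultimately show ?thesis by blast
  qed
qed

lemma isometric_iff:
  assumes "F.tvalid (tform q)" "F.tvalid (tform q')"
  shows "isometric C q q' \<longleftrightarrow> T.isom (tform q) (tform q')"
proof -
  obtain M b M' b' where q: "q = (M, b)" "q' = (M', b')" by (metis surj_pair)
  have M [simp]: "M \<in> Ob C" "M' \<in> Ob C" "b \<in> Hom C (M \<diamondop>\<^sub>o M) (Unit C)" "b' \<in> Hom C (M' \<diamondop>\<^sub>o M') (Unit C)"
    using assms q by (simp_all add: tform_def)
  have act: "tact (Some (M', M', b')) (Some (M, M', f)) (Some (M, M', f)) = Some (M, M, b) \<longleftrightarrow> b' \<cdot> (f \<diamondop> f) = b"
    if "f \<in> Hom C M M'" for f using that by simp
  show ?thesis
  proof
    assume "isometric C q q'"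
    then obtain f g where fg: "inverse_arrows C M M' f g" "b' \<cdot> (f \<diamondop> f) = b"
      by (auto simp: isometric_def q iso_arrow_def)
    then have "T.inverse_pair M M' (Some (M, M', f)) (Some (M', M, g))" using inverse_pair_iff by simp
    moreover have "f \<in> Hom C M M'" using fg by (simp add: inverse_arrows_def)
    ultimately show "T.isom (tform q) (tform q')"
      using act[of f] fg(2) assms by (auto simp: T.isom_def tform_def q)
  next
    assume "T.isom (tform q) (tform q')"
    then obtain f g where fg: "T.inverse_pair M M' f g" "tact (Some (M', M', b')) f f = Some (M, M, b)"
      by (auto simp: T.isom_def tform_def q)
    note r = inverse_pair_raw[OF fg(1)]
    have "tval f \<in> Hom C M M'" using r(3) by (simp add: inverse_arrows_def)
    then have "b' \<cdot> (tval f \<diamondop> tval f) = b" using act[of "tval f"] fg(2) unfolding r(1)[symmetric] by simp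
    then show "isometric C q q'" using r(3) by (auto simp: isometric_def q iso_arrow_def)
  qed
qed

lemma act_sum_typed:
  assumes "biproduct C M M' S i j p q" "b \<in> Hom C (M \<diamondop>\<^sub>o M) (Unit C)" "b' \<in> Hom C (M' \<diamondop>\<^sub>o M') (Unit C)"
  shows "F.tplus (tact (Some (M, M, b)) (Some (S, M, p)) (Some (S, M, p))) (tact (Some (M', M', b')) (Some (S, M', q)) (Some (S, M', q)))
    = Some (S, S, b \<cdot> (p \<diamondop> p) \<uplus> b' \<cdot> (q \<diamondop> q))"
  using assms form_comp_closed(2)[of M M S S b p p] form_comp_closed(2)[of M' M' S S b' q q]
  by (simp add: biproduct_def)

lemma orthogonal_sum_iff:
  assumes "F.tvalid (tform u)" "F.tvalid (tform v)" "F.tvalid (tform w)"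
  shows "orthogonal_sum C u v w \<longleftrightarrow> T.osum (tform u) (tform v) (tform w)"
proof -
  obtain M b M' b' S s where q: "u = (M, b)" "v = (M', b')" "w = (S, s)" by (metis surj_pair)
  have M: "b \<in> Hom C (M \<diamondop>\<^sub>o M) (Unit C)" "b' \<in> Hom C (M' \<diamondop>\<^sub>o M') (Unit C)"
    using assms q by (simp_all add: tform_def)
  show ?thesis
  proof
    assume "orthogonal_sum C u v w"
    then obtain i j p p' where bp: "biproduct C M M' S i j p p'" and s: "s = b \<cdot> (p \<diamondop> p) \<uplus> b' \<cdot> (p' \<diamondop> p')"
      by (auto simp: orthogonal_sum_def q)
    note x = bp[folded bip_iff] act_sum_typed[OF bp M]
    have "\<exists>i j p p'. T.bip M M' S i j p p' \<and>
        Some (S, S, s) = F.tplus (tact (Some (M, M, b)) p p) (tact (Some (M', M', b')) p' p')"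
      using x(1) x(2)[symmetric] unfolding s by blast
    then show "T.osum (tform u) (tform v) (tform w)"
      using assms unfolding T.osum_def q tform_simps typed_simps by blast
  next
    assume "T.osum (tform u) (tform v) (tform w)"
    then obtain i j p p' where bp: "T.bip M M' S i j p p'"
      and s: "Some (S, S, s) = F.tplus (tact (Some (M, M, b)) p p) (tact (Some (M', M', b')) p' p')"
      unfolding T.osum_def q tform_def by auto
    note bp' = bip_raw[OF bp] and d = T.bipD[OF bp]
    have p: "p = Some (S, M, tval p)" by (rule arrow_eq) (use d in blast)+
    have p': "p' = Some (S, M', tval p')" by (rule arrow_eq) (use d in blast)+
    have "s = b \<cdot> (tval p \<diamondop> tval p) \<uplus> b' \<cdot> (tval p' \<diamondop> tval p')"
      using s act_sum_typed[OF bp' M] unfolding p[symmetric] p'[symmetric] by simp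
    then show "orthogonal_sum C u v w" using bp' by (auto simp: orthogonal_sum_def q)
  qed
qed

lemma tev_raw: "M \<in> Ob C \<Longrightarrow> Dual C M \<in> Ob C \<and> Ev C M \<in> Hom C (Dual C M \<diamondop>\<^sub>o M) (Unit C)"
  using Dual[of M] by (simp add: duality_def)

lemma weakly_symmetric_iff: "weakly_symmetric C M \<longleftrightarrow> T.ws M"
proof (cases "M \<in> Ob C")
  case True
  then show ?thesis
    using tev_raw[OF True] swap_closed[of "Dual C M" M "Ev C M"]
    by (auto simp: weakly_symmetric_def T.ws_def tev_def)
qed (simp add: weakly_symmetric_def T.ws_def)

lemma hyp_sum_typed:
  assumes bp: "biproduct C M (Dual C M) S i j p q"
  shows "F.tplus (tact (tev M) (Some (S, Dual C M, q)) (Some (S, M, p)))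
      (tact (tswap (tev M)) (Some (S, M, p)) (Some (S, Dual C M, q)))
    = Some (S, S, Ev C M \<cdot> (q \<diamondop> p) \<uplus> Ev C M \<cdot> Braid C M (Dual C M) \<cdot> (p \<diamondop> q))"
proof -
  have o [simp]: "M \<in> Ob C" "S \<in> Ob C" "p \<in> Hom C S M" "q \<in> Hom C S (Dual C M)"
    using bp by (simp_all add: biproduct_def)
  have e [simp]: "Dual C M \<in> Ob C" "Ev C M \<in> Hom C (Dual C M \<diamondop>\<^sub>o M) (Unit C)" using tev_raw[of M] by simp_all
  note s = swap_closed[OF e(1) o(1) e(2)]
  show ?thesis
    using s form_comp_closed(2)[OF e(1) o(1) o(2,2) e(2) o(4,3)] form_comp_closed(2)[OF o(1) e(1) o(2,2) s o(3,4)]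
    by (simp add: tev_def)
qed

lemma hyperbolic_object_iff:
  assumes "F.tvalid (tform w)"
  shows "hyperbolic_object C M w \<longleftrightarrow> T.hyp M (tform w)"
proof -
  obtain S s where q: "w = (S, s)" by (metis surj_pair)
  show ?thesis
  proof
    assume "hyperbolic_object C M w"
    then obtain i j p p' where bp: "biproduct C M (Dual C M) S i j p p'"
      and s: "s = Ev C M \<cdot> (p' \<diamondop> p) \<uplus> Ev C M \<cdot> Braid C M (Dual C M) \<cdot> (p \<diamondop> p')"
      by (auto simp: hyperbolic_object_def q)
    note x = bp[folded bip_iff] hyp_sum_typed[OF bp]
    have "\<exists>i j p p'. T.bip M (Dual C M) S i j p p' \<and>
        Some (S, S, s) = F.tplus (tact (tev M) p' p) (tact (tswap (tev M)) p p')"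
      using x(1) x(2)[symmetric] unfolding s by blast
    then show "T.hyp M (tform w)"
      using assms unfolding T.hyp_def q tform_simps typed_simps by blast
  next
    assume "T.hyp M (tform w)"
    then obtain i j p p' where bp: "T.bip M (Dual C M) S i j p p'"
      and s: "Some (S, S, s) = F.tplus (tact (tev M) p' p) (tact (tswap (tev M)) p p')"
      unfolding T.hyp_def q tform_def by auto
    note bp' = bip_raw[OF bp] and d = T.bipD[OF bp]
    have p: "p = Some (S, M, tval p)" by (rule arrow_eq) (use d in blast)+
    have p': "p' = Some (S, Dual C M, tval p')" by (rule arrow_eq) (use d in blast)+
    have "s = Ev C M \<cdot> (tval p' \<diamondop> tval p) \<uplus> Ev C M \<cdot> Braid C M (Dual C M) \<cdot> (tval p \<diamondop> tval p')"
      using s hyp_sum_typed[OF bp'] unfolding p[symmetric] p'[symmetric] by simp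
    then show "hyperbolic_object C M w" using bp' by (auto simp: hyperbolic_object_def q)
  qed
qed

end

section \<open>The Witt group\<close>

context fusion
begin

lemma quad_frm: "q \<in> quadratic_objects C \<Longrightarrow> F.tvalid (tform q)"
  by (simp add: quad_iff)

lemma quadratic_isometric_iff:
  "\<lbrakk>q \<in> quadratic_objects C; q' \<in> quadratic_objects C\<rbrakk> \<Longrightarrow> isometric C q q' \<longleftrightarrow> T.isom (tform q) (tform q')"
  by (intro isometric_iff quad_frm)

lemma quadratic_sum_iff:
  "\<lbrakk>u \<in> quadratic_objects C; v \<in> quadratic_objects C; w \<in> quadratic_objects C\<rbrakk> \<Longrightarrow>
    orthogonal_sum C u v w \<longleftrightarrow> T.osum (tform u) (tform v) (tform w)"
  by (intro orthogonal_sum_iff quad_frm)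

lemmas quadratic_iffs = quadratic_isometric_iff quadratic_sum_iff

lemma quad_surj:
  assumes "T.quad b"
  obtains q where "q \<in> quadratic_objects C" "tform q = b"
proof -
  obtain q where "tform q = b" by (rule tform_surj[of b]) (use assms in simp_all)
  then show thesis using that assms quad_iff by blast
qed

lemma sum_of_quads:
  assumes "T.quad b" "T.quad b'"
  obtains s where "T.quad s" "T.osum b b' s"
proof -
  have "tsrc b \<in> Ob C" "tsrc b' \<in> Ob C" using assms by simp_all
  then obtain S i j p q where "T.bip (tsrc b) (tsrc b') S i j p q"
    using biproduct_exists ex_bip_iff by metis
  then have "T.osum b b' (F.tplus (tact b p p) (tact b' q q))"
    by (intro T.osum_exists) (use assms in simp_all)
  then show thesis using that T.osum_quad assms by blast
qed

sublocale Quad: sum_relation "quadratic_objects C" "isometric C" "orthogonal_sum C"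
  "{(Z, z) \<in> quadratic_objects C. zero_object C Z}"
proof
  let ?E = "{(Z, z) \<in> quadratic_objects C. zero_object C Z}"
  have E: "z \<in> ?E \<longleftrightarrow> z \<in> quadratic_objects C \<and> T.zob (tsrc (tform z))" for z
    using zob_iff by (auto simp: case_prod_beta)
  fix u v w p q r u' v' q' z z'
  note q = quad_iff[THEN iffD1]
  show "isometric C u u" if "u \<in> quadratic_objects C"
    using that T.isom_refl quadratic_iffs q[OF that] by simp
  show "isometric C v u" if "u \<in> quadratic_objects C" "v \<in> quadratic_objects C" "isometric C u v"
    using that T.isom_sym quadratic_iffs by blast
  show "isometric C u w" if h: "u \<in> quadratic_objects C" "v \<in> quadratic_objects C" "w \<in> quadratic_objects C"
    "isometric C u v" "isometric C v w"
    unfolding quadratic_isometric_iff[OF h(1,3)]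
    by (rule T.isom_trans[OF h(4)[unfolded quadratic_isometric_iff[OF h(1,2)]] h(5)[unfolded quadratic_isometric_iff[OF h(2,3)]]])
  show "\<exists>q\<in>quadratic_objects C. orthogonal_sum C u v q" if uv: "u \<in> quadratic_objects C" "v \<in> quadratic_objects C"
  proof -
    obtain s where s: "T.quad s" "T.osum (tform u) (tform v) s" using sum_of_quads q[OF uv(1)] q[OF uv(2)] by blast
    obtain w where "w \<in> quadratic_objects C" "tform w = s" using quad_surj[OF s(1)] .
    then show ?thesis using s(2) uv quadratic_sum_iff by blast
  qed
  show "isometric C q q'"
    if h: "u \<in> quadratic_objects C" "v \<in> quadratic_objects C" "u' \<in> quadratic_objects C" "v' \<in> quadratic_objects C"
      "q \<in> quadratic_objects C" "q' \<in> quadratic_objects C" "orthogonal_sum C u v q" "orthogonal_sum C u' v' q'"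
      "isometric C u u'" "isometric C v v'"
    unfolding quadratic_isometric_iff[OF h(5,6)]
    by (rule T.osum_unique[OF h(7)[unfolded quadratic_sum_iff[OF h(1,2,5)]] h(8)[unfolded quadratic_sum_iff[OF h(3,4,6)]]
          h(9)[unfolded quadratic_isometric_iff[OF h(1,3)]] h(10)[unfolded quadratic_isometric_iff[OF h(2,4)]]])
  show "orthogonal_sum C u v q'"
    if h: "u \<in> quadratic_objects C" "v \<in> quadratic_objects C" "q \<in> quadratic_objects C" "q' \<in> quadratic_objects C"
      "orthogonal_sum C u v q" "isometric C q q'"
    unfolding quadratic_sum_iff[OF h(1,2,4)]
    by (rule T.osum_transport[OF h(5)[unfolded quadratic_sum_iff[OF h(1,2,3)]] h(6)[unfolded quadratic_isometric_iff[OF h(3,4)]]])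
  show "orthogonal_sum C v u q"
    if h: "u \<in> quadratic_objects C" "v \<in> quadratic_objects C" "q \<in> quadratic_objects C" "orthogonal_sum C u v q"
    unfolding quadratic_sum_iff[OF h(2,1,3)]
    by (rule T.osum_commute[OF h(4)[unfolded quadratic_sum_iff[OF h(1,2,3)]]])
  show "orthogonal_sum C u r q"
    if h: "u \<in> quadratic_objects C" "v \<in> quadratic_objects C" "w \<in> quadratic_objects C" "p \<in> quadratic_objects C"
      "q \<in> quadratic_objects C" "r \<in> quadratic_objects C"
      "orthogonal_sum C u v p" "orthogonal_sum C p w q" "orthogonal_sum C v w r"
    unfolding quadratic_sum_iff[OF h(1,6,5)]
    by (rule T.osum_assoc[OF h(7)[unfolded quadratic_sum_iff[OF h(1,2,4)]] h(8)[unfolded quadratic_sum_iff[OF h(4,3,5)]]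
          h(9)[unfolded quadratic_sum_iff[OF h(2,3,6)]]])
  show "?E \<subseteq> quadratic_objects C" by auto
  obtain Z where Z: "T.zob Z" using zero_object_exists zob_iff by blast
  obtain q where "q \<in> quadratic_objects C" "tform q = F.tzero Z Z" using quad_surj[OF T.zob_quad[OF Z]] .
  then show "?E \<noteq> {}" using E[of q] Z by auto
  show "isometric C z z' \<longleftrightarrow> z' \<in> ?E" if "z \<in> ?E" "z' \<in> quadratic_objects C"
    using that T.zob_isom[of "tform z" "tform z'"] quadratic_isometric_iff[of z z'] quad_iff unfolding E by blast
  show "orthogonal_sum C z u u" if "z \<in> ?E" "u \<in> quadratic_objects C"
    using that T.zob_osum[of "tform z" "tform u"] quadratic_sum_iff[of z u u] quad_iff unfolding E by blast
qed

lemma isometry_class_eq: "isometry_class C = Quad.cls"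
  by (simp add: fun_eq_iff isometry_class_def Quad.cls_def)

lemma quadratic_monoid_eq: "quadratic_monoid C = Quad.class_monoid"
  by (simp add: quadratic_monoid_def Quad.class_monoid_def isometry_class_eq)

lemma ws_Ob: "T.ws M \<Longrightarrow> M \<in> Ob C"
  by (simp add: T.ws_def)

sublocale Weak: sum_relation "{M. weakly_symmetric C M}" "isomorphic C"
  "\<lambda>M N S. \<exists>i\<^sub>1 i\<^sub>2 p\<^sub>1 p\<^sub>2. biproduct C M N S i\<^sub>1 i\<^sub>2 p\<^sub>1 p\<^sub>2" "{Z. weakly_symmetric C Z \<and> zero_object C Z}"
  unfolding weakly_symmetric_iff isomorphic_iff ex_bip_iff[symmetric] zob_iff[symmetric]
proof (unfold_locales, unfold mem_Collect_eq)
  fix M N S M' N' S' L R Z Z'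
  show "\<exists>f g. T.inverse_pair M M f g" if "T.ws M" using T.inverse_pair_I ws_Ob that by blast
  show "\<exists>f g. T.inverse_pair N M f g" if "\<exists>f g. T.inverse_pair M N f g" using T.inverse_pair_sym that by blast
  show "\<exists>f g. T.inverse_pair M S f g" if "\<exists>f g. T.inverse_pair M N f g" "\<exists>f g. T.inverse_pair N S f g"
    using T.inverse_pair_comp that by blast
  show "\<exists>S\<in>{M. T.ws M}. \<exists>i j p q. T.bip M N S i j p q" if h: "T.ws M" "T.ws N"
  proof -
    obtain S i j p q where "T.bip M N S i j p q"
      using biproduct_exists[OF ws_Ob[OF h(1)] ws_Ob[OF h(2)]] ex_bip_iff by metis
    then show ?thesis using T.ws_bip h by blast
  qed
  show "\<exists>f g. T.inverse_pair S S' f g"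
    if "\<exists>i j p q. T.bip M N S i j p q" "\<exists>i j p q. T.bip M' N' S' i j p q"
      "\<exists>f g. T.inverse_pair M M' f g" "\<exists>f g. T.inverse_pair N N' f g"
    using that T.bip_unique by blast
  show "\<exists>i j p q. T.bip M N S' i j p q" if "\<exists>i j p q. T.bip M N S i j p q" "\<exists>f g. T.inverse_pair S S' f g"
    using that T.bip_transport by blast
  show "\<exists>i j p q. T.bip N M S i j p q" if "\<exists>i j p q. T.bip M N S i j p q" using that T.bip_commute by blast
  show "\<exists>i j p q. T.bip M R S i j p q" if "\<exists>i j p q. T.bip M N M' i j p q" "\<exists>i j p q. T.bip M' L S i j p q"
    "\<exists>i j p q. T.bip N L R i j p q" using that by (elim exE) (intro exI, erule (2) T.bip_assoc)
  show "{Z. T.ws Z \<and> T.zob Z} \<subseteq> {M. T.ws M}" by blast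
  show "{Z. T.ws Z \<and> T.zob Z} \<noteq> {}" using zero_object_exists zob_iff T.ws_zob by blast
  show "(\<exists>f g. T.inverse_pair Z Z' f g) \<longleftrightarrow> T.ws Z' \<and> T.zob Z'" if "T.ws Z \<and> T.zob Z" "T.ws Z'"
    using that T.zob_iso T.zob_inverse_pair by blast
  show "\<exists>i j p q. T.bip Z M M i j p q" if "T.ws Z \<and> T.zob Z" "T.ws M" using that T.bip_zob ws_Ob by blast
qed

lemma weakly_symmetric_class_eq: "weakly_symmetric_class C = Weak.cls"
  by (simp add: fun_eq_iff weakly_symmetric_class_def Weak.cls_def)

lemma weakly_symmetric_monoid_eq: "weakly_symmetric_monoid C = Weak.class_monoid"
  by (simp add: weakly_symmetric_monoid_def Weak.class_monoid_def weakly_symmetric_class_eq)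

lemma hyperbolic_exists:
  assumes "T.ws M"
  obtains q where "q \<in> quadratic_objects C" "T.hyp M (tform q)"
proof -
  have "M \<in> Ob C" by (rule ws_Ob[OF assms])
  then obtain S i j p q where "T.bip M (Dual C M) S i j p q"
    using biproduct_exists[of M "Dual C M"] ex_bip_iff T.ev_type(1) by metis
  then have h: "T.hyp M (F.tplus (tact (tev M) q p) (tact (tswap (tev M)) p q))" by (rule T.hyp_exists)
  obtain w where w: "w \<in> quadratic_objects C" "tform w = F.tplus (tact (tev M) q p) (tact (tswap (tev M)) p q)"
    using quad_surj[OF T.hyp_quad[OF h assms]] .
  then show thesis using that h by simp
qed

text \<open>Hyperbolic objects of isomorphic objects are isometric, and everything isometric to a
  hyperbolic object is hyperbolic on the same \<open>M\<close>. So the set collected by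
  \<open>hyperbolic_class\<close> is exactly one isometry class.\<close>

lemma hyperbolic_class_eq:
  assumes M: "T.ws M" and q: "q \<in> quadratic_objects C" "T.hyp M (tform q)"
  shows "hyperbolic_class C (Weak.cls M) = Quad.cls q"
proof -
  have "isometric C q q'" if q': "q' \<in> quadratic_objects C" and h: "M' \<in> Weak.cls M" "hyperbolic_object C M' q'" for q' M'
  proof -
    have "isomorphic C M M'" "weakly_symmetric C M'" using h(1) by (simp_all add: Weak.cls_def)
    then obtain f g where fg: "T.inverse_pair M M' f g" "T.ws M'"
      unfolding weakly_symmetric_iff isomorphic_iff by blast
    have "T.hyp M (tform q')"
      using T.hyp_iso_object[OF _ fg(2) T.inverse_pair_sym[OF fg(1)]] h(2) hyperbolic_object_iff[OF quad_frm[OF q']] by blast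
    then show ?thesis using T.hyp_unique[OF q(2)] quadratic_isometric_iff[OF q(1) q'] by blast
  qed
  moreover have "hyperbolic_object C M q'" if "q' \<in> quadratic_objects C" "isometric C q q'" for q'
    using T.hyp_transport[OF q(2)] quadratic_isometric_iff[OF q(1) that(1)] that(2)
      hyperbolic_object_iff[OF quad_frm[OF that(1)]] by blast
  moreover have "M \<in> Weak.cls M" by (rule Weak.cls_self) (use M in \<open>simp add: weakly_symmetric_iff\<close>)
  ultimately show ?thesis unfolding hyperbolic_class_def Quad.cls_def by blast
qed

lemma class_monoid_carrier:
  "carrier (weakly_symmetric_monoid C) = Weak.cls ` {M. T.ws M}"
  "carrier (quadratic_monoid C) = Quad.cls ` quadratic_objects C"
  unfolding weakly_symmetric_monoid_eq Weak.class_monoid_def quadratic_monoid_eq Quad.class_monoid_def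
    weakly_symmetric_iff[symmetric] by simp_all

lemma class_monoid_one:
  "T.zob Z \<Longrightarrow> \<one>\<^bsub>weakly_symmetric_monoid C\<^esub> = Weak.cls Z"
  "\<lbrakk>q \<in> quadratic_objects C; T.zob (fst q)\<rbrakk> \<Longrightarrow> \<one>\<^bsub>quadratic_monoid C\<^esub> = Quad.cls q"
proof -
  show "\<one>\<^bsub>weakly_symmetric_monoid C\<^esub> = Weak.cls Z" if "T.zob Z"
    using Weak.cls_E[of Z] T.ws_zob[OF that] that
    unfolding weakly_symmetric_monoid_eq Weak.class_monoid_def zob_iff by (simp add: weakly_symmetric_iff)
  show "\<one>\<^bsub>quadratic_monoid C\<^esub> = Quad.cls q" if "q \<in> quadratic_objects C" "T.zob (fst q)"
    using Quad.cls_E[of q] that by (simp add: quadratic_monoid_eq Quad.class_monoid_def zob_iff case_prod_beta)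
qed

lemma quadratic_class_mult:
  "\<lbrakk>u \<in> quadratic_objects C; v \<in> quadratic_objects C; w \<in> quadratic_objects C; T.osum (tform u) (tform v) (tform w)\<rbrakk>
    \<Longrightarrow> Quad.cls u \<otimes>\<^bsub>quadratic_monoid C\<^esub> Quad.cls v = Quad.cls w"
  unfolding quadratic_monoid_eq by (rule Quad.cls_mult) (simp_all add: quadratic_sum_iff)

sublocale Witt: comm_monoid_hom "weakly_symmetric_monoid C" "quadratic_monoid C" "hyperbolic_class C"
proof (intro comm_monoid_hom.intro comm_monoid_hom_axioms.intro)
  show "comm_monoid (weakly_symmetric_monoid C)" "comm_monoid (quadratic_monoid C)"
    unfolding weakly_symmetric_monoid_eq quadratic_monoid_eq
    by (rule Weak.comm_monoid_class_monoid Quad.comm_monoid_class_monoid)+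
next
  fix c assume "c \<in> carrier (weakly_symmetric_monoid C)"
  then obtain M where M: "c = Weak.cls M" "T.ws M" by (auto simp: class_monoid_carrier)
  obtain q where q: "q \<in> quadratic_objects C" "T.hyp M (tform q)" using hyperbolic_exists[OF M(2)] .
  show "hyperbolic_class C c \<in> carrier (quadratic_monoid C)"
    unfolding M(1) hyperbolic_class_eq[OF M(2) q] class_monoid_carrier using q(1) by blast
next
  fix c d assume "c \<in> carrier (weakly_symmetric_monoid C)" "d \<in> carrier (weakly_symmetric_monoid C)"
  then obtain M N where M: "c = Weak.cls M" "T.ws M" and N: "d = Weak.cls N" "T.ws N"
    by (auto simp: class_monoid_carrier)
  obtain q where q: "q \<in> quadratic_objects C" "T.hyp M (tform q)" using hyperbolic_exists[OF M(2)] .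
  obtain r where r: "r \<in> quadratic_objects C" "T.hyp N (tform r)" using hyperbolic_exists[OF N(2)] .
  obtain t0 where t0: "T.quad t0" "T.osum (tform q) (tform r) t0"
    using sum_of_quads q(1) r(1) unfolding quad_iff by blast
  obtain t where t: "t \<in> quadratic_objects C" "T.osum (tform q) (tform r) (tform t)"
    using quad_surj[OF t0(1)] t0(2) by metis
  obtain S i j p p' where S: "T.bip M N S i j p p'"
    using biproduct_exists[OF ws_Ob[OF M(2)] ws_Ob[OF N(2)]] ex_bip_iff by metis
  have wsS: "T.ws S" by (rule T.ws_bip[OF S M(2) N(2)])
  have "c \<otimes>\<^bsub>weakly_symmetric_monoid C\<^esub> d = Weak.cls S"
    unfolding weakly_symmetric_monoid_eq M(1) N(1)
    by (rule Weak.cls_mult) (use M(2) N(2) wsS bip_raw[OF S] in \<open>auto simp: weakly_symmetric_iff\<close>)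
  then show "hyperbolic_class C (c \<otimes>\<^bsub>weakly_symmetric_monoid C\<^esub> d) =
      hyperbolic_class C c \<otimes>\<^bsub>quadratic_monoid C\<^esub> hyperbolic_class C d"
    using hyperbolic_class_eq[OF wsS t(1) T.hyp_osum[OF q(2) M(2) r(2) N(2) t(2) S]]
      hyperbolic_class_eq[OF M(2) q] hyperbolic_class_eq[OF N(2) r] quadratic_class_mult[OF q(1) r(1) t] M(1) N(1) by simp
next
  obtain Z where Z: "T.zob Z" using zero_object_exists zob_iff by blast
  obtain q where q: "q \<in> quadratic_objects C" "tform q = F.tzero Z Z" using quad_surj[OF T.zob_quad[OF Z]] .
  have "fst q = Z" using q(2) tform_simps(2)[of q] by simp
  moreover have "T.hyp Z (tform q)"
    using T.hyp_zob[OF T.zob_quad[OF Z]] Z q(2) by simp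
  ultimately show "hyperbolic_class C \<one>\<^bsub>weakly_symmetric_monoid C\<^esub> = \<one>\<^bsub>quadratic_monoid C\<^esub>"
    using class_monoid_one(1)[OF Z] class_monoid_one(2)[OF q(1)] hyperbolic_class_eq[OF T.ws_zob[OF Z] q(1)] Z by simp
qed

lemma witt_group_eq: "witt_group C = Witt.W"
  by (simp add: witt_group_def K0_quadratic_def hyperbolic_subgroup_def Witt.image_subgroup_def)

lemma witt_class_eq: "witt_class C q = Witt.coset_class (Quad.cls q)"
  by (simp add: witt_class_def K0_quadratic_def hyperbolic_subgroup_def Witt.image_subgroup_def
      Witt.coset_class_def isometry_class_eq)

end

context fusion_simples
begin

declare One_nat_def [simp del]

lemma witt_group_comm: "comm_group (witt_group C)"
  unfolding witt_group_eq by (rule Witt.W_comm_group)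

sublocale WG: comm_group "witt_group C" by (rule witt_group_comm)

lemma quadratic_class_closed: "q \<in> quadratic_objects C \<Longrightarrow> Quad.cls q \<in> carrier (quadratic_monoid C)"
  by (simp add: class_monoid_carrier)

lemma witt_class_closed: "q \<in> quadratic_objects C \<Longrightarrow> witt_class C q \<in> carrier (witt_group C)"
  unfolding witt_group_eq witt_class_eq by (intro Witt.coset_class_closed quadratic_class_closed)

lemma witt_class_sum:
  "\<lbrakk>u \<in> quadratic_objects C; v \<in> quadratic_objects C; w \<in> quadratic_objects C; T.osum (tform u) (tform v) (tform w)\<rbrakk>
    \<Longrightarrow> witt_class C w = witt_class C u \<otimes>\<^bsub>witt_group C\<^esub> witt_class C v"
  using Witt.coset_class_mult[OF quadratic_class_closed[of u] quadratic_class_closed[of v]] quadratic_class_mult[of u v w]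
  unfolding witt_group_eq witt_class_eq by metis

lemma witt_class_isom:
  "\<lbrakk>u \<in> quadratic_objects C; v \<in> quadratic_objects C; T.isom (tform u) (tform v)\<rbrakk> \<Longrightarrow> witt_class C u = witt_class C v"
  using Quad.cls_eq_iff[of u v] quadratic_isometric_iff[of u v] by (simp add: witt_class_eq)

lemma witt_class_hyp:
  assumes "T.ws M" "q \<in> quadratic_objects C" "T.hyp M (tform q)"
  shows "witt_class C q = \<one>\<^bsub>witt_group C\<^esub>"
proof -
  have "Weak.cls M \<in> carrier (weakly_symmetric_monoid C)" using assms(1) by (simp add: class_monoid_carrier)
  from Witt.coset_class_f[OF this] show ?thesis
    unfolding witt_group_eq witt_class_eq hyperbolic_class_eq[OF assms] .
qed

lemma quadratic_sum:
  assumes "u \<in> quadratic_objects C" "v \<in> quadratic_objects C"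
  obtains w where "w \<in> quadratic_objects C" "T.osum (tform u) (tform v) (tform w)"
proof -
  obtain s where s: "T.quad s" "T.osum (tform u) (tform v) s" using sum_of_quads assms unfolding quad_iff by blast
  obtain w where "w \<in> quadratic_objects C" "tform w = s" using quad_surj[OF s(1)] .
  then show thesis using that s(2) by blast
qed

lemma witt_class_square:
  assumes q: "q \<in> quadratic_objects C"
  shows "witt_class C q \<otimes>\<^bsub>witt_group C\<^esub> witt_class C q = \<one>\<^bsub>witt_group C\<^esub>"
proof -
  have Q: "T.quad (tform q)" using q quad_iff by blast
  obtain w where w: "w \<in> quadratic_objects C" "T.osum (tform q) (tform q) (tform w)" using quadratic_sum[OF q q] .
  obtain z where "z * z = (-1 :: 'k)" using S.sqrt_ex by blast
  from T.osum_double_hyp[OF Q w(2) this] T.quad_ws[OF Q] show ?thesis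
    using witt_class_sum[OF q q w] witt_class_hyp[OF _ w(1)] by metis
qed

text \<open>In exponent two a class is its own inverse, so the difference of two quadratic objects
  is represented by their orthogonal sum.\<close>

lemma witt_class_surj:
  assumes x: "x \<in> carrier (witt_group C)"
  obtains q where "q \<in> quadratic_objects C" "x = witt_class C q"
proof -
  obtain a b where ab: "a \<in> carrier (quadratic_monoid C)" "b \<in> carrier (quadratic_monoid C)"
    "x = Witt.coset_class a \<otimes>\<^bsub>witt_group C\<^esub> inv\<^bsub>witt_group C\<^esub> Witt.coset_class b"
    using Witt.coset_class_surj x unfolding witt_group_eq by blast
  then obtain u v where u: "u \<in> quadratic_objects C" "a = Quad.cls u" and v: "v \<in> quadratic_objects C" "b = Quad.cls v"
    by (auto simp: class_monoid_carrier)
  have inv: "inv\<^bsub>witt_group C\<^esub> witt_class C v = witt_class C v"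
    by (rule WG.inv_equality) (use witt_class_square witt_class_closed v in auto)
  obtain w where w: "w \<in> quadratic_objects C" "T.osum (tform u) (tform v) (tform w)" using quadratic_sum[OF u(1) v(1)] .
  have "x = witt_class C w"
    using ab(3) inv witt_class_sum[OF u(1) v(1) w] unfolding u(2) v(2) witt_class_eq by simp
  then show thesis using that w(1) by blast
qed

sublocale WG: exponent_two_group "witt_group C"
  by unfold_locales (metis witt_class_surj witt_class_square)

text \<open>Vanishing means that \<open>q \<perp> h \<perp> r\<close> and \<open>k \<perp> r\<close>
  are isometric for hyperbolic \<open>h\<close> and \<open>k\<close>. Hyperbolic objects contain the
  self-dual \<open>X i\<close> an even number of times.\<close>

lemma witt_class_one_even:
  assumes q: "q \<in> quadratic_objects C" and one: "witt_class C q = \<one>\<^bsub>witt_group C\<^esub>" and i: "i \<in> S.symmetric_simples"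
  shows "even (S.mult i (fst q))"
proof -
  obtain c d t where c: "c \<in> carrier (weakly_symmetric_monoid C)" and d: "d \<in> carrier (weakly_symmetric_monoid C)"
    and t: "t \<in> carrier (quadratic_monoid C)"
    and eq: "Quad.cls q \<otimes>\<^bsub>quadratic_monoid C\<^esub> hyperbolic_class C d \<otimes>\<^bsub>quadratic_monoid C\<^esub> t =
      hyperbolic_class C c \<otimes>\<^bsub>quadratic_monoid C\<^esub> t"
    using one unfolding witt_group_eq witt_class_eq Witt.coset_class_eq_one_iff[OF quadratic_class_closed[OF q]] by blast
  obtain M N where M: "c = Weak.cls M" "T.ws M" and N: "d = Weak.cls N" "T.ws N"
    using c d by (auto simp: class_monoid_carrier)
  obtain r where r: "r \<in> quadratic_objects C" "t = Quad.cls r" using t by (auto simp: class_monoid_carrier)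
  obtain h where h: "h \<in> quadratic_objects C" "T.hyp N (tform h)" using hyperbolic_exists[OF N(2)] .
  obtain k where k: "k \<in> quadratic_objects C" "T.hyp M (tform k)" using hyperbolic_exists[OF M(2)] .
  obtain u where u: "u \<in> quadratic_objects C" "T.osum (tform q) (tform h) (tform u)" using quadratic_sum[OF q h(1)] .
  obtain v where v: "v \<in> quadratic_objects C" "T.osum (tform u) (tform r) (tform v)" using quadratic_sum[OF u(1) r(1)] .
  obtain w where w: "w \<in> quadratic_objects C" "T.osum (tform k) (tform r) (tform w)" using quadratic_sum[OF k(1) r(1)] .
  have "Quad.cls v = Quad.cls w"
    using eq unfolding M(1) N(1) r(2) hyperbolic_class_eq[OF N(2) h] hyperbolic_class_eq[OF M(2) k]
      quadratic_class_mult[OF q h(1) u] quadratic_class_mult[OF u(1) r(1) v] quadratic_class_mult[OF k(1) r(1) w] .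
  then have vw: "T.isom (tform v) (tform w)"
    using Quad.cls_eq_iff[OF v(1) w(1)] quadratic_isometric_iff[OF v(1) w(1)] by blast
  obtain e where e: "T.quad e" "tsrc e = X i" and iI: "i \<in> {1..n}" using i by (auto simp: S.symmetric_simples_def)
  have e': "ttrg e = X i" "T.perfect e" using T.quadD(2,4)[OF e(1)] e(2) by simp_all
  have "even (S.mult i (fst h))" "even (S.mult i (fst k))"
    using S.mult_hyp_even[OF iI h(2) e'(2) e(2) e'(1)] S.mult_hyp_even[OF iI k(2) e'(2) e(2) e'(1)] by simp_all
  \<comment> \<open>Comparing multiplicities moves the equation to the natural numbers, where the
    common summand \<open>r\<close> can be cancelled.\<close>
  moreover have "S.mult i (fst q) + S.mult i (fst h) + S.mult i (fst r) = S.mult i (fst k) + S.mult i (fst r)"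
    using S.mult_osum[OF iI u(2)] S.mult_osum[OF iI v(2)] S.mult_osum[OF iI w(2)] S.mult_isom[OF iI vw] by simp
  ultimately show ?thesis by (metis add_right_cancel even_add)
qed

section \<open>The classes of the simple quadratic objects form a basis\<close>

context
  fixes b :: "nat \<Rightarrow> 'm"
  assumes b: "\<And>i. i \<in> S.symmetric_simples \<Longrightarrow> (X i, b i) \<in> quadratic_objects C"
begin

abbreviation simple_class :: "nat \<Rightarrow> _" where "simple_class i \<equiv> witt_class C (X i, b i)"

lemma symmetric_simples_subset: "S.symmetric_simples \<subseteq> {1..n}" "finite S.symmetric_simples"
proof -
  show "S.symmetric_simples \<subseteq> {1..n}" by (auto simp: S.symmetric_simples_def)
  then show "finite S.symmetric_simples" using finite_subset by blast
qed

lemma simple_class_closed: "A \<subseteq> S.symmetric_simples \<Longrightarrow> simple_class \<in> A \<rightarrow> carrier (witt_group C)"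
  using b witt_class_closed by blast

text \<open>Since squares are trivial, multiplying by the class of \<open>i\<close> adds
  \<open>i\<close> to the index set or removes it.\<close>

lemma toggle_product:
  assumes A: "A \<subseteq> S.symmetric_simples" and i: "i \<in> S.symmetric_simples"
  shows "\<exists>B\<subseteq>S.symmetric_simples. simple_class i \<otimes>\<^bsub>witt_group C\<^esub> finprod (witt_group C) simple_class A =
    finprod (witt_group C) simple_class B"
proof -
  have fin: "finite A" "finite (A - {i})" using A symmetric_simples_subset(2) finite_subset by blast+
  have cl: "simple_class \<in> A \<rightarrow> carrier (witt_group C)" "simple_class \<in> A - {i} \<rightarrow> carrier (witt_group C)"
    "simple_class i \<in> carrier (witt_group C)"
    using simple_class_closed[of A] simple_class_closed[of "A - {i}"] A b witt_class_closed i by blast+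
  show ?thesis
  proof (cases "i \<in> A")
    case True
    have "finprod (witt_group C) simple_class (insert i (A - {i})) =
        simple_class i \<otimes>\<^bsub>witt_group C\<^esub> finprod (witt_group C) simple_class (A - {i})"
      by (rule WG.finprod_insert[OF fin(2) _ cl(2,3)]) simp
    then have "simple_class i \<otimes>\<^bsub>witt_group C\<^esub> finprod (witt_group C) simple_class A =
        finprod (witt_group C) simple_class (A - {i})"
      using True WG.square_one[OF cl(3)] WG.finprod_closed[OF cl(2)] cl(3)
      by (simp add: insert_absorb WG.m_assoc[symmetric])
    then show ?thesis using A by blast
  next
    case False
    then show ?thesis
      using WG.finprod_insert[OF fin(1) False cl(1,3)] A i by (intro exI[of _ "insert i A"]) simp
  qed
qed

lemma witt_class_span:
  assumes "q \<in> quadratic_objects C"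
  shows "\<exists>A\<subseteq>S.symmetric_simples. witt_class C q = finprod (witt_group C) simple_class A"
proof -
  \<comment> \<open>The induction runs over typed forms, so the claim quantifies over the quadratic
    objects that encode a given form.\<close>
  have "\<forall>q. q \<in> quadratic_objects C \<and> tform q = \<beta> \<longrightarrow>
      (\<exists>A\<subseteq>S.symmetric_simples. witt_class C q = finprod (witt_group C) simple_class A)" if "T.quad \<beta>" for \<beta>
    using that
  proof (induction \<beta> rule: S.quad_induct)
    case (zero \<beta>)
    have "T.ws (tsrc \<beta>)" "T.hyp (tsrc \<beta>) \<beta>" using T.ws_zob T.hyp_zob zero by blast+
    then have "witt_class C q = finprod (witt_group C) simple_class {}"
      if "q \<in> quadratic_objects C" "tform q = \<beta>" for q
      using witt_class_hyp[of "tsrc \<beta>" q] that by simp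
    then show ?case by blast
  next
    case (simple i \<gamma> \<beta>' \<beta>)
    obtain u where u: "u \<in> quadratic_objects C" "tform u = \<gamma>" using quad_surj[OF simple(2)] .
    obtain v where v: "v \<in> quadratic_objects C" "tform v = \<beta>'" using quad_surj[OF simple(4)] .
    have iI: "i \<in> {1..n}" using simple(1) symmetric_simples_subset(1) by blast
    have bi: "(X i, b i) \<in> quadratic_objects C" "T.quad (tform (X i, b i))"
      using b[OF simple(1)] quad_iff by blast+
    have "T.isom (tform u) (tform (X i, b i))"
      unfolding u(2) by (rule S.simple_quad_unique[OF iI bi(2) _ simple(2,3)]) simp
    then have wu: "witt_class C u = simple_class i" by (rule witt_class_isom[OF u(1) bi(1)])
    obtain A where A: "A \<subseteq> S.symmetric_simples" "witt_class C v = finprod (witt_group C) simple_class A"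
      using simple(7) v by blast
    obtain B where B: "B \<subseteq> S.symmetric_simples" "simple_class i \<otimes>\<^bsub>witt_group C\<^esub>
        finprod (witt_group C) simple_class A = finprod (witt_group C) simple_class B"
      using toggle_product[OF A(1) simple(1)] by blast
    have "witt_class C q = finprod (witt_group C) simple_class B"
      if "q \<in> quadratic_objects C" "tform q = \<beta>" for q
      using witt_class_sum[OF u(1) v(1) that(1)] simple(6) u(2) v(2) that(2) wu A(2) B(2) by simp
    then show ?case using B(1) by blast
  next
    case (hyperbolic M h \<beta>' \<beta>)
    obtain u where u: "u \<in> quadratic_objects C" "tform u = h" using quad_surj[OF hyperbolic(3)] .
    obtain v where v: "v \<in> quadratic_objects C" "tform v = \<beta>'" using quad_surj[OF hyperbolic(4)] .
    have "witt_class C u = \<one>\<^bsub>witt_group C\<^esub>" using witt_class_hyp[OF hyperbolic(1) u(1)] u(2) hyperbolic(2) by simp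
    moreover obtain A where A: "A \<subseteq> S.symmetric_simples" "witt_class C v = finprod (witt_group C) simple_class A"
      using hyperbolic(7) v by blast
    ultimately have "witt_class C q = finprod (witt_group C) simple_class A" if "q \<in> quadratic_objects C" "tform q = \<beta>" for q
      using witt_class_sum[OF u(1) v(1) that(1)] hyperbolic(6) u(2) v(2) that(2) witt_class_closed[OF v(1)] by simp
    then show ?case using A(1) by blast
  qed
  then show ?thesis using assms quad_iff by blast
qed

text \<open>Realises a product of simple classes by an object that contains each \<open>X i\<close>
  with \<open>i \<in> A\<close> once and no other, so that the parity criterion can be applied to
  it.\<close>

lemma simple_class_product:
  assumes "finite A" "A \<subseteq> S.symmetric_simples"
  shows "\<exists>q\<in>quadratic_objects C. witt_class C q = finprod (witt_group C) simple_class A \<and>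
    (\<forall>i\<in>{1..n}. S.mult i (fst q) = (if i \<in> A then 1 else 0))"
  using assms
proof (induction A rule: finite_induct)
  case empty
  obtain Z where Z: "T.zob Z" using S.zob_ex by blast
  obtain q where q: "q \<in> quadratic_objects C" "tform q = F.tzero Z Z" using quad_surj[OF T.zob_quad[OF Z]] .
  have fq: "fst q = Z" using q(2) tform_simps(2)[of q] by simp
  have "Z \<in> Ob C" using Z by (simp add: T.zob_def)
  \<comment> \<open>A zero object is a neutral summand, and additivity forces its multiplicities to
    vanish.\<close>
  then have "S.mult i Z = 0" if "i \<in> {1..n}" for i
    using S.mult_bip[OF that T.bip_zob[OF Z]] by simp
  moreover have "T.hyp Z (tform q)" using T.hyp_zob[OF T.zob_quad[OF Z]] Z q(2) by simp
  then have "witt_class C q = \<one>\<^bsub>witt_group C\<^esub>" by (rule witt_class_hyp[OF T.ws_zob[OF Z] q(1)])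
  ultimately show ?case using q(1) fq by (intro bexI[of _ q]) simp_all
next
  case (insert j A)
  then obtain q where q: "q \<in> quadratic_objects C" "witt_class C q = finprod (witt_group C) simple_class A"
    and m: "\<forall>i\<in>{1..n}. S.mult i (fst q) = (if i \<in> A then 1 else 0)" by blast
  have j: "j \<in> S.symmetric_simples" "j \<in> {1..n}" and A: "A \<subseteq> S.symmetric_simples"
    using insert.prems symmetric_simples_subset(1) by auto
  obtain w where w: "w \<in> quadratic_objects C" "T.osum (tform (X j, b j)) (tform q) (tform w)"
    using quadratic_sum[OF b[OF j(1)] q(1)] .
  have "witt_class C w = finprod (witt_group C) simple_class (insert j A)"
    using witt_class_sum[OF b[OF j(1)] q(1) w] q(2)
      WG.finprod_insert[OF insert(1,2) simple_class_closed[OF A]] witt_class_closed[OF b[OF j(1)]] by simp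
  moreover have "S.mult i (fst w) = (if i \<in> insert j A then 1 else 0)" if i: "i \<in> {1..n}" for i
    using S.mult_osum[OF i w(2)] m i insert(2) S.mult_self[OF j(2)] S.mult_other[OF i j(2)] by (cases "i = j") simp_all
  ultimately show ?case using w(1) by blast
qed

lemma simple_class_basis:
  "inj_on simple_class S.symmetric_simples \<and>
   vectorspace.basis (residue_ring 2) (exponent_two_space (witt_group C)) (simple_class ` S.symmetric_simples)"
proof (rule WG.basis_criterion[OF symmetric_simples_subset(2) simple_class_closed[OF subset_refl]])
  fix x assume x: "x \<in> carrier (witt_group C)"
  obtain q where "q \<in> quadratic_objects C" "x = witt_class C q" using witt_class_surj[OF x] .
  then show "\<exists>A\<subseteq>S.symmetric_simples. x = finprod (witt_group C) simple_class A"
    using witt_class_span by simp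
next
  fix A assume A: "A \<subseteq> S.symmetric_simples" "finprod (witt_group C) simple_class A = \<one>\<^bsub>witt_group C\<^esub>"
  obtain q where q: "q \<in> quadratic_objects C" "witt_class C q = finprod (witt_group C) simple_class A"
    and m: "\<forall>i\<in>{1..n}. S.mult i (fst q) = (if i \<in> A then 1 else 0)"
    using simple_class_product[OF finite_subset[OF A(1) symmetric_simples_subset(2)] A(1)] by blast
  \<comment> \<open>A member of \<open>A\<close> would occur exactly once in \<open>q\<close>,
    whereas a trivial Witt class forces an even multiplicity.\<close>
  have "i \<notin> A" if "i \<in> S.symmetric_simples" for i
    using witt_class_one_even[OF q(1) _ that] q(2) A(2) m that symmetric_simples_subset(1) by fastforce
  then show "A = {}" using A(1) by blast
qed

end

section \<open>Symmetric forms on simple objects and the braid scalar\<close>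

lemma dual_index_eq:
  assumes "i \<in> {1..n}" "j \<in> {1..n}" "isomorphic C (Dual C (X i)) (X j)"
  shows "dual_index C n X i = j"
  unfolding dual_index_def
proof (rule the_equality)
  show "j \<in> {1..n} \<and> isomorphic C (Dual C (X i)) (X j)" using assms by blast
  fix l assume l: "l \<in> {1..n} \<and> isomorphic C (Dual C (X i)) (X l)"
  then have "isomorphic C (X l) (X j)"
    using assms(3) T.inverse_pair_sym T.inverse_pair_comp unfolding isomorphic_iff by blast
  then show "l = j" using reps l assms(2) unfolding simple_representatives_def by blast
qed

context
  fixes e :: "nat \<Rightarrow> 'm" and i :: nat
  assumes evs: "simple_evaluations C n X e" and i: "i \<in> {1..n}" and self_dual: "dual_index C n X i = i"
begin

abbreviation E where "E \<equiv> Some (X i, X i, e i)"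

text \<open>For a self-dual index the evaluation is a form on \<open>X i\<close>, and it is the
  evaluation of a duality of \<open>X i\<close> with itself.\<close>

lemma simple_evaluation_perfect: "T.perfect E"
proof -
  obtain c where d: "duality C (X i) (X i) (e i) c" using evs i self_dual unfolding simple_evaluations_def by metis
  then have "F.tvalid E" by (simp add: duality_def)
  then show ?thesis using duality_left[OF d] unfolding T.perfect_def by simp
qed

text \<open>Gives the uniqueness behind the definite description in \<open>braid_scalar\<close>: a
  perfect form on a simple object is not zero.\<close>

lemma simple_evaluation_scalar_inj:
  assumes "F.tscale c E = F.tscale d E"
  shows "c = d"
proof (rule ccontr)
  assume "c \<noteq> d"
  have v: "F.tvalid E" by (rule T.perfect_frm[OF simple_evaluation_perfect])
  have o: "X i \<in> Ob C" using i by simp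
  have "F.tscale (c + - d) E = F.tplus (F.tscale c E) (F.tscale (- d) E)" by (rule F.scale_add)
  also have "\<dots> = F.tscale (d + - d) E" unfolding assms by (rule F.scale_add[symmetric])
  also have "\<dots> = F.tzero (X i) (X i)" using F.scale_zero[OF v] by simp
  finally have "E = F.tzero (X i) (X i)" by (rule F.scale_eq_zero) (use \<open>c \<noteq> d\<close> v o in auto)
  then show False using S.simple_quad_nonzero[OF i simple_evaluation_perfect] by simp
qed

text \<open>The forms on \<open>X i\<close> are the multiples of one perfect form, so the swapped
  evaluation is a multiple of the evaluation, and the factor is the braid scalar.\<close>

lemma swap_simple_evaluation: "tswap E = F.tscale (braid_scalar C n X e i) E"
proof -
  have v: "F.tvalid E" by (rule T.perfect_frm[OF simple_evaluation_perfect])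
  have o: "X i \<in> Ob C" "e i \<in> Hom C (X i \<diamondop>\<^sub>o X i) (Unit C)" using v by simp_all
  obtain c where c: "tswap E = F.tscale c E"
    using S.simple_form_unique[OF i simple_evaluation_perfect, of "tswap E"] T.swap_type[OF v] by auto
  have raw: "tswap E = F.tscale r E \<longleftrightarrow> e i \<cdot> Braid C (X i) (X i) = ScaleM C r (e i)" for r
    using o by simp
  have "braid_scalar C n X e i = c"
    unfolding braid_scalar_def self_dual
    by (rule the_equality) (use raw c simple_evaluation_scalar_inj in metis)+
  then show ?thesis using c by simp
qed

end

text \<open>A perfect form on \<open>X i\<close> makes it isomorphic to its dual, and it is a
  nonzero multiple of the evaluation. Swapping multiplies it by the braid scalar, so it is symmetric
  iff that scalar is one; conversely the evaluation itself is then a quadratic form.\<close>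

lemma symmetric_simples_eq:
  assumes evs: "simple_evaluations C n X e"
  shows "S.symmetric_simples = {i \<in> {1..n}. i = dual_index C n X i \<and> braid_scalar C n X e i = 1}"
proof (intro equalityI subsetI)
  fix i assume "i \<in> S.symmetric_simples"
  then obtain b where i: "i \<in> {1..n}" and b: "T.quad b" "tsrc b = X i" by (auto simp: S.symmetric_simples_def)
  note q = T.quadD[OF b(1)]
  have o: "X i \<in> Ob C" using i by simp
  have tb: "ttrg b = X i" using q(2) b(2) by simp
  obtain h where h: "A.tvalid h" "tsrc h = X i" "ttrg h = Dual C (X i)" "tact (tev (X i)) h (tI (X i)) = b"
    using T.perfect_ex[OF T.perfect_ev[OF o] q(1)] tb b(2) o by auto
  have "\<exists>g. T.inverse_pair (X i) (Dual C (X i)) h g"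
    using T.perfect_iso_arrow[OF T.perfect_ev[OF o] h(1)] h q(4) o by simp
  then have "isomorphic C (Dual C (X i)) (X i)" using T.inverse_pair_sym unfolding isomorphic_iff by blast
  then have sd: "dual_index C n X i = i" by (rule dual_index_eq[OF i i])
  let ?E = "Some (X i, X i, e i)"
  note swap = swap_simple_evaluation[OF evs i sd] and inj = simple_evaluation_scalar_inj[OF evs i sd]
    and perf = simple_evaluation_perfect[OF evs i sd]
  obtain c where c: "b = F.tscale c ?E"
    using S.simple_form_unique[OF i perf _ _ q(1) b(2) tb] by auto
  have "c \<noteq> 0"
  proof
    assume "c = 0"
    then have "b = F.tzero (X i) (X i)" unfolding c using F.scale_zero[OF T.perfect_frm[OF perf]] by simp
    then show False using S.simple_quad_nonzero[OF i q(4) b(2) tb] by blast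
  qed
  have "F.tscale (c * braid_scalar C n X e i) ?E = tswap b"
    unfolding c T.swap_fscale swap F.scale_scale ..
  also have "\<dots> = F.tscale c ?E" unfolding q(3) by (rule c)
  finally have "c * braid_scalar C n X e i = c" by (rule inj)
  then have "braid_scalar C n X e i = 1" using \<open>c \<noteq> 0\<close> by simp
  then show "i \<in> {i \<in> {1..n}. i = dual_index C n X i \<and> braid_scalar C n X e i = 1}" using i sd by simp
next
  fix i assume "i \<in> {i \<in> {1..n}. i = dual_index C n X i \<and> braid_scalar C n X e i = 1}"
  then have i: "i \<in> {1..n}" and sd: "dual_index C n X i = i" and one: "braid_scalar C n X e i = 1" by auto
  let ?E = "Some (X i, X i, e i)"
  have perf: "T.perfect ?E" by (rule simple_evaluation_perfect[OF evs i sd])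
  have "tswap ?E = ?E" using swap_simple_evaluation[OF evs i sd] one F.scale_one T.perfect_frm[OF perf] by metis
  then have "T.quad ?E" using perf by (intro T.quadI) simp_all
  then show "i \<in> S.symmetric_simples" unfolding S.symmetric_simples_def using i by force
qed

lemma witt_space_eq: "witt_space C = exponent_two_space (witt_group C)"
  by (simp add: witt_space_def exponent_two_space_def)

lemma symmetric_simple_form:
  assumes "i \<in> S.symmetric_simples"
  shows "\<exists>b. (X i, b) \<in> quadratic_objects C \<and>
    (\<forall>b'. (X i, b') \<in> quadratic_objects C \<longrightarrow> isometric C (X i, b') (X i, b))"
proof -
  obtain \<beta> where i: "i \<in> {1..n}" and \<beta>: "T.quad \<beta>" "tsrc \<beta> = X i" using assms by (auto simp: S.symmetric_simples_def)
  obtain q where q: "q \<in> quadratic_objects C" "tform q = \<beta>" using quad_surj[OF \<beta>(1)] .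
  then obtain b where b: "q = (X i, b)" using \<beta>(2) by (cases q) auto
  have "isometric C (X i, b') (X i, b)" if "(X i, b') \<in> quadratic_objects C" for b'
    using S.simple_quad_unique[OF i, of "tform q" "tform (X i, b')"] that q \<beta> b
    by (simp add: quadratic_isometric_iff quad_iff)
  then show ?thesis using q(1) b by blast
qed

end

theorem proposition3p1:
  fixes C :: "('o, 'm, 'k::{alg_closed_field, field_char_0}) rigid_braided_category_data"
    and n :: nat and X :: "nat \<Rightarrow> 'o" and e :: "nat \<Rightarrow> 'm" and J :: "nat set"
  assumes "braided_fusion_category C"
    and "simple_representatives C n X"
    and "simple_evaluations C n X e"
    and "J = {i \<in> {1..n}. i = dual_index C n X i \<and> braid_scalar C n X e i = 1}"
  shows "(\<forall>i\<in>J. \<exists>b. (X i, b) \<in> quadratic_objects C \<and>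
            (\<forall>b'. (X i, b') \<in> quadratic_objects C \<longrightarrow> isometric C (X i, b') (X i, b))) \<and>
         vectorspace (residue_ring 2) (witt_space C) \<and>
         (\<forall>b. (\<forall>i\<in>J. (X i, b i) \<in> quadratic_objects C) \<longrightarrow>
            inj_on (\<lambda>i. witt_class C (X i, b i)) J \<and>
            vectorspace.basis (residue_ring 2) (witt_space C)
              ((\<lambda>i. witt_class C (X i, b i)) ` J))"
proof -
  interpret fusion_simples C n X
    by (intro fusion_simples.intro fusion.intro fusion_simples_axioms.intro assms(1,2))
  have J: "J = S.symmetric_simples" using symmetric_simples_eq[OF assms(3)] assms(4) by simp
  show ?thesis
    unfolding J witt_space_eq using symmetric_simple_form WG.vectorspace_V simple_class_basis by blast
qed

end
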